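(* Let $k$ be an algebraically closed field of characteristic $2$. Then $kA_5$ has exactly four projective indecomposable modules up to isomorphism, $P_1,P_2,P_3,P_4$, where $P_i=P_{S_i}$ is the projective cover of the simple module $S_i$, and $$kA_5\cong P_1\oplus P_2^{\,2}\oplus P_3^{\,2}\oplus P_4^{\,4}$$ as left $kA_5$-modules. Their structure is as follows. (a) $P_1$ has radical layers, from top to bottom, $S_1,\ S_3\oplus S_2,\ S_1\oplus S_1,\ S_2\oplus S_3,\ S_1$. Moreover $\operatorname{rad}P_1/\operatorname{soc}P_1$ is the direct sum of two uniserial modules, one with radical layers $S_3,S_1,S_2$ and the other with radical layers $S_2,S_1,S_3$ (from top to bottom); specifically $\operatorname{rad}P_1/\operatorname{soc}P_1\cong T_2^{A_5}\oplus T_3^{A_5}$. (b) $P_2$ is uniserial with radical layers, from top to bottom, $S_2,S_1,S_3,S_1,S_2$. (c) $P_3$ is uniserial with radical layers, from top to bottom, $S_3,S_1,S_2,S_1,S_3$. (d) $P_4=S_4$.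
   Context: Modules are finitely generated left modules. The simple $kA_5$-modules are $S_1,S_2,S_3,S_4$: $S_1=k_{A_5}$ is the trivial module; $S_2$ is the two-dimensional module obtained from an isomorphism $A_5\cong SL_2(\mathbb F_4)$ and the natural action on $\mathbb F_4^2$, extending scalars from $\mathbb F_4\subseteq k$ to $k$; $S_3$ is the two-dimensional module obtained from $S_2$ by applying the nontrivial automorphism of $\mathbb F_4$ (swapping $\omega$ and $\omega^2$) to the matrix entries; $S_4$ is the four-dimensional submodule, consisting of vectors with coordinate sum $0$, of the permutation module $k^5$ of $A_5$ acting on $\{1,\dots,5\}$. Here $\omega\in k$ is a root of $x^2+x+1$. $A_4$ is regarded as the subgroup of $A_5$ fixing the point $5$. $T_2$ and $T_3$ are the one-dimensional $kA_4$-modules on which $V_4=\langle(1,2)(3,4),(1,3)(2,4)\rangle$ acts trivially and $(1,2,3)$ acts as $\omega$ and $\omega^2$ respectively, and $T_i^{A_5}$ is the module induced from $A_4$ to $A_5$. The radical layers of a module $U$ are the quotients $\operatorname{rad}^{n-1}U/\operatorname{rad}^{n}U$ ($n\ge 1$, $\operatorname{rad}^0U=U$), listed from top to bottom in order of increasing $n$, where $\operatorname{rad}^nU=\operatorname{rad}(\operatorname{rad}^{n-1}U)$ and $\operatorname{rad}U$ is the intersection of all maximal submodules of $U$; $\operatorname{soc}U$ is the largest semisimple submodule. A module is uniserial if it has a unique composition series. *)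

theory Defs
  imports
    "HOL-Analysis.Determinants"
    "HOL-Computational_Algebra.Polynomial"
    "HOL-Algebra.Sym_Groups"
    "HOL-Algebra.AbelCoset"
    "HOL-Algebra.Module"
begin

section \<open>Left modules over a ring that need not be commutative\<close>

text \<open>
  The locale \<^locale>\<open>module\<close> of \<^theory>\<open>HOL-Algebra.Module\<close> asks for a commutative ring, so the
  predicate is restated over an arbitrary ring. The record type of modules and the locale
  \<^locale>\<open>submodule\<close>, which does not mention commutativity, are those of the library.
  The record also has the ring fields \<open>mult\<close> and \<open>one\<close>; they play no role for modules and are
  left undefined. Submodules are carrier sets; the submodule \<open>N\<close> of \<open>M\<close> regarded as a module is
  \<open>M\<lparr>carrier := N\<rparr>\<close>.
\<close>

locale left_module = R?: ring R + M?: abelian_group M for R (structure) and M (structure) +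
  assumes smult_closed [simp, intro]:
      "\<lbrakk>a \<in> carrier R; x \<in> carrier M\<rbrakk> \<Longrightarrow> a \<odot>\<^bsub>M\<^esub> x \<in> carrier M"
    and smult_l_distr:
      "\<lbrakk>a \<in> carrier R; b \<in> carrier R; x \<in> carrier M\<rbrakk> \<Longrightarrow>
        (a \<oplus> b) \<odot>\<^bsub>M\<^esub> x = a \<odot>\<^bsub>M\<^esub> x \<oplus>\<^bsub>M\<^esub> b \<odot>\<^bsub>M\<^esub> x"
    and smult_r_distr:
      "\<lbrakk>a \<in> carrier R; x \<in> carrier M; y \<in> carrier M\<rbrakk> \<Longrightarrow>
        a \<odot>\<^bsub>M\<^esub> (x \<oplus>\<^bsub>M\<^esub> y) = a \<odot>\<^bsub>M\<^esub> x \<oplus>\<^bsub>M\<^esub> a \<odot>\<^bsub>M\<^esub> y"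
    and smult_assoc1:
      "\<lbrakk>a \<in> carrier R; b \<in> carrier R; x \<in> carrier M\<rbrakk> \<Longrightarrow>
        (a \<otimes> b) \<odot>\<^bsub>M\<^esub> x = a \<odot>\<^bsub>M\<^esub> (b \<odot>\<^bsub>M\<^esub> x)"
    and smult_one [simp]: "x \<in> carrier M \<Longrightarrow> \<one> \<odot>\<^bsub>M\<^esub> x = x"

definition mod_hom :: "'a ring \<Rightarrow> ('a, 'm) module \<Rightarrow> ('a, 'n) module \<Rightarrow> ('m \<Rightarrow> 'n) set" where
  "mod_hom R M N = {h \<in> carrier M \<rightarrow> carrier N.
     (\<forall>x\<in>carrier M. \<forall>y\<in>carrier M. h (x \<oplus>\<^bsub>M\<^esub> y) = h x \<oplus>\<^bsub>N\<^esub> h y) \<and>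
     (\<forall>a\<in>carrier R. \<forall>x\<in>carrier M. h (a \<odot>\<^bsub>M\<^esub> x) = a \<odot>\<^bsub>N\<^esub> h x)}"

definition mod_iso :: "'a ring \<Rightarrow> ('a, 'm) module \<Rightarrow> ('a, 'n) module \<Rightarrow> bool" where
  "mod_iso R M N \<longleftrightarrow> (\<exists>h\<in>mod_hom R M N. bij_betw h (carrier M) (carrier N))"

definition mod_sum :: "('a, 'm) module \<Rightarrow> ('a, 'n) module \<Rightarrow> ('a, 'm \<times> 'n) module"
    (infixr \<open>\<oplus>\<^sub>m\<close> 65) where
  "M \<oplus>\<^sub>m N = \<lparr>carrier = carrier M \<times> carrier N, mult = undefined, one = undefined,
     zero = (\<zero>\<^bsub>M\<^esub>, \<zero>\<^bsub>N\<^esub>),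
     add = (\<lambda>(x, y) (x', y'). (x \<oplus>\<^bsub>M\<^esub> x', y \<oplus>\<^bsub>N\<^esub> y')),
     smult = (\<lambda>a (x, y). (a \<odot>\<^bsub>M\<^esub> x, a \<odot>\<^bsub>N\<^esub> y))\<rparr>"

definition mod_power :: "('a, 'm) module \<Rightarrow> nat \<Rightarrow> ('a, nat \<Rightarrow> 'm) module" where
  "mod_power M n = \<lparr>carrier = {..<n} \<rightarrow>\<^sub>E carrier M, mult = undefined, one = undefined,
     zero = (\<lambda>i\<in>{..<n}. \<zero>\<^bsub>M\<^esub>),
     add = (\<lambda>x y. \<lambda>i\<in>{..<n}. x i \<oplus>\<^bsub>M\<^esub> y i),
     smult = (\<lambda>a x. \<lambda>i\<in>{..<n}. a \<odot>\<^bsub>M\<^esub> x i)\<rparr>"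

definition regular_module :: "'a ring \<Rightarrow> ('a, 'a) module" where
  "regular_module R = \<lparr>carrier = carrier R, mult = undefined, one = undefined,
     zero = \<zero>\<^bsub>R\<^esub>, add = add R, smult = mult R\<rparr>"

definition quot_module :: "('a, 'm) module \<Rightarrow> 'm set \<Rightarrow> ('a, 'm set) module" where
  "quot_module M N = \<lparr>carrier = a_rcosets\<^bsub>M\<^esub> N, mult = undefined, one = undefined,
     zero = N, add = set_add M,
     smult = (\<lambda>a X. \<Union>x\<in>X. N +>\<^bsub>M\<^esub> (a \<odot>\<^bsub>M\<^esub> x))\<rparr>"

definition submodule_span :: "'a ring \<Rightarrow> ('a, 'm) module \<Rightarrow> 'm set \<Rightarrow> 'm set" where
  "submodule_span R M X = \<Inter>{N. submodule N R M \<and> X \<subseteq> N}"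

definition internal_sum :: "'a ring \<Rightarrow> ('a, 'm) module \<Rightarrow> 'm set \<Rightarrow> 'm set \<Rightarrow> bool" where
  "internal_sum R M N N' \<longleftrightarrow> submodule N R M \<and> submodule N' R M \<and>
     N \<inter> N' = {\<zero>\<^bsub>M\<^esub>} \<and> N <+>\<^bsub>M\<^esub> N' = carrier M"

definition simple_module :: "'a ring \<Rightarrow> ('a, 'm) module \<Rightarrow> bool" where
  "simple_module R M \<longleftrightarrow> left_module R M \<and> carrier M \<noteq> {\<zero>\<^bsub>M\<^esub>} \<and>
     (\<forall>N. submodule N R M \<longrightarrow> N = {\<zero>\<^bsub>M\<^esub>} \<or> N = carrier M)"

definition indecomposable :: "'a ring \<Rightarrow> ('a, 'm) module \<Rightarrow> bool" where
  "indecomposable R M \<longleftrightarrow> left_module R M \<and> carrier M \<noteq> {\<zero>\<^bsub>M\<^esub>} \<and>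
     (\<forall>N N'. internal_sum R M N N' \<longrightarrow> N = {\<zero>\<^bsub>M\<^esub>} \<or> N' = {\<zero>\<^bsub>M\<^esub>})"

text \<open>Modules are finitely generated throughout, so finite direct sums suffice here and in the
  definition of projective modules.\<close>

definition semisimple_module :: "'a ring \<Rightarrow> ('a, 'm) module \<Rightarrow> bool" where
  "semisimple_module R M \<longleftrightarrow> left_module R M \<and>
     (\<exists>n (N :: nat \<Rightarrow> 'm set).
        (\<forall>i<n. submodule (N i) R M \<and> simple_module R (M\<lparr>carrier := N i\<rparr>)) \<and>
        bij_betw (\<lambda>x. \<Oplus>\<^bsub>M\<^esub>i\<in>{..<n}. x i) (Pi\<^sub>E {..<n} N) (carrier M))"

definition projective :: "'a ring \<Rightarrow> ('a, 'm) module \<Rightarrow> bool" where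
  "projective R P \<longleftrightarrow> left_module R P \<and>
     (\<exists>n N N'. internal_sum R (mod_power (regular_module R) n) N N' \<and>
        mod_iso R P ((mod_power (regular_module R) n)\<lparr>carrier := N\<rparr>))"

definition projective_indecomposable :: "'a ring \<Rightarrow> ('a, 'm) module \<Rightarrow> bool" where
  "projective_indecomposable R P \<longleftrightarrow> projective R P \<and> indecomposable R P"

text \<open>A projective cover is an essential epimorphism from a projective module.\<close>

definition projective_cover :: "'a ring \<Rightarrow> ('a, 'm) module \<Rightarrow> ('a, 'n) module \<Rightarrow> bool" where
  "projective_cover R P S \<longleftrightarrow> projective R P \<and>
     (\<exists>\<pi>\<in>mod_hom R P S. \<pi> ` carrier P = carrier S \<and>
        (\<forall>N. submodule N R P \<and> \<pi> ` N = carrier S \<longrightarrow> N = carrier P))"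


section \<open>Radical, socle, uniserial modules\<close>

definition maximal_submodule :: "'a ring \<Rightarrow> ('a, 'm) module \<Rightarrow> 'm set \<Rightarrow> bool" where
  "maximal_submodule R M N \<longleftrightarrow> submodule N R M \<and> N \<noteq> carrier M \<and>
     (\<forall>N'. submodule N' R M \<and> N \<subseteq> N' \<longrightarrow> N' = N \<or> N' = carrier M)"

definition rad :: "'a ring \<Rightarrow> ('a, 'm) module \<Rightarrow> 'm set" where
  "rad R M = carrier M \<inter> \<Inter>{N. maximal_submodule R M N}"

primrec rad_power :: "'a ring \<Rightarrow> ('a, 'm) module \<Rightarrow> nat \<Rightarrow> 'm set" where
  "rad_power R M 0 = carrier M"
| "rad_power R M (Suc n) = rad R (M\<lparr>carrier := rad_power R M n\<rparr>)"

definition rad_layer :: "'a ring \<Rightarrow> ('a, 'm) module \<Rightarrow> nat \<Rightarrow> ('a, 'm set) module" where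
  "rad_layer R M n = quot_module (M\<lparr>carrier := rad_power R M (n - 1)\<rparr>) (rad_power R M n)"

text \<open>The expected layers, from top to bottom, are given by predicates such as \<open>mod_iso R S\<close>,
  because the representatives \<open>S\<close> live in different types. The layers after the listed
  ones vanish.\<close>

definition has_radical_layers ::
    "'a ring \<Rightarrow> ('a, 'm) module \<Rightarrow> (('a, 'm set) module \<Rightarrow> bool) list \<Rightarrow> bool" where
  "has_radical_layers R M Ls \<longleftrightarrow>
     (\<forall>n\<in>{1..length Ls}. (Ls ! (n - 1)) (rad_layer R M n)) \<and>
     rad_power R M (length Ls) = {\<zero>\<^bsub>M\<^esub>}"

definition soc :: "'a ring \<Rightarrow> ('a, 'm) module \<Rightarrow> 'm set" where
  "soc R M = (GREATEST N. submodule N R M \<and> semisimple_module R (M\<lparr>carrier := N\<rparr>))"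

definition composition_series :: "'a ring \<Rightarrow> ('a, 'm) module \<Rightarrow> 'm set list \<Rightarrow> bool" where
  "composition_series R M Ns \<longleftrightarrow>
     Ns \<noteq> [] \<and> hd Ns = {\<zero>\<^bsub>M\<^esub>} \<and> last Ns = carrier M \<and>
     (\<forall>N\<in>set Ns. submodule N R M) \<and>
     (\<forall>i. Suc i < length Ns \<longrightarrow> Ns ! i \<subseteq> Ns ! Suc i \<and>
        simple_module R (quot_module (M\<lparr>carrier := Ns ! Suc i\<rparr>) (Ns ! i)))"

definition uniserial :: "'a ring \<Rightarrow> ('a, 'm) module \<Rightarrow> bool" where
  "uniserial R M \<longleftrightarrow> left_module R M \<and> (\<exists>!Ns. composition_series R M Ns)"


section \<open>Group algebras of finite groups and induced modules\<close>

text \<open>An element of \<open>kG\<close>, for a finite group \<open>G\<close>, is its coefficient function, which is 0 outside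
  the carrier of \<open>G\<close>.\<close>

definition group_algebra :: "'g monoid \<Rightarrow> ('g \<Rightarrow> 'k::field) ring" where
  "group_algebra G = \<lparr>carrier = {a. \<forall>g. g \<notin> carrier G \<longrightarrow> a g = 0},
     mult = (\<lambda>a b g. if g \<in> carrier G
       then \<Sum>x\<in>carrier G. a x * b (inv\<^bsub>G\<^esub> x \<otimes>\<^bsub>G\<^esub> g) else 0),
     one = (\<lambda>g. if g = \<one>\<^bsub>G\<^esub> then 1 else 0),
     zero = (\<lambda>g. 0),
     add = (\<lambda>a b g. a g + b g)\<rparr>"

definition ga_single :: "'k::field \<Rightarrow> 'g \<Rightarrow> 'g \<Rightarrow> 'k" where
  "ga_single c g = (\<lambda>x. if x = g then c else 0)"

text \<open>For a subgroup \<open>H\<close> of \<open>G\<close> and a \<open>kH\<close>-module \<open>V\<close>, the induced module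
  \<open>kG \<otimes>\<^bsub>kH\<^esub> V\<close> is the quotient of \<open>kG \<otimes>\<^bsub>k\<^esub> V\<close> by the submodule generated by all
  \<open>g h \<otimes> v - g \<otimes> h v\<close>. As \<open>G\<close> is a basis of \<open>kG\<close>, an element \<open>\<Sum>g. g \<otimes> f g\<close> of
  \<open>kG \<otimes>\<^bsub>k\<^esub> V\<close> is represented by the function \<open>f\<close>, and \<open>x \<in> G\<close> takes it to
  \<open>\<Sum>g. x g \<otimes> f g = \<Sum>g. g \<otimes> f (x\<^sup>-\<^sup>1 g)\<close>. The field acts on \<open>V\<close> through the multiples of the
  identity of \<open>kH\<close>.\<close>

definition scalar_tensor ::
    "'g monoid \<Rightarrow> ('g \<Rightarrow> 'k::field, 'v) module \<Rightarrow> ('g \<Rightarrow> 'k, 'g \<Rightarrow> 'v) module" where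
  "scalar_tensor G V = \<lparr>carrier = carrier G \<rightarrow>\<^sub>E carrier V, mult = undefined, one = undefined,
     zero = (\<lambda>g\<in>carrier G. \<zero>\<^bsub>V\<^esub>),
     add = (\<lambda>f f'. \<lambda>g\<in>carrier G. f g \<oplus>\<^bsub>V\<^esub> f' g),
     smult = (\<lambda>a f. \<lambda>g\<in>carrier G.
       \<Oplus>\<^bsub>V\<^esub>x\<in>carrier G. ga_single (a x) \<one>\<^bsub>G\<^esub> \<odot>\<^bsub>V\<^esub> f (inv\<^bsub>G\<^esub> x \<otimes>\<^bsub>G\<^esub> g))\<rparr>"

definition pure_tensor ::
    "'g monoid \<Rightarrow> ('g \<Rightarrow> 'k::field, 'v) module \<Rightarrow> 'g \<Rightarrow> 'v \<Rightarrow> 'g \<Rightarrow> 'v" where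
  "pure_tensor G V g v = (\<lambda>x\<in>carrier G. if x = g then v else \<zero>\<^bsub>V\<^esub>)"

definition induced_module ::
    "'g monoid \<Rightarrow> 'g set \<Rightarrow> ('g \<Rightarrow> 'k::field, 'v) module \<Rightarrow> ('g \<Rightarrow> 'k, ('g \<Rightarrow> 'v) set) module" where
  "induced_module G H V = quot_module (scalar_tensor G V)
     (submodule_span (group_algebra G) (scalar_tensor G V)
       {pure_tensor G V (g \<otimes>\<^bsub>G\<^esub> h) v
          \<ominus>\<^bsub>scalar_tensor G V\<^esub> pure_tensor G V g (ga_single 1 h \<odot>\<^bsub>V\<^esub> v) | g h v.
        g \<in> carrier G \<and> h \<in> H \<and> v \<in> carrier V})"

text \<open>Modules given by a linear character and by a matrix representation of the group.\<close>

definition char_module :: "'g monoid \<Rightarrow> ('g \<Rightarrow> 'k) \<Rightarrow> ('g \<Rightarrow> 'k::field, 'k) module" where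
  "char_module G \<psi> = \<lparr>carrier = UNIV, mult = undefined, one = undefined, zero = 0, add = (+),
     smult = (\<lambda>a v. \<Sum>g\<in>carrier G. a g * (\<psi> g * v))\<rparr>"

definition matrix_module ::
    "'g monoid \<Rightarrow> ('g \<Rightarrow> 'k^'n^'n) \<Rightarrow> ('g \<Rightarrow> 'k::field, 'k^'n) module" where
  "matrix_module G \<rho> = \<lparr>carrier = UNIV, mult = undefined, one = undefined, zero = 0, add = (+),
     smult = (\<lambda>a v. \<Sum>g\<in>carrier G. a g *s (\<rho> g *v v))\<rparr>"


section \<open>The modules for the alternating groups of degrees 5 and 4\<close>

definition A5 :: "(nat \<Rightarrow> nat) monoid" where
  "A5 = alt_group 5"

definition kA5 :: "((nat \<Rightarrow> nat) \<Rightarrow> 'k::field) ring" where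
  "kA5 = group_algebra A5"

definition A4 :: "(nat \<Rightarrow> nat) set" where
  "A4 = {p \<in> carrier A5. p 5 = 5}"

text \<open>\<open>\<omega>\<close> stands for a root of \<open>x\<^sup>2 + x + 1\<close> in a field of characteristic 2; the field with four
  elements is the subfield \<open>{0, 1, \<omega>, \<omega>\<^sup>2}\<close>, and its nontrivial automorphism is squaring.\<close>

definition F4 :: "'k::field \<Rightarrow> 'k set" where
  "F4 \<omega> = {0, 1, \<omega>, \<omega>\<^sup>2}"

definition SL2F4 :: "'k::field \<Rightarrow> ('k^2^2) monoid" where
  "SL2F4 \<omega> = \<lparr>carrier = {A. (\<forall>i j. A $ i $ j \<in> F4 \<omega>) \<and> det A = 1}, mult = (**), one = mat 1\<rparr>"

definition S1 :: "((nat \<Rightarrow> nat) \<Rightarrow> 'k::field, 'k) module" where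
  "S1 = char_module A5 (\<lambda>g. 1)"

definition S2 :: "((nat \<Rightarrow> nat) \<Rightarrow> 'k^2^2) \<Rightarrow> ((nat \<Rightarrow> nat) \<Rightarrow> 'k::field, 'k^2) module" where
  "S2 \<phi> = matrix_module A5 \<phi>"

definition S3 :: "((nat \<Rightarrow> nat) \<Rightarrow> 'k^2^2) \<Rightarrow> ((nat \<Rightarrow> nat) \<Rightarrow> 'k::field, 'k^2) module" where
  "S3 \<phi> = matrix_module A5 (\<lambda>g. \<chi> i j. (\<phi> g $ i $ j)\<^sup>2)"

text \<open>A vector of \<open>k\<^sup>5\<close> is a function that is 0 outside \<open>{1..5}\<close>. As \<open>p\<close> takes the \<open>i\<close>-th basis
  vector to the \<open>p i\<close>-th one, the \<open>i\<close>-th coordinate of \<open>p f\<close> is \<open>f (p\<^sup>-\<^sup>1 i)\<close>.\<close>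

definition perm_module :: "((nat \<Rightarrow> nat) \<Rightarrow> 'k::field, nat \<Rightarrow> 'k) module" where
  "perm_module = \<lparr>carrier = {f. \<forall>i. i \<notin> {1..5} \<longrightarrow> f i = 0}, mult = undefined, one = undefined,
     zero = (\<lambda>i. 0), add = (\<lambda>f f' i. f i + f' i),
     smult = (\<lambda>a f i. \<Sum>p\<in>carrier A5. a p * f (inv' p i))\<rparr>"

definition S4 :: "((nat \<Rightarrow> nat) \<Rightarrow> 'k::field, nat \<Rightarrow> 'k) module" where
  "S4 = perm_module\<lparr>carrier := {f \<in> carrier perm_module. (\<Sum>i=1..5. f i) = 0}\<rparr>"

definition V4 :: "(nat \<Rightarrow> nat) set" where
  "V4 = generate A5 {cycle_of_list [1, 2] \<circ> cycle_of_list [3, 4],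
                     cycle_of_list [1, 3] \<circ> cycle_of_list [2, 4]}"

text \<open>The one-dimensional \<open>kA\<^sub>4\<close>-module on which \<open>V\<^sub>4\<close> acts trivially and \<open>c = (1,2,3)\<close> acts as
  the cube root of unity \<open>\<zeta>\<close>: every element of \<open>A\<^sub>4\<close> lies in a coset \<open>c\<^sup>i V\<^sub>4\<close>, on which the
  character is \<open>\<zeta>\<^sup>i\<close>.\<close>

definition T_char :: "'k::field \<Rightarrow> (nat \<Rightarrow> nat) \<Rightarrow> 'k" where
  "T_char \<zeta> p = \<zeta> ^ (LEAST i. \<exists>v\<in>V4. p = (cycle_of_list [1, 2, 3] ^^ i) \<circ> v)"

definition T :: "'k::field \<Rightarrow> ((nat \<Rightarrow> nat) \<Rightarrow> 'k, 'k) module" where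
  "T \<zeta> = char_module (A5\<lparr>carrier := A4\<rparr>) (T_char \<zeta>)"

end

theory Submission
  imports Defs
begin

text \<open>
  Let \<open>c = (1 2 3 4 5)\<close>, \<open>s = (1 4)(2 3)\<close> and \<open>g = (1 2)(3 4)\<close>, and let \<open>A\<close> be the group algebra.
  The eigenvalue \<open>\<zeta>\<close> of \<open>\<phi> c\<close> is a primitive fifth root of unity, and the five idempotents \<open>E i\<close>
  of \<open>k\<langle>c\<rangle>\<close> (lemma \<open>sum_E\<close>) cut \<open>A\<close> into the pieces \<open>E i A E j\<close>. Every element of the group is
  \<open>c^a y c^b\<close> with \<open>y \<in> {1, s, g, g s}\<close> (lemma \<open>A5_double_coset\<close>), so a piece is spanned by
  \<open>E i E j\<close>, \<open>E i s E j\<close>, \<open>H i j = E i g E j\<close> and \<open>H' i j = E i g s E j\<close>; the relations between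
  \<open>c\<close> and \<open>g\<close> give a multiplication table whose coefficients lie in \<open>{0, 1, t, t + 1}\<close> with
  \<open>t = \<zeta> + \<zeta>^4\<close> (lemmas \<open>hecke\<close>). In this table there are idempotents \<open>E 0\<close>, \<open>e 1\<close>, \<open>e 2\<close>, \<open>f 1\<close>
  and arrows \<open>a i\<close>, \<open>b i\<close> between \<open>E 0\<close> and \<open>e i\<close> with \<open>b i a i = 0\<close> and
  \<open>a 1 b 1 a 2 b 2 = a 2 b 2 a 1 b 1 = w\<close>: this is the quiver of the principal block with its
  relations. The projective indecomposable modules are \<open>A E 0\<close>, \<open>A e 1\<close>, \<open>A e 2\<close> and \<open>A f 1\<close>.

  The radicals are found without the radical of \<open>A\<close>. Each simple module \<open>S\<close> has a vector \<open>v\<close> fixed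
  by one of the idempotents \<open>u\<close>, and the annihilator \<open>I\<close> of \<open>v\<close> has the property that every \<open>x \<notin> I\<close> can be multiplied back to \<open>u\<close>, that is,
  \<open>y x u = u\<close> for some \<open>y\<close> (lemmas \<open>local_E0\<close>, \<open>local_e1\<close>, \<open>local_e2\<close>, \<open>local_f\<close>). Hence for every \<open>m = u m \<noteq> 0\<close> in any
  module, \<open>I m\<close> is the unique maximal submodule of \<open>A m\<close>, with quotient \<open>S\<close> (\<open>rad_gen\<close>,
  \<open>gen_layer\<close>). As \<open>I u\<close> is generated by the arrows starting at \<open>u\<close>, all radicals are obtained by
  right multiplication along paths of the quiver (\<open>path_imgs\<close>). The modules \<open>A e i\<close> are uniserial
  because each path continues in one way only; in \<open>A E 0\<close> two paths run side by side, and the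
  radical of a sum of two local submodules is the sum of their radicals (\<open>rad_two_gens\<close>). The
  socle of \<open>A E 0\<close> is \<open>A w\<close>, since \<open>w\<close> lies in every nonzero submodule (\<open>w_in_lideal\<close>).

  A decomposition of \<open>1\<close> into nine idempotents that are conjugate to \<open>E 0\<close>, \<open>e 1\<close>, \<open>e 2\<close>, \<open>f 1\<close>
  decomposes the regular module. If an indecomposable projective \<open>Q\<close> mapped onto none of the four
  modules, all its coordinates in a free module would be elements \<open>x\<close> with \<open>x A\<close> contained in the four
  annihilators; such elements shift the radical series of the four modules, so products of five of
  them vanish, and \<open>Q\<close> would be zero (\<open>pim_classification\<close>).

  For the induced modules it suffices to find in each summand of the heart a generator on which the
  subgroup fixing \<open>5\<close> acts by the character, and whose five components under the \<open>E i\<close> do not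
  vanish: the latter makes the kernel of the map from the induced module trivial, because this
  module is free over \<open>k\<langle>c\<rangle>\<close> (\<open>induced_iso\<close>).
\<close>

section \<open>Submodules, homomorphisms and quotients\<close>

context left_module
begin

lemma smult_l_zero [simp]: "x \<in> carrier M \<Longrightarrow> \<zero> \<odot>\<^bsub>M\<^esub> x = \<zero>\<^bsub>M\<^esub>"
  using smult_l_distr[of \<zero> \<zero> x] M.add.l_cancel_one'[of "\<zero> \<odot>\<^bsub>M\<^esub> x" "\<zero> \<odot>\<^bsub>M\<^esub> x"] by simp

lemma smult_r_zero [simp]: "a \<in> carrier R \<Longrightarrow> a \<odot>\<^bsub>M\<^esub> \<zero>\<^bsub>M\<^esub> = \<zero>\<^bsub>M\<^esub>"
  using smult_r_distr[of a "\<zero>\<^bsub>M\<^esub>" "\<zero>\<^bsub>M\<^esub>"]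
    M.add.l_cancel_one'[of "a \<odot>\<^bsub>M\<^esub> \<zero>\<^bsub>M\<^esub>" "a \<odot>\<^bsub>M\<^esub> \<zero>\<^bsub>M\<^esub>"] by simp

lemma smult_l_minus: 
  assumes "a \<in> carrier R" "x \<in> carrier M"
  shows "(\<ominus> a) \<odot>\<^bsub>M\<^esub> x = \<ominus>\<^bsub>M\<^esub> (a \<odot>\<^bsub>M\<^esub> x)"
  using assms smult_l_distr[of "\<ominus> a" a x] M.minus_equality[of "(\<ominus> a) \<odot>\<^bsub>M\<^esub> x" "a \<odot>\<^bsub>M\<^esub> x"]
  by (simp add: R.l_neg)

lemma smult_l_diff:
  assumes "a \<in> carrier R" "b \<in> carrier R" "x \<in> carrier M"
  shows "(a \<ominus> b) \<odot>\<^bsub>M\<^esub> x = a \<odot>\<^bsub>M\<^esub> x \<ominus>\<^bsub>M\<^esub> b \<odot>\<^bsub>M\<^esub> x"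
  using assms by (simp add: a_minus_def smult_l_distr smult_l_minus)

lemma submodule_iff:
  "submodule N R M \<longleftrightarrow> N \<subseteq> carrier M \<and> \<zero>\<^bsub>M\<^esub> \<in> N \<and>
     (\<forall>x\<in>N. \<forall>y\<in>N. x \<oplus>\<^bsub>M\<^esub> y \<in> N) \<and> (\<forall>a\<in>carrier R. \<forall>x\<in>N. a \<odot>\<^bsub>M\<^esub> x \<in> N)" (is "_ \<longleftrightarrow> ?r")
proof
  assume "submodule N R M"
  then interpret N: submodule N R M .
  show ?r using N.subset N.one_closed N.m_closed by auto
next
  assume r: ?r
  have "inv\<^bsub>add_monoid M\<^esub> x \<in> N" if "x \<in> N" for x
  proof -
    have "inv\<^bsub>add_monoid M\<^esub> x = (\<ominus> \<one>) \<odot>\<^bsub>M\<^esub> x"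
      using that r smult_l_minus[of \<one> x] by (auto simp: a_inv_def)
    then show ?thesis using that r by auto
  qed
  with r show "submodule N R M"
    by (unfold_locales) auto
qed

lemma submodule_minus:
  assumes "submodule N R M" "x \<in> N" shows "\<ominus>\<^bsub>M\<^esub> x \<in> N"
proof -
  have "\<ominus>\<^bsub>M\<^esub> x = (\<ominus> \<one>) \<odot>\<^bsub>M\<^esub> x" using assms smult_l_minus[of \<one> x] by (auto simp: submodule_iff)
  with assms show ?thesis by (auto simp: submodule_iff)
qed

lemma submodule_diff:
  assumes "submodule N R M" "x \<in> N" "y \<in> N" shows "x \<ominus>\<^bsub>M\<^esub> y \<in> N"
  using assms submodule_minus[OF assms(1,3)] by (auto simp: submodule_iff a_minus_def)

lemma diff_eq_zero_iff:
  assumes "x \<in> carrier M" "y \<in> carrier M"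
  shows "x \<ominus>\<^bsub>M\<^esub> y = \<zero>\<^bsub>M\<^esub> \<longleftrightarrow> x = y"
proof
  assume "x \<ominus>\<^bsub>M\<^esub> y = \<zero>\<^bsub>M\<^esub>"
  then have "(x \<ominus>\<^bsub>M\<^esub> y) \<oplus>\<^bsub>M\<^esub> y = \<zero>\<^bsub>M\<^esub> \<oplus>\<^bsub>M\<^esub> y" by simp
  then show "x = y" using assms by (simp add: a_minus_def M.a_assoc M.l_neg)
qed (use assms in \<open>simp add: a_minus_def M.r_neg\<close>)

lemma diff_zero: "x \<in> carrier M \<Longrightarrow> x \<ominus>\<^bsub>M\<^esub> \<zero>\<^bsub>M\<^esub> = x"
  using M.minus_equality[of "\<zero>\<^bsub>M\<^esub>" "\<zero>\<^bsub>M\<^esub>"] by (simp add: a_minus_def)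

lemma submodule_zero: "submodule {\<zero>\<^bsub>M\<^esub>} R M" 
  by (auto simp: submodule_iff)

lemma submodule_carrier: "submodule (carrier M) R M"
  by (auto simp: submodule_iff)

lemma mem_set_add: "x \<in> N <+>\<^bsub>M\<^esub> L \<longleftrightarrow> (\<exists>y\<in>N. \<exists>z\<in>L. x = y \<oplus>\<^bsub>M\<^esub> z)"
  by (auto simp: set_add_def set_mult_def)

lemma submodule_add:
  assumes N: "submodule N R M" and L: "submodule L R M" shows "submodule (N <+>\<^bsub>M\<^esub> L) R M"
  unfolding submodule_iff
proof (intro conjI ballI subsetI)
  show "x \<in> carrier M" if "x \<in> N <+>\<^bsub>M\<^esub> L" for x
    using that N L by (auto simp: submodule_iff mem_set_add)
  have "\<zero>\<^bsub>M\<^esub> = \<zero>\<^bsub>M\<^esub> \<oplus>\<^bsub>M\<^esub> \<zero>\<^bsub>M\<^esub>" by simp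
  then show "\<zero>\<^bsub>M\<^esub> \<in> N <+>\<^bsub>M\<^esub> L"
    using N L unfolding mem_set_add submodule_iff by blast
next
  fix x y assume "x \<in> N <+>\<^bsub>M\<^esub> L" "y \<in> N <+>\<^bsub>M\<^esub> L"
  then obtain n l n' l' where e: "n \<in> N" "l \<in> L" "n' \<in> N" "l' \<in> L"
    "x = n \<oplus>\<^bsub>M\<^esub> l" "y = n' \<oplus>\<^bsub>M\<^esub> l'" by (auto simp: mem_set_add)
  then have c: "n \<in> carrier M" "n' \<in> carrier M" "l \<in> carrier M" "l' \<in> carrier M"
    using N L by (auto simp: submodule_iff)
  have "x \<oplus>\<^bsub>M\<^esub> y = (n \<oplus>\<^bsub>M\<^esub> n') \<oplus>\<^bsub>M\<^esub> (l \<oplus>\<^bsub>M\<^esub> l')" using c e by (simp add: M.a_ac)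
  then show "x \<oplus>\<^bsub>M\<^esub> y \<in> N <+>\<^bsub>M\<^esub> L"
    using e N L unfolding mem_set_add submodule_iff by blast
next
  fix a x assume a: "a \<in> carrier R" and "x \<in> N <+>\<^bsub>M\<^esub> L"
  then obtain n l where e: "n \<in> N" "l \<in> L" "x = n \<oplus>\<^bsub>M\<^esub> l" by (auto simp: mem_set_add)
  then have "a \<odot>\<^bsub>M\<^esub> x = a \<odot>\<^bsub>M\<^esub> n \<oplus>\<^bsub>M\<^esub> a \<odot>\<^bsub>M\<^esub> l"
    using a N L smult_r_distr[OF a, of n l] by (auto simp: submodule_iff subset_iff)
  then show "a \<odot>\<^bsub>M\<^esub> x \<in> N <+>\<^bsub>M\<^esub> L"
    using a e N L unfolding mem_set_add submodule_iff by blast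
qed

lemma set_add_subset_left:
  assumes "submodule N R M" "submodule L R M" shows "N \<subseteq> N <+>\<^bsub>M\<^esub> L"
proof
  fix x assume x: "x \<in> N"
  then have "x = x \<oplus>\<^bsub>M\<^esub> \<zero>\<^bsub>M\<^esub>" using assms by (auto simp: submodule_iff)
  then show "x \<in> N <+>\<^bsub>M\<^esub> L" using x assms unfolding mem_set_add submodule_iff by blast
qed

lemma set_add_subset_right:
  assumes "submodule N R M" "submodule L R M" shows "L \<subseteq> N <+>\<^bsub>M\<^esub> L"
proof
  fix x assume x: "x \<in> L"
  then have "x = \<zero>\<^bsub>M\<^esub> \<oplus>\<^bsub>M\<^esub> x" using assms by (auto simp: submodule_iff)
  then show "x \<in> N <+>\<^bsub>M\<^esub> L" using x assms unfolding mem_set_add submodule_iff by blast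
qed

lemma set_add_least:
  assumes "submodule N R M" "L \<subseteq> N" "L' \<subseteq> N" shows "L <+>\<^bsub>M\<^esub> L' \<subseteq> N"
  using assms by (auto simp: mem_set_add submodule_iff subset_iff)

lemma left_module_submodule:
  assumes "submodule N R M" shows "left_module R (M\<lparr>carrier := N\<rparr>)"
proof -
  note N = assms[unfolded submodule_iff]
  have "abelian_group (M\<lparr>carrier := N\<rparr>)"
  proof (rule abelian_groupI, goal_cases)
    case (6 x)
    then show ?case using N submodule_minus[OF assms, of x] M.l_neg[of x] by auto
  qed (use N in \<open>auto simp: M.a_ac subset_iff\<close>)
  then show ?thesis
    using N R.ring_axioms unfolding left_module_def left_module_axioms_def
    by (auto simp: subset_iff smult_l_distr smult_r_distr smult_assoc1)
qed

lemma submodule_of_submodule: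
  assumes "submodule N R M"
  shows "submodule L R (M\<lparr>carrier := N\<rparr>) \<longleftrightarrow> submodule L R M \<and> L \<subseteq> N"
  using assms left_module.submodule_iff[OF left_module_submodule[OF assms], of L]
  by (auto simp: submodule_iff)

lemma mem_coset_iff:
  assumes K: "submodule K R M" and x: "x \<in> carrier M"
  shows "z \<in> K +>\<^bsub>M\<^esub> x \<longleftrightarrow> z \<in> carrier M \<and> z \<ominus>\<^bsub>M\<^esub> x \<in> K"
proof
  assume "z \<in> K +>\<^bsub>M\<^esub> x"
  then obtain k where "k \<in> K" "z = k \<oplus>\<^bsub>M\<^esub> x" by (auto simp: a_r_coset_def')
  moreover from this have "k \<in> carrier M" using K by (auto simp: submodule_iff)
  ultimately show "z \<in> carrier M \<and> z \<ominus>\<^bsub>M\<^esub> x \<in> K" using x by (simp add: a_minus_def M.a_assoc M.r_neg)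
next
  assume z: "z \<in> carrier M \<and> z \<ominus>\<^bsub>M\<^esub> x \<in> K"
  then have "z = (z \<ominus>\<^bsub>M\<^esub> x) \<oplus>\<^bsub>M\<^esub> x" using x by (simp add: a_minus_def M.a_assoc M.l_neg)
  with z show "z \<in> K +>\<^bsub>M\<^esub> x" by (auto simp: a_r_coset_def')
qed

lemma coset_eq_iff:
  assumes K: "submodule K R M" and x: "x \<in> carrier M" "y \<in> carrier M"
  shows "K +>\<^bsub>M\<^esub> x = K +>\<^bsub>M\<^esub> y \<longleftrightarrow> x \<ominus>\<^bsub>M\<^esub> y \<in> K"
proof
  have "\<zero>\<^bsub>M\<^esub> \<in> K" using K by (simp add: submodule_iff)
  then have "x \<in> K +>\<^bsub>M\<^esub> x" using mem_coset_iff[OF K x(1)] x by (simp add: a_minus_def M.r_neg)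
  then show "x \<ominus>\<^bsub>M\<^esub> y \<in> K" if "K +>\<^bsub>M\<^esub> x = K +>\<^bsub>M\<^esub> y"
    using that mem_coset_iff[OF K x(2)] by simp
  assume d: "x \<ominus>\<^bsub>M\<^esub> y \<in> K"
  have "z \<ominus>\<^bsub>M\<^esub> y \<in> K \<longleftrightarrow> z \<ominus>\<^bsub>M\<^esub> x \<in> K" if z: "z \<in> carrier M" for z
  proof
    assume "z \<ominus>\<^bsub>M\<^esub> x \<in> K"
    then have "(z \<ominus>\<^bsub>M\<^esub> x) \<oplus>\<^bsub>M\<^esub> (x \<ominus>\<^bsub>M\<^esub> y) \<in> K" using d K by (simp add: submodule_iff)
    then show "z \<ominus>\<^bsub>M\<^esub> y \<in> K" using x z by (simp add: a_minus_def M.a_assoc M.r_neg1)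
  next
    assume "z \<ominus>\<^bsub>M\<^esub> y \<in> K"
    then have "(z \<ominus>\<^bsub>M\<^esub> y) \<oplus>\<^bsub>M\<^esub> (\<ominus>\<^bsub>M\<^esub> (x \<ominus>\<^bsub>M\<^esub> y)) \<in> K"
      using submodule_minus[OF K d] K by (simp add: submodule_iff)
    moreover have "\<ominus>\<^bsub>M\<^esub> (x \<ominus>\<^bsub>M\<^esub> y) = y \<ominus>\<^bsub>M\<^esub> x"
      using x by (simp add: a_minus_def M.minus_add M.a_comm)
    ultimately show "z \<ominus>\<^bsub>M\<^esub> x \<in> K" using x z by (simp add: a_minus_def M.a_assoc M.r_neg1)
  qed
  then show "K +>\<^bsub>M\<^esub> x = K +>\<^bsub>M\<^esub> y" using mem_coset_iff[OF K] x by blast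
qed

end

lemma mod_homI:
  assumes "\<And>x. x \<in> carrier M \<Longrightarrow> h x \<in> carrier N"
    and "\<And>x y. x \<in> carrier M \<Longrightarrow> y \<in> carrier M \<Longrightarrow> h (x \<oplus>\<^bsub>M\<^esub> y) = h x \<oplus>\<^bsub>N\<^esub> h y"
    and "\<And>a x. a \<in> carrier R \<Longrightarrow> x \<in> carrier M \<Longrightarrow> h (a \<odot>\<^bsub>M\<^esub> x) = a \<odot>\<^bsub>N\<^esub> h x"
  shows "h \<in> mod_hom R M N"
  using assms by (auto simp: mod_hom_def)

lemma mod_homD:
  assumes "h \<in> mod_hom R M N"
  shows "x \<in> carrier M \<Longrightarrow> h x \<in> carrier N"
    and "x \<in> carrier M \<Longrightarrow> y \<in> carrier M \<Longrightarrow> h (x \<oplus>\<^bsub>M\<^esub> y) = h x \<oplus>\<^bsub>N\<^esub> h y"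
    and "a \<in> carrier R \<Longrightarrow> x \<in> carrier M \<Longrightarrow> h (a \<odot>\<^bsub>M\<^esub> x) = a \<odot>\<^bsub>N\<^esub> h x"
  using assms by (auto simp: mod_hom_def)

lemma mod_hom_zero:
  assumes "left_module R M" "left_module R N" "h \<in> mod_hom R M N"
  shows "h \<zero>\<^bsub>M\<^esub> = \<zero>\<^bsub>N\<^esub>"
proof -
  interpret M: left_module R M by fact
  interpret N: left_module R N by fact
  have "h (\<zero>\<^bsub>R\<^esub> \<odot>\<^bsub>M\<^esub> \<zero>\<^bsub>M\<^esub>) = \<zero>\<^bsub>R\<^esub> \<odot>\<^bsub>N\<^esub> h \<zero>\<^bsub>M\<^esub>"
    by (rule mod_homD(3)[OF assms(3)]) auto
  then show ?thesis using mod_homD(1)[OF assms(3), of "\<zero>\<^bsub>M\<^esub>"] by simp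
qed

lemma mod_hom_diff:
  assumes "left_module R M" "left_module R N" "h \<in> mod_hom R M N" "x \<in> carrier M" "y \<in> carrier M"
  shows "h (x \<ominus>\<^bsub>M\<^esub> y) = h x \<ominus>\<^bsub>N\<^esub> h y"
proof -
  interpret M: left_module R M by fact
  interpret N: left_module R N by fact
  have "x \<ominus>\<^bsub>M\<^esub> y = x \<oplus>\<^bsub>M\<^esub> (\<ominus>\<^bsub>R\<^esub> \<one>\<^bsub>R\<^esub>) \<odot>\<^bsub>M\<^esub> y"
    "h x \<ominus>\<^bsub>N\<^esub> h y = h x \<oplus>\<^bsub>N\<^esub> (\<ominus>\<^bsub>R\<^esub> \<one>\<^bsub>R\<^esub>) \<odot>\<^bsub>N\<^esub> h y"
    using assms(4,5) mod_homD(1)[OF assms(3)]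
    by (auto simp: a_minus_def M.smult_l_minus N.smult_l_minus)
  then show ?thesis using assms(4,5) mod_homD[OF assms(3)] by simp
qed

lemma left_module_surj_image:
  assumes "left_module R M" "h \<in> mod_hom R M N" "h ` carrier M = carrier N" "h \<zero>\<^bsub>M\<^esub> = \<zero>\<^bsub>N\<^esub>"
  shows "left_module R N"
proof -
  interpret M: left_module R M by fact
  note h = mod_homD[OF assms(2)]
  have N: "\<exists>x\<in>carrier M. y = h x" if "y \<in> carrier N" for y using that assms(3) by auto
  have z: "\<zero>\<^bsub>N\<^esub> \<in> carrier N" using h(1)[of "\<zero>\<^bsub>M\<^esub>"] assms(4) by simp
  have "abelian_group N"
  proof (rule abelian_groupI, goal_cases)
    case (1 x y)
    from N[OF 1(1)] N[OF 1(2)] show ?case by (auto simp: h(2)[symmetric] intro!: h(1))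
  next
    case 2 show ?case by (rule z)
  next
    case (3 x y z)
    from N[OF 3(1)] N[OF 3(2)] N[OF 3(3)] show ?case by (auto simp: h(2)[symmetric] M.M.a_assoc)
  next
    case (4 x y)
    from N[OF 4(1)] N[OF 4(2)] show ?case by (auto simp: h(2)[symmetric] M.M.a_comm)
  next
    case (5 x)
    from N[OF 5] show ?case unfolding assms(4)[symmetric] by (auto simp: h(2)[symmetric])
  next
    case (6 x)
    from N[OF 6] obtain x' where x: "x' \<in> carrier M" "x = h x'" by blast
    then have "h (\<ominus>\<^bsub>M\<^esub> x') \<oplus>\<^bsub>N\<^esub> x = \<zero>\<^bsub>N\<^esub>"
      unfolding assms(4)[symmetric] by (simp add: h(2)[symmetric] M.M.l_neg)
    then show ?case using x h(1) by auto
  qed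
  moreover have "left_module_axioms R N"
  proof (unfold_locales, goal_cases)
    case (1 a x)
    from N[OF 1(2)] 1(1) show ?case by (auto simp: h(3)[symmetric] intro!: h(1))
  next
    case (2 a b x)
    from N[OF 2(3)] 2(1,2) show ?case by (auto simp: h(3)[symmetric] h(2)[symmetric] M.smult_l_distr)
  next
    case (3 a x y)
    from N[OF 3(2)] N[OF 3(3)] 3(1) show ?case
      by (auto simp: h(3)[symmetric] h(2)[symmetric] M.smult_r_distr)
  next
    case (4 a b x)
    from N[OF 4(3)] 4(1,2) show ?case by (auto simp: h(3)[symmetric] M.smult_assoc1)
  next
    case (5 x)
    from N[OF 5] show ?case by (auto simp: h(3)[symmetric])
  qed
  ultimately show ?thesis using M.R.ring_axioms by (simp add: left_module_def)
qed

lemma quot_module_props: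
  assumes "left_module R M" "submodule K R M"
  shows quot_hom: "(\<lambda>x. K +>\<^bsub>M\<^esub> x) \<in> mod_hom R M (quot_module M K)"
    and quot_surj: "(\<lambda>x. K +>\<^bsub>M\<^esub> x) ` carrier M = carrier (quot_module M K)"
    and quot_left_module: "left_module R (quot_module M K)"
    and quot_zero_iff: "\<And>x. x \<in> carrier M \<Longrightarrow> K +>\<^bsub>M\<^esub> x = \<zero>\<^bsub>quot_module M K\<^esub> \<longleftrightarrow> x \<in> K"
proof -
  interpret M: left_module R M by fact
  interpret K: submodule K R M by fact
  interpret S: abelian_subgroup K M
    by (rule abelian_subgroupI3) (auto intro!: additive_subgroup.intro K.subgroup_axioms M.M.abelian_group_axioms)
  show surj: "(\<lambda>x. K +>\<^bsub>M\<^esub> x) ` carrier M = carrier (quot_module M K)"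
    by (auto simp: quot_module_def A_RCOSETS_def')
  show hom: "(\<lambda>x. K +>\<^bsub>M\<^esub> x) \<in> mod_hom R M (quot_module M K)"
  proof (rule mod_homI)
    fix x assume "x \<in> carrier M" then show "K +>\<^bsub>M\<^esub> x \<in> carrier (quot_module M K)" using surj by blast
  next
    fix x y assume "x \<in> carrier M" "y \<in> carrier M"
    then show "K +>\<^bsub>M\<^esub> (x \<oplus>\<^bsub>M\<^esub> y) = (K +>\<^bsub>M\<^esub> x) \<oplus>\<^bsub>quot_module M K\<^esub> (K +>\<^bsub>M\<^esub> y)"
      using S.a_rcos_sum by (simp add: quot_module_def)
  next
    fix a x assume ax: "a \<in> carrier R" "x \<in> carrier M"
    have "K +>\<^bsub>M\<^esub> (a \<odot>\<^bsub>M\<^esub> z) = K +>\<^bsub>M\<^esub> (a \<odot>\<^bsub>M\<^esub> x)" if "z \<in> K +>\<^bsub>M\<^esub> x" for z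
    proof -
      have z: "z \<in> carrier M" "z \<ominus>\<^bsub>M\<^esub> x \<in> K" using that M.mem_coset_iff[OF assms(2) ax(2)] by auto
      have "a \<odot>\<^bsub>M\<^esub> z = a \<odot>\<^bsub>M\<^esub> ((z \<ominus>\<^bsub>M\<^esub> x) \<oplus>\<^bsub>M\<^esub> x)"
        using z ax by (simp add: a_minus_def M.M.a_assoc M.M.l_neg)
      also have "\<dots> = a \<odot>\<^bsub>M\<^esub> (z \<ominus>\<^bsub>M\<^esub> x) \<oplus>\<^bsub>M\<^esub> a \<odot>\<^bsub>M\<^esub> x"
        using z ax by (simp add: M.smult_r_distr)
      finally have "a \<odot>\<^bsub>M\<^esub> z \<ominus>\<^bsub>M\<^esub> a \<odot>\<^bsub>M\<^esub> x = a \<odot>\<^bsub>M\<^esub> (z \<ominus>\<^bsub>M\<^esub> x)"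
        using z ax by (simp add: a_minus_def M.M.a_assoc M.M.r_neg)
      then show ?thesis using M.coset_eq_iff[OF assms(2), of "a \<odot>\<^bsub>M\<^esub> z" "a \<odot>\<^bsub>M\<^esub> x"] z ax by simp
    qed
    moreover have "x \<in> K +>\<^bsub>M\<^esub> x" by (rule S.a_rcos_self[OF ax(2)])
    ultimately have "(\<Union>z\<in>K +>\<^bsub>M\<^esub> x. K +>\<^bsub>M\<^esub> (a \<odot>\<^bsub>M\<^esub> z)) = K +>\<^bsub>M\<^esub> (a \<odot>\<^bsub>M\<^esub> x)" by blast
    then show "K +>\<^bsub>M\<^esub> (a \<odot>\<^bsub>M\<^esub> x) = a \<odot>\<^bsub>quot_module M K\<^esub> (K +>\<^bsub>M\<^esub> x)"
      by (simp add: quot_module_def)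
  qed
  have K: "K \<subseteq> carrier M" using assms(2) by (simp add: M.submodule_iff)
  then have z: "K +>\<^bsub>M\<^esub> \<zero>\<^bsub>M\<^esub> = \<zero>\<^bsub>quot_module M K\<^esub>"
    by (simp add: quot_module_def M.M.a_coset_add_zero)
  show "left_module R (quot_module M K)"
    by (rule left_module_surj_image[OF assms(1) hom surj z])
  show "K +>\<^bsub>M\<^esub> x = \<zero>\<^bsub>quot_module M K\<^esub> \<longleftrightarrow> x \<in> K" if "x \<in> carrier M" for x
    unfolding z[symmetric] using that M.coset_eq_iff[OF assms(2) that, of "\<zero>\<^bsub>M\<^esub>"]
    M.diff_zero[OF that]
    by simp
qed

context
  fixes R :: "'a ring" and M :: "('a, 'm) module" and N :: "('a, 'n) module" and h
  assumes M: "left_module R M" and N: "left_module R N" and h: "h \<in> mod_hom R M N"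
begin

interpretation M: left_module R M by (rule M)
interpretation N: left_module R N by (rule N)

lemma image_submodule:
  assumes L: "submodule L R M" shows "submodule (h ` L) R N"
proof -
  note hs = mod_homD[OF h] and z = mod_hom_zero[OF M N h]
  have "L \<subseteq> carrier M" using L by (auto simp: M.submodule_iff)
  then show ?thesis
    using L hs(1) z unfolding N.submodule_iff M.submodule_iff
    by (auto simp: subset_iff hs(2)[symmetric] hs(3)[symmetric] intro!: imageI) (metis imageI)
qed

lemma vimage_submodule:
  assumes L: "submodule L R N" shows "submodule {x \<in> carrier M. h x \<in> L} R M"
  using L mod_homD[OF h] mod_hom_zero[OF M N h] unfolding N.submodule_iff M.submodule_iff by auto

lemma kernel_submodule: "submodule {x \<in> carrier M. h x = \<zero>\<^bsub>N\<^esub>} R M"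
  using vimage_submodule[OF N.submodule_zero] by simp

text \<open>The isomorphism theorem for a module \<open>S\<close> and a homomorphic image \<open>N\<close> of the same \<open>M\<close>.
  The isomorphism takes \<open>k x\<close> to the coset of \<open>h x\<close>.\<close>

lemma iso_of_surjections:
  assumes S: "left_module R S" and k: "k \<in> mod_hom R M S" "k ` carrier M = carrier S"
    and surj: "h ` carrier M = carrier N"
    and ker: "\<And>x. x \<in> carrier M \<Longrightarrow> h x = \<zero>\<^bsub>N\<^esub> \<Longrightarrow> k x = \<zero>\<^bsub>S\<^esub>"
  shows "mod_iso R S (quot_module N (h ` {x \<in> carrier M. k x = \<zero>\<^bsub>S\<^esub>}))"
proof -
  interpret S: left_module R S by fact
  define K where "K = h ` {x \<in> carrier M. k x = \<zero>\<^bsub>S\<^esub>}"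
  note ks = mod_homD[OF k(1)] and hs = mod_homD[OF h]
  have "submodule {x \<in> carrier M. k x \<in> {\<zero>\<^bsub>S\<^esub>}} R M"
    using ks mod_hom_zero[OF M S k(1)] unfolding M.submodule_iff by auto
  then have K: "submodule K R N" unfolding K_def using image_submodule by fastforce
  note q = quot_module_props[OF N K]
  define \<theta> where "\<theta> = (\<lambda>s. K +>\<^bsub>N\<^esub> h (SOME x. x \<in> carrier M \<and> k x = s))"
  have in_K: "h x \<in> K \<longleftrightarrow> k x = \<zero>\<^bsub>S\<^esub>" if x: "x \<in> carrier M" for x
  proof
    assume "h x \<in> K"
    then obtain y where y: "y \<in> carrier M" "k y = \<zero>\<^bsub>S\<^esub>" "h x = h y" by (auto simp: K_def)
    then have "h (x \<ominus>\<^bsub>M\<^esub> y) = \<zero>\<^bsub>N\<^esub>"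
      using x mod_hom_diff[OF M N h x y(1)] hs by (simp add: a_minus_def N.M.r_neg)
    then have "k (x \<ominus>\<^bsub>M\<^esub> y) = \<zero>\<^bsub>S\<^esub>" using ker x y by simp
    then show "k x = \<zero>\<^bsub>S\<^esub>"
      using x y mod_hom_diff[OF M S k(1) x y(1)] ks(1)[OF x] by (metis S.diff_eq_zero_iff ks(1))
  qed (auto simp: K_def x)
  have same: "K +>\<^bsub>N\<^esub> h x = K +>\<^bsub>N\<^esub> h y \<longleftrightarrow> k x = k y" if "x \<in> carrier M" "y \<in> carrier M" for x y
  proof -
    have "K +>\<^bsub>N\<^esub> h x = K +>\<^bsub>N\<^esub> h y \<longleftrightarrow> h (x \<ominus>\<^bsub>M\<^esub> y) \<in> K"
      using that N.coset_eq_iff[OF K] hs mod_hom_diff[OF M N h] by simp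
    also have "\<dots> \<longleftrightarrow> k x \<ominus>\<^bsub>S\<^esub> k y = \<zero>\<^bsub>S\<^esub>"
      using that in_K mod_hom_diff[OF M S k(1)] by simp
    also have "\<dots> \<longleftrightarrow> k x = k y" using that ks by (simp add: S.diff_eq_zero_iff)
    finally show ?thesis .
  qed
  have \<theta>: "\<theta> (k x) = K +>\<^bsub>N\<^esub> h x" if x: "x \<in> carrier M" for x
  proof -
    have "(SOME y. y \<in> carrier M \<and> k y = k x) \<in> carrier M \<and> k (SOME y. y \<in> carrier M \<and> k y = k x) = k x"
      by (rule someI) (use x in auto)
    then show ?thesis unfolding \<theta>_def using same[OF _ x] by blast
  qed
  have rep: "\<exists>x\<in>carrier M. s = k x" if "s \<in> carrier S" for s using that k(2) by auto
  have "\<theta> \<in> mod_hom R S (quot_module N K)"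
  proof (rule mod_homI)
    fix s assume "s \<in> carrier S"
    then obtain x where x: "x \<in> carrier M" "s = k x" using rep by blast
    then show "\<theta> s \<in> carrier (quot_module N K)" using \<theta> mod_homD(1)[OF q(1)] hs by simp
  next
    fix s s' assume "s \<in> carrier S" "s' \<in> carrier S"
    then obtain x y where x: "x \<in> carrier M" "s = k x" "y \<in> carrier M" "s' = k y" using rep by metis
    then show "\<theta> (s \<oplus>\<^bsub>S\<^esub> s') = \<theta> s \<oplus>\<^bsub>quot_module N K\<^esub> \<theta> s'"
      using \<theta>[of "x \<oplus>\<^bsub>M\<^esub> y"] \<theta>[of x] \<theta>[of y] ks(2)[of x y] hs(2)[of x y] mod_homD(2)[OF q(1), of "h x" "h y"] hs(1)
      by simp
  next
    fix a s assume a: "a \<in> carrier R" "s \<in> carrier S"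
    then obtain x where x: "x \<in> carrier M" "s = k x" using rep by blast
    then show "\<theta> (a \<odot>\<^bsub>S\<^esub> s) = a \<odot>\<^bsub>quot_module N K\<^esub> \<theta> s"
      using a \<theta>[of "a \<odot>\<^bsub>M\<^esub> x"] \<theta>[of x] ks(3)[of a x] hs(3)[of a x] mod_homD(3)[OF q(1), of a "h x"] hs(1)
      by simp
  qed
  moreover have "inj_on \<theta> (carrier S)"
    by (rule inj_onI) (metis \<theta> rep same)
  moreover have "\<theta> ` carrier S = carrier (quot_module N K)"
  proof -
    have "\<theta> ` k ` carrier M = (\<lambda>y. K +>\<^bsub>N\<^esub> y) ` h ` carrier M" using \<theta> by force
    then show ?thesis using k(2) surj q(2) by simp
  qed
  ultimately show ?thesis unfolding mod_iso_def bij_betw_def K_def by blast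
qed

lemma simple_image_iff:
  assumes surj: "h ` carrier M = carrier N"
  shows "simple_module R N \<longleftrightarrow>
    (let K = {x \<in> carrier M. h x = \<zero>\<^bsub>N\<^esub>} in K \<noteq> carrier M \<and>
      (\<forall>L. submodule L R M \<and> K \<subseteq> L \<longrightarrow> L = K \<or> L = carrier M))"
proof -
  define K where "K = {x \<in> carrier M. h x = \<zero>\<^bsub>N\<^esub>}"
  note hs = mod_homD[OF h] and hz = mod_hom_zero[OF M N h]
  have K0: "K = carrier M \<longleftrightarrow> carrier N = {\<zero>\<^bsub>N\<^esub>}"
  proof
    assume "K = carrier M"
    have "y = \<zero>\<^bsub>N\<^esub>" if y: "y \<in> carrier N" for y
    proof -
      obtain x where "x \<in> carrier M" "y = h x" using y unfolding surj[symmetric] by (rule imageE)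
      with \<open>K = carrier M\<close> show ?thesis unfolding K_def by blast
    qed
    then show "carrier N = {\<zero>\<^bsub>N\<^esub>}" by auto
  next
    assume "carrier N = {\<zero>\<^bsub>N\<^esub>}"
    then show "K = carrier M" using hs(1) unfolding K_def by auto
  qed
  have pull: "h ` {x \<in> carrier M. h x \<in> L} = L" if "L \<subseteq> carrier N" for L
    using that unfolding surj[symmetric] by blast
  have push: "{x \<in> carrier M. h x \<in> h ` L} = L" if L: "submodule L R M" "K \<subseteq> L" for L
  proof -
    have "x \<in> L" if x: "x \<in> carrier M" "y \<in> L" "h x = h y" for x y
    proof -
      have y: "y \<in> carrier M" using x L by (auto simp: M.submodule_iff)
      have "x \<ominus>\<^bsub>M\<^esub> y \<in> K" using x y mod_hom_diff[OF M N h, of x y] hs(1)[of y]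
        by (simp add: K_def N.diff_eq_zero_iff)
      then have "(x \<ominus>\<^bsub>M\<^esub> y) \<oplus>\<^bsub>M\<^esub> y \<in> L" using L x by (auto simp: M.submodule_iff)
      then show "x \<in> L" using x y by (simp add: a_minus_def M.M.a_assoc M.M.l_neg)
    qed
    then show ?thesis using L by (auto simp: M.submodule_iff)
  qed
  show ?thesis
    unfolding Let_def K_def[symmetric] simple_module_def
  proof (intro iffI conjI allI impI)
    assume a: "left_module R N \<and> carrier N \<noteq> {\<zero>\<^bsub>N\<^esub>} \<and> (\<forall>L. submodule L R N \<longrightarrow> L = {\<zero>\<^bsub>N\<^esub>} \<or> L = carrier N)"
    show "K \<noteq> carrier M" using a K0 by blast
    fix L assume L: "submodule L R M \<and> K \<subseteq> L"
    have "h ` L = {\<zero>\<^bsub>N\<^esub>} \<or> h ` L = carrier N" using a image_submodule L by blast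
    then show "L = K \<or> L = carrier M"
    proof
      assume "h ` L = {\<zero>\<^bsub>N\<^esub>}"
      then have "{x \<in> carrier M. h x \<in> {\<zero>\<^bsub>N\<^esub>}} = L" using push L by metis
      then show ?thesis by (simp add: K_def)
    next
      assume "h ` L = carrier N"
      then have "{x \<in> carrier M. h x \<in> carrier N} = L" using push L by metis
      then show ?thesis using hs(1) by auto
    qed
  next
    assume a: "K \<noteq> carrier M \<and> (\<forall>L. submodule L R M \<and> K \<subseteq> L \<longrightarrow> L = K \<or> L = carrier M)"
    show "left_module R N" by (rule N)
    show "carrier N \<noteq> {\<zero>\<^bsub>N\<^esub>}" using a K0 by blast
    fix L assume L: "submodule L R N"
    have sub: "K \<subseteq> {x \<in> carrier M. h x \<in> L}" using L by (auto simp: K_def N.submodule_iff)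
    have "h ` K = {\<zero>\<^bsub>N\<^esub>}" using hz by (auto simp: K_def image_iff)
    have "L \<subseteq> carrier N" using L by (auto simp: N.submodule_iff)
    from sub have "{x \<in> carrier M. h x \<in> L} = K \<or> {x \<in> carrier M. h x \<in> L} = carrier M"
      using a vimage_submodule[OF L] by blast
    then show "L = {\<zero>\<^bsub>N\<^esub>} \<or> L = carrier N"
    proof
      assume e: "{x \<in> carrier M. h x \<in> L} = K"
      show ?thesis using pull[OF \<open>L \<subseteq> carrier N\<close>] \<open>h ` K = {\<zero>\<^bsub>N\<^esub>}\<close> unfolding e by simp
    next
      assume e: "{x \<in> carrier M. h x \<in> L} = carrier M"
      show ?thesis using pull[OF \<open>L \<subseteq> carrier N\<close>] surj unfolding e by simp
    qed
  qed
qed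

end

lemma simple_quot_iff:
  assumes "left_module R M" "submodule K R M"
  shows "simple_module R (quot_module M K) \<longleftrightarrow>
    K \<noteq> carrier M \<and> (\<forall>L. submodule L R M \<and> K \<subseteq> L \<longrightarrow> L = K \<or> L = carrier M)"
proof -
  note q = quot_module_props[OF assms]
  have "{x \<in> carrier M. K +>\<^bsub>M\<^esub> x = \<zero>\<^bsub>quot_module M K\<^esub>} = K"
    using q(4) assms(2) left_module.submodule_iff[OF assms(1)] by auto
  then show ?thesis using simple_image_iff[OF assms(1) q(3,1,2)] by (simp add: Let_def)
qed

lemma mod_iso_sym:
  assumes "left_module R M" "mod_iso R M N" shows "mod_iso R N M"
proof -
  interpret M: left_module R M by fact
  obtain h where h: "h \<in> mod_hom R M N" "bij_betw h (carrier M) (carrier N)"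
    using assms by (auto simp: mod_iso_def)
  define k where "k = the_inv_into (carrier M) h"
  have k: "bij_betw k (carrier N) (carrier M)" unfolding k_def by (rule bij_betw_the_inv_into[OF h(2)])
  have hk: "h (k y) = y" "k y \<in> carrier M" if "y \<in> carrier N" for y
    using that h(2) k unfolding k_def bij_betw_def by (auto intro: f_the_inv_into_f)
  have kh: "k (h x) = x" if "x \<in> carrier M" for x
    using that h(2) unfolding k_def bij_betw_def by (auto intro: the_inv_into_f_f)
  have "k \<in> mod_hom R N M"
  proof (rule mod_homI)
    fix x y assume xy: "x \<in> carrier N" "y \<in> carrier N"
    have "k (x \<oplus>\<^bsub>N\<^esub> y) = k (h (k x) \<oplus>\<^bsub>N\<^esub> h (k y))" using xy hk by simp
    also have "\<dots> = k (h (k x \<oplus>\<^bsub>M\<^esub> k y))" using xy hk(2) by (simp only: mod_homD(2)[OF h(1)])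
    also have "\<dots> = k x \<oplus>\<^bsub>M\<^esub> k y" using xy hk(2) by (simp only: kh M.M.a_closed)
    finally show "k (x \<oplus>\<^bsub>N\<^esub> y) = k x \<oplus>\<^bsub>M\<^esub> k y" .
  next
    fix a x assume ax: "a \<in> carrier R" "x \<in> carrier N"
    have "k (a \<odot>\<^bsub>N\<^esub> x) = k (a \<odot>\<^bsub>N\<^esub> h (k x))" using ax hk by simp
    also have "\<dots> = k (h (a \<odot>\<^bsub>M\<^esub> k x))" using ax hk(2) by (simp only: mod_homD(3)[OF h(1)])
    also have "\<dots> = a \<odot>\<^bsub>M\<^esub> k x" using ax hk(2) by (simp only: kh M.smult_closed)
    finally show "k (a \<odot>\<^bsub>N\<^esub> x) = a \<odot>\<^bsub>M\<^esub> k x" .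
  qed (rule hk)
  with k show ?thesis by (auto simp: mod_iso_def)
qed

lemma mod_iso_trans:
  assumes "mod_iso R M N" "mod_iso R N L" shows "mod_iso R M L"
proof -
  obtain h k where h: "h \<in> mod_hom R M N" "bij_betw h (carrier M) (carrier N)"
    and k: "k \<in> mod_hom R N L" "bij_betw k (carrier N) (carrier L)"
    using assms by (auto simp: mod_iso_def)
  have "k \<circ> h \<in> mod_hom R M L"
    by (rule mod_homI) (simp_all add: mod_homD[OF h(1)] mod_homD[OF k(1)])
  then show ?thesis using bij_betw_trans[OF h(2) k(2)] by (auto simp: mod_iso_def)
qed

lemma mod_sum_simps [simp]:
  "carrier (M \<oplus>\<^sub>m N) = carrier M \<times> carrier N"
  "\<zero>\<^bsub>M \<oplus>\<^sub>m N\<^esub> = (\<zero>\<^bsub>M\<^esub>, \<zero>\<^bsub>N\<^esub>)"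
  "(x, y) \<oplus>\<^bsub>M \<oplus>\<^sub>m N\<^esub> (x', y') = (x \<oplus>\<^bsub>M\<^esub> x', y \<oplus>\<^bsub>N\<^esub> y')"
  "a \<odot>\<^bsub>M \<oplus>\<^sub>m N\<^esub> (x, y) = (a \<odot>\<^bsub>M\<^esub> x, a \<odot>\<^bsub>N\<^esub> y)"
  by (simp_all add: mod_sum_def)

lemma left_module_mod_sum:
  assumes "left_module R M" "left_module R N" shows "left_module R (M \<oplus>\<^sub>m N)"
proof -
  interpret M: left_module R M by fact
  interpret N: left_module R N by fact
  have "abelian_group (M \<oplus>\<^sub>m N)"
  proof (rule abelian_groupI, goal_cases)
    case (6 x)
    then show ?case
      by (intro bexI[of _ "(\<ominus>\<^bsub>M\<^esub> fst x, \<ominus>\<^bsub>N\<^esub> snd x)"]) (auto simp: M.M.l_neg N.M.l_neg)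
  qed (auto simp: M.M.a_ac N.M.a_ac)
  then show ?thesis
    unfolding left_module_def left_module_axioms_def
    using M.R.ring_axioms
    by (auto simp: M.smult_l_distr M.smult_r_distr M.smult_assoc1
        N.smult_l_distr N.smult_r_distr N.smult_assoc1)
qed

lemma mod_iso_sum:
  assumes "mod_iso R M M'" "mod_iso R N N'" shows "mod_iso R (M \<oplus>\<^sub>m N) (M' \<oplus>\<^sub>m N')"
proof -
  obtain h k where h: "h \<in> mod_hom R M M'" "bij_betw h (carrier M) (carrier M')"
    and k: "k \<in> mod_hom R N N'" "bij_betw k (carrier N) (carrier N')"
    using assms by (auto simp: mod_iso_def)
  have "map_prod h k \<in> mod_hom R (M \<oplus>\<^sub>m N) (M' \<oplus>\<^sub>m N')"
    by (rule mod_homI) (auto simp: mod_homD[OF h(1)] mod_homD[OF k(1)])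
  moreover have "bij_betw (map_prod h k) (carrier (M \<oplus>\<^sub>m N)) (carrier (M' \<oplus>\<^sub>m N'))"
    using bij_betw_map_prod[OF h(2) k(2)] by simp
  ultimately show ?thesis by (auto simp: mod_iso_def)
qed

lemma mod_iso_sum_commute: "mod_iso R (M \<oplus>\<^sub>m N) (N \<oplus>\<^sub>m M)"
proof -
  have "prod.swap \<in> mod_hom R (M \<oplus>\<^sub>m N) (N \<oplus>\<^sub>m M)" by (rule mod_homI) auto
  moreover have "bij_betw prod.swap (carrier (M \<oplus>\<^sub>m N)) (carrier (N \<oplus>\<^sub>m M))"
    by (rule bij_betw_byWitness[where f' = prod.swap]) auto
  ultimately show ?thesis by (auto simp: mod_iso_def)
qed

lemma mod_iso_internal_sum:
  assumes "left_module R M" "internal_sum R M N L"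
  shows "mod_iso R (M\<lparr>carrier := N\<rparr> \<oplus>\<^sub>m M\<lparr>carrier := L\<rparr>) M"
proof -
  interpret M: left_module R M by fact
  have NL: "submodule N R M" "submodule L R M" "N \<inter> L = {\<zero>\<^bsub>M\<^esub>}" "N <+>\<^bsub>M\<^esub> L = carrier M"
    using assms by (auto simp: internal_sum_def)
  have c: "N \<subseteq> carrier M" "L \<subseteq> carrier M" using NL by (auto simp: M.submodule_iff)
  have hom: "(\<lambda>(x, y). x \<oplus>\<^bsub>M\<^esub> y) \<in> mod_hom R (M\<lparr>carrier := N\<rparr> \<oplus>\<^sub>m M\<lparr>carrier := L\<rparr>) M"
    by (rule mod_homI) (use c in \<open>auto simp: subset_iff M.M.a_ac M.smult_r_distr\<close>)
  have inj: "x = x' \<and> y = y'" if "x \<oplus>\<^bsub>M\<^esub> y = x' \<oplus>\<^bsub>M\<^esub> y'" "x \<in> N" "x' \<in> N" "y \<in> L" "y' \<in> L" for x x' y y'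
  proof -
    have cc: "x \<in> carrier M" "x' \<in> carrier M" "y \<in> carrier M" "y' \<in> carrier M" using that c by auto
    have "x \<ominus>\<^bsub>M\<^esub> x' = (x \<oplus>\<^bsub>M\<^esub> y) \<oplus>\<^bsub>M\<^esub> (\<ominus>\<^bsub>M\<^esub> y \<oplus>\<^bsub>M\<^esub> \<ominus>\<^bsub>M\<^esub> x')"
      using cc by (simp add: a_minus_def M.M.a_assoc M.M.r_neg2)
    also have "\<dots> = (x' \<oplus>\<^bsub>M\<^esub> y') \<oplus>\<^bsub>M\<^esub> (\<ominus>\<^bsub>M\<^esub> x' \<oplus>\<^bsub>M\<^esub> \<ominus>\<^bsub>M\<^esub> y)"
      using that(1) cc by (simp add: M.M.a_comm)
    also have "\<dots> = y' \<oplus>\<^bsub>M\<^esub> x' \<oplus>\<^bsub>M\<^esub> (\<ominus>\<^bsub>M\<^esub> x' \<oplus>\<^bsub>M\<^esub> \<ominus>\<^bsub>M\<^esub> y)"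
      using cc by (simp add: M.M.a_comm)
    also have "\<dots> = y' \<ominus>\<^bsub>M\<^esub> y"
      using cc by (simp add: a_minus_def M.M.a_assoc M.M.r_neg2)
    finally have "x \<ominus>\<^bsub>M\<^esub> x' \<in> N \<inter> L" "y' \<ominus>\<^bsub>M\<^esub> y \<in> N \<inter> L"
      using M.submodule_diff[OF NL(1), of x x'] M.submodule_diff[OF NL(2), of y' y] that by auto
    then have "x \<ominus>\<^bsub>M\<^esub> x' = \<zero>\<^bsub>M\<^esub>" "y' \<ominus>\<^bsub>M\<^esub> y = \<zero>\<^bsub>M\<^esub>" using NL(3) by auto
    then show ?thesis using cc M.diff_eq_zero_iff by metis
  qed
  moreover have "inj_on (\<lambda>(x, y). x \<oplus>\<^bsub>M\<^esub> y) (N \<times> L)"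
  proof (rule inj_onI)
    fix p p' assume "p \<in> N \<times> L" "p' \<in> N \<times> L"
      "(case p of (x, y) \<Rightarrow> x \<oplus>\<^bsub>M\<^esub> y) = (case p' of (x, y) \<Rightarrow> x \<oplus>\<^bsub>M\<^esub> y)"
    then show "p = p'" using inj[of "fst p" "snd p" "fst p'" "snd p'"]
      by (simp add: case_prod_beta prod_eq_iff mem_Times_iff)
  qed
  moreover have "(\<lambda>(x, y). x \<oplus>\<^bsub>M\<^esub> y) ` (N \<times> L) = carrier M"
    unfolding NL(4)[symmetric] by (force simp: M.mem_set_add)
  ultimately show ?thesis using hom unfolding mod_iso_def bij_betw_def by auto
qed

section \<open>Local generators\<close>

lemma regular_simps [simp]:
  "carrier (regular_module R) = carrier R" "\<zero>\<^bsub>regular_module R\<^esub> = \<zero>\<^bsub>R\<^esub>"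
  "x \<oplus>\<^bsub>regular_module R\<^esub> y = x \<oplus>\<^bsub>R\<^esub> y" "x \<odot>\<^bsub>regular_module R\<^esub> y = x \<otimes>\<^bsub>R\<^esub> y"
  by (simp_all add: regular_module_def)

lemma left_module_regular:
  assumes "ring R" shows "left_module R (regular_module R)"
proof -
  interpret R: ring R by fact
  have "abelian_group (regular_module R)"
    by (rule abelian_groupI) (auto simp: R.a_ac R.add.m_assoc intro: bexI[of _ "\<ominus>\<^bsub>R\<^esub> _"] R.l_neg)
  then show ?thesis
    unfolding left_module_def left_module_axioms_def using assms
    by (auto simp: R.l_distr R.r_distr R.m_assoc)
qed

definition smult_set :: "('a, 'm) module \<Rightarrow> 'a set \<Rightarrow> 'm \<Rightarrow> 'm set" where
  "smult_set M I m = (\<lambda>a. a \<odot>\<^bsub>M\<^esub> m) ` I"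

lemma smult_set_carrier_update [simp]: "smult_set (M\<lparr>carrier := N\<rparr>) I m = smult_set M I m"
  by (simp add: smult_set_def)

abbreviation left_ideal :: "'a ring \<Rightarrow> 'a set \<Rightarrow> bool" where
  "left_ideal R I \<equiv> submodule I R (regular_module R)"

text \<open>The condition on a left ideal \<open>I\<close> and an element \<open>u\<close> that makes \<open>I m\<close> the only maximal submodule of
  \<open>R m\<close> for every nonzero \<open>m\<close> with \<open>u m = m\<close>: a multiple \<open>x m\<close> with \<open>x \<notin> I\<close> generates all of \<open>R m\<close>.\<close>

definition local_top :: "'a ring \<Rightarrow> 'a \<Rightarrow> 'a set \<Rightarrow> bool" where
  "local_top R e I \<longleftrightarrow> left_ideal R I \<and> e \<in> carrier R \<and> e \<notin> I \<and>
     (\<forall>a\<in>carrier R - I. \<exists>y\<in>carrier R. y \<otimes>\<^bsub>R\<^esub> (a \<otimes>\<^bsub>R\<^esub> e) = e)"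

definition local_gen :: "'a ring \<Rightarrow> 'a \<Rightarrow> 'a set \<Rightarrow> ('a, 'm) module \<Rightarrow> 'm \<Rightarrow> bool" where
  "local_gen R e I M m \<longleftrightarrow> local_top R e I \<and> m \<in> carrier M \<and> e \<odot>\<^bsub>M\<^esub> m = m \<and> m \<noteq> \<zero>\<^bsub>M\<^esub>"

definition cyclic_on :: "'a ring \<Rightarrow> ('a, 's) module \<Rightarrow> 's \<Rightarrow> 'a set \<Rightarrow> bool" where
  "cyclic_on R S v I \<longleftrightarrow> left_module R S \<and> v \<in> carrier S \<and>
     smult_set S (carrier R) v = carrier S \<and> I = {a \<in> carrier R. a \<odot>\<^bsub>S\<^esub> v = \<zero>\<^bsub>S\<^esub>}"

lemma left_ideal_iff:
  assumes "ring R"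
  shows "left_ideal R I \<longleftrightarrow> I \<subseteq> carrier R \<and> \<zero>\<^bsub>R\<^esub> \<in> I \<and> (\<forall>x\<in>I. \<forall>y\<in>I. x \<oplus>\<^bsub>R\<^esub> y \<in> I) \<and>
    (\<forall>a\<in>carrier R. \<forall>x\<in>I. a \<otimes>\<^bsub>R\<^esub> x \<in> I)"
  using left_module.submodule_iff[OF left_module_regular[OF assms], of I] by simp

lemma smult_set_submodule:
  assumes "left_module R M" "m \<in> carrier M" "left_ideal R I"
  shows "submodule (smult_set M I m) R M"
proof -
  interpret M: left_module R M by fact
  note I = assms(3)[unfolded left_ideal_iff[OF M.R.ring_axioms]]
  have sub: "a \<in> carrier R" if "a \<in> I" for a using I that by auto
  have "\<zero>\<^bsub>M\<^esub> = \<zero>\<^bsub>R\<^esub> \<odot>\<^bsub>M\<^esub> m" using assms(2) by simp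
  then have "\<zero>\<^bsub>M\<^esub> \<in> smult_set M I m" using I unfolding smult_set_def by blast
  then show ?thesis
    using I assms(2) unfolding M.submodule_iff smult_set_def
    by (auto simp: sub M.smult_l_distr[symmetric] M.smult_assoc1[symmetric])
qed

lemma carrier_left_ideal: "ring R \<Longrightarrow> left_ideal R (carrier R)"
  by (simp add: left_ideal_iff ring.ring_simprules)

lemma smult_set_mono: "I \<subseteq> J \<Longrightarrow> smult_set M I m \<subseteq> smult_set M J m"
  by (auto simp: smult_set_def)

lemma mem_smult_set_self:
  assumes "left_module R M" "m \<in> carrier M" shows "m \<in> smult_set M (carrier R) m"
proof -
  interpret M: left_module R M by fact
  have "\<one>\<^bsub>R\<^esub> \<odot>\<^bsub>M\<^esub> m = m" using assms by simp
  then show ?thesis unfolding smult_set_def using M.R.one_closed by (metis imageI)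
qed

lemma smult_set_least:
  assumes "left_module R M" "submodule N R M" "m \<in> N" shows "smult_set M (carrier R) m \<subseteq> N"
  using assms(2,3) left_module.submodule_iff[OF assms(1)] by (auto simp: smult_set_def)

lemma smult_set_hom:
  assumes "h \<in> mod_hom R M N" "I \<subseteq> carrier R" "m \<in> carrier M"
  shows "smult_set N I (h m) = h ` smult_set M I m"
  using assms mod_homD(3)[OF assms(1)] unfolding smult_set_def image_image
  by (intro image_cong) auto

context
  fixes R :: "'a ring" and M :: "('a, 'm) module" and e :: 'a and I m
  assumes M: "left_module R M" and gen: "local_gen R e I M m"
begin

interpretation M: left_module R M by (rule M)

lemma
  shows gen_mem: "m \<in> carrier M" and gen_e: "e \<in> carrier R" "e \<odot>\<^bsub>M\<^esub> m = m"
    and gen_nz: "m \<noteq> \<zero>\<^bsub>M\<^esub>"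
    and gen_ideal: "left_ideal R I" and gen_sub: "I \<subseteq> carrier R"
    and gen_unit: "\<And>a. a \<in> carrier R \<Longrightarrow> a \<notin> I \<Longrightarrow> \<exists>y\<in>carrier R. y \<otimes>\<^bsub>R\<^esub> (a \<otimes>\<^bsub>R\<^esub> e) = e"
    and gen_one: "\<one>\<^bsub>R\<^esub> \<notin> I"
proof -
  show a: "m \<in> carrier M" "e \<in> carrier R" "e \<odot>\<^bsub>M\<^esub> m = m" "m \<noteq> \<zero>\<^bsub>M\<^esub>" "left_ideal R I"
    and "\<And>a. a \<in> carrier R \<Longrightarrow> a \<notin> I \<Longrightarrow> \<exists>y\<in>carrier R. y \<otimes>\<^bsub>R\<^esub> (a \<otimes>\<^bsub>R\<^esub> e) = e"
    using gen by (auto simp: local_gen_def local_top_def)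
  note I = a(5)[unfolded left_ideal_iff[OF M.R.ring_axioms]]
  show "I \<subseteq> carrier R" using I by blast
  show "\<one>\<^bsub>R\<^esub> \<notin> I"
  proof
    assume "\<one>\<^bsub>R\<^esub> \<in> I"
    then have "e \<otimes>\<^bsub>R\<^esub> \<one>\<^bsub>R\<^esub> \<in> I" using I a(2) by blast
    then show False using gen a(2) by (simp add: local_gen_def local_top_def)
  qed
qed

lemma gen_recover:
  assumes a: "a \<in> carrier R" "a \<notin> I" shows "\<exists>y\<in>carrier R. y \<odot>\<^bsub>M\<^esub> (a \<odot>\<^bsub>M\<^esub> m) = m"
proof -
  obtain y where y: "y \<in> carrier R" "y \<otimes>\<^bsub>R\<^esub> (a \<otimes>\<^bsub>R\<^esub> e) = e" using gen_unit[OF a] by blast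
  have "y \<odot>\<^bsub>M\<^esub> (a \<odot>\<^bsub>M\<^esub> (e \<odot>\<^bsub>M\<^esub> m)) = (y \<otimes>\<^bsub>R\<^esub> (a \<otimes>\<^bsub>R\<^esub> e)) \<odot>\<^bsub>M\<^esub> m"
    using y(1) a(1) gen_e(1) gen_mem by (simp add: M.smult_assoc1)
  then show ?thesis using y gen_e(2) by auto
qed

lemma gen_in_submodule:
  assumes N: "submodule N R M" and a: "a \<in> carrier R" "a \<notin> I" "a \<odot>\<^bsub>M\<^esub> m \<in> N"
  shows "m \<in> N"
  using gen_recover[OF a(1,2)] a(3) N unfolding M.submodule_iff by metis

lemma gen_dichotomy:
  assumes N: "submodule N R M" "N \<subseteq> smult_set M (carrier R) m"
  shows "N = smult_set M (carrier R) m \<or> N \<subseteq> smult_set M I m"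
proof (cases "m \<in> N")
  case True
  then show ?thesis using N smult_set_least[OF M N(1)] by auto
next
  case False
  then show ?thesis using N gen_in_submodule[OF N(1)] unfolding smult_set_def by blast
qed

lemma gen_ideal_cancel:
  assumes a: "a \<in> carrier R" "a \<odot>\<^bsub>M\<^esub> m \<in> smult_set M I m" shows "a \<in> I"
proof -
  obtain b where b: "b \<in> I" "a \<odot>\<^bsub>M\<^esub> m = b \<odot>\<^bsub>M\<^esub> m" using a(2) unfolding smult_set_def by blast
  have bR: "b \<in> carrier R" using b gen_sub by blast
  have "(a \<ominus>\<^bsub>R\<^esub> b) \<odot>\<^bsub>M\<^esub> m = \<zero>\<^bsub>M\<^esub>"
    using a b bR gen_mem by (simp add: M.smult_l_diff M.diff_eq_zero_iff)
  then have "a \<ominus>\<^bsub>R\<^esub> b \<in> I"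
    using gen_in_submodule[OF M.submodule_zero, of "a \<ominus>\<^bsub>R\<^esub> b"] a(1) bR gen_nz by auto
  then have "(a \<ominus>\<^bsub>R\<^esub> b) \<oplus>\<^bsub>R\<^esub> b \<in> I"
    using b gen_ideal unfolding left_ideal_iff[OF M.R.ring_axioms] by blast
  then show ?thesis using a(1) bR by (simp add: a_minus_def M.R.a_assoc M.R.l_neg)
qed

lemma gen_ann: "a \<in> carrier R \<Longrightarrow> a \<odot>\<^bsub>M\<^esub> m = \<zero>\<^bsub>M\<^esub> \<Longrightarrow> a \<in> I"
  using gen_ideal_cancel[of a] smult_set_submodule[OF M gen_mem gen_ideal]
  by (simp add: M.submodule_iff)

lemma gen_not_in: "m \<notin> smult_set M I m"
  using gen_ideal_cancel[of "\<one>\<^bsub>R\<^esub>"] gen_one gen_mem by auto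

lemma gen_minus_one:
  assumes "b \<in> I" shows "\<one>\<^bsub>R\<^esub> \<ominus>\<^bsub>R\<^esub> b \<notin> I"
proof
  assume "\<one>\<^bsub>R\<^esub> \<ominus>\<^bsub>R\<^esub> b \<in> I"
  then have "(\<one>\<^bsub>R\<^esub> \<ominus>\<^bsub>R\<^esub> b) \<oplus>\<^bsub>R\<^esub> b \<in> I"
    using assms gen_ideal unfolding left_ideal_iff[OF M.R.ring_axioms] by blast
  moreover have "b \<in> carrier R" using assms gen_sub by blast
  ultimately show False using gen_one by (simp add: a_minus_def M.R.a_assoc M.R.l_neg)
qed

lemma gen_submodules: "submodule (smult_set M (carrier R) m) R M" "submodule (smult_set M I m) R M"
  using smult_set_submodule[OF M gen_mem] gen_ideal carrier_left_ideal[OF M.R.ring_axioms] by auto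

lemma maximal_gen_iff:
  "maximal_submodule R (M\<lparr>carrier := smult_set M (carrier R) m\<rparr>) L \<longleftrightarrow> L = smult_set M I m"
proof -
  note s = gen_submodules
  have le: "smult_set M I m \<subseteq> smult_set M (carrier R) m" using gen_sub by (rule smult_set_mono)
  have ne: "smult_set M I m \<noteq> smult_set M (carrier R) m"
    using gen_not_in mem_smult_set_self[OF M gen_mem] by blast
  show ?thesis
    unfolding maximal_submodule_def M.submodule_of_submodule[OF s(1)]
    using gen_dichotomy s le ne by simp blast
qed

text \<open>A proper submodule of \<open>R m\<close> cannot contain \<open>x m\<close> with \<open>x \<notin> I\<close>, since this element recovers \<open>m\<close>;
  so \<open>I m\<close> is the largest proper submodule.\<close>

lemma rad_gen: "rad R (M\<lparr>carrier := smult_set M (carrier R) m\<rparr>) = smult_set M I m"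
proof -
  have "{N. maximal_submodule R (M\<lparr>carrier := smult_set M (carrier R) m\<rparr>) N} = {smult_set M I m}"
    using maximal_gen_iff by auto
  moreover have "smult_set M I m \<subseteq> smult_set M (carrier R) m" using gen_sub by (rule smult_set_mono)
  ultimately show ?thesis unfolding rad_def by auto
qed

text \<open>Both \<open>R m / I m\<close> and the cyclic module \<open>S\<close> with annihilator \<open>I\<close> are the quotient of \<open>R\<close> by \<open>I\<close>.\<close>

lemma gen_layer:
  assumes S: "cyclic_on R S v I"
  shows "mod_iso R S (quot_module (M\<lparr>carrier := smult_set M (carrier R) m\<rparr>) (smult_set M I m))"
proof -
  let ?N = "M\<lparr>carrier := smult_set M (carrier R) m\<rparr>"
  have Sv: "left_module R S" "v \<in> carrier S" "smult_set S (carrier R) v = carrier S"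
    "I = {a \<in> carrier R. a \<odot>\<^bsub>S\<^esub> v = \<zero>\<^bsub>S\<^esub>}" using S by (auto simp: cyclic_on_def)
  interpret S: left_module R S by fact
  have "mod_iso R S (quot_module ?N ((\<lambda>a. a \<odot>\<^bsub>M\<^esub> m) ` {a \<in> carrier (regular_module R). a \<odot>\<^bsub>S\<^esub> v = \<zero>\<^bsub>S\<^esub>}))"
  proof (rule iso_of_surjections[where k = "\<lambda>a. a \<odot>\<^bsub>S\<^esub> v"])
    show "left_module R (regular_module R)" by (rule left_module_regular[OF M.R.ring_axioms])
    show "left_module R ?N" by (rule M.left_module_submodule[OF gen_submodules(1)])
    show "(\<lambda>a. a \<odot>\<^bsub>M\<^esub> m) \<in> mod_hom R (regular_module R) ?N"
      using gen_mem by (intro mod_homI) (auto simp: smult_set_def M.smult_l_distr M.smult_assoc1)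
    show "(\<lambda>a. a \<odot>\<^bsub>S\<^esub> v) \<in> mod_hom R (regular_module R) S"
      using Sv(2) by (intro mod_homI) (auto simp: S.smult_l_distr S.smult_assoc1)
    show "x \<odot>\<^bsub>S\<^esub> v = \<zero>\<^bsub>S\<^esub>" if "x \<in> carrier (regular_module R)" "x \<odot>\<^bsub>M\<^esub> m = \<zero>\<^bsub>?N\<^esub>" for x
      using gen_ann[of x] that Sv(4) by simp
  qed (use Sv in \<open>auto simp: smult_set_def\<close>)
  then show ?thesis using Sv(4) by (simp add: smult_set_def)
qed

end

lemma local_gen_hom_image:
  assumes "local_gen R e I M m" "h \<in> mod_hom R M N" "h m \<noteq> \<zero>\<^bsub>N\<^esub>"
  shows "local_gen R e I N (h m)"
  using assms mod_homD[OF assms(2)] unfolding local_gen_def local_top_def by metis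

section \<open>Radicals of sums of two local submodules\<close>

lemma (in left_module) set_add_commute:
  assumes "N \<subseteq> carrier M" "L \<subseteq> carrier M"
  shows "N <+>\<^bsub>M\<^esub> L = L <+>\<^bsub>M\<^esub> N"
  using assms M.a_comm by (auto simp: set_eq_iff mem_set_add subset_iff) metis+

context
  fixes R :: "'a ring" and M :: "('a, 'm) module" and e e' :: 'a and I I' m m'
  assumes M: "left_module R M" and gen: "local_gen R e I M m" and gen': "local_gen R e' I' M m'"
    and out: "m \<notin> smult_set M (carrier R) m'"
begin

interpretation M: left_module R M by (rule M)

private lemma relation_top:
  assumes a: "a \<in> carrier R" "b \<in> carrier R" "a \<odot>\<^bsub>M\<^esub> m = b \<odot>\<^bsub>M\<^esub> m'" shows "a \<in> I"
proof (rule ccontr)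
  assume "a \<notin> I"
  moreover have "a \<odot>\<^bsub>M\<^esub> m \<in> smult_set M (carrier R) m'" using a by (auto simp: smult_set_def)
  ultimately show False
    using gen_in_submodule[OF M gen gen_submodules(1)[OF M gen']] a out by blast
qed

text \<open>If \<open>a - b\<close> were not in \<open>I\<close>, then \<open>m\<close> would be a multiple of \<open>(a - b) m = (b' - a') m'\<close>, although it does not
  lie in the submodule generated by \<open>m'\<close>.\<close>

lemma sum_relation_top:
  assumes a: "a \<in> carrier R" "a' \<in> carrier R" "b \<in> I" "b' \<in> carrier R"
    and eq: "a \<odot>\<^bsub>M\<^esub> m \<oplus>\<^bsub>M\<^esub> a' \<odot>\<^bsub>M\<^esub> m' = b \<odot>\<^bsub>M\<^esub> m \<oplus>\<^bsub>M\<^esub> b' \<odot>\<^bsub>M\<^esub> m'"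
  shows "a \<in> I"
proof -
  note mm = gen_mem[OF M gen] gen_mem[OF M gen']
  have b: "b \<in> carrier R" using a gen_sub[OF M gen] by blast
  let ?A = "a \<odot>\<^bsub>M\<^esub> m" and ?A' = "a' \<odot>\<^bsub>M\<^esub> m'" and ?B = "b \<odot>\<^bsub>M\<^esub> m" and ?B' = "b' \<odot>\<^bsub>M\<^esub> m'"
  have c: "?A \<in> carrier M" "?A' \<in> carrier M" "?B \<in> carrier M" "?B' \<in> carrier M" using a b mm by auto
  have "?A \<ominus>\<^bsub>M\<^esub> ?B = (?A \<oplus>\<^bsub>M\<^esub> ?A') \<oplus>\<^bsub>M\<^esub> (\<ominus>\<^bsub>M\<^esub> ?A' \<oplus>\<^bsub>M\<^esub> \<ominus>\<^bsub>M\<^esub> ?B)"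
    using c by (simp add: a_minus_def M.M.a_assoc M.M.r_neg2)
  also have "\<dots> = (?B' \<oplus>\<^bsub>M\<^esub> ?B) \<oplus>\<^bsub>M\<^esub> (\<ominus>\<^bsub>M\<^esub> ?B \<oplus>\<^bsub>M\<^esub> \<ominus>\<^bsub>M\<^esub> ?A')"
    unfolding eq using c by (simp add: M.M.a_comm)
  also have "\<dots> = ?B' \<ominus>\<^bsub>M\<^esub> ?A'"
    using c by (simp add: a_minus_def M.M.a_assoc M.M.r_neg2)
  finally have "(a \<ominus>\<^bsub>R\<^esub> b) \<odot>\<^bsub>M\<^esub> m = (b' \<ominus>\<^bsub>R\<^esub> a') \<odot>\<^bsub>M\<^esub> m'"
    using a b mm by (simp add: M.smult_l_diff)
  then have "a \<ominus>\<^bsub>R\<^esub> b \<in> I" using relation_top[of "a \<ominus>\<^bsub>R\<^esub> b" "b' \<ominus>\<^bsub>R\<^esub> a'"] a b by simp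
  then have "(a \<ominus>\<^bsub>R\<^esub> b) \<oplus>\<^bsub>R\<^esub> b \<in> I"
    using a gen_ideal[OF M gen] unfolding left_ideal_iff[OF M.R.ring_axioms] by blast
  then show ?thesis using a b by (simp add: a_minus_def M.R.a_assoc M.R.l_neg)
qed

lemma maximal_sum:
  "maximal_submodule R (M\<lparr>carrier := smult_set M (carrier R) m <+>\<^bsub>M\<^esub> smult_set M (carrier R) m'\<rparr>)
     (smult_set M I m <+>\<^bsub>M\<^esub> smult_set M (carrier R) m')"
proof -
  let ?A = "smult_set M (carrier R) m" and ?B = "smult_set M (carrier R) m'" and ?K = "smult_set M I m"
  note s = gen_submodules[OF M gen] gen_submodules(1)[OF M gen']
  note mm = gen_mem[OF M gen] gen_mem[OF M gen']
  have sAB: "submodule (?A <+>\<^bsub>M\<^esub> ?B) R M" and sKB: "submodule (?K <+>\<^bsub>M\<^esub> ?B) R M"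
    using M.submodule_add s by auto
  have KA: "?K \<subseteq> ?A" using gen_sub[OF M gen] by (rule smult_set_mono)
  have sub: "?K <+>\<^bsub>M\<^esub> ?B \<subseteq> ?A <+>\<^bsub>M\<^esub> ?B" using KA unfolding subset_iff M.mem_set_add by blast
  have mAB: "m \<in> ?A <+>\<^bsub>M\<^esub> ?B"
    using M.set_add_subset_left[OF s(1,3)] mem_smult_set_self[OF M mm(1)] by blast
  have "m \<notin> ?K <+>\<^bsub>M\<^esub> ?B"
  proof
    assume "m \<in> ?K <+>\<^bsub>M\<^esub> ?B"
    then obtain b b' where b: "b \<in> I" "b' \<in> carrier R" "m = b \<odot>\<^bsub>M\<^esub> m \<oplus>\<^bsub>M\<^esub> b' \<odot>\<^bsub>M\<^esub> m'"
      by (auto simp: M.mem_set_add smult_set_def)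
    have "\<one>\<^bsub>R\<^esub> \<odot>\<^bsub>M\<^esub> m \<oplus>\<^bsub>M\<^esub> \<zero>\<^bsub>R\<^esub> \<odot>\<^bsub>M\<^esub> m' = b \<odot>\<^bsub>M\<^esub> m \<oplus>\<^bsub>M\<^esub> b' \<odot>\<^bsub>M\<^esub> m'"
      using b(3) mm by simp
    then have "\<one>\<^bsub>R\<^esub> \<in> I" using sum_relation_top[of "\<one>\<^bsub>R\<^esub>" "\<zero>\<^bsub>R\<^esub>" b b'] b by simp
    then show False using gen_one[OF M gen] by blast
  qed
  moreover have "L = ?K <+>\<^bsub>M\<^esub> ?B \<or> L = ?A <+>\<^bsub>M\<^esub> ?B"
    if L: "submodule L R M" "L \<subseteq> ?A <+>\<^bsub>M\<^esub> ?B" "?K <+>\<^bsub>M\<^esub> ?B \<subseteq> L" for L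
  proof (cases "L \<subseteq> ?K <+>\<^bsub>M\<^esub> ?B")
    case False
    then obtain x where x: "x \<in> L" "x \<notin> ?K <+>\<^bsub>M\<^esub> ?B" by blast
    then obtain a b where ab: "a \<in> carrier R" "b \<in> carrier R" "x = a \<odot>\<^bsub>M\<^esub> m \<oplus>\<^bsub>M\<^esub> b \<odot>\<^bsub>M\<^esub> m'"
      using L(2) unfolding subset_iff M.mem_set_add smult_set_def by blast
    have "a \<notin> I" using x(2) ab unfolding M.mem_set_add smult_set_def by blast
    have B: "?B \<subseteq> L" using M.set_add_subset_right[OF s(2,3)] L(3) by blast
    then have "x \<ominus>\<^bsub>M\<^esub> b \<odot>\<^bsub>M\<^esub> m' \<in> L" using M.submodule_diff[OF L(1) x(1)] ab(2) unfolding smult_set_def by blast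
    moreover have "x \<ominus>\<^bsub>M\<^esub> b \<odot>\<^bsub>M\<^esub> m' = a \<odot>\<^bsub>M\<^esub> m"
      using ab mm by (simp add: a_minus_def M.M.a_assoc M.M.r_neg)
    ultimately have "m \<in> L" using gen_in_submodule[OF M gen L(1) ab(1) \<open>a \<notin> I\<close>] by simp
    then have "?A \<subseteq> L" by (rule smult_set_least[OF M L(1)])
    then show ?thesis using M.set_add_least[OF L(1)] B L(2) by blast
  qed (use L in blast)
  ultimately show ?thesis
    unfolding maximal_submodule_def M.submodule_of_submodule[OF sAB]
    using sKB sub mAB by auto
qed

lemma small_in_maximal:
  assumes L: "maximal_submodule R (M\<lparr>carrier := smult_set M (carrier R) m <+>\<^bsub>M\<^esub> smult_set M (carrier R) m'\<rparr>) L"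
  shows "smult_set M I m \<subseteq> L"
proof (rule ccontr)
  let ?A = "smult_set M (carrier R) m" and ?B = "smult_set M (carrier R) m'" and ?K = "smult_set M I m"
  assume n: "\<not> ?K \<subseteq> L"
  note s = gen_submodules[OF M gen] gen_submodules(1)[OF M gen']
  note mm = gen_mem[OF M gen] gen_mem[OF M gen']
  have sAB: "submodule (?A <+>\<^bsub>M\<^esub> ?B) R M" using M.submodule_add s by auto
  have L: "submodule L R M" "L \<subseteq> ?A <+>\<^bsub>M\<^esub> ?B"
    and max: "\<And>N'. submodule N' R M \<Longrightarrow> N' \<subseteq> ?A <+>\<^bsub>M\<^esub> ?B \<Longrightarrow> L \<subseteq> N' \<Longrightarrow> N' = L \<or> N' = ?A <+>\<^bsub>M\<^esub> ?B"
    using assms unfolding maximal_submodule_def M.submodule_of_submodule[OF sAB] by auto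
  have AB: "?A \<subseteq> ?A <+>\<^bsub>M\<^esub> ?B" by (rule M.set_add_subset_left[OF s(1,3)])
  have KA: "?K \<subseteq> ?A" using gen_sub[OF M gen] by (rule smult_set_mono)
  have "L <+>\<^bsub>M\<^esub> ?K = L \<or> L <+>\<^bsub>M\<^esub> ?K = ?A <+>\<^bsub>M\<^esub> ?B"
    using max[of "L <+>\<^bsub>M\<^esub> ?K"] M.submodule_add[OF L(1) s(2)] M.set_add_least[OF sAB L(2), of ?K] AB KA
      M.set_add_subset_left[OF L(1) s(2)] by blast
  then have "m \<in> L <+>\<^bsub>M\<^esub> ?K"
    using n M.set_add_subset_right[OF L(1) s(2)] AB mem_smult_set_self[OF M mm(1)] by blast
  then obtain l b where b: "l \<in> L" "b \<in> I" "m = l \<oplus>\<^bsub>M\<^esub> b \<odot>\<^bsub>M\<^esub> m"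
    by (auto simp: M.mem_set_add smult_set_def)
  have bR: "b \<in> carrier R" using b gen_sub[OF M gen] by blast
  have lM: "l \<in> carrier M" using b L by (auto simp: M.submodule_iff)
  have "(\<one>\<^bsub>R\<^esub> \<ominus>\<^bsub>R\<^esub> b) \<odot>\<^bsub>M\<^esub> m = m \<ominus>\<^bsub>M\<^esub> b \<odot>\<^bsub>M\<^esub> m" using bR mm by (simp add: M.smult_l_diff)
  also have "\<dots> = (l \<oplus>\<^bsub>M\<^esub> b \<odot>\<^bsub>M\<^esub> m) \<ominus>\<^bsub>M\<^esub> b \<odot>\<^bsub>M\<^esub> m" using b(3) by simp
  also have "\<dots> = l" using lM bR mm by (simp add: a_minus_def M.M.a_assoc M.M.r_neg)
  finally have "m \<in> L"
    using gen_in_submodule[OF M gen L(1), of "\<one>\<^bsub>R\<^esub> \<ominus>\<^bsub>R\<^esub> b"] b(1) bR gen_minus_one[OF M gen b(2)] by simp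
  then have "?A \<subseteq> L" by (rule smult_set_least[OF M L(1)])
  then show False using n KA by blast
qed

end

context
  fixes R :: "'a ring" and M :: "('a, 'm) module" and e e' :: 'a and I I' m m'
  assumes M: "left_module R M" and gen: "local_gen R e I M m" and gen': "local_gen R e' I' M m'"
    and out: "m \<notin> smult_set M (carrier R) m'" and out': "m' \<notin> smult_set M (carrier R) m"
begin

interpretation M: left_module R M by (rule M)

text \<open>The two maximal submodules that enlarge one radical by the whole of the other summand intersect in the sum of
  the radicals, and every maximal submodule contains that sum.\<close>

lemma rad_two_gens:
  "rad R (M\<lparr>carrier := smult_set M (carrier R) m <+>\<^bsub>M\<^esub> smult_set M (carrier R) m'\<rparr>) =
     smult_set M I m <+>\<^bsub>M\<^esub> smult_set M I' m'" (is "rad R (M\<lparr>carrier := ?A <+>\<^bsub>M\<^esub> ?B\<rparr>) = ?K <+>\<^bsub>M\<^esub> ?L")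
proof -
  note s = gen_submodules[OF M gen] gen_submodules[OF M gen']
  have c: "?A \<subseteq> carrier M" "?B \<subseteq> carrier M" "?K \<subseteq> carrier M" "?L \<subseteq> carrier M"
    using s by (auto simp: M.submodule_iff)
  have KA: "?K \<subseteq> ?A" "?L \<subseteq> ?B"
    using gen_sub[OF M gen] gen_sub[OF M gen'] smult_set_mono by metis+
  have comm: "?B <+>\<^bsub>M\<^esub> ?A = ?A <+>\<^bsub>M\<^esub> ?B" "?L <+>\<^bsub>M\<^esub> ?A = ?A <+>\<^bsub>M\<^esub> ?L"
    using M.set_add_commute c by auto
  have max: "maximal_submodule R (M\<lparr>carrier := ?A <+>\<^bsub>M\<^esub> ?B\<rparr>) (?K <+>\<^bsub>M\<^esub> ?B)"
    "maximal_submodule R (M\<lparr>carrier := ?A <+>\<^bsub>M\<^esub> ?B\<rparr>) (?A <+>\<^bsub>M\<^esub> ?L)"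
    using maximal_sum[OF M gen gen' out] maximal_sum[OF M gen' gen out'] comm by simp_all
  show ?thesis
  proof
    show "rad R (M\<lparr>carrier := ?A <+>\<^bsub>M\<^esub> ?B\<rparr>) \<subseteq> ?K <+>\<^bsub>M\<^esub> ?L"
    proof
      fix x assume "x \<in> rad R (M\<lparr>carrier := ?A <+>\<^bsub>M\<^esub> ?B\<rparr>)"
      then have x: "x \<in> ?K <+>\<^bsub>M\<^esub> ?B" "x \<in> ?A <+>\<^bsub>M\<^esub> ?L" using max unfolding rad_def by blast+
      then obtain b b' where b: "b \<in> I" "b' \<in> carrier R" "x = b \<odot>\<^bsub>M\<^esub> m \<oplus>\<^bsub>M\<^esub> b' \<odot>\<^bsub>M\<^esub> m'"
        by (auto simp: M.mem_set_add smult_set_def)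
      from x(2) obtain d d' where d: "d \<in> carrier R" "d' \<in> I'" "x = d \<odot>\<^bsub>M\<^esub> m \<oplus>\<^bsub>M\<^esub> d' \<odot>\<^bsub>M\<^esub> m'"
        by (auto simp: M.mem_set_add smult_set_def)
      have R: "b \<in> carrier R" "d' \<in> carrier R" using b d gen_sub[OF M gen] gen_sub[OF M gen'] by auto
      have "b' \<odot>\<^bsub>M\<^esub> m' \<oplus>\<^bsub>M\<^esub> b \<odot>\<^bsub>M\<^esub> m = d' \<odot>\<^bsub>M\<^esub> m' \<oplus>\<^bsub>M\<^esub> d \<odot>\<^bsub>M\<^esub> m"
        using b d R gen_mem[OF M gen] gen_mem[OF M gen'] by (metis M.M.a_comm M.smult_closed)
      then have "b' \<in> I'" using sum_relation_top[OF M gen' gen out', of b' b d' d] b d R by simp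
      then show "x \<in> ?K <+>\<^bsub>M\<^esub> ?L" using b unfolding M.mem_set_add smult_set_def by blast
    qed
    have sAB: "submodule (?A <+>\<^bsub>M\<^esub> ?B) R M" using M.submodule_add s by auto
    have "?K <+>\<^bsub>M\<^esub> ?L \<subseteq> L" if L: "maximal_submodule R (M\<lparr>carrier := ?A <+>\<^bsub>M\<^esub> ?B\<rparr>) L" for L
    proof (rule M.set_add_least)
      show "submodule L R M"
        using L unfolding maximal_submodule_def M.submodule_of_submodule[OF sAB] by auto
      show "?K \<subseteq> L" by (rule small_in_maximal[OF M gen gen' out L])
      show "?L \<subseteq> L" by (rule small_in_maximal[OF M gen' gen out']) (use L comm in simp)
    qed
    moreover have "?K <+>\<^bsub>M\<^esub> ?L \<subseteq> ?A <+>\<^bsub>M\<^esub> ?B"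
      using KA unfolding subset_iff M.mem_set_add by blast
    ultimately show "?K <+>\<^bsub>M\<^esub> ?L \<subseteq> rad R (M\<lparr>carrier := ?A <+>\<^bsub>M\<^esub> ?B\<rparr>)" unfolding rad_def by auto
  qed
qed

lemma two_gens_layer:
  assumes S: "cyclic_on R S v I" and S': "cyclic_on R S' v' I'"
  shows "mod_iso R (S \<oplus>\<^sub>m S')
    (quot_module (M\<lparr>carrier := smult_set M (carrier R) m <+>\<^bsub>M\<^esub> smult_set M (carrier R) m'\<rparr>)
      (smult_set M I m <+>\<^bsub>M\<^esub> smult_set M I' m'))"
proof -
  let ?A = "smult_set M (carrier R) m" and ?B = "smult_set M (carrier R) m'"
  let ?N = "M\<lparr>carrier := ?A <+>\<^bsub>M\<^esub> ?B\<rparr>" and ?F = "regular_module R \<oplus>\<^sub>m regular_module R"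
  let ?h = "\<lambda>(a, b). a \<odot>\<^bsub>M\<^esub> m \<oplus>\<^bsub>M\<^esub> b \<odot>\<^bsub>M\<^esub> m'" and ?k = "\<lambda>(a, b). (a \<odot>\<^bsub>S\<^esub> v, b \<odot>\<^bsub>S'\<^esub> v')"
  note s = gen_submodules[OF M gen] gen_submodules[OF M gen']
  note mm = gen_mem[OF M gen] gen_mem[OF M gen']
  have Sv: "left_module R S" "v \<in> carrier S" "smult_set S (carrier R) v = carrier S"
    "I = {a \<in> carrier R. a \<odot>\<^bsub>S\<^esub> v = \<zero>\<^bsub>S\<^esub>}" using S by (auto simp: cyclic_on_def)
  have Sv': "left_module R S'" "v' \<in> carrier S'" "smult_set S' (carrier R) v' = carrier S'"
    "I' = {a \<in> carrier R. a \<odot>\<^bsub>S'\<^esub> v' = \<zero>\<^bsub>S'\<^esub>}" using S' by (auto simp: cyclic_on_def)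
  interpret S: left_module R S by fact
  interpret S': left_module R S' by fact
  have sAB: "submodule (?A <+>\<^bsub>M\<^esub> ?B) R M" using M.submodule_add s by auto
  have "mod_iso R (S \<oplus>\<^sub>m S') (quot_module ?N (?h ` {x \<in> carrier ?F. ?k x = \<zero>\<^bsub>S \<oplus>\<^sub>m S'\<^esub>}))"
  proof (rule iso_of_surjections[where k = ?k])
    show "left_module R ?F" by (intro left_module_mod_sum left_module_regular M.R.ring_axioms)
    show "left_module R ?N" by (rule M.left_module_submodule[OF sAB])
    show "left_module R (S \<oplus>\<^sub>m S')" by (rule left_module_mod_sum[OF Sv(1) Sv'(1)])
    show "?h \<in> mod_hom R ?F ?N"
    proof (rule mod_homI)
      fix x assume "x \<in> carrier ?F" then show "?h x \<in> carrier ?N" by (auto simp: M.mem_set_add smult_set_def)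
    qed (use mm in \<open>auto simp: M.smult_l_distr M.smult_assoc1 M.smult_r_distr M.M.a_ac\<close>)
    show "?k \<in> mod_hom R ?F (S \<oplus>\<^sub>m S')"
      using Sv(2) Sv'(2) by (intro mod_homI) (auto simp: S.smult_l_distr S.smult_assoc1 S'.smult_l_distr S'.smult_assoc1)
    show "?h ` carrier ?F = carrier ?N"
      by (force simp: M.mem_set_add smult_set_def)
    show "?k ` carrier ?F = carrier (S \<oplus>\<^sub>m S')"
      unfolding mod_sum_simps Sv(3)[symmetric] Sv'(3)[symmetric] by (auto simp: smult_set_def)
    fix x assume x: "x \<in> carrier ?F" "?h x = \<zero>\<^bsub>?N\<^esub>"
    obtain a b where ab: "x = (a, b)" by (cases x)
    have R: "a \<in> carrier R" "b \<in> carrier R" using x ab by auto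
    have z: "\<zero>\<^bsub>R\<^esub> \<in> I" "\<zero>\<^bsub>R\<^esub> \<in> I'"
      using gen_ideal[OF M gen] gen_ideal[OF M gen'] by (auto simp: left_ideal_iff[OF M.R.ring_axioms])
    have e: "a \<odot>\<^bsub>M\<^esub> m \<oplus>\<^bsub>M\<^esub> b \<odot>\<^bsub>M\<^esub> m' = \<zero>\<^bsub>R\<^esub> \<odot>\<^bsub>M\<^esub> m \<oplus>\<^bsub>M\<^esub> \<zero>\<^bsub>R\<^esub> \<odot>\<^bsub>M\<^esub> m'" using x ab mm by simp
    then have "a \<in> I" using sum_relation_top[OF M gen gen' out R z(1) M.R.zero_closed] by blast
    moreover have "b \<odot>\<^bsub>M\<^esub> m' \<oplus>\<^bsub>M\<^esub> a \<odot>\<^bsub>M\<^esub> m = \<zero>\<^bsub>R\<^esub> \<odot>\<^bsub>M\<^esub> m' \<oplus>\<^bsub>M\<^esub> \<zero>\<^bsub>R\<^esub> \<odot>\<^bsub>M\<^esub> m"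
      using e R mm by (simp add: M.M.a_comm)
    then have "b \<in> I'" using sum_relation_top[OF M gen' gen out' R(2,1) z(2) M.R.zero_closed] by blast
    ultimately show "?k x = \<zero>\<^bsub>S \<oplus>\<^sub>m S'\<^esub>" using Sv(4) Sv'(4) ab by simp
  qed
  moreover have "?h ` {x \<in> carrier ?F. ?k x = \<zero>\<^bsub>S \<oplus>\<^sub>m S'\<^esub>} = smult_set M I m <+>\<^bsub>M\<^esub> smult_set M I' m'"
    unfolding Sv(4) Sv'(4) by (force simp: M.mem_set_add smult_set_def)
  ultimately show ?thesis by simp
qed

end

section \<open>Radical layers, composition series and socle\<close>

lemma rad_power_Suc:
  "rad_power R M (Suc n) = rad_power R (M\<lparr>carrier := rad R M\<rparr>) n"
  by (induction n) simp_all

lemma has_radical_layers_Nil: "has_radical_layers R M [] \<longleftrightarrow> carrier M = {\<zero>\<^bsub>M\<^esub>}"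
  by (simp add: has_radical_layers_def)

lemma has_radical_layers_Cons:
  "has_radical_layers R M (L # Ls) \<longleftrightarrow>
     L (quot_module M (rad R M)) \<and> has_radical_layers R (M\<lparr>carrier := rad R M\<rparr>) Ls"
proof -
  let ?M = "M\<lparr>carrier := rad R M\<rparr>"
  have 1: "rad_layer R M 1 = quot_module M (rad R M)" by (simp add: rad_layer_def)
  have s: "rad_layer R M (Suc (Suc n)) = rad_layer R ?M (Suc n)" for n
    unfolding rad_layer_def diff_Suc_1 rad_power_Suc[of R M] by simp
  have shift: "(\<forall>n\<in>{1..m}. P n) \<longleftrightarrow> (\<forall>n<m. P (Suc n))" for m and P :: "nat \<Rightarrow> bool"
    unfolding image_Suc_lessThan[symmetric] by auto
  have "(\<forall>n\<in>{1..length (L # Ls)}. ((L # Ls) ! (n - 1)) (rad_layer R M n)) \<longleftrightarrow>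
      (\<forall>n<Suc (length Ls). ((L # Ls) ! n) (rad_layer R M (Suc n)))"
    unfolding shift by simp
  also have "\<dots> \<longleftrightarrow> L (quot_module M (rad R M)) \<and> (\<forall>n<length Ls. (Ls ! n) (rad_layer R ?M (Suc n)))"
    unfolding less_Suc_eq_0_disj using 1 s by auto
  also have "(\<forall>n<length Ls. (Ls ! n) (rad_layer R ?M (Suc n))) \<longleftrightarrow>
      (\<forall>n\<in>{1..length Ls}. (Ls ! (n - 1)) (rad_layer R ?M n))"
    unfolding shift by simp
  finally show ?thesis
    unfolding has_radical_layers_def using rad_power_Suc[of R M "length Ls"] by simp
qed

primrec local_series :: "'a ring \<Rightarrow> ('a, 'm) module \<Rightarrow> ('a \<times> 'a set \<times> 'm) list \<Rightarrow> 'm set \<Rightarrow> bool" where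
  "local_series R M [] N \<longleftrightarrow> N = {\<zero>\<^bsub>M\<^esub>}"
| "local_series R M (g # gs) N \<longleftrightarrow> (case g of (e, I, m) \<Rightarrow>
     local_gen R e I M m \<and> N = smult_set M (carrier R) m \<and> local_series R M gs (smult_set M I m))"

text \<open>A local series descends by \<open>I m\<close> being generated by the next entry, so its members are the radical powers.\<close>

lemma has_radical_layers_local_series:
  assumes M: "left_module R M"
  shows "local_series R M gs N \<Longrightarrow>
    list_all2 (\<lambda>(e, I, m) L. local_gen R e I M m \<longrightarrow>
      L (quot_module (M\<lparr>carrier := smult_set M (carrier R) m\<rparr>) (smult_set M I m))) gs Ls \<Longrightarrow>
    has_radical_layers R (M\<lparr>carrier := N\<rparr>) Ls"
proof (induction gs arbitrary: N Ls)
  case Nil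
  then show ?case by (simp add: has_radical_layers_Nil)
next
  case (Cons g gs)
  obtain e I m where g: "g = (e, I, m)" by (cases g)
  obtain L Ls' where Ls: "Ls = L # Ls'" "list_all2 (\<lambda>(e, I, m) L. local_gen R e I M m \<longrightarrow>
      L (quot_module (M\<lparr>carrier := smult_set M (carrier R) m\<rparr>) (smult_set M I m))) gs Ls'"
      "local_gen R e I M m \<longrightarrow> L (quot_module (M\<lparr>carrier := smult_set M (carrier R) m\<rparr>) (smult_set M I m))"
    using Cons.prems(2) g by (auto simp: list_all2_Cons1)
  have s: "local_gen R e I M m" "N = smult_set M (carrier R) m" "local_series R M gs (smult_set M I m)"
    using Cons.prems(1) g by auto
  show ?case
    unfolding Ls(1) has_radical_layers_Cons s(2) rad_gen[OF M s(1)]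
    using Ls(3) s(1) Cons.IH[OF s(3) Ls(2)] by simp
qed

text \<open>In a chain in which every member is the unique maximal submodule of its successor, a composition series has
  no choice at any step; induction along the chain.\<close>

lemma uniserial_chain:
  assumes M: "left_module R M" and Ns: "Ns \<noteq> []" "hd Ns = {\<zero>\<^bsub>M\<^esub>}" "last Ns = carrier M"
    and sub: "\<And>N. N \<in> set Ns \<Longrightarrow> submodule N R M"
    and step: "\<And>i. Suc i < length Ns \<Longrightarrow> Ns ! i \<subset> Ns ! Suc i \<and>
      (\<forall>L. submodule L R M \<and> L \<subseteq> Ns ! Suc i \<longrightarrow> L = Ns ! Suc i \<or> L \<subseteq> Ns ! i)"
  shows "uniserial R M"
proof -
  interpret M: left_module R M by fact
  have simple_step: "simple_module R (quot_module (M\<lparr>carrier := B\<rparr>) A) \<longleftrightarrow>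
      A \<noteq> B \<and> (\<forall>L. submodule L R M \<and> A \<subseteq> L \<and> L \<subseteq> B \<longrightarrow> L = A \<or> L = B)"
    if "submodule A R M" "submodule B R M" "A \<subseteq> B" for A B
    using simple_quot_iff[OF M.left_module_submodule[OF that(2)], of A] that
    unfolding M.submodule_of_submodule[OF that(2)] by auto
  have nth_sub: "submodule (Ns ! i) R M" if "i < length Ns" for i using that sub by simp
  have cs: "composition_series R M Ns"
    unfolding composition_series_def
  proof (intro conjI allI impI ballI)
    fix i assume i: "Suc i < length Ns"
    show "Ns ! i \<subseteq> Ns ! Suc i" using step[OF i] by blast
    show "simple_module R (quot_module (M\<lparr>carrier := Ns ! Suc i\<rparr>) (Ns ! i))"
      using simple_step[OF nth_sub nth_sub, of i "Suc i"] step[OF i] i by auto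
  qed (use Ns sub in auto)
  have below: "L \<in> set Ns" if L: "submodule L R M" for L
  proof -
    have "L \<subseteq> Ns ! i \<Longrightarrow> i < length Ns \<Longrightarrow> L \<in> set Ns" for i
    proof (induction i)
      case 0
      then have "L \<subseteq> {\<zero>\<^bsub>M\<^esub>}" using Ns by (simp add: hd_conv_nth)
      then have "L = Ns ! 0" using L Ns by (auto simp: M.submodule_iff hd_conv_nth)
      then show ?case using 0 by simp
    next
      case (Suc i)
      then show ?case using step[of i] L by (cases "L = Ns ! Suc i") auto
    qed
    from this[of "length Ns - 1"] show ?thesis
      using Ns L by (auto simp: last_conv_nth M.submodule_iff)
  qed
  have mono: "Ns ! i \<subseteq> Ns ! j" if "i \<le> j" "j < length Ns" for i j
    using that
  proof (induction j rule: dec_induct)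
    case (step n) then show ?case using assms(6)[of n] by auto
  qed simp
  have smono: "Ns ! i \<subset> Ns ! j" if "i < j" "j < length Ns" for i j
    using that mono[of "Suc i" j] step[of i] by auto
  have uniq: "Ms = Ns" if Ms: "composition_series R M Ms" for Ms
  proof -
    have Mne: "Ms \<noteq> []" "hd Ms = {\<zero>\<^bsub>M\<^esub>}" "last Ms = carrier M" "\<And>N. N \<in> set Ms \<Longrightarrow> submodule N R M"
      and Mst: "\<And>i. Suc i < length Ms \<Longrightarrow> Ms ! i \<subseteq> Ms ! Suc i \<and>
        simple_module R (quot_module (M\<lparr>carrier := Ms ! Suc i\<rparr>) (Ms ! i))"
      using Ms by (auto simp: composition_series_def)
    have eq: "i < length Ms \<Longrightarrow> i < length Ns \<Longrightarrow> Ms ! i = Ns ! i" for i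
    proof (induction i)
      case 0 then show ?case using Mne Ns by (simp add: hd_conv_nth[symmetric])
    next
      case (Suc i)
      then have e: "Ms ! i = Ns ! i" by simp
      have sM: "submodule (Ms ! i) R M" "submodule (Ms ! Suc i) R M" using Mne(4) Suc.prems by simp_all
      have ms: "Ms ! i \<subset> Ms ! Suc i" "\<And>L. submodule L R M \<Longrightarrow> Ms ! i \<subseteq> L \<Longrightarrow> L \<subseteq> Ms ! Suc i \<Longrightarrow> L = Ms ! i \<or> L = Ms ! Suc i"
        using Mst[OF Suc.prems(1)] simple_step[OF sM] by auto
      obtain j where j: "j < length Ns" "Ms ! Suc i = Ns ! j" using below[OF sM(2)] by (auto simp: in_set_conv_nth)
      have "i < j"
      proof (rule ccontr)
        assume "\<not> i < j"
        then have "Ns ! j \<subseteq> Ns ! i" using mono[of j i] Suc.prems by simp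
        then show False using ms(1) j e by auto
      qed
      then have "Ns ! Suc i \<subseteq> Ms ! Suc i" using mono[of "Suc i" j] j by simp
      moreover have "Ms ! i \<subset> Ns ! Suc i" using e step[OF Suc.prems(2)] by auto
      ultimately show ?case using ms(2)[OF nth_sub[OF Suc.prems(2)]] by auto
    qed
    have len: "length Ms = length Ns"
    proof (rule linorder_cases)
      assume l: "length Ms < length Ns"
      then have "Ns ! (length Ms - 1) = carrier M" using eq[of "length Ms - 1"] Mne by (simp add: last_conv_nth)
      moreover have "Ns ! (length Ms - 1) \<subset> Ns ! (length Ns - 1)" 
      proof (rule smono)
        show "length Ms - 1 < length Ns - 1" using l Mne(1) by (cases Ms) auto
      qed (use Ns(1) in simp)
      ultimately show ?thesis using Ns by (auto simp: last_conv_nth)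
    next
      assume l: "length Ns < length Ms"
      let ?i = "length Ns - 1"
      have i: "Suc ?i < length Ms" "Suc ?i = length Ns" using l Ns(1) by (cases Ns; simp)+
      have "Ms ! ?i = carrier M" using eq[of ?i] Ns(1,3) l by (simp add: last_conv_nth)
      moreover have s: "submodule (Ms ! ?i) R M" "submodule (Ms ! Suc ?i) R M" using Mne(4) i by simp_all
      moreover have "Ms ! ?i \<noteq> Ms ! Suc ?i" using Mst[OF i(1)] simple_step[OF s] by auto
      ultimately show ?thesis using Mst[OF i(1)] by (auto simp: M.submodule_iff)
    qed simp
    show ?thesis by (rule nth_equalityI) (use len eq in auto)
  qed
  show ?thesis unfolding uniserial_def using M cs uniq by blast
qed

lemma local_series_chain:
  assumes M: "left_module R M"
  shows "local_series R M gs N \<Longrightarrow> submodule N R M \<and>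
    (\<exists>Ns. Ns \<noteq> [] \<and> hd Ns = {\<zero>\<^bsub>M\<^esub>} \<and> last Ns = N \<and> (\<forall>N\<in>set Ns. submodule N R M) \<and>
    (\<forall>i. Suc i < length Ns \<longrightarrow> Ns ! i \<subset> Ns ! Suc i \<and>
      (\<forall>L. submodule L R M \<and> L \<subseteq> Ns ! Suc i \<longrightarrow> L = Ns ! Suc i \<or> L \<subseteq> Ns ! i)))"
proof (induction gs arbitrary: N)
  case Nil
  interpret M: left_module R M by fact
  show ?case using Nil by (auto intro!: exI[of _ "[{\<zero>\<^bsub>M\<^esub>}]"] M.submodule_zero)
next
  case (Cons g gs)
  interpret M: left_module R M by fact
  obtain e I m where g: "g = (e, I, m)" by (cases g)
  have s: "local_gen R e I M m" "N = smult_set M (carrier R) m" "local_series R M gs (smult_set M I m)"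
    using Cons.prems(1) g by auto
  obtain Ns where Ns: "Ns \<noteq> []" "hd Ns = {\<zero>\<^bsub>M\<^esub>}" "last Ns = smult_set M I m" "\<forall>N\<in>set Ns. submodule N R M"
    "\<forall>i. Suc i < length Ns \<longrightarrow> Ns ! i \<subset> Ns ! Suc i \<and>
      (\<forall>L. submodule L R M \<and> L \<subseteq> Ns ! Suc i \<longrightarrow> L = Ns ! Suc i \<or> L \<subseteq> Ns ! i)"
    using Cons.IH[OF s(3)] by blast
  have N: "submodule N R M" unfolding s(2) by (rule gen_submodules[OF M s(1)])
  have top: "smult_set M I m \<subset> N \<and> (\<forall>L. submodule L R M \<and> L \<subseteq> N \<longrightarrow> L = N \<or> L \<subseteq> smult_set M I m)"
  proof (intro conjI psubsetI allI impI)
    show "smult_set M I m \<subseteq> N" unfolding s(2) by (rule smult_set_mono[OF gen_sub[OF M s(1)]])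
    show "smult_set M I m \<noteq> N"
      using gen_not_in[OF M s(1)] mem_smult_set_self[OF M gen_mem[OF M s(1)]] s(2) by blast
  qed (use gen_dichotomy[OF M s(1)] s(2) in blast)
  have "(Ns @ [N]) ! i \<subset> (Ns @ [N]) ! Suc i \<and>
      (\<forall>L. submodule L R M \<and> L \<subseteq> (Ns @ [N]) ! Suc i \<longrightarrow> L = (Ns @ [N]) ! Suc i \<or> L \<subseteq> (Ns @ [N]) ! i)"
    if "Suc i < length (Ns @ [N])" for i
  proof (cases "Suc i < length Ns")
    case True
    then show ?thesis using Ns(5) by (simp add: nth_append)
  next
    case False
    then have "Suc i = length Ns" using that by simp
    moreover from this have "Ns ! i = smult_set M I m" using Ns(1,3) by (metis diff_Suc_1 last_conv_nth)
    ultimately show ?thesis using top by (simp add: nth_append)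
  qed
  then show ?case using N Ns by (intro conjI exI[of _ "Ns @ [N]"]) auto
qed

lemma uniserial_local_series:
  assumes M: "left_module R M" and gs: "local_series R M gs N"
  shows "uniserial R (M\<lparr>carrier := N\<rparr>)"
proof -
  interpret M: left_module R M by fact
  obtain Ns where N: "submodule N R M" and Ns: "Ns \<noteq> []" "hd Ns = {\<zero>\<^bsub>M\<^esub>}" "last Ns = N" "\<forall>N\<in>set Ns. submodule N R M"
    "\<forall>i. Suc i < length Ns \<longrightarrow> Ns ! i \<subset> Ns ! Suc i \<and>
      (\<forall>L. submodule L R M \<and> L \<subseteq> Ns ! Suc i \<longrightarrow> L = Ns ! Suc i \<or> L \<subseteq> Ns ! i)"
    using local_series_chain[OF M gs] by blast
  have mono: "Ns ! i \<subseteq> Ns ! j" if "i \<le> j" "j < length Ns" for i j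
    using that
  proof (induction j rule: dec_induct)
    case (step n) then show ?case using Ns(5)[rule_format, of n] by auto
  qed simp
  have "L \<subseteq> N" if L: "L \<in> set Ns" for L
  proof -
    obtain i where "i < length Ns" "L = Ns ! i" using L by (auto simp: in_set_conv_nth)
    then show ?thesis using mono[of i "length Ns - 1"] Ns(1,3) by (simp add: last_conv_nth)
  qed
  then show ?thesis
    using Ns by (intro uniserial_chain[where Ns = Ns] M.left_module_submodule[OF N])
      (auto simp: M.submodule_of_submodule[OF N])
qed

lemma semisimple_simple_submodule:
  assumes M: "left_module R M" and W: "submodule W R M" "simple_module R (M\<lparr>carrier := W\<rparr>)"
  shows "semisimple_module R (M\<lparr>carrier := W\<rparr>)"
proof -
  interpret M: left_module R M by fact
  let ?W = "M\<lparr>carrier := W\<rparr>"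
  interpret W: left_module R ?W by (rule M.left_module_submodule[OF W(1)])
  have sum: "(\<Oplus>\<^bsub>?W\<^esub>i\<in>{..<1}. x i) = x 0" if "x (0::nat) \<in> W" for x
  proof -
    have "{..<1} = {0::nat}" by auto
    moreover have "x 0 \<in> carrier M" using that W(1) by (auto simp: M.submodule_iff)
    ultimately show ?thesis using that W.M.finsum_insert[of "{}" 0 x] by simp
  qed
  have "bij_betw (\<lambda>x. \<Oplus>\<^bsub>?W\<^esub>i\<in>{..<1}. x i) (Pi\<^sub>E {..<1::nat} (\<lambda>_. W)) W"
  proof (rule bij_betw_byWitness[where f' = "\<lambda>w. \<lambda>i\<in>{..<1}. w"])
    show "\<forall>x\<in>Pi\<^sub>E {..<1::nat} (\<lambda>_. W). (\<lambda>i\<in>{..<1}. \<Oplus>\<^bsub>?W\<^esub>i\<in>{..<1}. x i) = x"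
      using sum by (auto simp: PiE_iff fun_eq_iff restrict_def extensional_def)
    show "\<forall>w\<in>W. (\<Oplus>\<^bsub>?W\<^esub>i\<in>{..<1::nat}. (\<lambda>i\<in>{..<1}. w) i) = w" using sum by simp
    show "(\<lambda>x. \<Oplus>\<^bsub>?W\<^esub>i\<in>{..<1}. x i) ` Pi\<^sub>E {..<1::nat} (\<lambda>_. W) \<subseteq> W" using sum by (auto simp: PiE_iff)
  qed (auto split: if_splits)
  moreover have "submodule W R ?W" using W.submodule_carrier by simp
  ultimately show ?thesis unfolding semisimple_module_def
    using W(2) W.left_module_axioms by (intro conjI exI[of _ 1] exI[of _ "\<lambda>_. W"]) auto
qed

text \<open>Every nonzero submodule contains the given simple one, so a semisimple submodule has a single simple summand.\<close>

lemma soc_simple: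
  assumes M: "left_module R M" and W: "submodule W R M" "simple_module R (M\<lparr>carrier := W\<rparr>)"
    and least: "\<And>N. submodule N R M \<Longrightarrow> N \<noteq> {\<zero>\<^bsub>M\<^esub>} \<Longrightarrow> W \<subseteq> N"
  shows "soc R M = W"
  unfolding soc_def
proof (rule Greatest_equality)
  show "submodule W R M \<and> semisimple_module R (M\<lparr>carrier := W\<rparr>)"
    using semisimple_simple_submodule[OF M W] W by blast
  interpret M: left_module R M by fact
  fix N assume N: "submodule N R M \<and> semisimple_module R (M\<lparr>carrier := N\<rparr>)"
  let ?N = "M\<lparr>carrier := N\<rparr>"
  interpret N: left_module R ?N using N M.left_module_submodule by blast
  obtain n and F :: "nat \<Rightarrow> 'b set" where F: "\<forall>i<n. submodule (F i) R ?N \<and> simple_module R (?N\<lparr>carrier := F i\<rparr>)"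
    "bij_betw (\<lambda>x. \<Oplus>\<^bsub>?N\<^esub>i\<in>{..<n}. x i) (Pi\<^sub>E {..<n} F) N"
    using N unfolding semisimple_module_def by auto
  have FW: "F i = W" if i: "i < n" for i
  proof -
    have Fi: "submodule (F i) R M" "F i \<subseteq> N" using F(1) i N M.submodule_of_submodule by auto
    have simp: "F i \<noteq> {\<zero>\<^bsub>M\<^esub>}" "\<And>L. submodule L R M \<Longrightarrow> L \<subseteq> F i \<Longrightarrow> L = {\<zero>\<^bsub>M\<^esub>} \<or> L = F i"
      using F(1) i unfolding simple_module_def by (auto simp: M.submodule_of_submodule[OF Fi(1)])
    have "W \<subseteq> F i" by (rule least[OF Fi(1) simp(1)])
    then show ?thesis using simp(2)[OF W(1)] W(2) unfolding simple_module_def by auto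
  qed
  show "N \<subseteq> W"
  proof
    fix y assume "y \<in> N"
    then obtain x where x: "x \<in> Pi\<^sub>E {..<n} F" "y = (\<Oplus>\<^bsub>?N\<^esub>i\<in>{..<n}. x i)"
      using F(2) unfolding bij_betw_def by blast
    have W0: "\<zero>\<^bsub>M\<^esub> \<in> W" "\<And>a b. a \<in> W \<Longrightarrow> b \<in> W \<Longrightarrow> a \<oplus>\<^bsub>M\<^esub> b \<in> W" using W(1) by (auto simp: M.submodule_iff)
    have sub: "x i \<in> N" if i: "i < n" for i
    proof -
      have "F i \<subseteq> N" using F(1) i N M.submodule_of_submodule by auto
      then show ?thesis using x(1) i by (auto simp: PiE_iff)
    qed
    have "k \<le> n \<Longrightarrow> (\<Oplus>\<^bsub>?N\<^esub>i\<in>{..<k}. x i) \<in> W" for k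
    proof (induction k)
      case (Suc k)
      have "(\<Oplus>\<^bsub>?N\<^esub>i\<in>{..<Suc k}. x i) = x k \<oplus>\<^bsub>M\<^esub> (\<Oplus>\<^bsub>?N\<^esub>i\<in>{..<k}. x i)"
        using N.M.finsum_insert[of "{..<k}" k x] Suc.prems sub by (simp add: lessThan_Suc Pi_def)
      moreover have "x k \<in> W" using x(1) FW[of k] Suc.prems by (auto simp: PiE_iff)
      ultimately show ?case using Suc W0 by simp
    qed (use W0 in simp)
    then show "y \<in> W" using x(2) by simp
  qed
qed

section \<open>Projective modules generated by an idempotent\<close>

abbreviation principal_module :: "'a ring \<Rightarrow> 'a \<Rightarrow> ('a, 'a) module" where
  "principal_module R e \<equiv> (regular_module R)\<lparr>carrier := smult_set (regular_module R) (carrier R) e\<rparr>"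

lemma mem_principal: "x \<in> smult_set (regular_module R) I e \<longleftrightarrow> (\<exists>a\<in>I. x = a \<otimes>\<^bsub>R\<^esub> e)"
  by (auto simp: smult_set_def)

lemma mod_power_simps [simp]:
  "carrier (mod_power M n) = {..<n} \<rightarrow>\<^sub>E carrier M" "\<zero>\<^bsub>mod_power M n\<^esub> = (\<lambda>i\<in>{..<n}. \<zero>\<^bsub>M\<^esub>)"
  "x \<oplus>\<^bsub>mod_power M n\<^esub> y = (\<lambda>i\<in>{..<n}. x i \<oplus>\<^bsub>M\<^esub> y i)"
  "a \<odot>\<^bsub>mod_power M n\<^esub> x = (\<lambda>i\<in>{..<n}. a \<odot>\<^bsub>M\<^esub> x i)"
  by (simp_all add: mod_power_def)

lemma left_module_mod_power:
  assumes "left_module R M" shows "left_module R (mod_power M n)"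
proof -
  interpret M: left_module R M by fact
  have "abelian_group (mod_power M n)"
  proof (rule abelian_groupI, goal_cases)
    case (6 x)
    then show ?case
      by (intro bexI[of _ "\<lambda>i\<in>{..<n}. \<ominus>\<^bsub>M\<^esub> x i"]) (auto simp: PiE_iff M.M.l_neg fun_eq_iff)
  qed (auto simp: PiE_iff M.M.a_ac fun_eq_iff extensional_def)
  then show ?thesis
    unfolding left_module_def left_module_axioms_def using M.R.ring_axioms
    by (auto simp: PiE_iff fun_eq_iff extensional_def M.smult_l_distr M.smult_r_distr M.smult_assoc1)
qed

lemma (in ring) idempotent_complement:
  assumes "e \<in> carrier R" "e \<otimes> e = e" "a \<in> carrier R" "b \<in> carrier R" "a \<otimes> e = b \<otimes> (\<one> \<ominus> e)"
  shows "a \<otimes> e = \<zero>"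
proof -
  have "a \<otimes> e = (a \<otimes> e) \<otimes> e" using assms(1-3) by (simp add: m_assoc)
  also have "\<dots> = (b \<otimes> (\<one> \<ominus> e)) \<otimes> e" by (simp only: assms(5))
  also have "\<dots> = b \<otimes> ((\<one> \<ominus> e) \<otimes> e)" using assms(1,4) by (simp add: m_assoc)
  also have "(\<one> \<ominus> e) \<otimes> e = \<zero>" using assms by (simp add: a_minus_def l_distr l_minus r_neg)
  finally show ?thesis using assms by simp
qed

text \<open>\<open>R e\<close> is a direct summand of \<open>R\<close>, complemented by \<open>R (1 - e)\<close>.\<close>

lemma projective_principal:
  assumes R: "ring R" and e: "e \<in> carrier R" "e \<otimes>\<^bsub>R\<^esub> e = e"
  shows "projective R (principal_module R e)"
proof -
  interpret R: ring R by fact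
  let ?F = "mod_power (regular_module R) 1"
  let ?c = "\<lambda>x. \<lambda>i\<in>{..<1::nat}. x"
  note reg = left_module_regular[OF R]
  interpret F: left_module R ?F by (rule left_module_mod_power[OF reg])
  interpret G: left_module R "regular_module R" by (rule reg)
  let ?A = "smult_set (regular_module R) (carrier R) e"
    and ?B = "smult_set (regular_module R) (carrier R) (\<one>\<^bsub>R\<^esub> \<ominus>\<^bsub>R\<^esub> e)"
  have hom: "?c \<in> mod_hom R (regular_module R) ?F" by (rule mod_homI) (auto simp: fun_eq_iff)
  have AB: "submodule ?A R (regular_module R)" "submodule ?B R (regular_module R)"
    using smult_set_submodule[OF reg] carrier_left_ideal[OF R] e by auto
  have sub: "?A \<subseteq> carrier R" "?B \<subseteq> carrier R" using AB by (auto simp: G.submodule_iff)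
  have inj: "?c x = ?c y \<longleftrightarrow> x = y" for x y :: 'a by (auto simp: fun_eq_iff restrict_def)
  have "internal_sum R ?F (?c ` ?A) (?c ` ?B)"
    unfolding internal_sum_def
  proof (intro conjI)
    show "submodule (?c ` ?A) R ?F" "submodule (?c ` ?B) R ?F"
      using image_submodule[OF reg F.left_module_axioms hom] AB by auto
    have "?A \<inter> ?B = {\<zero>\<^bsub>R\<^esub>}"
    proof
      show "{\<zero>\<^bsub>R\<^esub>} \<subseteq> ?A \<inter> ?B" using AB by (auto simp: G.submodule_iff)
      show "?A \<inter> ?B \<subseteq> {\<zero>\<^bsub>R\<^esub>}" using R.idempotent_complement[OF e] by (auto simp: mem_principal)
    qed
    moreover have "?c ` ?A \<inter> ?c ` ?B = ?c ` (?A \<inter> ?B)" using inj by (auto simp: image_iff)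
    ultimately show "?c ` ?A \<inter> ?c ` ?B = {\<zero>\<^bsub>?F\<^esub>}" by simp
    show "?c ` ?A <+>\<^bsub>?F\<^esub> ?c ` ?B = carrier ?F"
    proof
      show "?c ` ?A <+>\<^bsub>?F\<^esub> ?c ` ?B \<subseteq> carrier ?F"
        using F.submodule_add[OF image_submodule[OF reg F.left_module_axioms hom AB(1)]
            image_submodule[OF reg F.left_module_axioms hom AB(2)]]
        unfolding F.submodule_iff by (rule conjunct1)
      show "carrier ?F \<subseteq> ?c ` ?A <+>\<^bsub>?F\<^esub> ?c ` ?B"
      proof
        fix f assume f: "f \<in> carrier ?F"
        then have x: "f 0 \<in> carrier R" "f = ?c (f 0)" by (auto simp: PiE_iff fun_eq_iff extensional_def)
        let ?a = "f 0 \<otimes>\<^bsub>R\<^esub> e" and ?b = "f 0 \<otimes>\<^bsub>R\<^esub> (\<one>\<^bsub>R\<^esub> \<ominus>\<^bsub>R\<^esub> e)"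
        have eq: "f 0 = ?a \<oplus>\<^bsub>R\<^esub> ?b"
          using x(1) e by (simp add: a_minus_def R.r_distr R.r_minus R.a_lcomm R.r_neg)
        have "?c (?a \<oplus>\<^bsub>R\<^esub> ?b) = ?c ?a \<oplus>\<^bsub>?F\<^esub> ?c ?b" by (auto simp: fun_eq_iff)
        then have "f = ?c ?a \<oplus>\<^bsub>?F\<^esub> ?c ?b" by (rule trans[OF trans[OF x(2) arg_cong[OF eq, of ?c]]])
        moreover have "?a \<in> ?A" "?b \<in> ?B" using x(1) by (auto simp: mem_principal)
        ultimately show "f \<in> ?c ` ?A <+>\<^bsub>?F\<^esub> ?c ` ?B"
          unfolding F.mem_set_add by (intro bexI[of _ "?c ?a"] bexI[of _ "?c ?b"] imageI)
      qed
    qed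
  qed
  moreover have "mod_iso R (principal_module R e) (?F\<lparr>carrier := ?c ` ?A\<rparr>)"
    unfolding mod_iso_def
  proof
    show "?c \<in> mod_hom R (principal_module R e) (?F\<lparr>carrier := ?c ` ?A\<rparr>)"
      by (rule mod_homI) (auto simp: fun_eq_iff)
    show "bij_betw ?c (carrier (principal_module R e)) (carrier (?F\<lparr>carrier := ?c ` ?A\<rparr>))"
      using inj by (auto simp: bij_betw_def inj_on_def)
  qed
  ultimately show ?thesis
    unfolding projective_def using G.left_module_submodule[OF AB(1)] by blast
qed

context
  fixes R :: "'a ring" and e I
  assumes R: "ring R" and e: "e \<otimes>\<^bsub>R\<^esub> e = e" and top: "local_top R e I"
begin

interpretation G: left_module R "regular_module R" by (rule left_module_regular[OF R])

lemma local_gen_idempotent: "local_gen R e I (regular_module R) e"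
proof -
  have "e \<noteq> \<zero>\<^bsub>R\<^esub>" using top left_ideal_iff[OF R] unfolding local_top_def by metis
  then show ?thesis using e top unfolding local_gen_def local_top_def by simp
qed

lemma indecomposable_principal: "indecomposable R (principal_module R e)"
proof -
  note gen = local_gen_idempotent and G = G.left_module_axioms
  note s = gen_submodules[OF G gen]
  let ?A = "smult_set (regular_module R) (carrier R) e" and ?K = "smult_set (regular_module R) I e"
  interpret P: left_module R "principal_module R e" by (rule G.left_module_submodule[OF s(1)])
  have eA: "e \<in> ?A" "e \<notin> ?K" using mem_smult_set_self[OF G gen_mem[OF G gen]] gen_not_in[OF G gen] by auto
  have "N = {\<zero>\<^bsub>R\<^esub>} \<or> N' = {\<zero>\<^bsub>R\<^esub>}" if "internal_sum R (principal_module R e) N N'" for N N'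
  proof -
    have N: "submodule N R (regular_module R)" "N \<subseteq> ?A" "submodule N' R (regular_module R)" "N' \<subseteq> ?A"
      and NN: "N \<inter> N' = {\<zero>\<^bsub>R\<^esub>}" "N <+>\<^bsub>principal_module R e\<^esub> N' = ?A"
      using that unfolding internal_sum_def G.submodule_of_submodule[OF s(1)] by auto
    have "N = ?A \<or> N' = ?A"
    proof (rule ccontr)
      assume "\<not> ?thesis"
      then have "N \<subseteq> ?K" "N' \<subseteq> ?K" using gen_dichotomy[OF G gen] N by blast+
      then have "N <+>\<^bsub>principal_module R e\<^esub> N' \<subseteq> ?K"
        using s(2) unfolding subset_iff P.mem_set_add G.submodule_iff by auto
      then show False using NN eA by blast
    qed
    then show ?thesis using NN N by blast
  qed
  moreover have "?A \<noteq> {\<zero>\<^bsub>R\<^esub>}" using eA gen_nz[OF G gen] by auto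
  ultimately show ?thesis unfolding indecomposable_def using P.left_module_axioms by simp
qed

lemma projective_indecomposable_principal: "projective_indecomposable R (principal_module R e)"
  unfolding projective_indecomposable_def
  using projective_principal[OF R _ e] indecomposable_principal top by (simp add: local_top_def)

lemma projective_cover_principal:
  assumes S: "cyclic_on R S v I" and ev: "e \<odot>\<^bsub>S\<^esub> v = v"
  shows "projective_cover R (principal_module R e) S"
proof -
  note gen = local_gen_idempotent and G = G.left_module_axioms
  have Sv: "left_module R S" "v \<in> carrier S" "smult_set S (carrier R) v = carrier S"
    "I = {a \<in> carrier R. a \<odot>\<^bsub>S\<^esub> v = \<zero>\<^bsub>S\<^esub>}" using S by (auto simp: cyclic_on_def)
  interpret S: left_module R S by fact
  have eR: "e \<in> carrier R" using top by (simp add: local_top_def)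
  note s = gen_submodules[OF G gen]
  let ?\<pi> = "\<lambda>x. x \<odot>\<^bsub>S\<^esub> v"
  have sub: "x \<in> carrier R" if "x \<in> smult_set (regular_module R) (carrier R) e" for x
    using that s(1) by (auto simp: G.submodule_iff)
  have \<pi>: "?\<pi> (a \<otimes>\<^bsub>R\<^esub> e) = a \<odot>\<^bsub>S\<^esub> v" if "a \<in> carrier R" for a
    using that eR Sv(2) by (simp add: S.smult_assoc1 ev)
  show ?thesis
    unfolding projective_cover_def
  proof (intro conjI bexI allI impI)
    show "projective R (principal_module R e)" by (rule projective_principal[OF R eR e])
    show "?\<pi> \<in> mod_hom R (principal_module R e) S"
      using Sv(2) by (intro mod_homI) (auto simp: S.smult_l_distr S.smult_assoc1 sub)
    show "?\<pi> ` carrier (principal_module R e) = carrier S"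
      unfolding Sv(3)[symmetric] using \<pi> by (force simp: smult_set_def image_image)
    fix N assume "submodule N R (principal_module R e) \<and> ?\<pi> ` N = carrier S"
    then have N: "submodule N R (regular_module R)" "N \<subseteq> smult_set (regular_module R) (carrier R) e" "?\<pi> ` N = carrier S"
      unfolding G.submodule_of_submodule[OF s(1)] by auto
    obtain x where x: "x \<in> N" "v = x \<odot>\<^bsub>S\<^esub> v"
      using Sv(2) unfolding N(3)[symmetric] by (rule imageE)
    obtain a where a: "a \<in> carrier R" "x = a \<otimes>\<^bsub>R\<^esub> e" using x(1) N(2) unfolding subset_iff mem_principal by blast
    have "v \<noteq> \<zero>\<^bsub>S\<^esub>" using top Sv(4) eR ev by (auto simp: local_top_def)
    then have "a \<notin> I" using a \<pi>[OF a(1)] x(2) Sv(4) by simp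
    then have "e \<in> N" using gen_in_submodule[OF G gen N(1) a(1)] a(2) x(1) by simp
    then show "N = carrier (principal_module R e)" using N smult_set_least[OF G N(1)] by auto
  qed
qed

text \<open>Under an isomorphism \<open>e\<close> goes to a generator of \<open>R e'\<close> that is fixed by \<open>e\<close>. The homomorphism
  \<open>R e' \<rightarrow> S\<close> with \<open>e' \<mapsto> v\<close> takes it to a vector fixed and killed by \<open>e\<close>, so it would be zero.\<close>

lemma not_iso_principal:
  assumes S: "left_module R S" "v \<in> carrier S" "v \<noteq> \<zero>\<^bsub>S\<^esub>" and e': "e' \<in> carrier R" "e' \<odot>\<^bsub>S\<^esub> v = v" "e' \<otimes>\<^bsub>R\<^esub> e' = e'"
    and kill: "\<And>x. x \<in> carrier S \<Longrightarrow> e \<odot>\<^bsub>S\<^esub> x = \<zero>\<^bsub>S\<^esub>"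
  shows "\<not> mod_iso R (principal_module R e) (principal_module R e')"
proof
  interpret S: left_module R S by fact
  have eR: "e \<in> carrier R" using top by (simp add: local_top_def)
  assume "mod_iso R (principal_module R e) (principal_module R e')"
  then obtain h where h: "h \<in> mod_hom R (principal_module R e) (principal_module R e')"
    "bij_betw h (carrier (principal_module R e)) (carrier (principal_module R e'))" by (auto simp: mod_iso_def)
  have in_P: "a \<otimes>\<^bsub>R\<^esub> e \<in> carrier (principal_module R e)" if "a \<in> carrier R" for a
    using that by (auto simp: mem_principal)
  have mem: "e \<in> carrier (principal_module R e)" "e' \<in> carrier (principal_module R e')"
    using eR e'(1) by (auto simp: mem_principal intro!: bexI[of _ "\<one>\<^bsub>R\<^esub>"])
  obtain x where x: "x \<in> carrier (principal_module R e)" "h x = e'"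
    using mem(2) unfolding bij_betw_imp_surj_on[OF h(2), symmetric] by (rule imageE) simp
  obtain b where b: "b \<in> carrier R" "x = b \<otimes>\<^bsub>R\<^esub> e" using x(1) by (auto simp: mem_principal)
  obtain c where c: "c \<in> carrier R" "h e = c \<otimes>\<^bsub>R\<^esub> e'" using mod_homD(1)[OF h(1) mem(1)] by (auto simp: mem_principal)
  have "h x = h ((b \<otimes>\<^bsub>R\<^esub> e) \<odot>\<^bsub>principal_module R e\<^esub> e)" using b eR e by (simp add: G.R.m_assoc)
  also have "\<dots> = (b \<otimes>\<^bsub>R\<^esub> e) \<otimes>\<^bsub>R\<^esub> h e" using mod_homD(3)[OF h(1) _ mem(1), of "b \<otimes>\<^bsub>R\<^esub> e"] b eR by simp
  finally have "e' = b \<otimes>\<^bsub>R\<^esub> (e \<otimes>\<^bsub>R\<^esub> (c \<otimes>\<^bsub>R\<^esub> e'))" using x(2) b c eR e'(1) by (simp add: G.R.m_assoc)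
  then have "e' \<odot>\<^bsub>S\<^esub> v = b \<odot>\<^bsub>S\<^esub> (e \<odot>\<^bsub>S\<^esub> ((c \<otimes>\<^bsub>R\<^esub> e') \<odot>\<^bsub>S\<^esub> v))"
    using b c eR e'(1) S(2) by (metis G.R.m_closed S.smult_assoc1)
  also have "\<dots> = \<zero>\<^bsub>S\<^esub>" using kill b c e' S(2) by simp
  finally show False using e' S by simp
qed

end

text \<open>An indecomposable projective module \<open>Q\<close> maps onto one of the \<open>R e\<close>; otherwise the
  coordinates of its elements in a free module would lie in a nilpotent ideal, whose powers
  are bounded by the sets \<open>Z t\<close>.\<close>

lemma projective_indecomposable_iso_principal:
  fixes Q :: "('a, 'm) module" and es :: "('a \<times> 'a set) set"
  assumes R: "ring R" and Q: "projective_indecomposable R Q"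
    and es: "\<And>e I. (e, I) \<in> es \<Longrightarrow> e \<otimes>\<^bsub>R\<^esub> e = e \<and> local_top R e I"
    and Z0: "Z 0 = carrier R" and Zr: "Z (r::nat) = {\<zero>\<^bsub>R\<^esub>}"
    and Zadd: "\<And>t. \<zero>\<^bsub>R\<^esub> \<in> Z t" "\<And>t x y. x \<in> Z t \<Longrightarrow> y \<in> Z t \<Longrightarrow> x \<oplus>\<^bsub>R\<^esub> y \<in> Z t"
    and ZJ: "\<And>t x z. x \<in> carrier R \<Longrightarrow> (\<And>e I b. (e, I) \<in> es \<Longrightarrow> b \<in> carrier R \<Longrightarrow> x \<otimes>\<^bsub>R\<^esub> b \<in> I) \<Longrightarrow>
      z \<in> Z t \<Longrightarrow> x \<otimes>\<^bsub>R\<^esub> z \<in> Z (Suc t)"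
  shows "\<exists>(e, I)\<in>es. mod_iso R Q (principal_module R e)"
proof -
  interpret R: ring R by (rule R)
  interpret G: left_module R "regular_module R" by (rule left_module_regular[OF R])
  note G = G.left_module_axioms
  have Qm: "left_module R Q" and Qnz: "carrier Q \<noteq> {\<zero>\<^bsub>Q\<^esub>}"
    and Qind: "\<And>N N'. internal_sum R Q N N' \<Longrightarrow> N = {\<zero>\<^bsub>Q\<^esub>} \<or> N' = {\<zero>\<^bsub>Q\<^esub>}"
    using Q unfolding projective_indecomposable_def indecomposable_def by auto
  interpret Q: left_module R Q by (rule Qm)
  obtain n N N' \<theta> where F: "internal_sum R (mod_power (regular_module R) n) N N'"
    and \<theta>: "\<theta> \<in> mod_hom R Q ((mod_power (regular_module R) n)\<lparr>carrier := N\<rparr>)" "bij_betw \<theta> (carrier Q) N"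
    using Q unfolding projective_indecomposable_def projective_def mod_iso_def by auto
  let ?F = "mod_power (regular_module R) n"
  interpret F: left_module R ?F by (rule left_module_mod_power[OF G])
  have N: "submodule N R ?F" "submodule N' R ?F" "N \<inter> N' = {\<zero>\<^bsub>?F\<^esub>}" "N <+>\<^bsub>?F\<^esub> N' = carrier ?F"
    using F by (auto simp: internal_sum_def)
  have NF: "N \<subseteq> carrier ?F" "N' \<subseteq> carrier ?F" using N by (auto simp: F.submodule_iff)
  have coord: "x s \<in> carrier R" if "x \<in> carrier ?F" "s < n" for x s using that by (auto simp: PiE_iff)
  have \<theta>N: "\<theta> q \<in> N" if "q \<in> carrier Q" for q using mod_homD(1)[OF \<theta>(1) that] by simp
  have hom: "(\<lambda>q. \<theta> q s \<otimes>\<^bsub>R\<^esub> (b \<otimes>\<^bsub>R\<^esub> e)) \<in> mod_hom R Q (principal_module R e)"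
    if b: "b \<in> carrier R" "e \<in> carrier R" "s < n" for b e s
  proof (rule mod_homI)
    have c: "\<theta> q s \<in> carrier R" if "q \<in> carrier Q" for q using coord NF \<theta>N that b(3) by blast
    show "\<theta> q s \<otimes>\<^bsub>R\<^esub> (b \<otimes>\<^bsub>R\<^esub> e) \<in> carrier (principal_module R e)" if "q \<in> carrier Q" for q
      using c[OF that] b by (auto simp: mem_principal R.m_assoc[symmetric])
    show "\<theta> (x \<oplus>\<^bsub>Q\<^esub> y) s \<otimes>\<^bsub>R\<^esub> (b \<otimes>\<^bsub>R\<^esub> e) =
      \<theta> x s \<otimes>\<^bsub>R\<^esub> (b \<otimes>\<^bsub>R\<^esub> e) \<oplus>\<^bsub>principal_module R e\<^esub> \<theta> y s \<otimes>\<^bsub>R\<^esub> (b \<otimes>\<^bsub>R\<^esub> e)"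
      if "x \<in> carrier Q" "y \<in> carrier Q" for x y
      using mod_homD(2)[OF \<theta>(1) that] c that b by (simp add: R.l_distr)
    show "\<theta> (a \<odot>\<^bsub>Q\<^esub> x) s \<otimes>\<^bsub>R\<^esub> (b \<otimes>\<^bsub>R\<^esub> e) = a \<odot>\<^bsub>principal_module R e\<^esub> (\<theta> x s \<otimes>\<^bsub>R\<^esub> (b \<otimes>\<^bsub>R\<^esub> e))"
      if "a \<in> carrier R" "x \<in> carrier Q" for a x
      using mod_homD(3)[OF \<theta>(1) that] c that b by (simp add: R.m_assoc)
  qed
  have "\<exists>(e, I)\<in>es. \<exists>f\<in>mod_hom R Q (principal_module R e). f ` carrier Q = carrier (principal_module R e)"
  proof (rule ccontr)
    assume "\<not> ?thesis"
    then have nosurj: "f ` carrier Q \<noteq> carrier (principal_module R e)" if "(e, I) \<in> es" "f \<in> mod_hom R Q (principal_module R e)" for e I f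
      using that by blast
    have J: "\<theta> q s \<otimes>\<^bsub>R\<^esub> b \<in> I" if q: "q \<in> carrier Q" "s < n" "(e, I) \<in> es" "b \<in> carrier R" for q s e I b
    proof -
      note eI = es[OF q(3)]
      note gen = local_gen_idempotent[OF R conjunct1[OF eI] conjunct2[OF eI]]
      note e = gen_e(1)[OF G gen]
      let ?f = "\<lambda>q. \<theta> q s \<otimes>\<^bsub>R\<^esub> (b \<otimes>\<^bsub>R\<^esub> e)"
      note s = gen_submodules[OF G gen]
      have "submodule (?f ` carrier Q) R (principal_module R e)"
        using image_submodule[OF Qm G.left_module_submodule[OF s(1)] hom[OF q(4) e q(2)] Q.submodule_carrier] .
      then have "?f ` carrier Q \<subseteq> smult_set (regular_module R) I e"
        using gen_dichotomy[OF G gen, of "?f ` carrier Q"] nosurj[OF q(3) hom[OF q(4) e q(2)]]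
        unfolding G.submodule_of_submodule[OF s(1)] by auto
      then have "?f q \<in> smult_set (regular_module R) I e" using q(1) by blast
      moreover have "\<theta> q s \<in> carrier R" using coord NF \<theta>N[OF q(1)] q(2) by blast
      ultimately show ?thesis
        using gen_ideal_cancel[OF G gen, of "\<theta> q s \<otimes>\<^bsub>R\<^esub> b"] q(4) e by (simp add: R.m_assoc)
    qed
    define \<delta> where "\<delta> r = (\<lambda>i\<in>{..<n}. if i = r then \<one>\<^bsub>R\<^esub> else \<zero>\<^bsub>R\<^esub>)" for r
    have "\<exists>y\<in>N. \<exists>y'\<in>N'. \<delta> r = y \<oplus>\<^bsub>?F\<^esub> y'" for r
    proof -
      have "\<delta> r \<in> N <+>\<^bsub>?F\<^esub> N'" unfolding N(4) \<delta>_def by auto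
      then show ?thesis unfolding F.mem_set_add .
    qed
    then obtain u u' where u: "\<And>r. u r \<in> N" "\<And>r. u' r \<in> N'" "\<And>r. \<delta> r = u r \<oplus>\<^bsub>?F\<^esub> u' r" by metis
    have Zq: "\<forall>x\<in>N. \<forall>s<n. x s \<in> Z t" for t
    proof (induction t)
      case 0 then show ?case using Z0 coord NF by blast
    next
      case (Suc t)
      show ?case
      proof (intro ballI)
        fix x assume x: "x \<in> N"
        have xF: "x \<in> carrier ?F" using x NF by blast
        have xJ: "x k \<otimes>\<^bsub>R\<^esub> b \<in> I" if "k < n" "(e, I) \<in> es" "b \<in> carrier R" for k e I b
        proof -
          obtain q where "q \<in> carrier Q" "x = \<theta> q"
            using x unfolding bij_betw_imp_surj_on[OF \<theta>(2), symmetric] by (rule imageE)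
          then show ?thesis using J that by blast
        qed
        have "k \<le> n \<Longrightarrow> \<exists>y\<in>N. \<exists>y'\<in>N'. (\<forall>s<n. y s \<oplus>\<^bsub>R\<^esub> y' s = (if s < k then x s else \<zero>\<^bsub>R\<^esub>)) \<and> (\<forall>s<n. y s \<in> Z (Suc t))" for k
        proof (induction k)
          case 0
          have "\<zero>\<^bsub>?F\<^esub> \<in> N" "\<zero>\<^bsub>?F\<^esub> \<in> N'" using N by (auto simp: F.submodule_iff)
          then show ?case by (rule_tac bexI, rule_tac bexI) (auto intro: Zadd)
        next
          case (Suc k)
          then obtain y y' where y: "y \<in> N" "y' \<in> N'" "\<And>s. s < n \<Longrightarrow> y s \<oplus>\<^bsub>R\<^esub> y' s = (if s < k then x s else \<zero>\<^bsub>R\<^esub>)"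
            "\<And>s. s < n \<Longrightarrow> y s \<in> Z (Suc t)" by auto
          have k: "k < n" using Suc.prems by simp
          have xk: "x k \<in> carrier R" by (rule coord[OF xF k])
          let ?y = "y \<oplus>\<^bsub>?F\<^esub> x k \<odot>\<^bsub>?F\<^esub> u k" and ?y' = "y' \<oplus>\<^bsub>?F\<^esub> x k \<odot>\<^bsub>?F\<^esub> u' k"
          have mem: "?y \<in> N" "?y' \<in> N'" using y(1,2) u(1,2) xk N(1,2) by (auto simp: F.submodule_iff simp del: mod_power_simps)
          have "?y s \<oplus>\<^bsub>R\<^esub> ?y' s = (if s < Suc k then x s else \<zero>\<^bsub>R\<^esub>)" if s: "s < n" for s
          proof -
            have c: "y s \<in> carrier R" "y' s \<in> carrier R" "u k s \<in> carrier R" "u' k s \<in> carrier R" "x s \<in> carrier R"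
              using coord[OF _ s] NF y(1,2) u(1,2) xF by blast+
            have d: "u k s \<oplus>\<^bsub>R\<^esub> u' k s = (if s = k then \<one>\<^bsub>R\<^esub> else \<zero>\<^bsub>R\<^esub>)"
              using arg_cong[OF u(3)[of k], of "\<lambda>f. f s"] s by (simp add: \<delta>_def)
            have "?y s \<oplus>\<^bsub>R\<^esub> ?y' s = (y s \<oplus>\<^bsub>R\<^esub> y' s) \<oplus>\<^bsub>R\<^esub> x k \<otimes>\<^bsub>R\<^esub> (u k s \<oplus>\<^bsub>R\<^esub> u' k s)"
              using s c xk by (simp add: R.r_distr R.a_ac)
            then show ?thesis using y(3)[OF s] d c xk by (auto simp: less_Suc_eq)
          qed
          moreover have "?y s \<in> Z (Suc t)" if s: "s < n" for s
          proof -
            have "x k \<otimes>\<^bsub>R\<^esub> u k s \<in> Z (Suc t)"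
              by (rule ZJ[OF xk]) (use xJ[OF k] Suc.IH \<open>\<forall>x\<in>N. \<forall>s<n. x s \<in> Z t\<close> u(1) s in blast)+
            then show ?thesis using y(4)[OF s] Zadd(2) s by simp
          qed
          ultimately show ?case using mem by blast
        qed
        from this[of n] obtain y y' where y: "y \<in> N" "y' \<in> N'" "\<And>s. s < n \<Longrightarrow> y s \<oplus>\<^bsub>R\<^esub> y' s = x s"
          "\<And>s. s < n \<Longrightarrow> y s \<in> Z (Suc t)" by auto
        have yF: "y \<in> carrier ?F" "y' \<in> carrier ?F" using y NF by blast+
        have eq: "x = y \<oplus>\<^bsub>?F\<^esub> y'" using y(3) xF by (auto simp: fun_eq_iff PiE_iff extensional_def)
        have "x \<ominus>\<^bsub>?F\<^esub> y = y'" unfolding eq using yF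
          by (simp add: a_minus_def F.M.a_ac F.M.r_neg1 F.M.r_neg F.M.a_lcomm del: mod_power_simps)
        then have "y' \<in> N \<inter> N'" using F.submodule_diff[OF N(1) x y(1)] y(2) by auto
        then have "x = y" unfolding eq using N(3) yF F.M.r_zero by (auto simp del: mod_power_simps)
        then show "\<forall>s<n. x s \<in> Z (Suc t)" using y(4) by blast
      qed
    qed
    have "x = \<zero>\<^bsub>?F\<^esub>" if x: "x \<in> N" for x
    proof -
      have "x s = \<zero>\<^bsub>R\<^esub>" if "s < n" for s using Zq[of r] x that Zr by blast
      then show ?thesis using x NF by (auto simp: fun_eq_iff PiE_iff extensional_def subset_iff)
    qed
    then have N0: "\<theta> q = \<theta> \<zero>\<^bsub>Q\<^esub>" if "q \<in> carrier Q" for q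
      using \<theta>N that Q.M.zero_closed by metis
    have "q = \<zero>\<^bsub>Q\<^esub>" if "q \<in> carrier Q" for q
      using N0[OF that] \<theta>(2) that unfolding bij_betw_def by (auto dest: inj_onD)
    then show False using Qnz by auto
  qed
  then obtain e I f where eI: "(e, I) \<in> es" and f: "f \<in> mod_hom R Q (principal_module R e)" "f ` carrier Q = carrier (principal_module R e)"
    by blast
  note eI' = es[OF eI]
  note gen = local_gen_idempotent[OF R conjunct1[OF eI'] conjunct2[OF eI']]
  have e: "e \<in> carrier R" "e \<otimes>\<^bsub>R\<^esub> e = e" using gen_e(1)[OF G gen] eI' by auto
  note s = gen_submodules[OF G gen]
  note P = G.left_module_submodule[OF s(1)]
  interpret P: left_module R "principal_module R e" by (rule P)
  have eP: "e \<in> carrier (principal_module R e)" using mem_smult_set_self[OF G gen_mem[OF G gen]] by simp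
  have right_e: "x \<otimes>\<^bsub>R\<^esub> e = x" if "x \<in> carrier (principal_module R e)" for x
    using that e by (auto simp: mem_principal R.m_assoc)
  have PR: "x \<in> carrier R" if "x \<in> carrier (principal_module R e)" for x using that e by (auto simp: mem_principal)
  obtain q0 where q0: "q0 \<in> carrier Q" "f q0 = e" using eP unfolding f(2)[symmetric] by (rule imageE) simp
  define q where "q = e \<odot>\<^bsub>Q\<^esub> q0"
  have q: "q \<in> carrier Q" "e \<odot>\<^bsub>Q\<^esub> q = q" using q0 e by (auto simp: q_def Q.smult_assoc1[symmetric])
  have fq: "f (a \<odot>\<^bsub>Q\<^esub> q) = a \<otimes>\<^bsub>R\<^esub> e" if "a \<in> carrier R" for a
    using that mod_homD(3)[OF f(1)] q0 q e by (simp add: q_def)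
  let ?K = "{x \<in> carrier Q. f x = \<zero>\<^bsub>principal_module R e\<^esub>}" and ?L = "smult_set Q (carrier R) q"
  have KL: "submodule ?K R Q" "submodule ?L R Q"
    using kernel_submodule[OF Qm P f(1)] smult_set_submodule[OF Qm q(1) carrier_left_ideal[OF R]] by auto
  have "internal_sum R Q ?K ?L"
    unfolding internal_sum_def
  proof (intro conjI KL)
    show "?K \<inter> ?L = {\<zero>\<^bsub>Q\<^esub>}"
    proof
      show "?K \<inter> ?L \<subseteq> {\<zero>\<^bsub>Q\<^esub>}"
      proof
        fix x assume x: "x \<in> ?K \<inter> ?L"
        then obtain a where a: "a \<in> carrier R" "x = a \<odot>\<^bsub>Q\<^esub> q" by (auto simp: smult_set_def)
        then have "a \<otimes>\<^bsub>R\<^esub> e = \<zero>\<^bsub>R\<^esub>" using x fq by simp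
        moreover have "x = (a \<otimes>\<^bsub>R\<^esub> e) \<odot>\<^bsub>Q\<^esub> q" using a e q by (simp add: Q.smult_assoc1)
        ultimately show "x \<in> {\<zero>\<^bsub>Q\<^esub>}" using q by simp
      qed
      show "{\<zero>\<^bsub>Q\<^esub>} \<subseteq> ?K \<inter> ?L" using KL by (auto simp: Q.submodule_iff)
    qed
    show "?K <+>\<^bsub>Q\<^esub> ?L = carrier Q"
    proof
      show "?K <+>\<^bsub>Q\<^esub> ?L \<subseteq> carrier Q" using Q.submodule_add[OF KL] by (simp add: Q.submodule_iff)
      show "carrier Q \<subseteq> ?K <+>\<^bsub>Q\<^esub> ?L"
      proof
        fix x assume x: "x \<in> carrier Q"
        let ?l = "f x \<odot>\<^bsub>Q\<^esub> q"
        have fx: "f x \<in> carrier (principal_module R e)" using mod_homD(1)[OF f(1) x] .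
        have l: "?l \<in> carrier Q" "?l \<in> ?L" using PR[OF fx] q by (auto simp: smult_set_def)
        have "f (x \<ominus>\<^bsub>Q\<^esub> ?l) = f x \<ominus>\<^bsub>principal_module R e\<^esub> f ?l" by (rule mod_hom_diff[OF Qm P f(1) x l(1)])
        also have "\<dots> = \<zero>\<^bsub>principal_module R e\<^esub>"
          using fq[OF PR[OF fx]] right_e[OF fx] fx P.diff_eq_zero_iff[OF fx fx] by simp
        finally have "x \<ominus>\<^bsub>Q\<^esub> ?l \<in> ?K" using x l by simp
        moreover have "x = (x \<ominus>\<^bsub>Q\<^esub> ?l) \<oplus>\<^bsub>Q\<^esub> ?l" using x l by (simp add: a_minus_def Q.M.a_assoc Q.M.l_neg)
        ultimately show "x \<in> ?K <+>\<^bsub>Q\<^esub> ?L" using l(2) unfolding Q.mem_set_add by blast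
      qed
    qed
  qed
  then have "?K = {\<zero>\<^bsub>Q\<^esub>} \<or> ?L = {\<zero>\<^bsub>Q\<^esub>}" by (rule Qind)
  moreover have "?L \<noteq> {\<zero>\<^bsub>Q\<^esub>}"
  proof
    assume "?L = {\<zero>\<^bsub>Q\<^esub>}"
    then have "q = \<zero>\<^bsub>Q\<^esub>" using mem_smult_set_self[OF Qm q(1)] by simp
    then have "e \<otimes>\<^bsub>R\<^esub> e = \<zero>\<^bsub>R\<^esub>" using fq[OF e(1)] mod_hom_zero[OF Qm P f(1)] q e by simp
    then show False using gen_nz[OF G gen] e by simp
  qed
  ultimately have K: "?K = {\<zero>\<^bsub>Q\<^esub>}" by blast
  have "inj_on f (carrier Q)"
  proof (rule inj_onI)
    fix x y assume xy: "x \<in> carrier Q" "y \<in> carrier Q" "f x = f y"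
    then have "f (x \<ominus>\<^bsub>Q\<^esub> y) = \<zero>\<^bsub>principal_module R e\<^esub>"
      using mod_hom_diff[OF Qm P f(1) xy(1,2)] P.diff_eq_zero_iff mod_homD(1)[OF f(1)] by simp
    then have "x \<ominus>\<^bsub>Q\<^esub> y \<in> ?K" using xy by simp
    then have "x \<ominus>\<^bsub>Q\<^esub> y \<in> {\<zero>\<^bsub>Q\<^esub>}" unfolding K .
    then show "x = y" using Q.diff_eq_zero_iff xy by simp
  qed
  then have "mod_iso R Q (principal_module R e)" unfolding mod_iso_def bij_betw_def using f by blast
  then show ?thesis using eI by blast
qed

section \<open>The alternating group of degree 5\<close>

text \<open>One-line notation, in which products of concrete permutations are computed by rewriting.\<close>

definition perm5 :: "nat \<Rightarrow> nat \<Rightarrow> nat \<Rightarrow> nat \<Rightarrow> nat \<Rightarrow> nat \<Rightarrow> nat" where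
  "perm5 a b c d e x = (if x = 1 then a else if x = 2 then b else if x = 3 then c
     else if x = 4 then d else if x = 5 then e else x)"

lemma perm5_simps [simp]:
  "perm5 a b c d e 1 = a" "perm5 a b c d e (Suc 0) = a" "perm5 a b c d e 2 = b"
  "perm5 a b c d e 3 = c" "perm5 a b c d e 4 = d" "perm5 a b c d e 5 = e"
  by (simp_all add: perm5_def)

lemma perm5_comp_perm5 [simp]:
  "perm5 a b c d e \<circ> perm5 a' b' c' d' e' =
     perm5 (perm5 a b c d e a') (perm5 a b c d e b') (perm5 a b c d e c') (perm5 a b c d e d') (perm5 a b c d e e')" (is "?l = ?r")
proof
  fix x :: nat
  consider "x = 1" | "x = 2" | "x = 3" | "x = 4" | "x = 5" | "x \<notin> {1, 2, 3, 4, 5}" by blast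
  then show "?l x = ?r x" by cases (simp_all, simp add: perm5_def)
qed

lemma perm5_inject [simp]:
  "perm5 a b c d e = perm5 a' b' c' d' e' \<longleftrightarrow> a = a' \<and> b = b' \<and> c = c' \<and> d = d' \<and> e = e'"
proof
  assume eq: "perm5 a b c d e = perm5 a' b' c' d' e'"
  show "a = a' \<and> b = b' \<and> c = c' \<and> d = d' \<and> e = e'"
    using fun_cong[OF eq, of 1] fun_cong[OF eq, of 2] fun_cong[OF eq, of 3] fun_cong[OF eq, of 4]
      fun_cong[OF eq, of 5] by simp
qed simp

lemma perm5_id: "id = perm5 1 2 3 4 5"
  by (auto simp: perm5_def fun_eq_iff)

definition cc :: "nat \<Rightarrow> nat" where "cc = perm5 2 3 4 5 1"
definition ss :: "nat \<Rightarrow> nat" where "ss = perm5 4 3 2 1 5"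
definition gg :: "nat \<Rightarrow> nat" where "gg = perm5 2 1 4 3 5"
definition hh :: "nat \<Rightarrow> nat" where "hh = perm5 2 3 1 4 5"

lemmas perm5_defs = cc_def ss_def gg_def hh_def

lemma cc_pow:
  "cc ^^ 2 = perm5 3 4 5 1 2" "cc ^^ 3 = perm5 4 5 1 2 3" "cc ^^ 4 = perm5 5 1 2 3 4" "cc ^^ 5 = id"
proof -
  show 2: "cc ^^ 2 = perm5 3 4 5 1 2" by (simp add: numeral_2_eq_2) (simp add: cc_def)
  show 3: "cc ^^ 3 = perm5 4 5 1 2 3" using funpow.simps(2)[of 2 cc] by (simp add: 2) (simp add: cc_def)
  show 4: "cc ^^ 4 = perm5 5 1 2 3 4" using funpow.simps(2)[of 3 cc] by (simp add: 3) (simp add: cc_def)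
  show "cc ^^ 5 = id" using funpow.simps(2)[of 4 cc] by (simp add: 4) (simp add: cc_def perm5_id)
qed

lemma A5_carrier: "p \<in> carrier A5 \<longleftrightarrow> p permutes {1..5} \<and> evenperm p"
  by (simp add: A5_def alt_group_carrier)

lemma A5_mult [simp]: "p \<otimes>\<^bsub>A5\<^esub> q = p \<circ> q" by (simp add: A5_def alt_group_mult)
lemma A5_one [simp]: "\<one>\<^bsub>A5\<^esub> = id" by (simp add: A5_def alt_group_one)
lemma A5_group: "group A5" unfolding A5_def by (rule alt_group_is_group)
lemma A5_finite [simp]: "finite (carrier A5)"
  by (rule finite_subset[OF _ finite_permutations[of "{1..5::nat}"]]) (auto simp: A5_carrier)
lemma A5_inv: "p \<in> carrier A5 \<Longrightarrow> inv\<^bsub>A5\<^esub> p = inv' p"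
  using alt_group_inv_equality[of p 5] by (simp add: A5_def)

lemma A5_id [simp]: "id \<in> carrier A5" using monoid.one_closed[OF group.is_monoid[OF A5_group]] by simp
lemma A5_comp [simp]: "p \<in> carrier A5 \<Longrightarrow> q \<in> carrier A5 \<Longrightarrow> p \<circ> q \<in> carrier A5"
  using monoid.m_closed[OF group.is_monoid[OF A5_group]] by simp
lemma A5_pow [simp]: "p \<in> carrier A5 \<Longrightarrow> p ^^ n \<in> carrier A5"
  by (induction n) auto

lemma A5_card: "card (carrier A5) = 60"
  using alt_group_card_carrier[of 5] by (simp add: A5_def fact_numeral)

lemma cycles_perm5:
  "cycle_of_list [1, 2, 3, 4, 5] = cc" "cycle_of_list [1, 2, 3] = hh"
  "cycle_of_list [1, 2] \<circ> cycle_of_list [3, 4] = gg" "cycle_of_list [1, 3] \<circ> cycle_of_list [2, 4] = gg \<circ> ss"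
  "cycle_of_list [1, 4] \<circ> cycle_of_list [2, 3] = ss"
  by (rule ext; simp add: perm5_defs perm5_def transpose_def)+

lemma A5_gens [simp]: "cc \<in> carrier A5" "ss \<in> carrier A5" "gg \<in> carrier A5"
proof -
  have "evenperm cc" "evenperm ss" "evenperm gg"
    unfolding cycles_perm5[symmetric]
    by (simp_all add: evenperm_comp permutation_compose permutation_swap_id evenperm_swap)
  moreover have "cc permutes {1..5}" "ss permutes {1..5}" "gg permutes {1..5}"
    unfolding cycles_perm5[symmetric] cycle_of_list.simps
    by (auto intro!: permutes_compose permutes_swap_id permutes_id)
  ultimately show "cc \<in> carrier A5" "ss \<in> carrier A5" "gg \<in> carrier A5" by (auto simp: A5_carrier)
qed

text \<open>The subgroup fixing 5 has twelve elements, each in the double coset of one of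
  \<open>1\<close>, \<open>s\<close>, \<open>g\<close>, \<open>g s\<close> with respect to \<open>\<langle>c\<rangle>\<close>.\<close>

definition A4_words :: "(nat \<times> (nat \<Rightarrow> nat) \<times> nat) list" where
  "A4_words = [(0, id, 0), (0, ss, 0), (0, gg, 0), (0, gg \<circ> ss, 0),
     (1, gg \<circ> ss, 2), (1, gg, 3), (4, gg, 2), (4, gg \<circ> ss, 3),
     (3, gg \<circ> ss, 4), (3, gg, 1), (2, gg \<circ> ss, 1), (2, gg, 4)]"

definition A4_list :: "(nat \<Rightarrow> nat) list" where
  "A4_list = [perm5 1 2 3 4 5, perm5 4 3 2 1 5, perm5 2 1 4 3 5, perm5 3 4 1 2 5,
    perm5 2 3 1 4 5, perm5 4 1 3 2 5, perm5 3 2 4 1 5, perm5 1 4 2 3 5,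
    perm5 3 1 2 4 5, perm5 4 2 1 3 5, perm5 1 3 4 2 5, perm5 2 4 3 1 5]"

lemma A4_words_list: "A4_list = map (\<lambda>(a, y, b). cc ^^ a \<circ> y \<circ> cc ^^ b) A4_words"
  by (simp add: A4_list_def A4_words_def cc_pow perm5_id[symmetric])
     (simp add: perm5_defs perm5_id)

lemma A4_list_A5: "set A4_list \<subseteq> carrier A5"
  unfolding A4_words_list by (auto simp: A4_words_def)

lemma A4_list_props: "u \<in> set A4_list \<Longrightarrow> u 5 = 5" "distinct A4_list"
  by (auto simp: A4_list_def)

lemma cc_pow_5: "i < 5 \<Longrightarrow> (cc ^^ i) 5 = (if i = 0 then 5 else i)"
proof -
  assume "i < 5"
  then consider "i = 0" | "i = 1" | "i = 2" | "i = 3" | "i = 4" by linarith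
  then show ?thesis by cases (simp_all add: cc_pow, simp add: cc_def)
qed

text \<open>The powers of the 5-cycle times the twelve listed elements give 60 different elements of the group.\<close>

lemma A5_normal_form:
  assumes p: "p \<in> carrier A5" shows "\<exists>i<5. \<exists>u\<in>set A4_list. p = cc ^^ i \<circ> u"
proof -
  let ?f = "\<lambda>(i, u). cc ^^ i \<circ> u" and ?D = "{..<5::nat} \<times> set A4_list"
  have "inj_on ?f ?D"
  proof (rule inj_onI, clarify)
    fix i j u v assume a: "i < (5::nat)" "j < (5::nat)" "u \<in> set A4_list" "v \<in> set A4_list"
      and eq: "cc ^^ i \<circ> u = cc ^^ j \<circ> v"
    have "(cc ^^ i) 5 = (cc ^^ j) 5" using fun_cong[OF eq, of 5] A4_list_props(1)[OF a(3)] A4_list_props(1)[OF a(4)] by simp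
    then have ij: "i = j" using a cc_pow_5 by (auto split: if_splits)
    have "inj (cc ^^ i)" using A5_pow[OF A5_gens(1), of i] by (auto simp: A5_carrier permutes_inj)
    then show "i = j \<and> u = v" using eq ij by (auto simp: fun_eq_iff inj_def)
  qed
  then have "card (?f ` ?D) = card ?D" by (rule card_image)
  also have "\<dots> = 60" using distinct_card[OF A4_list_props(2)] by (simp add: card_cartesian_product A4_list_def)
  finally have "card (?f ` ?D) = card (carrier A5)" by (simp add: A5_card)
  moreover have "?f ` ?D \<subseteq> carrier A5" using A4_list_A5 by auto
  ultimately have "?f ` ?D = carrier A5" using A5_finite by (metis card_subset_eq)
  then show ?thesis using p by force
qed

lemma A4_iff: "p \<in> A4 \<longleftrightarrow> p \<in> set A4_list"
proof
  assume "p \<in> A4"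
  then have p: "p \<in> carrier A5" "p 5 = 5" by (auto simp: A4_def)
  obtain i u where u: "i < 5" "u \<in> set A4_list" "p = cc ^^ i \<circ> u" using A5_normal_form[OF p(1)] by blast
  then have "(cc ^^ i) 5 = 5" using p(2) A4_list_props(1)[OF u(2)] by simp
  then have "i = 0" using cc_pow_5[OF u(1)] u(1) by (auto split: if_splits)
  then show "p \<in> set A4_list" using u by simp
qed (use A4_list_props A4_list_A5 in \<open>auto simp: A4_def\<close>)

lemma A5_double_coset:
  assumes "p \<in> carrier A5"
  shows "\<exists>a b y. y \<in> {id, ss, gg, gg \<circ> ss} \<and> p = cc ^^ a \<circ> y \<circ> cc ^^ b"
proof -
  obtain i u where u: "u \<in> set A4_list" "p = cc ^^ i \<circ> u" using A5_normal_form[OF assms] by blast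
  have "\<exists>(a, y, b)\<in>set A4_words. u = cc ^^ a \<circ> y \<circ> cc ^^ b" using u(1) unfolding A4_words_list by auto
  then obtain a y b where w: "(a, y, b) \<in> set A4_words" "u = cc ^^ a \<circ> y \<circ> cc ^^ b" by blast
  have "y \<in> {id, ss, gg, gg \<circ> ss}" using w(1) by (auto simp: A4_words_def)
  moreover have "p = cc ^^ (i + a) \<circ> y \<circ> cc ^^ b" unfolding u(2) w(2) by (simp add: funpow_add o_assoc)
  ultimately show ?thesis by blast
qed

section \<open>The group algebra as a type\<close>

lemma group_algebra_sum_mult:
  fixes a b :: "'g \<Rightarrow> 'k::field"
  assumes G: "group G" and fin: "finite (carrier G)"
  shows "(\<Sum>g\<in>carrier G. (a \<otimes>\<^bsub>group_algebra G\<^esub> b) g * F g) =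
    (\<Sum>x\<in>carrier G. \<Sum>y\<in>carrier G. a x * b y * F (x \<otimes>\<^bsub>G\<^esub> y))"
proof -
  interpret G: group G by fact
  have "(\<Sum>g\<in>carrier G. (a \<otimes>\<^bsub>group_algebra G\<^esub> b) g * F g) =
      (\<Sum>g\<in>carrier G. \<Sum>x\<in>carrier G. a x * b (inv\<^bsub>G\<^esub> x \<otimes>\<^bsub>G\<^esub> g) * F g)"
    by (simp add: group_algebra_def sum_distrib_right)
  also have "\<dots> = (\<Sum>x\<in>carrier G. \<Sum>g\<in>carrier G. a x * b (inv\<^bsub>G\<^esub> x \<otimes>\<^bsub>G\<^esub> g) * F g)"
    by (rule sum.swap)
  also have "\<dots> = (\<Sum>x\<in>carrier G. \<Sum>y\<in>carrier G. a x * b y * F (x \<otimes>\<^bsub>G\<^esub> y))"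
  proof (rule sum.cong[OF refl])
    fix x assume x: "x \<in> carrier G"
    show "(\<Sum>g\<in>carrier G. a x * b (inv\<^bsub>G\<^esub> x \<otimes>\<^bsub>G\<^esub> g) * F g) = (\<Sum>y\<in>carrier G. a x * b y * F (x \<otimes>\<^bsub>G\<^esub> y))"
      by (rule sum.reindex_bij_witness[of _ "\<lambda>y. x \<otimes>\<^bsub>G\<^esub> y" "\<lambda>g. inv\<^bsub>G\<^esub> x \<otimes>\<^bsub>G\<^esub> g"])
         (use x in \<open>auto simp: G.m_assoc[symmetric]\<close>)
  qed
  finally show ?thesis .
qed

lemma group_algebra_ring:
  assumes G: "group G" and fin: "finite (carrier G)"
  shows "ring (group_algebra G :: ('g \<Rightarrow> 'k::field) ring)"
proof -
  interpret G: group G by fact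
  let ?A = "group_algebra G :: ('g \<Rightarrow> 'k::field) ring"
  have mult: "(a \<otimes>\<^bsub>?A\<^esub> b) g = (\<Sum>x\<in>carrier G. a x * b (inv\<^bsub>G\<^esub> x \<otimes>\<^bsub>G\<^esub> g))" if "g \<in> carrier G" for a b g
    using that by (simp add: group_algebra_def)
  have out: "(a \<otimes>\<^bsub>?A\<^esub> b) g = 0" if "g \<notin> carrier G" for a b g
    using that by (simp add: group_algebra_def)
  show ?thesis
  proof (rule ringI)
    show "abelian_group ?A"
    proof (rule abelian_groupI, goal_cases)
      case (6 x)
      then show ?case by (intro bexI[of _ "\<lambda>g. - x g"]) (auto simp: group_algebra_def)
    qed (auto simp: group_algebra_def algebra_simps)
    show "Group.monoid ?A"
    proof (rule monoidI)
      fix a b c assume abc: "a \<in> carrier ?A" "b \<in> carrier ?A" "c \<in> carrier ?A"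
      show "a \<otimes>\<^bsub>?A\<^esub> b \<in> carrier ?A" using out by (auto simp: group_algebra_def)
      show "(a \<otimes>\<^bsub>?A\<^esub> b) \<otimes>\<^bsub>?A\<^esub> c = a \<otimes>\<^bsub>?A\<^esub> (b \<otimes>\<^bsub>?A\<^esub> c)"
      proof (rule ext)
        fix g show "((a \<otimes>\<^bsub>?A\<^esub> b) \<otimes>\<^bsub>?A\<^esub> c) g = (a \<otimes>\<^bsub>?A\<^esub> (b \<otimes>\<^bsub>?A\<^esub> c)) g"
        proof (cases "g \<in> carrier G")
          case True
          have "((a \<otimes>\<^bsub>?A\<^esub> b) \<otimes>\<^bsub>?A\<^esub> c) g =
              (\<Sum>x\<in>carrier G. \<Sum>y\<in>carrier G. a x * b y * c (inv\<^bsub>G\<^esub> (x \<otimes>\<^bsub>G\<^esub> y) \<otimes>\<^bsub>G\<^esub> g))"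
            unfolding mult[OF True] using group_algebra_sum_mult[OF G fin, of a b "\<lambda>z. c (inv\<^bsub>G\<^esub> z \<otimes>\<^bsub>G\<^esub> g)"] .
          also have "\<dots> = (\<Sum>x\<in>carrier G. a x * (b \<otimes>\<^bsub>?A\<^esub> c) (inv\<^bsub>G\<^esub> x \<otimes>\<^bsub>G\<^esub> g))"
            using True by (intro sum.cong[OF refl]) (simp add: mult sum_distrib_left G.inv_mult_group G.m_assoc mult.assoc)
          also have "\<dots> = (a \<otimes>\<^bsub>?A\<^esub> (b \<otimes>\<^bsub>?A\<^esub> c)) g" unfolding mult[OF True] ..
          finally show ?thesis .
        qed (simp add: out)
      qed
    next
      show "\<one>\<^bsub>?A\<^esub> \<in> carrier ?A" by (auto simp: group_algebra_def)
      fix a assume a: "a \<in> carrier ?A"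
      have one: "\<one>\<^bsub>?A\<^esub> x = (if x = \<one>\<^bsub>G\<^esub> then 1 else 0)" for x by (simp add: group_algebra_def)
      show "\<one>\<^bsub>?A\<^esub> \<otimes>\<^bsub>?A\<^esub> a = a"
      proof
        fix g show "(\<one>\<^bsub>?A\<^esub> \<otimes>\<^bsub>?A\<^esub> a) g = a g"
        proof (cases "g \<in> carrier G")
          case True
          have "(\<one>\<^bsub>?A\<^esub> \<otimes>\<^bsub>?A\<^esub> a) g = (\<Sum>x\<in>carrier G. if x = \<one>\<^bsub>G\<^esub> then a g else 0)"
            unfolding mult[OF True] one using True by (intro sum.cong) auto
          then show ?thesis using fin by simp
        next
          case False
          then show ?thesis using a out by (simp add: group_algebra_def)
        qed
      qed
      show "a \<otimes>\<^bsub>?A\<^esub> \<one>\<^bsub>?A\<^esub> = a"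
      proof
        fix g show "(a \<otimes>\<^bsub>?A\<^esub> \<one>\<^bsub>?A\<^esub>) g = a g"
        proof (cases "g \<in> carrier G")
          case True
          have "inv\<^bsub>G\<^esub> x \<otimes>\<^bsub>G\<^esub> g = \<one>\<^bsub>G\<^esub> \<longleftrightarrow> x = g" if "x \<in> carrier G" for x
            using that True by (metis G.inv_closed G.inv_equality G.inv_inv G.l_inv)
          then have "(a \<otimes>\<^bsub>?A\<^esub> \<one>\<^bsub>?A\<^esub>) g = (\<Sum>x\<in>carrier G. if x = g then a g else 0)"
            unfolding mult[OF True] one by (intro sum.cong) auto
          then show ?thesis using fin True by simp
        next
          case False
          then show ?thesis using a out by (simp add: group_algebra_def)
        qed
      qed
    qed
  qed (auto simp: group_algebra_def fun_eq_iff algebra_simps sum.distrib)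
qed

lemma kA5_ring: "ring (kA5 :: ((nat \<Rightarrow> nat) \<Rightarrow> 'k::field) ring)"
  unfolding kA5_def by (rule group_algebra_ring[OF A5_group A5_finite])

text \<open>The carrier of the group algebra as a type of class \<open>ring_1\<close>, so that the simplifier can compute in it.\<close>

typedef (overloaded) 'k galg = "carrier (kA5 :: ((nat \<Rightarrow> nat) \<Rightarrow> 'k::field) ring)"
  morphisms gcoef Galg
  using kA5_ring ring.ring_simprules(2) by blast

setup_lifting type_definition_galg

instantiation galg :: (field) ring_1
begin

lift_definition zero_galg :: "'a galg" is "\<zero>\<^bsub>kA5\<^esub>" by (rule ring.ring_simprules(2)[OF kA5_ring])
lift_definition one_galg :: "'a galg" is "\<one>\<^bsub>kA5\<^esub>" by (rule ring.ring_simprules(6)[OF kA5_ring])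
lift_definition plus_galg :: "'a galg \<Rightarrow> 'a galg \<Rightarrow> 'a galg" is "add kA5"
  by (rule ring.ring_simprules(1)[OF kA5_ring])
lift_definition times_galg :: "'a galg \<Rightarrow> 'a galg \<Rightarrow> 'a galg" is "mult kA5"
  by (rule ring.ring_simprules(5)[OF kA5_ring])
lift_definition uminus_galg :: "'a galg \<Rightarrow> 'a galg" is "a_inv kA5"
  by (rule ring.ring_simprules(3)[OF kA5_ring])
lift_definition minus_galg :: "'a galg \<Rightarrow> 'a galg \<Rightarrow> 'a galg" is "\<lambda>a b. a \<ominus>\<^bsub>kA5\<^esub> b"
  by (rule ring.ring_simprules(4)[OF kA5_ring])

instance
proof
  interpret R: ring "kA5 :: ((nat \<Rightarrow> nat) \<Rightarrow> 'a::field) ring" by (rule kA5_ring)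
  fix a b c :: "'a galg"
  show "a * b * c = a * (b * c)" by transfer (rule R.m_assoc)
  show "1 * a = a" "a * 1 = a" by (transfer, simp)+
  show "a + b + c = a + (b + c)" by transfer (rule R.a_assoc)
  show "a + b = b + a" by transfer (rule R.a_comm)
  show "0 + a = a" by transfer simp
  show "- a + a = 0" by transfer (rule R.l_neg)
  show "a - b = a + - b" by transfer (simp add: a_minus_def)
  show "(a + b) * c = a * c + b * c" by transfer (rule R.l_distr)
  show "a * (b + c) = a * b + a * c" by transfer (rule R.r_distr)
  show "(0::'a galg) \<noteq> 1"
    by transfer (auto simp: kA5_def group_algebra_def fun_eq_iff)
qed

end

lemmas gcoef_ring = zero_galg.rep_eq one_galg.rep_eq plus_galg.rep_eq times_galg.rep_eq
  uminus_galg.rep_eq minus_galg.rep_eq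

lemma gcoef_simps [simp]:
  "gcoef 0 g = 0" "gcoef (a + b) g = gcoef a g + gcoef b g"
  "gcoef 1 g = (if g = id then 1 else 0)"
  by (simp_all add: gcoef_ring kA5_def group_algebra_def)

lemma kA5_carrier_iff: "a \<in> carrier kA5 \<longleftrightarrow> (\<forall>g. g \<notin> carrier A5 \<longrightarrow> a g = 0)"
  by (simp add: kA5_def group_algebra_def)

lemma gcoef_outside: "g \<notin> carrier A5 \<Longrightarrow> gcoef a g = 0"
  using gcoef[of a] by (simp add: kA5_carrier_iff)

lemma gcoef_mult: "gcoef (a * b) g =
    (if g \<in> carrier A5 then \<Sum>x\<in>carrier A5. gcoef a x * gcoef b (inv\<^bsub>A5\<^esub> x \<circ> g) else 0)"
  by (simp add: gcoef_ring kA5_def group_algebra_def)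

lift_definition scale :: "'k::field \<Rightarrow> 'k galg \<Rightarrow> 'k galg" (infixr \<open>\<star>\<close> 75) is
  "\<lambda>c a g. c * a g" by (simp add: kA5_carrier_iff)

lift_definition single :: "(nat \<Rightarrow> nat) \<Rightarrow> 'k::field galg" is
  "\<lambda>p g. if g = p \<and> p \<in> carrier A5 then 1 else 0" by (auto simp: kA5_carrier_iff)

lemma gcoef_scale [simp]: "gcoef (c \<star> a) g = c * gcoef a g" by (simp add: scale.rep_eq)

lemma gcoef_single: "gcoef (single p) g = (if g = p \<and> p \<in> carrier A5 then 1 else 0)"
  by (simp add: single.rep_eq)

lemma gcoef_eqI: "(\<And>g. g \<in> carrier A5 \<Longrightarrow> gcoef a g = gcoef b g) \<Longrightarrow> a = b"
  unfolding gcoef_inject[symmetric] using gcoef_outside by (metis ext)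

lemma scale_simps [simp]:
  "1 \<star> a = a" "0 \<star> a = 0" "c \<star> (0 :: 'k::field galg) = 0" "c \<star> d \<star> a = (c * d) \<star> a"
  "(c \<star> a) * b = c \<star> (a * b)" "a * (c \<star> b) = c \<star> (a * b)"
  for c d :: "'k::field"
  by (rule gcoef_eqI; simp add: gcoef_mult sum_distrib_left mult_ac)+

lemma scale_add: "(c + d) \<star> a = c \<star> a + d \<star> a" "c \<star> (a + b) = c \<star> a + c \<star> b"
  by (rule gcoef_eqI; simp add: algebra_simps)+

lemma scale_sum: "c \<star> (\<Sum>i\<in>I. f i) = (\<Sum>i\<in>I. c \<star> f i)" "(\<Sum>i\<in>I. d i) \<star> a = (\<Sum>i\<in>I. d i \<star> a)"
  by (induction I rule: infinite_finite_induct) (simp_all add: scale_add)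

lemma gcoef_sum: "gcoef (\<Sum>i\<in>I. f i) g = (\<Sum>i\<in>I. gcoef (f i) g)"
  by (induction I rule: infinite_finite_induct) simp_all

lemma single_id [simp]: "single id = 1"
  by (rule gcoef_eqI) (simp add: gcoef_single)

lemma gcoef_single_mult:
  assumes p: "p \<in> carrier A5" "g \<in> carrier A5"
  shows "gcoef (single p * a) g = gcoef a (inv\<^bsub>A5\<^esub> p \<circ> g)"
  using p by (simp add: gcoef_mult gcoef_single if_distrib[of "\<lambda>u. u * _"] cong: if_cong)

lemma single_mult [simp]:
  assumes p: "p \<in> carrier A5" "q \<in> carrier A5" shows "single p * single q = single (p \<circ> q)"
proof (rule gcoef_eqI)
  interpret G: group A5 by (rule A5_group)
  fix g assume g: "g \<in> carrier A5"
  have "inv\<^bsub>A5\<^esub> p \<otimes>\<^bsub>A5\<^esub> g = q \<longleftrightarrow> g = p \<otimes>\<^bsub>A5\<^esub> q" using p g G.inv_solve_left' by metis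
  then show "gcoef (single p * single q) g = gcoef (single (p \<circ> q)) g"
    using p g by (simp add: gcoef_single_mult gcoef_single)
qed

lemma single_power: "p \<in> carrier A5 \<Longrightarrow> single p ^ n = single (p ^^ n)"
  by (induction n) simp_all

lemma galg_expand: "a = (\<Sum>p\<in>carrier A5. gcoef a p \<star> single p)"
proof (rule gcoef_eqI)
  fix g assume "g \<in> carrier A5"
  then have "(\<Sum>p\<in>carrier A5. gcoef a p * (if g = p \<and> p \<in> carrier A5 then 1 else 0)) = gcoef a g"
    by (simp add: if_distrib[of "\<lambda>x. _ * x"] if_bool_eq_conj[symmetric] cong: if_cong sum.cong)
  then show "gcoef a g = gcoef (\<Sum>p\<in>carrier A5. gcoef a p \<star> single p) g"
    by (simp add: gcoef_sum gcoef_single)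
qed

lemma galg_induct [case_names single scale add]:
  assumes "\<And>p. p \<in> carrier A5 \<Longrightarrow> P (single p)" "\<And>c a. P a \<Longrightarrow> P (c \<star> a)" "\<And>a b. P a \<Longrightarrow> P b \<Longrightarrow> P (a + b)"
  shows "P a"
proof -
  have "P (\<Sum>p\<in>A. gcoef a p \<star> single p)" if "A \<subseteq> carrier A5" "finite A" for A
    using that(2,1)
  proof (induction A rule: finite_induct)
    case empty
    have "P (0 \<star> single id)" by (rule assms(2)[OF assms(1)[OF A5_id]])
    then show ?case by simp
  qed (use assms in auto)
  then show ?thesis using galg_expand[of a] by (metis A5_finite order_refl)
qed

section \<open>Eigenspaces of a 5-cycle and the Hecke algebra\<close>

definition C :: "'k::field galg" where "C = single cc"
definition S :: "'k::field galg" where "S = single ss"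
definition G :: "'k::field galg" where "G = single gg"

lemma C_pow: "C ^ n = single (cc ^^ n)"
  by (simp add: C_def single_power)

lemma group_relations:
  "C ^ 5 = (1 :: 'k::field galg)" "S * S = (1 :: 'k galg)" "G * G = (1 :: 'k galg)" "G * S = S * (G :: 'k galg)"
  "S * C = C ^ 4 * (S :: 'k galg)"
  "G * C * G = C ^ 4 * G * (C ^ 4 :: 'k galg)" "G * C ^ 2 * G = C ^ 2 * (G * S) * (C ^ 2 :: 'k galg)"
  "G * C ^ 3 * G = C ^ 3 * (G * S) * (C ^ 3 :: 'k galg)" "G * C ^ 4 * G = C * G * (C :: 'k galg)"
proof -
  have p: "cc ^^ 5 = id" "ss \<circ> ss = id" "gg \<circ> gg = id" "gg \<circ> ss = ss \<circ> gg" "ss \<circ> cc = cc ^^ 4 \<circ> ss"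
    "gg \<circ> cc \<circ> gg = cc ^^ 4 \<circ> gg \<circ> cc ^^ 4" "gg \<circ> cc ^^ 2 \<circ> gg = cc ^^ 2 \<circ> (gg \<circ> ss) \<circ> cc ^^ 2"
    "gg \<circ> cc ^^ 3 \<circ> gg = cc ^^ 3 \<circ> (gg \<circ> ss) \<circ> cc ^^ 3" "gg \<circ> cc ^^ 4 \<circ> gg = cc \<circ> gg \<circ> cc"
    unfolding cc_pow by (simp_all only: perm5_defs perm5_id perm5_comp_perm5 perm5_simps)
  show "C ^ 5 = (1 :: 'k galg)" "S * S = (1 :: 'k galg)" "G * G = (1 :: 'k galg)" "G * S = S * (G :: 'k galg)"
    "S * C = C ^ 4 * (S :: 'k galg)"
    "G * C * G = C ^ 4 * G * (C ^ 4 :: 'k galg)" "G * C ^ 2 * G = C ^ 2 * (G * S) * (C ^ 2 :: 'k galg)"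
    "G * C ^ 3 * G = C ^ 3 * (G * S) * (C ^ 3 :: 'k galg)" "G * C ^ 4 * G = C * G * (C :: 'k galg)"
    unfolding C_pow by (simp_all only: C_def S_def G_def single_mult A5_gens A5_comp A5_pow p single_id)
qed

lemma power_mod_5:
  fixes z :: "'a::monoid_mult"
  assumes "z ^ 5 = 1" shows "z ^ n = z ^ (n mod 5)"
proof -
  have "z ^ n = z ^ (5 * (n div 5) + n mod 5)" by simp
  also have "\<dots> = z ^ (n mod 5)" by (simp only: power_add power_mult assms power_one mult_1_left)
  finally show ?thesis .
qed

locale fifth_root =
  fixes \<zeta> :: "'k::field"
  assumes char2: "(1::'k) + 1 = 0" and prim: "\<zeta> ^ 4 + \<zeta> ^ 3 + \<zeta> ^ 2 + \<zeta> + 1 = 0"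
begin

lemma double_scalar [simp]: "(x::'k) + x = 0" "(x::'k) + (x + y) = y"
proof -
  have "x + x = x * (1 + 1)" by (simp only: distrib_left mult_1_right)
  then show "x + x = 0" by (simp only: char2 mult_zero_right)
  then show "x + (x + y) = y" by (simp only: add.assoc[symmetric] add_0)
qed

lemma add_zero_eq:
  assumes "(x::'k) + y = 0" shows "x = y"
proof -
  have "x = (x + y) + y" by (simp only: add.assoc double_scalar(1) add_0_right)
  then show ?thesis by (simp only: assms add_0)
qed

lemma double_galg [simp]: "(x::'k galg) + x = 0" "(x::'k galg) + (x + y) = y"
proof -
  show a: "x + x = 0" for x :: "'k galg" by (rule gcoef_eqI) simp
  show "x + (x + y) = y" using a[of x] by (simp add: add.assoc[symmetric])
qed

lemma root_pow5: "\<zeta> ^ 5 = 1"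
proof -
  have "(\<zeta> + 1) * (\<zeta> ^ 4 + \<zeta> ^ 3 + \<zeta> ^ 2 + \<zeta> + 1) = \<zeta> ^ 5 + 1"
  proof -
    have "\<zeta> * \<zeta> ^ 4 = \<zeta> ^ 5" "\<zeta> * \<zeta> ^ 3 = \<zeta> ^ 4" "\<zeta> * \<zeta> ^ 2 = \<zeta> ^ 3"
      using power_Suc[of \<zeta> 4] power_Suc[of \<zeta> 3] power_Suc[of \<zeta> 2] by simp_all
    moreover have "\<zeta> * \<zeta> = \<zeta> ^ 2" by (simp add: power2_eq_square)
    ultimately show ?thesis by (simp add: distrib_left distrib_right add_ac)
  qed
  then have "\<zeta> ^ 5 + 1 = 0" unfolding prim by simp
  then have "(\<zeta> ^ 5 + 1) + 1 = 1" by simp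
  then show ?thesis by (simp only: add.assoc char2 add_0_right)
qed

lemma root_pow_mod: "\<zeta> ^ n = \<zeta> ^ (n mod 5)"
  by (rule power_mod_5[OF root_pow5])

lemma root_pow_cong: "m mod 5 = n mod 5 \<Longrightarrow> \<zeta> ^ m = \<zeta> ^ n"
  by (metis root_pow_mod)

definition t :: 'k where "t = \<zeta> + \<zeta> ^ 4"

lemma t_other: "\<zeta> ^ 2 + \<zeta> ^ 3 = t + 1"
proof -
  have "(\<zeta> ^ 4 + \<zeta> ^ 3 + \<zeta> ^ 2 + \<zeta> + 1) + (t + 1) = \<zeta> ^ 2 + \<zeta> ^ 3"
    by (simp add: t_def add_ac)
  then show ?thesis unfolding prim by simp
qed

lemma t_square: "t * t = t + 1"
proof -
  have "\<zeta> * \<zeta> ^ 4 = \<zeta> ^ 5" "\<zeta> ^ 4 * \<zeta> = \<zeta> ^ 5" "\<zeta> ^ 4 * \<zeta> ^ 4 = \<zeta> ^ 8"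
    using power_Suc[of \<zeta> 4] power_add[of \<zeta> 4 4] by (simp_all add: mult.commute)
  moreover have "\<zeta> * \<zeta> = \<zeta> ^ 2" by (simp add: power2_eq_square)
  ultimately have "t * t = \<zeta> ^ 2 + \<zeta> ^ 8 + (\<zeta> ^ 5 + \<zeta> ^ 5)" by (simp add: t_def distrib_left distrib_right add_ac)
  also have "\<zeta> ^ 8 = \<zeta> ^ 3" by (rule root_pow_cong) simp
  finally show ?thesis by (simp add: t_other)
qed

definition br :: "nat \<Rightarrow> 'k" where "br n = \<zeta> ^ n + \<zeta> ^ (4 * n)"

lemma br_mod: "br n = (if n mod 5 = 0 then 0 else if n mod 5 = 1 \<or> n mod 5 = 4 then t else t + 1)"
proof -
  have "br n = \<zeta> ^ (n mod 5) + \<zeta> ^ (4 * (n mod 5))"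
    unfolding br_def using root_pow_mod[of n] root_pow_cong[of "4 * n" "4 * (n mod 5)"] by (simp add: mod_mult_right_eq)
  moreover have "\<zeta> ^ 8 = \<zeta> ^ 3" "\<zeta> ^ 12 = \<zeta> ^ 2" "\<zeta> ^ 16 = \<zeta>"
    using root_pow_cong[of 8 3] root_pow_cong[of 12 2] root_pow_cong[of 16 1] by simp_all
  moreover have "n mod 5 < 5" by simp
  then have "n mod 5 = 0 \<or> n mod 5 = 1 \<or> n mod 5 = 2 \<or> n mod 5 = 3 \<or> n mod 5 = 4" by linarith
  ultimately show ?thesis using t_other by (auto simp: t_def add_ac)
qed

text \<open>The primitive idempotents of \<open>k\<langle>c\<rangle>\<close>. The factor \<open>1/5\<close> is \<open>1\<close> in characteristic 2, and \<open>4 i\<close> stands for \<open>-i\<close>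
  modulo 5.\<close>

definition E :: "nat \<Rightarrow> 'k galg" where "E i = (\<Sum>m<5. \<zeta> ^ (4 * i * m) \<star> C ^ m)"

abbreviation neg :: "nat \<Rightarrow> nat" where "neg i \<equiv> (4 * i) mod 5"

lemma E_expand: "E i = 1 + (\<zeta>^i)^4 \<star> C + (\<zeta>^i)^3 \<star> C^2 + (\<zeta>^i)^2 \<star> C^3 + \<zeta>^i \<star> C^4"
proof -
  have p: "\<zeta> ^ (4 * i * 1) = (\<zeta>^i)^4" "\<zeta> ^ (4 * i * 2) = (\<zeta>^i)^3" "\<zeta> ^ (4 * i * 3) = (\<zeta>^i)^2" "\<zeta> ^ (4 * i * 4) = \<zeta>^i"
    unfolding power_mult[symmetric] by (rule root_pow_cong; presburger)+
  have "{..<5::nat} = {0, 1, 2, 3, 4}" by auto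
  then show ?thesis unfolding E_def using p by (simp add: add_ac)
qed

lemma root_i_pow5: "(\<zeta>^i)^5 = 1" by (metis mult.commute power_mult power_one root_pow5)

lemma C_E: "C * E i = \<zeta>^i \<star> E i" and E_C: "E i * C = \<zeta>^i \<star> E i"
proof -
  define z where "z = \<zeta>^i"
  have z: "z * z^4 = 1" "z * z^3 = z^4" "z * z^2 = z^3" "z * z = z^2"
    using root_i_pow5[of i] by (simp_all add: z_def eval_nat_numeral)
  have c: "C * C = C^2" "C * C^2 = C^3" "C * C^3 = C^4" "C * C^4 = (1::'k galg)"
     "C^2 * C = C^3" "C^3 * C = C^4" "C^4 * C = (1::'k galg)"
    using group_relations(1)[where 'k = 'k] by (simp_all add: eval_nat_numeral mult.assoc)
  show "C * E i = \<zeta>^i \<star> E i" "E i * C = \<zeta>^i \<star> E i"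
    unfolding E_expand z_def[symmetric] by (simp_all add: distrib_left distrib_right c z scale_add add_ac)
qed

lemma Cpow_E: "C ^ n * E i = \<zeta> ^ (i * n) \<star> E i" and E_Cpow: "E i * C ^ n = \<zeta> ^ (i * n) \<star> E i"
  by (induction n) (simp_all add: mult.assoc C_E E_C power_add mult_ac, simp add: power_commutes mult.assoc[symmetric] E_C power_add mult_ac)

lemma E_mod: "E (i mod 5) = E i"
proof -
  have "\<zeta> ^ (i mod 5) = \<zeta> ^ i" by (rule root_pow_mod[symmetric])
  then show ?thesis unfolding E_expand by simp
qed

lemma E_mult_general: "E i * E j = (\<Sum>m<5. \<zeta> ^ (m * (4 * i + j))) \<star> E j"
  unfolding E_def[of i] by (simp add: sum_distrib_right Cpow_E scale_sum power_add[symmetric] algebra_simps)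

lemma power_sum: "(\<Sum>m<5. \<zeta> ^ (m * n)) = (if n mod 5 = 0 then 1 else 0)"
proof -
  have e: "{..<5::nat} = {0, 1, 2, 3, 4}" by auto
  have r: "\<zeta> ^ (m * n) = \<zeta> ^ ((m * (n mod 5)) mod 5)" for m
    by (rule root_pow_cong) (simp add: mod_mult_right_eq)
  have "n mod 5 < 5" by simp
  then have "n mod 5 = 0 \<or> n mod 5 = 1 \<or> n mod 5 = 2 \<or> n mod 5 = 3 \<or> n mod 5 = 4" by linarith
  then show ?thesis
    unfolding r e using prim by (elim disjE) (simp_all add: add_ac power2_eq_square)
qed

lemma E_mult: "i < 5 \<Longrightarrow> j < 5 \<Longrightarrow> E i * E j = (if i = j then E i else 0)"
proof -
  assume "i < 5" "j < 5"
  then have "i = 0 \<or> i = 1 \<or> i = 2 \<or> i = 3 \<or> i = 4" "j = 0 \<or> j = 1 \<or> j = 2 \<or> j = 3 \<or> j = 4"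
    by linarith+
  then have "(4 * i + j) mod 5 = 0 \<longleftrightarrow> i = j" by (elim disjE) simp_all
  then show ?thesis using E_mult_general[of i j] power_sum[of "4 * i + j"] by (cases "i = j") simp_all
qed

lemma S_Cpow: "S * C ^ n = C ^ (4 * n) * (S :: 'k galg)"
proof (induction n)
  case (Suc n)
  have "S * C ^ Suc n = (S * C) * (C ^ n :: 'k galg)" by (simp add: mult.assoc)
  also have "\<dots> = C ^ 4 * (C ^ (4 * n) * S)" unfolding group_relations(5) mult.assoc Suc ..
  finally show ?case by (simp add: power_add mult.assoc)
qed simp

lemma S_E: "S * E i = E (neg i) * S"
proof -
  have "S * E i = E (4 * i) * S"
    unfolding E_expand distrib_left distrib_right
  proof -
    let ?z = "\<zeta> ^ i"
    have z: "\<zeta> ^ (4 * i) = ?z ^ 4" by (simp add: power_mult[symmetric] mult.commute)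
    have p: "(?z^4)^4 = ?z" "(?z^4)^3 = ?z^2" "(?z^4)^2 = ?z^3"
      using power_mod_5[OF root_i_pow5, of i 16] power_mod_5[OF root_i_pow5, of i 12] power_mod_5[OF root_i_pow5, of i 8]
      by (simp_all add: mult.commute flip: power_mult)
    have c5: "C ^ n = (C ^ (n mod 5) :: 'k galg)" for n
      by (rule power_mod_5[OF group_relations(1)])
    have s: "S * C = C^4 * (S :: 'k galg)" "S * C^2 = C^3 * (S :: 'k galg)" "S * C^3 = C^2 * (S :: 'k galg)" "S * C^4 = C * (S :: 'k galg)"
      using S_Cpow[of 1] S_Cpow[of 2] S_Cpow[of 3] S_Cpow[of 4] c5[of 8] c5[of 12] c5[of 16] by simp_all
    show "S * 1 + S * ?z^4 \<star> C + S * ?z^3 \<star> C^2 + S * ?z^2 \<star> C^3 + S * ?z \<star> C^4 =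
      1 * S + (\<zeta> ^ (4 * i))^4 \<star> C * S + (\<zeta> ^ (4 * i))^3 \<star> C^2 * S + (\<zeta> ^ (4 * i))^2 \<star> C^3 * S + (\<zeta> ^ (4 * i)) \<star> C^4 * S"
      unfolding z p by (simp add: s add_ac)
  qed
  then show ?thesis using E_mod[of "4 * i"] by simp
qed

lemma sum_E: "E 0 + E 1 + E 2 + E 3 + E 4 = 1"
proof -
  have "\<zeta>^8 = \<zeta>^3" "\<zeta>^12 = \<zeta>^2" "\<zeta>^16 = \<zeta>" "\<zeta>^6 = \<zeta>" "\<zeta>^9 = \<zeta>^4"
    using root_pow_cong[of 8 3] root_pow_cong[of 12 2] root_pow_cong[of 16 1] root_pow_cong[of 6 1] root_pow_cong[of 9 4] by simp_all
  moreover have p: "x + (\<zeta> + (\<zeta>^2 + (\<zeta>^3 + \<zeta>^4))) = x + 1" for x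
  proof -
    have "(\<zeta> + (\<zeta>^2 + (\<zeta>^3 + \<zeta>^4))) + 1 = 0" using prim by (simp add: add_ac)
    then have e: "\<zeta> + (\<zeta>^2 + (\<zeta>^3 + \<zeta>^4)) = 1"
      by (rule add_zero_eq)
    show ?thesis unfolding e ..
  qed
  have "1 + \<zeta>^4 + \<zeta>^3 + \<zeta>^2 + \<zeta> = 0" using prim by (simp add: add_ac)
  ultimately have "(1 + \<zeta>^4 + \<zeta>^8 + \<zeta>^12 + \<zeta>^16) = 0" "1 + \<zeta>^3 + \<zeta>^6 + \<zeta>^9 + \<zeta>^12 = 0"
    "1 + \<zeta>^2 + \<zeta>^4 + \<zeta>^6 + \<zeta>^8 = 0" "1 + \<zeta> + \<zeta>^2 + \<zeta>^3 + \<zeta>^4 = 0"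
    by (simp_all add: add_ac)
  note z = this
  have e: "E 0 + E 1 + E 2 + E 3 + E 4 = (1 + 1 + 1 + 1 + 1) \<star> 1 + (1 + \<zeta>^4 + \<zeta>^8 + \<zeta>^12 + \<zeta>^16) \<star> C
      + (1 + \<zeta>^3 + \<zeta>^6 + \<zeta>^9 + \<zeta>^12) \<star> C^2 + (1 + \<zeta>^2 + \<zeta>^4 + \<zeta>^6 + \<zeta>^8) \<star> C^3 + (1 + \<zeta> + \<zeta>^2 + \<zeta>^3 + \<zeta>^4) \<star> C^4"
    unfolding E_expand scale_add by (simp add: add_ac power_mult[symmetric])
  show ?thesis unfolding e z by simp
qed

definition H :: "nat \<Rightarrow> nat \<Rightarrow> 'k galg" where "H i j = E i * G * E j"
definition H' :: "nat \<Rightarrow> nat \<Rightarrow> 'k galg" where "H' i j = E i * (G * S) * E j"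
definition D :: "nat \<Rightarrow> 'k galg" where "D i = S * E i"

lemma H'_left: "H' i j = S * H (neg i) j"
proof -
  have "S * (E (neg i) * G * E j) = E (neg (neg i)) * (S * G) * E j"
    by (simp add: mult.assoc[symmetric] S_E)
  moreover have "E (neg (neg i)) = E i"
  proof -
    have "neg (neg i) = 4 * (4 * i) mod 5" by (rule mod_mult_right_eq)
    also have "4 * (4 * i) = i + 5 * (3 * i)" by simp
    also have "\<dots> mod 5 = i mod 5" by (rule mod_mult_self2)
    finally have "neg (neg i) = i mod 5" .
    then show ?thesis using E_mod[of i] by simp
  qed
  ultimately show ?thesis unfolding H_def H'_def group_relations(4) by simp
qed

lemma H'_right: "H' i j = H i (neg j) * S"
  unfolding H_def H'_def by (simp add: mult.assoc S_E)

lemma C_sandwich: "E i * (C ^ a * Y * C ^ b) * E k = \<zeta> ^ (i * a + k * b) \<star> (E i * Y * E k)"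
proof -
  have "E i * (C ^ a * Y * C ^ b) * E k = (E i * C ^ a) * Y * (C ^ b * E k)" by (simp only: mult.assoc)
  then show ?thesis by (simp only: E_Cpow Cpow_E scale_simps power_add mult.commute[of "\<zeta> ^ (i * a)"])
qed

text \<open>Expand the middle idempotent into powers of \<open>c\<close> and use \<open>g c g = c^-1 g c^-1\<close> and
  \<open>g c^2 g = c^2 g s c^2\<close>, with the inverse relations: each pair of opposite powers contributes a sum of
  two opposite powers of \<open>\<zeta>\<close>.\<close>

lemma H_H_general: "H i j * H j k = E i * E k + br (i + j + k) \<star> H i k + br (2 * i + 2 * k + 3 * j) \<star> H' i k" if "j < 5"
proof -
  have "H i j * H j k = E i * G * (E j * E j) * G * E k" by (simp add: H_def mult.assoc)
  also have "E j * E j = E j" using that by (simp add: E_mult)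
  also have "E i * G * E j * G * E k = E i * (G * G) * E k + (\<zeta>^j)^4 \<star> (E i * (G * C * G) * E k) + (\<zeta>^j)^3 \<star> (E i * (G * C^2 * G) * E k)
     + (\<zeta>^j)^2 \<star> (E i * (G * C^3 * G) * E k) + \<zeta>^j \<star> (E i * (G * C^4 * G) * E k)"
    unfolding E_expand[of j] by (simp add: distrib_left distrib_right mult.assoc)
  also have "E i * (G * G) * E k = E i * E k" by (simp add: group_relations)
  also have "E i * (G * C * G) * E k = \<zeta>^(i*4 + k*4) \<star> H i k"
    unfolding group_relations H_def by (rule C_sandwich)
  also have "E i * (G * C^2 * G) * E k = \<zeta>^(i*2 + k*2) \<star> H' i k"
    unfolding group_relations(7) H'_def by (rule C_sandwich)
  also have "E i * (G * C^3 * G) * E k = \<zeta>^(i*3 + k*3) \<star> H' i k"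
    unfolding group_relations(8) H'_def by (rule C_sandwich)
  also have "E i * (G * C^4 * G) * E k = \<zeta>^(i*1 + k*1) \<star> H i k"
    unfolding group_relations(9) H_def using C_sandwich[of i 1 G 1 k] by simp
  finally have "H i j * H j k = E i * E k + (\<zeta>^(j*4 + (i*4 + k*4)) + \<zeta>^(j + (i + k))) \<star> H i k
      + (\<zeta>^(j*3 + (i*2 + k*2)) + \<zeta>^(j*2 + (i*3 + k*3))) \<star> H' i k"
    by (simp only: scale_add scale_simps power_add[symmetric] power_mult[symmetric] add_ac mult_1_right)
  moreover have "\<zeta>^(j*4 + (i*4 + k*4)) + \<zeta>^(j + (i + k)) = br (i + j + k)"
    unfolding br_def by (simp add: add_ac distrib_left mult.commute)
  moreover have "\<zeta>^(j*2 + (i*3 + k*3)) = \<zeta>^(4 * (2*i + 2*k + 3*j))"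
  proof (rule root_pow_cong)
    have "4 * (2*i + 2*k + 3*j) = (j*2 + (i*3 + k*3)) + 5 * (i + k + 2 * j)" by simp
    then show "(j*2 + (i*3 + k*3)) mod 5 = 4 * (2*i + 2*k + 3*j) mod 5" by (simp only: mod_mult_self2)
  qed
  then have "\<zeta>^(j*3 + (i*2 + k*2)) + \<zeta>^(j*2 + (i*3 + k*3)) = br (2*i + 2*k + 3*j)"
    unfolding br_def by (simp add: add_ac mult.commute)
  ultimately show ?thesis by simp
qed

lemma neg_neg: "i < 5 \<Longrightarrow> neg (neg i) = i"
proof -
  assume i: "i < 5"
  have "neg (neg i) = 4 * (4 * i) mod 5" by (rule mod_mult_right_eq)
  also have "4 * (4 * i) = i + 5 * (3 * i)" by simp
  also have "\<dots> mod 5 = i mod 5" by (rule mod_mult_self2)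
  finally show ?thesis using i by simp
qed

lemma S_S_mult: "S * (S * (x :: 'k galg)) = x"
  by (simp add: group_relations mult.assoc[symmetric])

lemma S_H': "i < 5 \<Longrightarrow> S * H' (neg i) j = H i j"
  by (simp add: H'_left neg_neg S_S_mult)

lemma S_H: "i < 5 \<Longrightarrow> S * H (neg i) j = H' i j"
  by (simp add: H'_left)

text \<open>The multiplication table of the double coset elements.\<close>

lemma H_H: "i < 5 \<Longrightarrow> j < 5 \<Longrightarrow> j' < 5 \<Longrightarrow> k < 5 \<Longrightarrow> H i j * H j' k =
    (if j = j' then (if i = k then E i else 0) + br (i + j + k) \<star> H i k + br (2*i + 2*k + 3*j) \<star> H' i k else 0)"
proof (cases "j = j'")
  case False
  assume "j < 5" "j' < 5"
  have "H i j * H j' k = E i * G * (E j * E j') * G * E k" by (simp add: H_def mult.assoc)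
  then show ?thesis using False \<open>j < 5\<close> \<open>j' < 5\<close> by (simp add: E_mult)
qed (simp add: H_H_general E_mult)

lemma H'_H: assumes ijk: "i < 5" "j < 5" "j' < 5" "k < 5" shows "H' i j * H j' k =
    (if j = j' then (if neg i = k then D k else 0) + br (neg i + j + k) \<star> H' i k
      + br (2*neg i + 2*k + 3*j) \<star> H i k else 0)"
proof -
  have n: "neg i < 5" by simp
  have "H' i j * H j' k = S * (H (neg i) j * H j' k)" by (simp add: H'_left mult.assoc)
  then show ?thesis unfolding H_H[OF n ijk(2-4)]
    using S_H'[OF ijk(1), of k] S_H[OF ijk(1), of k] by (simp add: distrib_left D_def)
qed

lemma D_right: "k < 5 \<Longrightarrow> E (neg k) * S = D k"
  unfolding D_def S_E ..

lemma H_S: "H i k * S = H' i (neg k)" if "k < 5"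
  using H'_right[of i "neg k"] neg_neg[OF that] by simp

lemma H'_S: "H' i k * S = H i (neg k)" if "k < 5"
  unfolding H'_right by (simp add: mult.assoc group_relations)

lemma H_H': assumes ijk: "i < 5" "j < 5" "j' < 5" "k < 5" shows "H i j * H' j' k =
    (if j = j' then (if i = neg k then D k else 0) + br (i + j + neg k) \<star> H' i k
      + br (2*i + 2*neg k + 3*j) \<star> H i k else 0)"
proof -
  have n: "neg k < 5" by simp
  have "H i j * H' j' k = (H i j * H j' (neg k)) * S" by (simp add: H'_right mult.assoc)
  then show ?thesis unfolding H_H[OF ijk(1-3) n]
    using H_S[OF n, of i] H'_S[OF n, of i] neg_neg[OF ijk(4)] D_right[OF ijk(4)] by (simp add: distrib_right)
qed

lemma H'_H': assumes ijk: "i < 5" "j < 5" "j' < 5" "k < 5" shows "H' i j * H' j' k =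
    (if j = j' then (if i = k then E i else 0) + br (neg i + j + neg k) \<star> H i k
      + br (2*neg i + 2*neg k + 3*j) \<star> H' i k else 0)"
proof -
  have n: "neg i < 5" by simp
  have "H' i j * H' j' k = S * (H (neg i) j * H' j' k)" by (simp add: H'_left mult.assoc)
  moreover have "neg i = neg k \<longleftrightarrow> i = k" using neg_neg[OF ijk(1)] neg_neg[OF ijk(4)] by metis
  moreover have "S * D k = E k" unfolding D_def by (rule S_S_mult)
  ultimately show ?thesis unfolding H_H'[OF n ijk(2-4)]
    using S_H'[OF ijk(1), of k] S_H[OF ijk(1), of k] by (simp add: distrib_left)
qed

lemma E_H: "i < 5 \<Longrightarrow> j < 5 \<Longrightarrow> E i * H j k = (if i = j then H j k else 0)"
  "i < 5 \<Longrightarrow> j < 5 \<Longrightarrow> E i * H' j k = (if i = j then H' j k else 0)"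
  by (simp_all add: H_def H'_def mult.assoc[symmetric] E_mult)

lemma H_E: "k < 5 \<Longrightarrow> j < 5 \<Longrightarrow> H i j * E k = (if j = k then H i j else 0)"
  "k < 5 \<Longrightarrow> j < 5 \<Longrightarrow> H' i j * E k = (if j = k then H' i j else 0)"
  by (simp_all add: H_def H'_def mult.assoc E_mult)

lemma D0: "D 0 * H 0 k = H' 0 k" "D 0 * H' 0 k = H 0 k" "D 0 * D 0 = E 0" "E 0 * D 0 = D 0" "D 0 * E 0 = D 0"
  "H i 0 * D 0 = H' i 0" "H' i 0 * D 0 = H i 0"
proof -
  have d: "D 0 = S * E 0" "D 0 = E 0 * S" using S_E[of 0] by (simp_all add: D_def)
  have "D 0 * H 0 k = S * (E 0 * H 0 k)" "D 0 * H' 0 k = S * (E 0 * H' 0 k)" by (simp_all add: d(1) mult.assoc)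
  then show "D 0 * H 0 k = H' 0 k" "D 0 * H' 0 k = H 0 k" using S_H[of 0 k] S_H'[of 0 k] by (simp_all add: E_H)
  have "H i 0 * D 0 = (H i 0 * E 0) * S" "H' i 0 * D 0 = (H' i 0 * E 0) * S" by (simp_all add: d(2) mult.assoc)
  then show "H i 0 * D 0 = H' i 0" "H' i 0 * D 0 = H i 0" using H_S[of 0 i] H'_S[of 0 i] by (simp_all add: H_E)
  have "D 0 * D 0 = (E 0 * S) * (S * E 0)" by (metis d)
  then have "D 0 * D 0 = E 0 * (S * S) * E 0" by (simp only: mult.assoc)
  then show "D 0 * D 0 = E 0" by (simp add: group_relations E_mult)
  show "D 0 * E 0 = D 0" unfolding d(1) by (simp add: mult.assoc E_mult)
  have "E 0 * D 0 = (E 0 * E 0) * S" by (simp add: d(2) mult.assoc)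
  then show "E 0 * D 0 = D 0" using d(2) by (simp add: E_mult)
qed

lemmas hecke = H_H H'_H H_H' H'_H' E_H H_E D0 E_mult br_mod

lemmas lin = scale_add distrib_left distrib_right t_square add_ac

text \<open>Elements of \<open>E i A E j\<close>.\<close>

lemma Peirce_span:
  "\<exists>\<alpha> \<beta> \<gamma> \<delta>. E i * a * E j = \<alpha> \<star> (E i * E j) + \<beta> \<star> (E i * (S * E j)) + \<gamma> \<star> H i j + \<delta> \<star> H' i j"
proof (induction a rule: galg_induct)
  case (single p)
  obtain a b y where y: "y \<in> {id, ss, gg, gg \<circ> ss}" "p = cc ^^ a \<circ> y \<circ> cc ^^ b"
    using A5_double_coset[OF single] by blast
  define Y :: "'k galg" where "Y = single y"
  have "y \<in> carrier A5" using y(1) by auto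
  then have "single p = C ^ a * Y * C ^ b" by (simp add: y(2) C_pow Y_def)
  then have "E i * single p * E j = \<zeta> ^ (i * a + j * b) \<star> (E i * Y * E j)" by (simp only: C_sandwich)
  moreover have "Y \<in> {1, S, G, G * S}" using y(1) by (auto simp: Y_def S_def G_def)
  moreover have "c \<star> (E i * (1::'k galg) * E j) = c \<star> (E i * E j) + 0 \<star> (E i * (S * E j)) + 0 \<star> H i j + 0 \<star> H' i j"
    "c \<star> (E i * S * E j) = 0 \<star> (E i * E j) + c \<star> (E i * (S * E j)) + 0 \<star> H i j + 0 \<star> H' i j"
    "c \<star> (E i * G * E j) = 0 \<star> (E i * E j) + 0 \<star> (E i * (S * E j)) + c \<star> H i j + 0 \<star> H' i j"
    "c \<star> (E i * (G * S) * E j) = 0 \<star> (E i * E j) + 0 \<star> (E i * (S * E j)) + 0 \<star> H i j + c \<star> H' i j" for c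
    by (simp_all add: H_def H'_def mult.assoc)
  ultimately show ?case by (elim insertE emptyE) metis+
next
  case (scale c a)
  then obtain \<alpha> \<beta> \<gamma> \<delta> where "E i * a * E j = \<alpha> \<star> (E i * E j) + \<beta> \<star> (E i * (S * E j)) + \<gamma> \<star> H i j + \<delta> \<star> H' i j" by blast
  then have "E i * (c \<star> a) * E j = (c * \<alpha>) \<star> (E i * E j) + (c * \<beta>) \<star> (E i * (S * E j)) + (c * \<gamma>) \<star> H i j + (c * \<delta>) \<star> H' i j"
    by (simp add: scale_add(2))
  then show ?case by blast
next
  case (add a b)
  obtain \<alpha> \<beta> \<gamma> \<delta> where a: "E i * a * E j = \<alpha> \<star> (E i * E j) + \<beta> \<star> (E i * (S * E j)) + \<gamma> \<star> H i j + \<delta> \<star> H' i j"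
    using add(1) by blast
  obtain \<alpha>' \<beta>' \<gamma>' \<delta>' where b: "E i * b * E j = \<alpha>' \<star> (E i * E j) + \<beta>' \<star> (E i * (S * E j)) + \<gamma>' \<star> H i j + \<delta>' \<star> H' i j"
    using add(2) by blast
  have "E i * (a + b) * E j = (\<alpha> + \<alpha>') \<star> (E i * E j) + (\<beta> + \<beta>') \<star> (E i * (S * E j)) + (\<gamma> + \<gamma>') \<star> H i j + (\<delta> + \<delta>') \<star> H' i j"
    using a b by (simp add: scale_add(1) distrib_left distrib_right add_ac)
  then show ?case by blast
qed

end

section \<open>Arrows and relations\<close>

context fifth_root
begin

declare One_nat_def [simp del]

text \<open>The arrows \<open>b i\<close> from \<open>E 0\<close> to \<open>e i\<close> and \<open>a i\<close> back, the idempotents \<open>e i\<close> of the two-dimensional simple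
  modules, the complements \<open>f i\<close> belonging to the four-dimensional one, and the mutually inverse elements
  \<open>p\<close>, \<open>q\<close> that identify \<open>A f 1\<close> with \<open>A f 2\<close>.\<close>

definition b :: "nat \<Rightarrow> 'k galg" where "b i = H i 0"
definition a :: "nat \<Rightarrow> 'k galg" where "a i = H' 0 i"
definition e :: "nat \<Rightarrow> 'k galg" where "e i = H i i + H' i i"
definition w :: "'k galg" where "w = E 0 + D 0 + H 0 0 + H' 0 0"
definition f :: "nat \<Rightarrow> 'k galg" where "f i = E i + e i"
definition p :: "'k galg" where "p = (t + 1) \<star> H 2 1 + H' 2 1"
definition q :: "'k galg" where "q = H 1 2 + t \<star> H' 1 2"

lemmas elt_defs = b_def a_def e_def w_def f_def p_def q_def

lemma ba_zero: "b 1 * a 1 = 0" "b 2 * a 2 = 0"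
  unfolding elt_defs by (simp_all add: hecke)

lemma ab: "a 1 * b 1 = D 0 + t \<star> H' 0 0 + (t + 1) \<star> H 0 0" "a 2 * b 2 = D 0 + (t + 1) \<star> H' 0 0 + t \<star> H 0 0"
  unfolding elt_defs by (simp_all add: hecke lin)

lemma abab: "a 1 * b 1 * (a 2 * b 2) = w" "a 2 * b 2 * (a 1 * b 1) = w"
  unfolding ab w_def by (simp_all add: hecke lin)

lemma E_elt [simp]: "E 0 * a i = a i" "i < 5 \<Longrightarrow> E i * b i = b i" "b i * E 0 = b i" "i < 5 \<Longrightarrow> a i * E i = a i"
  "i < 5 \<Longrightarrow> E i * e i = e i" "i < 5 \<Longrightarrow> e i * E i = e i" "E 0 * w = w" "w * E 0 = w"
  "i < 5 \<Longrightarrow> E i * f i = f i" "i < 5 \<Longrightarrow> f i * E i = f i" "E 2 * p = p" "p * E 1 = p" "E 1 * q = q" "q * E 2 = q"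
  unfolding elt_defs by (simp_all add: hecke lin)

lemma idempotents: "e 1 * e 1 = e 1" "e 2 * e 2 = e 2" "a 1 * e 1 = a 1" "a 2 * e 2 = a 2" "e 1 * b 1 = b 1" "e 2 * b 2 = b 2"
  unfolding elt_defs by (simp_all add: hecke lin)

lemma f_e: "f i * e i = 0" "e i * f i = 0" "f i * f i = f i" if "e i * e i = e i" "i < 5"
  using that by (simp_all add: f_def distrib_left distrib_right E_mult)

lemma pq: "q * p = f 1" "p * q = f 2"
  unfolding elt_defs by (simp_all add: hecke lin)

lemma p_f: "p * f 1 = p" "f 2 * p = p" "f 1 * q = q" "q * f 2 = q"
  unfolding elt_defs by (simp_all add: hecke lin)

lemma paths: "b 1 * (a 2 * b 2) = H 1 0 + H' 1 0" "b 2 * (a 1 * b 1) = H 2 0 + H' 2 0"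
  "a 2 * (b 2 * a 1) = H 0 1 + H' 0 1" "a 1 * (b 1 * a 2) = H 0 2 + H' 0 2"
  "b 2 * a 1 = (t + 1) \<star> H 2 1 + t \<star> H' 2 1" "b 1 * a 2 = (t + 1) \<star> H 1 2 + t \<star> H' 1 2"
  "b 1 * (a 2 * (b 2 * a 1)) = E 1 + (t + 1) \<star> H 1 1 + t \<star> H' 1 1"
  "b 2 * (a 1 * (b 1 * a 2)) = E 2 + t \<star> H 2 2 + (t + 1) \<star> H' 2 2"
  unfolding elt_defs by (simp_all add: hecke lin)

lemma E_S_E: "i < 5 \<Longrightarrow> j < 5 \<Longrightarrow> E i * (S * E j) = (if i = neg j then D j else 0)"
proof -
  assume ij: "i < 5" "j < 5"
  have "E i * (S * E j) = (E i * E (neg j)) * S" by (simp only: S_E mult.assoc)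
  then show ?thesis using ij D_right[OF ij(2)] by (cases "i = neg j") (simp_all add: E_mult)
qed

lemma span_00: "\<exists>\<alpha> \<beta> \<gamma> \<delta>. E 0 * x * E 0 = \<alpha> \<star> E 0 + \<beta> \<star> (a 1 * b 1) + \<gamma> \<star> (a 2 * b 2) + \<delta> \<star> w"
proof -
  obtain \<alpha> \<beta> \<gamma> \<delta> where x: "E 0 * x * E 0 = \<alpha> \<star> E 0 + \<beta> \<star> D 0 + \<gamma> \<star> H 0 0 + \<delta> \<star> H' 0 0"
    using Peirce_span[of 0 x 0] by (auto simp: E_S_E E_mult)
  let ?A = "a 1 * b 1" and ?B = "a 2 * b 2"
  have d: "D 0 = E 0 + ?A + ?B + w" and h: "H 0 0 = D 0 + ?A + t \<star> ?A + t \<star> ?B"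
    unfolding ab w_def by (simp_all add: lin)
  have h': "H' 0 0 = H 0 0 + ?A + ?B" unfolding ab by (simp add: lin)
  have "E 0 * x * E 0 = (\<alpha> + \<beta> + \<gamma> + \<delta>) \<star> E 0 + (\<beta> + \<gamma> * t + \<delta> * (t + 1)) \<star> ?A
      + (\<beta> + \<gamma> * (t + 1) + \<delta> * t) \<star> ?B + (\<beta> + \<gamma> + \<delta>) \<star> w"
    unfolding x h' h d by (simp add: scale_add distrib_left distrib_right add_ac)
  then show ?thesis by blast
qed

lemma span_i0: "\<exists>\<alpha> \<beta>. E 1 * x * E 0 = \<alpha> \<star> b 1 + \<beta> \<star> (b 1 * (a 2 * b 2))"
  "\<exists>\<alpha> \<beta>. E 2 * x * E 0 = \<alpha> \<star> b 2 + \<beta> \<star> (b 2 * (a 1 * b 1))"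
proof -
  have *: "\<gamma> \<star> h + \<delta> \<star> h' = (\<gamma> + \<delta>) \<star> h + \<delta> \<star> (h + h')" for \<gamma> \<delta> and h h' :: "'k galg"
    by (simp add: scale_add add_ac)
  obtain \<gamma> \<delta> where x1: "E 1 * x * E 0 = \<gamma> \<star> H 1 0 + \<delta> \<star> H' 1 0"
    using Peirce_span[of 1 x 0] by (auto simp: E_S_E E_mult)
  show "\<exists>\<alpha> \<beta>. E 1 * x * E 0 = \<alpha> \<star> b 1 + \<beta> \<star> (b 1 * (a 2 * b 2))"
    unfolding x1 paths(1) unfolding b_def by (intro exI, rule *)
  obtain \<gamma> \<delta> where x2: "E 2 * x * E 0 = \<gamma> \<star> H 2 0 + \<delta> \<star> H' 2 0"
    using Peirce_span[of 2 x 0] by (auto simp: E_S_E E_mult)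
  show "\<exists>\<alpha> \<beta>. E 2 * x * E 0 = \<alpha> \<star> b 2 + \<beta> \<star> (b 2 * (a 1 * b 1))"
    unfolding x2 paths(2) unfolding b_def by (intro exI, rule *)
qed

lemma times_e: "H 0 1 * e 1 = H 0 1" "H' 0 1 * e 1 = H' 0 1" "H 0 2 * e 2 = H 0 2" "H' 0 2 * e 2 = H' 0 2"
  "H 1 1 * e 1 = (t + 1) \<star> e 1 + b 1 * (a 2 * (b 2 * a 1))" "H' 1 1 * e 1 = t \<star> e 1 + b 1 * (a 2 * (b 2 * a 1))"
  "H 2 2 * e 2 = t \<star> e 2 + b 2 * (a 1 * (b 1 * a 2))" "H' 2 2 * e 2 = (t + 1) \<star> e 2 + b 2 * (a 1 * (b 1 * a 2))"
  "H 2 1 * e 1 = (t + 1) \<star> (b 2 * a 1)" "H' 2 1 * e 1 = t \<star> (b 2 * a 1)"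
  "H 1 2 * e 2 = (t + 1) \<star> (b 1 * a 2)" "H' 1 2 * e 2 = t \<star> (b 1 * a 2)"
  unfolding paths(7,8) unfolding paths(5,6) e_def by (simp_all add: hecke lin)

lemma times_f: "H 0 1 * f 1 = 0" "H' 0 1 * f 1 = 0" "H 1 1 * f 1 = f 1" "H' 1 1 * f 1 = f 1"
  "H 2 1 * f 1 = p" "H' 2 1 * f 1 = t \<star> p"
  unfolding elt_defs by (simp_all add: hecke lin)

lemma Peirce_times:
  assumes y: "E j * y = y" and ij: "i < 5" "j < 5" "i \<noteq> neg j"
  shows "\<exists>\<alpha> \<gamma> \<delta>. E i * x * y = \<alpha> \<star> (if i = j then y else 0) + \<gamma> \<star> (H i j * y) + \<delta> \<star> (H' i j * y)"
proof -
  obtain \<alpha> \<beta> \<gamma> \<delta> where "E i * x * E j = \<alpha> \<star> (E i * E j) + \<beta> \<star> (E i * (S * E j)) + \<gamma> \<star> H i j + \<delta> \<star> H' i j"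
    using Peirce_span by blast
  then have "E i * x * E j * y = \<alpha> \<star> ((if i = j then E i else 0) * y) + \<gamma> \<star> (H i j * y) + \<delta> \<star> (H' i j * y)"
    using ij by (simp add: E_mult E_S_E distrib_right)
  then show ?thesis using y by (auto simp: mult.assoc split: if_splits)
qed

lemma span_0i: "\<exists>\<alpha> \<beta>. E 0 * x * e 1 = \<alpha> \<star> a 1 + \<beta> \<star> (a 2 * (b 2 * a 1))"
  "\<exists>\<alpha> \<beta>. E 0 * x * e 2 = \<alpha> \<star> a 2 + \<beta> \<star> (a 1 * (b 1 * a 2))"
proof -
  have *: "\<gamma> \<star> h + \<delta> \<star> h' = (\<gamma> + \<delta>) \<star> h' + \<gamma> \<star> (h + h')" for \<gamma> \<delta> and h h' :: "'k galg"
    by (simp add: scale_add add_ac)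
  obtain \<gamma> \<delta> where x3: "E 0 * x * e 1 = \<gamma> \<star> H 0 1 + \<delta> \<star> H' 0 1"
    using Peirce_times[of 1 "e 1" 0 x] by (auto simp: times_e)
  show "\<exists>\<alpha> \<beta>. E 0 * x * e 1 = \<alpha> \<star> a 1 + \<beta> \<star> (a 2 * (b 2 * a 1))"
    unfolding x3 paths(3) unfolding a_def by (intro exI, rule *)
  obtain \<gamma> \<delta> where x4: "E 0 * x * e 2 = \<gamma> \<star> H 0 2 + \<delta> \<star> H' 0 2"
    using Peirce_times[of 2 "e 2" 0 x] by (auto simp: times_e)
  show "\<exists>\<alpha> \<beta>. E 0 * x * e 2 = \<alpha> \<star> a 2 + \<beta> \<star> (a 1 * (b 1 * a 2))"
    unfolding x4 paths(4) unfolding a_def by (intro exI, rule *)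
qed

lemma span_ii: "\<exists>\<alpha> \<beta>. E 1 * x * e 1 = \<alpha> \<star> e 1 + \<beta> \<star> (b 1 * (a 2 * (b 2 * a 1)))"
  "\<exists>\<alpha> \<beta>. E 2 * x * e 2 = \<alpha> \<star> e 2 + \<beta> \<star> (b 2 * (a 1 * (b 1 * a 2)))"
proof -
  have *: "\<alpha> \<star> h + \<gamma> \<star> (\<mu> \<star> h + h') + \<delta> \<star> (\<nu> \<star> h + h') = (\<alpha> + \<gamma> * \<mu> + \<delta> * \<nu>) \<star> h + (\<gamma> + \<delta>) \<star> h'"
    for \<alpha> \<gamma> \<delta> \<mu> \<nu> and h h' :: "'k galg"
    by (simp add: scale_add add_ac)
  obtain \<alpha> \<gamma> \<delta> where x: "E 1 * x * e 1 = \<alpha> \<star> e 1 + \<gamma> \<star> (H 1 1 * e 1) + \<delta> \<star> (H' 1 1 * e 1)"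
    using Peirce_times[of 1 "e 1" 1 x] by auto
  show "\<exists>\<alpha> \<beta>. E 1 * x * e 1 = \<alpha> \<star> e 1 + \<beta> \<star> (b 1 * (a 2 * (b 2 * a 1)))"
    unfolding x times_e * by blast
  obtain \<alpha> \<gamma> \<delta> where x: "E 2 * x * e 2 = \<alpha> \<star> e 2 + \<gamma> \<star> (H 2 2 * e 2) + \<delta> \<star> (H' 2 2 * e 2)"
    using Peirce_times[of 2 "e 2" 2 x] by auto
  show "\<exists>\<alpha> \<beta>. E 2 * x * e 2 = \<alpha> \<star> e 2 + \<beta> \<star> (b 2 * (a 1 * (b 1 * a 2)))"
    unfolding x times_e * by blast
qed

lemma span_ij: "\<exists>\<alpha>. E 2 * x * e 1 = \<alpha> \<star> (b 2 * a 1)" "\<exists>\<alpha>. E 1 * x * e 2 = \<alpha> \<star> (b 1 * a 2)"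
proof -
  obtain \<gamma> \<delta> where x: "E 2 * x * e 1 = \<gamma> \<star> (H 2 1 * e 1) + \<delta> \<star> (H' 2 1 * e 1)"
    using Peirce_times[of 1 "e 1" 2 x] by auto
  show "\<exists>\<alpha>. E 2 * x * e 1 = \<alpha> \<star> (b 2 * a 1)"
    unfolding x times_e scale_simps scale_add(1)[symmetric] by blast
  obtain \<gamma> \<delta> where x: "E 1 * x * e 2 = \<gamma> \<star> (H 1 2 * e 2) + \<delta> \<star> (H' 1 2 * e 2)"
    using Peirce_times[of 2 "e 2" 1 x] by auto
  show "\<exists>\<alpha>. E 1 * x * e 2 = \<alpha> \<star> (b 1 * a 2)"
    unfolding x times_e scale_simps scale_add(1)[symmetric] by blast
qed

lemma span_f: "E 0 * x * f 1 = 0" "\<exists>\<alpha>. E 1 * x * f 1 = \<alpha> \<star> f 1" "\<exists>\<alpha>. E 2 * x * f 1 = \<alpha> \<star> p"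
proof -
  show "E 0 * x * f 1 = 0" using Peirce_times[of 1 "f 1" 0 x] by (auto simp: times_f)
  obtain \<alpha> \<gamma> \<delta> where x: "E 1 * x * f 1 = \<alpha> \<star> f 1 + \<gamma> \<star> (H 1 1 * f 1) + \<delta> \<star> (H' 1 1 * f 1)"
    using Peirce_times[of 1 "f 1" 1 x] by auto
  show "\<exists>\<alpha>. E 1 * x * f 1 = \<alpha> \<star> f 1"
    unfolding x times_f scale_simps scale_add(1)[symmetric] by blast
  obtain \<gamma> \<delta> where x: "E 2 * x * f 1 = \<gamma> \<star> (H 2 1 * f 1) + \<delta> \<star> (H' 2 1 * f 1)"
    using Peirce_times[of 1 "f 1" 2 x] by auto
  show "\<exists>\<alpha>. E 2 * x * f 1 = \<alpha> \<star> p"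
    unfolding x times_f scale_simps scale_add(1)[symmetric] by blast
qed

text \<open>Nonvanishing: the coefficient at the identity.\<close>

lemma cc_pow_fix: "(cc ^^ n) 5 = 5 \<Longrightarrow> cc ^^ n = id"
proof -
  assume n: "(cc ^^ n) 5 = 5"
  have "cc ^^ n = cc ^^ (n mod 5)"
  proof
    fix x show "(cc ^^ n) x = (cc ^^ (n mod 5)) x"
      by (rule funpow_mod_eq[symmetric]) (simp add: cc_pow(4))
  qed
  moreover from this have "n mod 5 = 0" using n cc_pow_5[of "n mod 5"] by (auto split: if_splits)
  ultimately show ?thesis by simp
qed

lemma word_not_id:
  assumes y: "y \<in> {ss, gg, gg \<circ> ss}" shows "cc ^^ i \<circ> y \<circ> cc ^^ j \<noteq> id"
proof
  assume eq: "cc ^^ i \<circ> y \<circ> cc ^^ j = id"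
  have "inj (cc ^^ j)" using A5_pow[OF A5_gens(1), of j] by (auto simp: A5_carrier permutes_inj)
  have "cc ^^ j \<circ> (cc ^^ i \<circ> y) = id"
  proof
    fix x
    have "(cc ^^ j) ((cc ^^ j \<circ> (cc ^^ i \<circ> y)) x) = (cc ^^ j) x" if "x = (cc ^^ j) z" for z
      using fun_cong[OF eq, of z] that by simp
    moreover have "surj (cc ^^ j)" using A5_pow[OF A5_gens(1), of j] by (auto simp: A5_carrier permutes_surj)
    then obtain z where "x = (cc ^^ j) z" by (metis surj_def)
    ultimately have "(cc ^^ j) ((cc ^^ j \<circ> (cc ^^ i \<circ> y)) x) = (cc ^^ j) x" by blast
    then show "(cc ^^ j \<circ> (cc ^^ i \<circ> y)) x = id x" using \<open>inj (cc ^^ j)\<close> by (simp add: inj_eq)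
  qed
  then have eq': "cc ^^ (j + i) \<circ> y = id" by (simp add: funpow_add o_assoc)
  have "y 5 = 5" using y by (auto simp: perm5_defs)
  then have "cc ^^ (j + i) = id" using fun_cong[OF eq', of 5] by (intro cc_pow_fix) simp
  then have "y = id" using eq' by simp
  then show False using y by (auto simp: perm5_defs perm5_id)
qed

lemma gcoef_E_word:
  assumes y: "y \<in> {ss, gg, gg \<circ> ss}" shows "gcoef (E i * single y * E j) id = 0"
proof -
  have yA: "y \<in> carrier A5" using y by auto
  have z: "gcoef (C ^ m * (single y * C ^ n) :: 'k galg) id = 0" for m n
    using word_not_id[OF y, of m n] by (auto simp: C_pow yA gcoef_single comp_assoc)
  show ?thesis
    unfolding E_def by (simp add: sum_distrib_left sum_distrib_right mult.assoc gcoef_sum z)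
qed

lemma gcoef_basis: "gcoef (E i) id = 1" "gcoef (D 0) id = 0" "gcoef (H i j) id = 0" "gcoef (H' i j) id = 0"
proof -
  have "gcoef (C ^ m :: 'k galg) id = 0" if "m \<in> {1, 2, 3, 4}" for m
  proof -
    have "cc ^^ m \<noteq> id"
    proof
      assume "cc ^^ m = id"
      then have "(cc ^^ m) 5 = 5" by simp
      then show False using that cc_pow_5[of m] by auto
    qed
    then show ?thesis unfolding C_pow by (simp add: gcoef_single)
  qed
  then show "gcoef (E i) id = 1" 
    unfolding E_expand using power_one_right[of "C :: 'k galg"] by (simp, metis insertCI)
  have "D 0 = E 0 * single ss * E 0" using D0(4) by (simp add: D_def S_def mult.assoc)
  then show "gcoef (D 0) id = 0" using gcoef_E_word[of ss 0 0] by simp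
  show "gcoef (H i j) id = 0" unfolding H_def G_def using gcoef_E_word by simp
  show "gcoef (H' i j) id = 0" unfolding H'_def G_def S_def using gcoef_E_word by simp
qed

lemma nonzero: "w \<noteq> 0" "b 1 * (a 2 * (b 2 * a 1)) \<noteq> 0" "b 2 * (a 1 * (b 1 * a 2)) \<noteq> 0"
proof -
  have "gcoef w id = 1" "gcoef (b 1 * (a 2 * (b 2 * a 1))) id = 1" "gcoef (b 2 * (a 1 * (b 1 * a 2))) id = 1"
    unfolding paths(7,8) w_def by (simp_all add: gcoef_basis)
  then show "w \<noteq> 0" "b 1 * (a 2 * (b 2 * a 1)) \<noteq> 0" "b 2 * (a 1 * (b 1 * a 2)) \<noteq> 0" by auto
qed

end

section \<open>Left ideals generated by paths\<close>

context fifth_root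
begin

definition lideal :: "'k galg set \<Rightarrow> bool" where
  "lideal I \<longleftrightarrow> 0 \<in> I \<and> (\<forall>x\<in>I. \<forall>y\<in>I. x + y \<in> I) \<and> (\<forall>x. \<forall>y\<in>I. x * y \<in> I)"

definition img :: "'k galg set \<Rightarrow> 'k galg \<Rightarrow> 'k galg set" where "img I m = (\<lambda>x. x * m) ` I"

abbreviation L :: "'k galg \<Rightarrow> 'k galg set" where "L \<equiv> img UNIV"

definition sumset :: "'k galg set \<Rightarrow> 'k galg set \<Rightarrow> 'k galg set" where
  "sumset A B = {x + y | x y. x \<in> A \<and> y \<in> B}"

lemma lidealD: assumes "lideal I"
  shows "0 \<in> I" "\<And>x y. x \<in> I \<Longrightarrow> y \<in> I \<Longrightarrow> x + y \<in> I" "\<And>x y. y \<in> I \<Longrightarrow> x * y \<in> I"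
    "\<And>c y. y \<in> I \<Longrightarrow> c \<star> y \<in> I"
proof -
  show "0 \<in> I" "\<And>x y. x \<in> I \<Longrightarrow> y \<in> I \<Longrightarrow> x + y \<in> I" and m: "\<And>x y. y \<in> I \<Longrightarrow> x * y \<in> I"
    using assms by (auto simp: lideal_def)
  show "c \<star> y \<in> I" if "y \<in> I" for c y using m[OF that, of "c \<star> 1"] by simp
qed

lemma lideal_scale_cancel: "lideal I \<Longrightarrow> c \<star> y \<in> I \<Longrightarrow> c \<noteq> 0 \<Longrightarrow> y \<in> I"
  using lidealD(4)[of I "c \<star> y" "inverse c"] by simp

lemma lideal_add_cancel: "lideal I \<Longrightarrow> x + y \<in> I \<Longrightarrow> y \<in> I \<Longrightarrow> x \<in> I"
  using lidealD(2)[of I "x + y" y] by (simp add: add.assoc)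

lemma lideal_L: "lideal (L m)"
proof -
  have "0 * m = 0" by simp
  then have "0 \<in> L m" unfolding img_def by (metis rangeI)
  then show ?thesis unfolding lideal_def img_def
    by (auto simp: distrib_right[symmetric] mult.assoc[symmetric])
qed

lemma L_self: "m \<in> L m" unfolding img_def using mult_1_left[of m] by (metis rangeI)

lemma L_times: "x * m \<in> L m" by (simp add: img_def)

lemma L_least: "lideal N \<Longrightarrow> m \<in> N \<Longrightarrow> L m \<subseteq> N"
  by (auto simp: img_def lidealD(3))

lemma lideal_sumset: assumes I: "lideal I" and K: "lideal K" shows "lideal (sumset I K)"
proof -
  have "0 + 0 \<in> sumset I K" unfolding sumset_def using lidealD(1)[OF I] lidealD(1)[OF K] by blast
  moreover have "(x + y) + (x' + y') \<in> sumset I K" if "x \<in> I" "y \<in> K" "x' \<in> I" "y' \<in> K" for x y x' y'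
  proof -
    have "(x + y) + (x' + y') = (x + x') + (y + y')" by (simp add: add_ac)
    then show ?thesis unfolding sumset_def using lidealD(2)[OF I that(1,3)] lidealD(2)[OF K that(2,4)] by blast
  qed
  moreover have "z * (x + y) \<in> sumset I K" if "x \<in> I" "y \<in> K" for x y z
    unfolding sumset_def distrib_left using lidealD(3)[OF I that(1)] lidealD(3)[OF K that(2)] by blast
  ultimately show ?thesis unfolding lideal_def by (auto simp: sumset_def[of I K])
qed

lemma mem_sumset: assumes "lideal I" "lideal K"
  shows "x \<in> I \<Longrightarrow> x \<in> sumset I K" "x \<in> K \<Longrightarrow> x \<in> sumset I K"
proof -
  have "x + 0 \<in> sumset I K" if "x \<in> I" using that lidealD(1)[OF assms(2)] unfolding sumset_def by blast
  then show "x \<in> I \<Longrightarrow> x \<in> sumset I K" by simp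
  have "0 + x \<in> sumset I K" if "x \<in> K" using that lidealD(1)[OF assms(1)] unfolding sumset_def by blast
  then show "x \<in> K \<Longrightarrow> x \<in> sumset I K" by simp
qed

lemma sumset_zero: "lideal I \<Longrightarrow> sumset I {0} = I" "sumset {0} I = I" "lideal I \<Longrightarrow> sumset I I = I"
  "sumset I K = sumset K I"
proof -
  show "sumset I {0} = I" "sumset {0} I = I" by (auto simp: sumset_def)
  show "sumset I I = I" if "lideal I" using lidealD[OF that] mem_sumset[OF that that] by (auto simp: sumset_def)
  have "sumset I K \<subseteq> sumset K I" for I K unfolding sumset_def using add.commute by blast
  then show "sumset I K = sumset K I" by blast
qed

lemma L_zero: "L 0 = {0}" by (auto simp: img_def)

lemma E_neg: "E 3 * x = S * (E 2 * (S * x))" "E 4 * x = S * (E 1 * (S * x))"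
proof -
  have "S * E 2 = E 3 * S" "S * E 1 = E 4 * S" using S_E[of 2] S_E[of 1] by simp_all
  then show "E 3 * x = S * (E 2 * (S * x))" "E 4 * x = S * (E 1 * (S * x))"
    by (simp_all only: mult.assoc[symmetric]) (simp_all only: mult.assoc S_S_mult)
qed

lemma E_decompose: "x = E 0 * x + E 1 * x + E 2 * x + E 3 * x + E 4 * x"
proof -
  have "(E 0 + E 1 + E 2 + E 3 + E 4) * x = x" unfolding sum_E by simp
  then show ?thesis by (simp add: distrib_right)
qed

text \<open>Membership in a left ideal is decided by the components under \<open>E 0\<close>, \<open>E 1\<close>, \<open>E 2\<close> of all multiples, because
  \<open>E 3\<close> and \<open>E 4\<close> are conjugate to \<open>E 2\<close> and \<open>E 1\<close> by \<open>s\<close>.\<close>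

lemma detect:
  assumes N: "lideal N" and x: "\<And>y. E 0 * (y * x) \<in> N" "\<And>y. E 1 * (y * x) \<in> N" "\<And>y. E 2 * (y * x) \<in> N"
  shows "x \<in> N"
proof -
  have "E 0 * x \<in> N" "E 1 * x \<in> N" "E 2 * x \<in> N" using x[of 1] by simp_all
  moreover have "E 3 * x \<in> N" "E 4 * x \<in> N"
    unfolding E_neg using x[of S] lidealD(3)[OF N] by auto
  ultimately have "E 0 * x + E 1 * x + E 2 * x + E 3 * x + E 4 * x \<in> N"
    by (intro lidealD(2)[OF N])
  then show ?thesis using E_decompose[of x] by simp
qed

definition top_ideal :: "'k galg set \<Rightarrow> 'k galg \<Rightarrow> nat set \<Rightarrow> bool" where
  "top_ideal I u J \<longleftrightarrow> lideal I \<and> u \<notin> I \<and> (\<forall>x. x * u \<in> I \<longleftrightarrow> x \<in> I) \<and> (\<forall>j\<in>J. \<forall>x. E j * x \<in> I)"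

lemma top_idealD: assumes "top_ideal I u J"
  shows "lideal I" "u \<notin> I" "\<And>x. x * u \<in> I \<longleftrightarrow> x \<in> I" "\<And>j x. j \<in> J \<Longrightarrow> E j * x \<in> I"
  using assms by (auto simp: top_ideal_def)

lemma component_not_in:
  assumes I: "top_ideal I u J" and x: "x \<notin> I"
  shows "\<exists>j\<in>{0, 1, 2, 3, 4} - J. E j * x * u \<notin> I"
proof (rule ccontr)
  assume n: "\<not> ?thesis"
  have "E j * (x * u) \<in> I" if "j \<in> {0, 1, 2, 3, 4}" for j
    using n that top_idealD(4)[OF I] by (cases "j \<in> J") (auto simp: mult.assoc)
  then have "E 0 * (x * u) + E 1 * (x * u) + E 2 * (x * u) + E 3 * (x * u) + E 4 * (x * u) \<in> I"
    by (intro lidealD(2)[OF top_idealD(1)[OF I]]) auto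
  then show False using E_decompose[of "x * u"] top_idealD(3)[OF I] x by simp
qed

lemma arrows_squares: "a 1 * b 1 * (a 1 * b 1) = 0" "a 2 * b 2 * (a 2 * b 2) = 0"
  "a 1 * b 1 * w = 0" "a 2 * b 2 * w = 0" "w * (a 1 * b 1) = 0" "w * (a 2 * b 2) = 0" "w * w = 0" "b 1 * w = 0" "b 2 * w = 0"
proof -
  have z: "b 1 * (a 1 * x) = 0" "b 2 * (a 2 * x) = 0" for x by (simp_all add: ba_zero mult.assoc[symmetric])
  note w1 = abab(1)[symmetric] and w2 = abab(2)[symmetric]
  show "a 1 * b 1 * (a 1 * b 1) = 0" "a 2 * b 2 * (a 2 * b 2) = 0" by (simp_all add: mult.assoc z)
  show b: "b 1 * w = 0" "b 2 * w = 0" by (simp add: w1 mult.assoc z, simp add: w2 mult.assoc z)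
  show aw: "a 1 * b 1 * w = 0" "a 2 * b 2 * w = 0" by (simp_all add: mult.assoc b)
  show "w * (a 1 * b 1) = 0" "w * (a 2 * b 2) = 0" by (simp add: w2 mult.assoc z, simp add: w1 mult.assoc z)
  show "w * w = 0" using aw by (simp add: w1 mult.assoc)
qed

lemma local_E0:
  assumes I: "top_ideal I (E 0) {1, 2, 3, 4}" and x: "x \<notin> I" shows "\<exists>y. y * (x * E 0) = E 0"
proof -
  note l = lidealD[OF top_idealD(1)[OF I]]
  have x0: "E 0 * x * E 0 \<notin> I" using component_not_in[OF I x] by auto
  obtain \<alpha> \<beta> \<gamma> \<delta> where z: "E 0 * x * E 0 = \<alpha> \<star> E 0 + \<beta> \<star> (a 1 * b 1) + \<gamma> \<star> (a 2 * b 2) + \<delta> \<star> w"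
    using span_00 by blast
  have b: "b 1 \<in> I" "b 2 \<in> I" using top_idealD(4)[OF I, of 1 "b 1"] top_idealD(4)[OF I, of 2 "b 2"] by simp_all
  then have ab': "a 1 * b 1 \<in> I" "a 2 * b 2 \<in> I" "w \<in> I" unfolding abab(1)[symmetric] using l(3) by auto
  have \<alpha>: "\<alpha> \<noteq> 0" using x0 z l(2,4) ab' by auto
  let ?A = "a 1 * b 1" and ?B = "a 2 * b 2"
  have e: "E 0 * ?A = ?A" "E 0 * ?B = ?B" "?A * E 0 = ?A" "?B * E 0 = ?B" "E 0 * E 0 = E 0"
    by (simp_all add: mult.assoc E_mult) (simp_all add: mult.assoc[symmetric])
  have "(E 0 * x * E 0) * (E 0 * x * E 0) = (\<alpha> * \<alpha>) \<star> E 0"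
    unfolding z by (simp only: distrib_left distrib_right scale_add(2) scale_simps e arrows_squares abab E_elt add_0_right add_0)
      (simp add: add_ac mult_ac)
  then have "(inverse (\<alpha> * \<alpha>) \<star> (E 0 * x * E 0)) * (E 0 * x * E 0) = E 0"
    using \<alpha> by (simp del: inverse_mult_distrib)
  moreover have "(inverse (\<alpha> * \<alpha>) \<star> (E 0 * x * E 0)) * (E 0 * x * E 0) = (inverse (\<alpha> * \<alpha>) \<star> (E 0 * x * E 0) * E 0) * (x * E 0)"
    by (simp add: mult.assoc)
  ultimately show ?thesis by metis
qed

lemma local_idempotent:
  assumes I: "top_ideal I u J" and J: "{0, 1, 2, 3, 4} - J \<subseteq> {i, i'}"
    and i: "\<And>x. E i' * x = S * (E i * (S * x))" and u: "u * u = u" "E i * u = u" "u * E i = u" and n: "n \<in> I" "u * n = n" "n * n = 0" "n * u = n"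
    and span: "\<And>x. \<exists>\<alpha> \<beta>. E i * x * u = \<alpha> \<star> u + \<beta> \<star> n"
    and x: "x \<notin> I"
  shows "\<exists>y. y * (x * u) = u"
proof -
  note l = lidealD[OF top_idealD(1)[OF I]]
  have "\<exists>c. E i * (c * x) * u \<notin> I"
  proof (cases "E i * x * u \<in> I")
    case True
    then have "E i' * x * u \<notin> I" using component_not_in[OF I x] J by auto
    then have "S * (E i * (S * x) * u) \<notin> I" unfolding i by (simp add: mult.assoc)
    then show ?thesis using l(3) by blast
  next
    case False
    then have "E i * (1 * x) * u \<notin> I" by simp
    then show ?thesis by blast
  qed
  then obtain c where c: "E i * (c * x) * u \<notin> I" by blast
  obtain \<alpha> \<beta> where z: "E i * (c * x) * u = \<alpha> \<star> u + \<beta> \<star> n" using span by blast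
  have \<alpha>: "\<alpha> \<noteq> 0" using c z l(4)[OF n(1)] by auto
  let ?y = "inverse \<alpha> \<star> u + (inverse \<alpha> * inverse \<alpha> * \<beta>) \<star> n"
  have "?y * (\<alpha> \<star> u + \<beta> \<star> n) = u + ((inverse \<alpha> * \<beta>) \<star> n + (inverse \<alpha> * inverse \<alpha> * \<beta> * \<alpha>) \<star> n)"
    using \<alpha> by (simp add: distrib_left distrib_right scale_add u n add_ac mult_ac)
  also have "inverse \<alpha> * inverse \<alpha> * \<beta> * \<alpha> = inverse \<alpha> * \<beta>" using \<alpha> by (simp add: mult_ac)
  finally have "?y * (E i * (c * x) * u) = u" unfolding z by simp
  then have "(?y * E i * c) * (x * u) = u" by (simp only: mult.assoc)
  then show ?thesis by blast
qed

lemma path_zero: "a 1 * (b 1 * (a 2 * (b 2 * a 1))) = 0" "a 2 * (b 2 * (a 1 * (b 1 * a 2))) = 0"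
proof -
  have "a 1 * (b 1 * (a 2 * (b 2 * a 1))) = a 1 * b 1 * (a 2 * b 2) * a 1" by (simp only: mult.assoc)
  also have "\<dots> = a 2 * b 2 * a 1 * (b 1 * a 1)" unfolding abab(1) abab(2)[symmetric] by (simp only: mult.assoc)
  finally show "a 1 * (b 1 * (a 2 * (b 2 * a 1))) = 0" by (simp add: ba_zero)
  have "a 2 * (b 2 * (a 1 * (b 1 * a 2))) = a 2 * b 2 * (a 1 * b 1) * a 2" by (simp only: mult.assoc)
  also have "\<dots> = a 1 * b 1 * a 2 * (b 2 * a 2)" unfolding abab(2) abab(1)[symmetric] by (simp only: mult.assoc)
  finally show "a 2 * (b 2 * (a 1 * (b 1 * a 2))) = 0" by (simp add: ba_zero)
qed

lemma a_in: assumes "top_ideal I u J" "0 \<in> J" shows "a i * x \<in> I" "a i \<in> I"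
  using top_idealD(4)[OF assms, of "a i * x"] top_idealD(4)[OF assms, of "a i"]
  by (simp_all add: mult.assoc[symmetric])

lemma local_e1:
  assumes I: "top_ideal I (e 1) {0, 2, 3}" and x: "x \<notin> I" shows "\<exists>y. y * (x * e 1) = e 1"
proof (rule local_idempotent[OF I _ E_neg(2) idempotents(1) _ _ _ _ _ _ span_ii(1) x])
  show "{0, 1, 2, 3, 4} - {0, 2, 3} \<subseteq> {1, 4::nat}" by auto
  let ?n = "b 1 * (a 2 * (b 2 * a 1))"
  show "?n \<in> I" using a_in(1)[OF I, of 2 "b 2 * a 1"] lidealD(3)[OF top_idealD(1)[OF I]] by simp
  show "e 1 * ?n = ?n" by (simp only: mult.assoc[symmetric] idempotents)
  show "?n * ?n = 0" by (simp add: mult.assoc path_zero)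
  show "?n * e 1 = ?n" by (simp only: mult.assoc idempotents)
qed simp_all

lemma local_e2:
  assumes I: "top_ideal I (e 2) {0, 1, 4}" and x: "x \<notin> I" shows "\<exists>y. y * (x * e 2) = e 2"
proof (rule local_idempotent[OF I _ E_neg(1) idempotents(2) _ _ _ _ _ _ span_ii(2) x])
  show "{0, 1, 2, 3, 4} - {0, 1, 4} \<subseteq> {2, 3::nat}" by auto
  let ?n = "b 2 * (a 1 * (b 1 * a 2))"
  show "?n \<in> I" using a_in(1)[OF I, of 1 "b 1 * a 2"] lidealD(3)[OF top_idealD(1)[OF I]] by simp
  show "e 2 * ?n = ?n" by (simp only: mult.assoc[symmetric] idempotents)
  show "?n * ?n = 0" by (simp add: mult.assoc path_zero)
  show "?n * e 2 = ?n" by (simp only: mult.assoc idempotents)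
qed simp_all

lemma f_span: "\<exists>\<alpha>. E 1 * (x * f 1) = \<alpha> \<star> f 1" "\<exists>\<alpha>. E 2 * (x * f 1) = \<alpha> \<star> p" "E 0 * (x * f 1) = 0"
  using span_f[of x] by (simp_all add: mult.assoc)

lemma f_lideal:
  assumes N: "lideal N" and x: "x * f 1 \<in> N" "x * f 1 \<noteq> 0" shows "f 1 \<in> N"
proof -
  have "\<exists>y. E 1 * (y * (x * f 1)) \<noteq> 0 \<or> E 2 * (y * (x * f 1)) \<noteq> 0"
  proof (rule ccontr)
    assume "\<not> ?thesis"
    moreover have "E 0 * (y * (x * f 1)) = 0" for y using f_span(3)[of "y * x"] by (simp add: mult.assoc)
    moreover have "lideal {0}" by (simp add: lideal_def)
    ultimately show False using detect[of "{0}" "x * f 1"] x(2) by auto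
  qed
  then obtain y where y: "E 1 * (y * (x * f 1)) \<noteq> 0 \<or> E 2 * (y * (x * f 1)) \<noteq> 0" by blast
  obtain \<alpha> where \<alpha>: "E 1 * (y * (x * f 1)) = \<alpha> \<star> f 1" using f_span(1)[of "y * x"] by (auto simp: mult.assoc)
  obtain \<beta> where \<beta>: "E 2 * (y * (x * f 1)) = \<beta> \<star> p" using f_span(2)[of "y * x"] by (auto simp: mult.assoc)
  have in_N: "E j * (y * (x * f 1)) \<in> N" for j using x(1) lidealD(3)[OF N] by blast
  show ?thesis
  proof (cases "\<alpha> = 0")
    case False
    then show ?thesis using in_N[of 1] \<alpha> lideal_scale_cancel[OF N] by simp
  next
    case True
    then have "\<beta> \<noteq> 0" using y \<alpha> \<beta> by auto
    then have "p \<in> N" using in_N[of 2] \<beta> lideal_scale_cancel[OF N] by simp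
    then show ?thesis using lidealD(3)[OF N, of p q] by (simp add: pq)
  qed
qed

lemma local_f:
  assumes I: "top_ideal I (f 1) J" and x: "x \<notin> I" shows "\<exists>y. y * (x * f 1) = f 1"
proof -
  have "x * f 1 \<noteq> 0" using top_idealD(3)[OF I, of x] x lidealD(1)[OF top_idealD(1)[OF I]] by auto
  then have "f 1 \<in> L (x * f 1)" by (rule f_lideal[OF lideal_L L_self])
  then obtain y where "f 1 = y * (x * f 1)" by (auto simp: img_def)
  then show ?thesis by metis
qed

lemma img_f: assumes I: "top_ideal I (f 1) J" shows "img I (f 1) = {0}"
proof -
  have "x * f 1 = 0" if "x \<in> I" for x
    using f_lideal[OF top_idealD(1)[OF I], of x] top_idealD(2,3)[OF I] that by blast
  moreover have "0 * f 1 \<in> img I (f 1)" unfolding img_def using lidealD(1)[OF top_idealD(1)[OF I]] by blast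
  ultimately show ?thesis by (auto simp: img_def)
qed

text \<open>The radicals of the projective modules are generated by the arrows.\<close>

lemma img_E0:
  assumes I: "top_ideal I (E 0) {1, 2, 3, 4}" and m: "E 0 * m = m"
  shows "img I m = sumset (L (b 1 * m)) (L (b 2 * m))"
proof
  note l = lidealD[OF top_idealD(1)[OF I]]
  let ?N = "sumset (L (b 1)) (L (b 2))"
  have N: "lideal ?N" by (intro lideal_sumset lideal_L)
  have bN: "x * b 1 \<in> ?N" "x * b 2 \<in> ?N" for x
    using mem_sumset[OF lideal_L lideal_L] L_times by auto
  have b1N: "b 1 \<in> ?N" "b 2 \<in> ?N" using bN[of 1] by simp_all
  have b: "b 1 \<in> I" "b 2 \<in> I" using top_idealD(4)[OF I, of 1 "b 1"] top_idealD(4)[OF I, of 2 "b 2"] by simp_all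
  have in_N: "x * E 0 \<in> ?N" if x: "x \<in> I" for x
  proof (rule detect[OF N])
    fix y
    obtain \<alpha> \<beta> \<gamma> \<delta> where z: "E 0 * (y * x) * E 0 = \<alpha> \<star> E 0 + \<beta> \<star> (a 1 * b 1) + \<gamma> \<star> (a 2 * b 2) + \<delta> \<star> w"
      using span_00 by blast
    have r: "\<beta> \<star> (a 1 * b 1) + \<gamma> \<star> (a 2 * b 2) + \<delta> \<star> w \<in> K" if "lideal K" "b 1 \<in> K" "b 2 \<in> K" for K
      unfolding abab(1)[symmetric] using that lidealD[OF that(1)] by (simp add: mult.assoc)
    have "E 0 * (y * x) * E 0 \<in> I" using top_idealD(3)[OF I] x l(3) by blast
    then have "\<alpha> \<star> E 0 \<in> I"
      unfolding z add.assoc using lideal_add_cancel[OF top_idealD(1)[OF I]] r[OF top_idealD(1)[OF I] b] by (simp add: add.assoc)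
    then have "\<alpha> = 0" using lideal_scale_cancel[OF top_idealD(1)[OF I]] top_idealD(2)[OF I] by blast
    then show "E 0 * (y * (x * E 0)) \<in> ?N" using z r[OF N] bN[of 1] by (simp add: mult.assoc)
    show "E 1 * (y * (x * E 0)) \<in> ?N"
      using span_i0(1)[of "y * x"] bN b1N lidealD(2,4)[OF N] by (auto simp: mult.assoc[symmetric])
    show "E 2 * (y * (x * E 0)) \<in> ?N"
      using span_i0(2)[of "y * x"] bN b1N lidealD(2,4)[OF N] by (auto simp: mult.assoc[symmetric])
  qed
  show "img I m \<subseteq> sumset (L (b 1 * m)) (L (b 2 * m))"
  proof
    fix z assume "z \<in> img I m"
    then obtain x where x: "x \<in> I" "z = x * m" by (auto simp: img_def)
    obtain y y' where "x * E 0 = y * b 1 + y' * b 2" using in_N[OF x(1)] by (auto simp: sumset_def img_def)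
    moreover have "z = (x * E 0) * m" using x(2) m by (simp add: mult.assoc)
    ultimately have "z = y * (b 1 * m) + y' * (b 2 * m)" by (simp add: distrib_right mult.assoc)
    then show "z \<in> sumset (L (b 1 * m)) (L (b 2 * m))" by (auto simp: sumset_def img_def)
  qed
  show "sumset (L (b 1 * m)) (L (b 2 * m)) \<subseteq> img I m"
  proof
    fix z assume "z \<in> sumset (L (b 1 * m)) (L (b 2 * m))"
    then obtain y y' where "z = y * (b 1 * m) + y' * (b 2 * m)" by (auto simp: sumset_def img_def)
    then have "z = (y * b 1 + y' * b 2) * m" by (simp add: distrib_right mult.assoc)
    moreover have "y * b 1 + y' * b 2 \<in> I" using b l by blast
    ultimately show "z \<in> img I m" by (auto simp: img_def)
  qed
qed

lemma img_arrow:
  assumes I: "top_ideal I u J" and J: "0 \<in> J" and u: "ai * u = ai" "ai \<in> I" and m: "u * m = m"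
    and sub: "\<And>x. x \<in> I \<Longrightarrow> x * u \<in> L ai"
  shows "img I m = L (ai * m)"
proof
  show "img I m \<subseteq> L (ai * m)"
  proof
    fix z assume "z \<in> img I m"
    then obtain x where x: "x \<in> I" "z = x * m" by (auto simp: img_def)
    obtain y where "x * u = y * ai" using sub[OF x(1)] by (auto simp: img_def)
    then have "z = y * (ai * m)" using x(2) m by (metis mult.assoc)
    then show "z \<in> L (ai * m)" by (auto simp: img_def)
  qed
  show "L (ai * m) \<subseteq> img I m"
    using lidealD(3)[OF top_idealD(1)[OF I] u(2)] by (auto simp: img_def mult.assoc[symmetric])
qed

lemma img_e1:
  assumes I: "top_ideal I (e 1) {0, 2, 3}" and m: "e 1 * m = m" shows "img I m = L (a 1 * m)"
proof (rule img_arrow[OF I _ idempotents(3) a_in(2)[OF I] m])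
  note l = lidealD[OF top_idealD(1)[OF I]]
  let ?N = "L (a 1)" and ?n = "b 1 * (a 2 * (b 2 * a 1))"
  note N = lideal_L[of "a 1"]
  have n: "?n = b 1 * a 2 * b 2 * a 1" "a 2 * (b 2 * a 1) = a 2 * b 2 * a 1" by (simp_all only: mult.assoc)
  fix x assume x: "x \<in> I"
  show "x * e 1 \<in> ?N"
  proof (rule detect[OF N])
    fix y
    show "E 0 * (y * (x * e 1)) \<in> ?N"
      using span_0i(1)[of "y * x"] L_times[of _ "a 1"] L_self[of "a 1"] lidealD(2,4)[OF N] n(2) by (auto simp: mult.assoc[symmetric])
    obtain \<alpha> \<beta> where z: "E 1 * (y * x) * e 1 = \<alpha> \<star> e 1 + \<beta> \<star> ?n" using span_ii(1) by blast
    have nI: "?n \<in> I" using a_in(1)[OF I, of 2 "b 2 * a 1"] l(3) by simp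
    have "E 1 * (y * x) * e 1 \<in> I" using top_idealD(3)[OF I] x l(3) by blast
    then have "\<alpha> \<star> e 1 \<in> I" unfolding z using lideal_add_cancel[OF top_idealD(1)[OF I]] l(4)[OF nI] by blast
    then have "\<alpha> = 0" using lideal_scale_cancel[OF top_idealD(1)[OF I]] top_idealD(2)[OF I] by blast
    then have "E 1 * (y * (x * e 1)) = \<beta> \<star> ?n" using z by (simp add: mult.assoc)
    moreover have "?n \<in> ?N" using L_times[of "b 1 * a 2 * b 2" "a 1"] by (simp add: mult.assoc)
    ultimately show "E 1 * (y * (x * e 1)) \<in> ?N" using lidealD(4)[OF N] by simp
    show "E 2 * (y * (x * e 1)) \<in> ?N"
      using span_ij(1)[of "y * x"] L_times[of _ "a 1"] lidealD(4)[OF N] by (auto simp: mult.assoc[symmetric])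
  qed
qed simp_all

lemma img_e2:
  assumes I: "top_ideal I (e 2) {0, 1, 4}" and m: "e 2 * m = m" shows "img I m = L (a 2 * m)"
proof (rule img_arrow[OF I _ idempotents(4) a_in(2)[OF I] m])
  note l = lidealD[OF top_idealD(1)[OF I]]
  let ?N = "L (a 2)" and ?n = "b 2 * (a 1 * (b 1 * a 2))"
  note N = lideal_L[of "a 2"]
  have n: "?n = b 2 * a 1 * b 1 * a 2" "a 1 * (b 1 * a 2) = a 1 * b 1 * a 2" by (simp_all only: mult.assoc)
  fix x assume x: "x \<in> I"
  show "x * e 2 \<in> ?N"
  proof (rule detect[OF N])
    fix y
    show "E 0 * (y * (x * e 2)) \<in> ?N"
      using span_0i(2)[of "y * x"] L_times[of _ "a 2"] L_self[of "a 2"] lidealD(2,4)[OF N] n(2) by (auto simp: mult.assoc[symmetric])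
    obtain \<alpha> \<beta> where z: "E 2 * (y * x) * e 2 = \<alpha> \<star> e 2 + \<beta> \<star> ?n" using span_ii(2) by blast
    have nI: "?n \<in> I" using a_in(1)[OF I, of 1 "b 1 * a 2"] l(3) by simp
    have "E 2 * (y * x) * e 2 \<in> I" using top_idealD(3)[OF I] x l(3) by blast
    then have "\<alpha> \<star> e 2 \<in> I" unfolding z using lideal_add_cancel[OF top_idealD(1)[OF I]] l(4)[OF nI] by blast
    then have "\<alpha> = 0" using lideal_scale_cancel[OF top_idealD(1)[OF I]] top_idealD(2)[OF I] by blast
    then have "E 2 * (y * (x * e 2)) = \<beta> \<star> ?n" using z by (simp add: mult.assoc)
    moreover have "?n \<in> ?N" using L_times[of "b 2 * a 1 * b 1" "a 2"] by (simp add: mult.assoc)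
    ultimately show "E 2 * (y * (x * e 2)) \<in> ?N" using lidealD(4)[OF N] by simp
    show "E 1 * (y * (x * e 2)) \<in> ?N"
      using span_ij(2)[of "y * x"] L_times[of _ "a 2"] lidealD(4)[OF N] by (auto simp: mult.assoc[symmetric])
  qed
qed simp_all

lemma arrows_nonzero: "a 1 * b 1 \<noteq> 0" "a 2 * b 2 \<noteq> 0" "b 1 * (a 2 * b 2) \<noteq> 0" "b 2 * (a 1 * b 1) \<noteq> 0"
  "b 1 \<noteq> 0" "b 2 \<noteq> 0" "a 1 \<noteq> 0" "a 2 \<noteq> 0" "b 2 * a 1 \<noteq> 0" "b 1 * a 2 \<noteq> 0"
  "a 2 * (b 2 * a 1) \<noteq> 0" "a 1 * (b 1 * a 2) \<noteq> 0"
proof -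
  have w: "w = a 1 * (b 1 * (a 2 * b 2))" "w = a 2 * (b 2 * (a 1 * b 1))"
    unfolding abab(1)[symmetric] abab(2)[symmetric] by (simp add: mult.assoc) (metis abab mult.assoc)
  show "b 1 * (a 2 * b 2) \<noteq> 0" "b 2 * (a 1 * b 1) \<noteq> 0" "b 1 \<noteq> 0" "b 2 \<noteq> 0" "a 1 \<noteq> 0" "a 2 \<noteq> 0"
    "a 1 * b 1 \<noteq> 0" "a 2 * b 2 \<noteq> 0"
    using nonzero(1) w by auto
  show "a 2 * (b 2 * a 1) \<noteq> 0" "a 1 * (b 1 * a 2) \<noteq> 0" "b 2 * a 1 \<noteq> 0" "b 1 * a 2 \<noteq> 0"
    using nonzero(2,3) by auto
qed

text \<open>Independence of paths ending at the same vertex.\<close>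

lemma scale_eq_zero: "c \<star> x = 0 \<Longrightarrow> x \<noteq> (0::'k galg) \<Longrightarrow> c = 0"
proof (rule ccontr)
  assume "c \<star> x = 0" "x \<noteq> 0" "c \<noteq> 0"
  then have "inverse c \<star> c \<star> x = 0" by simp
  then show False using \<open>c \<noteq> 0\<close> \<open>x \<noteq> 0\<close> by simp
qed

lemma E_b: "E 1 * b 1 = b 1" "E 2 * b 2 = b 2" by simp_all

lemma E_bx: "E 1 * (b 1 * x) = b 1 * x" "E 2 * (b 2 * x) = b 2 * x"
  by (simp_all only: mult.assoc[symmetric] E_b)

lemma b_L: "\<exists>\<alpha>. E 2 * (x * b 1) = \<alpha> \<star> (b 2 * (a 1 * b 1))" "\<exists>\<alpha>. E 1 * (x * b 2) = \<alpha> \<star> (b 1 * (a 2 * b 2))"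
proof -
  have "E 2 * (x * b 1) = (E 2 * x * e 1) * b 1" "E 1 * (x * b 2) = (E 1 * x * e 2) * b 2"
    by (simp_all only: mult.assoc idempotents)
  moreover obtain \<alpha> \<beta> where "E 2 * x * e 1 = \<alpha> \<star> (b 2 * a 1)" "E 1 * x * e 2 = \<beta> \<star> (b 1 * a 2)"
    using span_ij[of x] by blast
  ultimately have "E 2 * (x * b 1) = \<alpha> \<star> (b 2 * (a 1 * b 1))" "E 1 * (x * b 2) = \<beta> \<star> (b 1 * (a 2 * b 2))"
    by (simp_all only: scale_simps mult.assoc[of "b 2" "a 1"] mult.assoc[of "b 1" "a 2"])
  then show "\<exists>\<alpha>. E 2 * (x * b 1) = \<alpha> \<star> (b 2 * (a 1 * b 1))" "\<exists>\<alpha>. E 1 * (x * b 2) = \<alpha> \<star> (b 1 * (a 2 * b 2))"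
    by blast+
qed

lemma b_independent: "b 2 \<notin> L (b 1)" "b 1 \<notin> L (b 2)"
proof -
  show "b 2 \<notin> L (b 1)"
  proof
    assume "b 2 \<in> L (b 1)"
    then obtain x where "b 2 = x * b 1" by (auto simp: img_def)
    then have "b 2 = E 2 * (x * b 1)" using E_b(2) by metis
    then obtain \<alpha> where "b 2 = \<alpha> \<star> (b 2 * (a 1 * b 1))" using b_L(1)[of x] by auto
    then have "b 2 * (a 1 * b 1) = \<alpha> \<star> (b 2 * (a 1 * b 1) * (a 1 * b 1))" by (metis scale_simps(5))
    then show False using arrows_nonzero(4) arrows_squares(1) by (simp add: mult.assoc)
  qed
  show "b 1 \<notin> L (b 2)"
  proof
    assume "b 1 \<in> L (b 2)"
    then obtain x where "b 1 = x * b 2" by (auto simp: img_def)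
    then have "b 1 = E 1 * (x * b 2)" using E_b(1) by metis
    then obtain \<alpha> where "b 1 = \<alpha> \<star> (b 1 * (a 2 * b 2))" using b_L(2)[of x] by auto
    then have "b 1 * (a 2 * b 2) = \<alpha> \<star> (b 1 * (a 2 * b 2) * (a 2 * b 2))" by (metis scale_simps(5))
    then show False using arrows_nonzero(3) arrows_squares(2) by (simp add: mult.assoc)
  qed
qed

lemma E0_ab: "E 0 * (a i * x) = a i * x" by (simp add: mult.assoc[symmetric])

lemma ab_L: "\<exists>\<alpha> \<beta>. E 0 * (x * (a 1 * b 1)) = \<alpha> \<star> (a 1 * b 1) + \<beta> \<star> w"
  "\<exists>\<alpha> \<beta>. E 0 * (x * (a 2 * b 2)) = \<alpha> \<star> (a 2 * b 2) + \<beta> \<star> w"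
proof -
  obtain \<alpha> \<beta> \<gamma> \<delta> where z: "E 0 * x * E 0 = \<alpha> \<star> E 0 + \<beta> \<star> (a 1 * b 1) + \<gamma> \<star> (a 2 * b 2) + \<delta> \<star> w"
    using span_00 by blast
  have "E 0 * (x * (a i * b i)) = (E 0 * x * E 0) * (a i * b i)" for i by (simp add: mult.assoc E0_ab)
  then show "\<exists>\<alpha> \<beta>. E 0 * (x * (a 1 * b 1)) = \<alpha> \<star> (a 1 * b 1) + \<beta> \<star> w"
    "\<exists>\<alpha> \<beta>. E 0 * (x * (a 2 * b 2)) = \<alpha> \<star> (a 2 * b 2) + \<beta> \<star> w"
    unfolding z by (simp_all add: distrib_right abab arrows_squares E0_ab) blast+
qed

lemma ab_independent: "a 2 * b 2 \<notin> L (a 1 * b 1)" "a 1 * b 1 \<notin> L (a 2 * b 2)"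
proof -
  show "a 2 * b 2 \<notin> L (a 1 * b 1)"
  proof
    assume "a 2 * b 2 \<in> L (a 1 * b 1)"
    then obtain x where "a 2 * b 2 = x * (a 1 * b 1)" by (auto simp: img_def)
    then have "a 2 * b 2 = E 0 * (x * (a 1 * b 1))" by (metis E0_ab)
    then obtain \<alpha> \<beta> where eq: "a 2 * b 2 = \<alpha> \<star> (a 1 * b 1) + \<beta> \<star> w" using ab_L(1)[of x] by auto
    have "a 1 * b 1 * (a 2 * b 2) = 0" unfolding eq by (simp add: distrib_left arrows_squares)
    then show False using nonzero(1) abab by simp
  qed
  show "a 1 * b 1 \<notin> L (a 2 * b 2)"
  proof
    assume "a 1 * b 1 \<in> L (a 2 * b 2)"
    then obtain x where "a 1 * b 1 = x * (a 2 * b 2)" by (auto simp: img_def)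
    then have "a 1 * b 1 = E 0 * (x * (a 2 * b 2))" by (metis E0_ab)
    then obtain \<alpha> \<beta> where eq: "a 1 * b 1 = \<alpha> \<star> (a 2 * b 2) + \<beta> \<star> w" using ab_L(2)[of x] by auto
    have "a 2 * b 2 * (a 1 * b 1) = 0" unfolding eq by (simp add: distrib_left arrows_squares)
    then show False using nonzero(1) abab by simp
  qed
qed

lemma bab_independent: "b 1 * (a 2 * b 2) \<notin> L (b 2 * (a 1 * b 1))" "b 2 * (a 1 * b 1) \<notin> L (b 1 * (a 2 * b 2))"
proof -
  show "b 1 * (a 2 * b 2) \<notin> L (b 2 * (a 1 * b 1))"
  proof
    assume "b 1 * (a 2 * b 2) \<in> L (b 2 * (a 1 * b 1))"
    then obtain x where "b 1 * (a 2 * b 2) = x * b 2 * (a 1 * b 1)" by (auto simp: img_def mult.assoc)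
    then have "E 1 * (b 1 * (a 2 * b 2)) = (E 1 * (x * b 2)) * (a 1 * b 1)" by (simp add: mult.assoc)
    moreover obtain \<alpha> where "E 1 * (x * b 2) = \<alpha> \<star> (b 1 * (a 2 * b 2))" using b_L(2)[of x] by auto
    moreover have "(\<alpha> \<star> (b 1 * (a 2 * b 2))) * (a 1 * b 1) = \<alpha> \<star> (b 1 * w)"
      by (simp only: scale_simps mult.assoc[of "b 1"] abab(2))
    ultimately have "b 1 * (a 2 * b 2) = \<alpha> \<star> (b 1 * w)" by (simp only: E_bx)
    then show False using arrows_nonzero arrows_squares by simp
  qed
  show "b 2 * (a 1 * b 1) \<notin> L (b 1 * (a 2 * b 2))"
  proof
    assume "b 2 * (a 1 * b 1) \<in> L (b 1 * (a 2 * b 2))"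
    then obtain x where "b 2 * (a 1 * b 1) = x * b 1 * (a 2 * b 2)" by (auto simp: img_def mult.assoc)
    then have "E 2 * (b 2 * (a 1 * b 1)) = (E 2 * (x * b 1)) * (a 2 * b 2)" by (simp add: mult.assoc)
    moreover obtain \<alpha> where "E 2 * (x * b 1) = \<alpha> \<star> (b 2 * (a 1 * b 1))" using b_L(1)[of x] by auto
    moreover have "(\<alpha> \<star> (b 2 * (a 1 * b 1))) * (a 2 * b 2) = \<alpha> \<star> (b 2 * w)"
      by (simp only: scale_simps mult.assoc[of "b 2"] abab(1))
    ultimately have "b 2 * (a 1 * b 1) = \<alpha> \<star> (b 2 * w)" by (simp only: E_bx)
    then show False using arrows_nonzero arrows_squares by simp
  qed
qed

lemma w_in: "w \<in> L (b 1)" "w \<in> L (b 2)"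
proof -
  have "a 1 * b 1 * a 2 * b 2 = w" "a 2 * b 2 * a 1 * b 1 = w"
    using abab by (simp_all only: mult.assoc)
  then show "w \<in> L (b 1)" "w \<in> L (b 2)"
    using L_times[of "a 1 * b 1 * a 2" "b 2"] L_times[of "a 2 * b 2 * a 1" "b 1"] by simp_all
qed

lemma L_b_Int: "L (b 1) \<inter> L (b 2) = L w"
proof
  show "L w \<subseteq> L (b 1) \<inter> L (b 2)" using L_least[OF lideal_L] w_in by blast
  show "L (b 1) \<inter> L (b 2) \<subseteq> L w"
  proof
    fix z assume z: "z \<in> L (b 1) \<inter> L (b 2)"
    show "z \<in> L w"
    proof (rule detect[OF lideal_L])
      fix y
      have yz: "y * z \<in> L (b 1)" "y * z \<in> L (b 2)" using z lidealD(3)[OF lideal_L] by auto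
      then obtain x x' where x: "y * z = x * b 1" "y * z = x' * b 2" by (auto simp: img_def)
      have e0: "E 0 * (x * b 1) = (E 0 * x * e 1) * b 1" "E 0 * (x' * b 2) = (E 0 * x' * e 2) * b 2"
        by (simp_all only: mult.assoc idempotents)
      obtain \<alpha> \<beta> where "E 0 * x * e 1 = \<alpha> \<star> a 1 + \<beta> \<star> (a 2 * (b 2 * a 1))" using span_0i(1) by blast
      then have 1: "E 0 * (y * z) = \<alpha> \<star> (a 1 * b 1) + \<beta> \<star> w"
        unfolding x(1) e0 abab(2)[symmetric] by (simp only: distrib_right scale_simps mult.assoc)
      obtain \<alpha>' \<beta>' where "E 0 * x' * e 2 = \<alpha>' \<star> a 2 + \<beta>' \<star> (a 1 * (b 1 * a 2))" using span_0i(2) by blast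
      then have 2: "E 0 * (y * z) = \<alpha>' \<star> (a 2 * b 2) + \<beta>' \<star> w"
        unfolding x(2) e0 abab(1)[symmetric] by (simp only: distrib_right scale_simps mult.assoc)
      have "a 2 * b 2 * (E 0 * (y * z)) = \<alpha> \<star> w" unfolding 1 by (simp only: distrib_left scale_simps abab arrows_squares add_0_right)
      moreover have "a 2 * b 2 * (E 0 * (y * z)) = 0" unfolding 2 by (simp only: distrib_left scale_simps abab arrows_squares add_0_right)
      ultimately have "\<alpha> = 0" using scale_eq_zero nonzero(1) by metis
      then show "E 0 * (y * z) \<in> L w" unfolding 1 using lidealD(4)[OF lideal_L L_self] by simp
      have e1: "E 1 * (x * b 1) = (E 1 * x * e 1) * b 1" "E 2 * (x' * b 2) = (E 2 * x' * e 2) * b 2"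
        by (simp_all only: mult.assoc idempotents)
      have z1: "b 1 * (a 2 * (b 2 * a 1)) * b 1 = 0" "b 2 * (a 1 * (b 1 * a 2)) * b 2 = 0"
        using arrows_squares(8)[folded abab(2)] arrows_squares(9)[folded abab(1)] by (simp_all add: mult.assoc)
      obtain \<alpha> where 1: "E 1 * (y * z) = \<alpha> \<star> b 1"
        unfolding x(1) e1 using span_ii(1)[of x] z1 by (auto simp: distrib_right idempotents)
      obtain \<beta> where 2: "E 1 * (y * z) = \<beta> \<star> (b 1 * (a 2 * b 2))" unfolding x(2) using b_L(2) by blast
      have "E 1 * (y * z) * (a 2 * b 2) = \<alpha> \<star> (b 1 * (a 2 * b 2))" unfolding 1 by simp
      moreover have "E 1 * (y * z) * (a 2 * b 2) = 0" unfolding 2 using arrows_squares(2) by (simp add: mult.assoc)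
      ultimately have "\<alpha> = 0" using scale_eq_zero arrows_nonzero(3) by metis
      then show "E 1 * (y * z) \<in> L w" unfolding 1 using lidealD(1)[OF lideal_L] by simp
      obtain \<alpha> where 1: "E 2 * (y * z) = \<alpha> \<star> b 2"
        unfolding x(2) e1 using span_ii(2)[of x'] z1 by (auto simp: distrib_right idempotents)
      obtain \<beta> where 2: "E 2 * (y * z) = \<beta> \<star> (b 2 * (a 1 * b 1))" unfolding x(1) using b_L(1) by blast
      have "E 2 * (y * z) * (a 1 * b 1) = \<alpha> \<star> (b 2 * (a 1 * b 1))" unfolding 1 by simp
      moreover have "E 2 * (y * z) * (a 1 * b 1) = 0" unfolding 2 using arrows_squares(1) by (simp add: mult.assoc)
      ultimately have "\<alpha> = 0" using scale_eq_zero arrows_nonzero(4) by metis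
      then show "E 2 * (y * z) \<in> L w" unfolding 1 using lidealD(1)[OF lideal_L] by simp
    qed
  qed
qed

text \<open>The socle of \<open>A E 0\<close> is generated by \<open>w\<close>.\<close>

lemma w_in_lideal_E0:
  assumes N: "lideal N" and x: "E 0 * x * E 0 \<in> N" "E 0 * x * E 0 \<noteq> 0" shows "w \<in> N"
proof -
  obtain \<alpha> \<beta> \<gamma> \<delta> where z: "E 0 * x * E 0 = \<alpha> \<star> E 0 + \<beta> \<star> (a 1 * b 1) + \<gamma> \<star> (a 2 * b 2) + \<delta> \<star> w"
    using span_00 by blast
  have in_N: "y * (E 0 * x * E 0) \<in> N" for y using lidealD(3)[OF N x(1)] .
  have ab0: "a i * b i * E 0 = a i * b i" for i by (simp add: mult.assoc)
  have 1: "w * (E 0 * x * E 0) = \<alpha> \<star> w" unfolding z by (simp add: distrib_left arrows_squares)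
  show ?thesis
  proof (cases "\<alpha> = 0")
    case False then show ?thesis using in_N[of w] 1 lideal_scale_cancel[OF N] by simp
  next
    case \<alpha>: True
    have 2: "a 2 * b 2 * (E 0 * x * E 0) = \<beta> \<star> w" unfolding z \<alpha> by (simp add: distrib_left arrows_squares abab)
    show ?thesis
    proof (cases "\<beta> = 0")
      case False then show ?thesis using in_N[of "a 2 * b 2"] 2 lideal_scale_cancel[OF N] by simp
    next
      case \<beta>: True
      have 3: "a 1 * b 1 * (E 0 * x * E 0) = \<gamma> \<star> w" unfolding z \<alpha> \<beta> by (simp add: distrib_left arrows_squares abab)
      show ?thesis
      proof (cases "\<gamma> = 0")
        case False then show ?thesis using in_N[of "a 1 * b 1"] 3 lideal_scale_cancel[OF N] by simp
      next
        case True
        then have "E 0 * x * E 0 = \<delta> \<star> w" using z \<alpha> \<beta> by simp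
        then show ?thesis using x lideal_scale_cancel[OF N] by (cases "\<delta> = 0") auto
      qed
    qed
  qed
qed

lemma w_in_lideal:
  assumes N: "lideal N" "N \<subseteq> L (E 0)" "N \<noteq> {0}" shows "w \<in> N"
proof -
  obtain z where z: "z \<in> N" "z \<noteq> 0" using N lidealD(1)[OF N(1)] by blast
  have zE: "z * E 0 = z" using z N(2) by (auto simp: img_def mult.assoc E_mult)
  have "lideal {0}" by (simp add: lideal_def)
  then obtain y where y: "E 0 * (y * z) \<noteq> 0 \<or> E 1 * (y * z) \<noteq> 0 \<or> E 2 * (y * z) \<noteq> 0"
    using detect[of "{0}" z] z(2) by auto
  have eq: "E j * (y * z) = E j * (y * z) * E 0" for j using zE by (simp add: mult.assoc)
  have in_N: "x * (E j * (y * z)) \<in> N" for x j using lidealD(3)[OF N(1)] z by blast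
  have ab0: "a i * b i * (a j * b j) \<noteq> 0" if "(i = 1 \<and> j = 2) \<or> (i = 2 \<and> j = 1)" for i j using that abab nonzero(1) by auto
  have reach: "w \<in> N" if i: "i = 1 \<or> i = 2" "E i * (y * z) \<noteq> 0" for i
  proof -
    obtain i' :: nat where i': "(i = 1 \<and> i' = 2) \<or> (i = 2 \<and> i' = 1)" using i(1) by blast
    obtain \<alpha> \<beta> where z: "E i * (y * z) = \<alpha> \<star> b i + \<beta> \<star> (b i * (a i' * b i'))"
      using eq[of i] span_i0[of "y * z"] i' by auto
    have az: "a i * (E i * (y * z)) = \<alpha> \<star> (a i * b i) + \<beta> \<star> w"
      unfolding z distrib_left scale_simps using i' abab by (auto simp: mult.assoc)
    have "a i * (E i * (y * z)) \<noteq> 0"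
    proof
      assume 0: "a i * (E i * (y * z)) = 0"
      then have "a i' * b i' * (\<alpha> \<star> (a i * b i) + \<beta> \<star> w) = 0" using az by simp
      then have "\<alpha> \<star> w = 0" using i' by (auto simp: distrib_left abab arrows_squares)
      then have "\<alpha> = 0" using scale_eq_zero nonzero(1) by blast
      moreover from this have "\<beta> = 0" using 0 az scale_eq_zero nonzero(1) by simp
      ultimately show False using z i(2) by simp
    qed
    moreover have "E 0 * (a i * (E i * (y * z))) * E 0 = a i * (E i * (y * z) * E 0)"
      unfolding E0_ab by (simp only: mult.assoc)
    then have "a i * (E i * (y * z)) = E 0 * (a i * (E i * (y * z))) * E 0"
      by (simp only: eq[symmetric])
    ultimately show ?thesis using w_in_lideal_E0[OF N(1), of "a i * (E i * (y * z))"] in_N by simp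
  qed
  show ?thesis
    using y reach[of 1] reach[of 2] w_in_lideal_E0[OF N(1), of "y * z"] in_N[of 1 0] eq[of 0] by auto
qed

end

section \<open>The projective indecomposable modules\<close>

context fifth_root
begin

abbreviation RM :: "((nat \<Rightarrow> nat) \<Rightarrow> 'k, (nat \<Rightarrow> nat) \<Rightarrow> 'k) module" where "RM \<equiv> regular_module kA5"

abbreviation PM :: "'k galg \<Rightarrow> ((nat \<Rightarrow> nat) \<Rightarrow> 'k, (nat \<Rightarrow> nat) \<Rightarrow> 'k) module" where
  "PM x \<equiv> principal_module kA5 (gcoef x)"

lemma carrier_range: "carrier kA5 = range (gcoef :: 'k galg \<Rightarrow> _)"
  by (rule type_definition.Rep_range[OF type_definition_galg, symmetric])

lemma gcoef_ops: "gcoef (x * y) = gcoef x \<otimes>\<^bsub>kA5\<^esub> gcoef y" "gcoef (x + y) = gcoef x \<oplus>\<^bsub>kA5\<^esub> gcoef y"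
  "gcoef 1 = \<one>\<^bsub>kA5\<^esub>" "gcoef 0 = \<zero>\<^bsub>kA5\<^esub>"
  by (simp_all add: gcoef_ring)

lemma gcoef_mem [simp]: "gcoef (x :: 'k galg) \<in> carrier kA5" unfolding carrier_range by simp

lemma RM_module: "left_module kA5 RM" by (rule left_module_regular[OF kA5_ring])

lemma smult_set_RM: "smult_set RM (gcoef ` I) (gcoef m) = gcoef ` img I m"
  by (simp add: smult_set_def img_def image_image gcoef_ops)

lemma smult_set_RM_carrier: "smult_set RM (carrier kA5) (gcoef m) = gcoef ` L m"
  unfolding carrier_range by (rule smult_set_RM)

lemma set_add_RM: "gcoef ` A <+>\<^bsub>RM\<^esub> gcoef ` B = gcoef ` sumset A B"
proof -
  have "gcoef ` A <+>\<^bsub>RM\<^esub> gcoef ` B = {gcoef x \<oplus>\<^bsub>kA5\<^esub> gcoef y | x y. x \<in> A \<and> y \<in> B}"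
    by (auto simp: set_add_def set_mult_def)
  also have "\<dots> = gcoef ` sumset A B" unfolding sumset_def by (auto simp: gcoef_ops[symmetric])
  finally show ?thesis .
qed

lemma left_ideal_gcoef: "left_ideal kA5 (gcoef ` I) \<longleftrightarrow> lideal I"
proof -
  have z: "(\<zero>\<^bsub>kA5\<^esub> \<in> gcoef ` I) = (0 \<in> I)" unfolding gcoef_ops(4)[symmetric] by (simp add: gcoef_inject inj_image_mem_iff inj_def)
  have "inj (gcoef :: 'k galg \<Rightarrow> _)" by (simp add: inj_def gcoef_inject)
  then show ?thesis
    unfolding left_ideal_iff[OF kA5_ring] lideal_def z carrier_range
    by (auto simp: gcoef_ops[symmetric] inj_image_mem_iff)
qed

lemma left_ideal_RM: assumes "submodule N kA5 RM" obtains I where "N = gcoef ` I" "lideal I"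
proof -
  have "N \<subseteq> carrier kA5" using assms left_module.submodule_iff[OF RM_module] by auto
  then have "N = gcoef ` (gcoef -` N)" unfolding carrier_range by blast
  then show thesis using that assms left_ideal_gcoef by metis
qed

lemma local_top_gcoef:
  assumes "lideal I" "u \<notin> I" "\<And>x. x \<notin> I \<Longrightarrow> \<exists>y. y * (x * u) = u"
  shows "local_top kA5 (gcoef u) (gcoef ` I)"
proof -
  have inj: "inj (gcoef :: 'k galg \<Rightarrow> _)" by (simp add: inj_def gcoef_inject)
  have "\<exists>y\<in>carrier kA5. y \<otimes>\<^bsub>kA5\<^esub> (z \<otimes>\<^bsub>kA5\<^esub> gcoef u) = gcoef u" if z: "z \<in> carrier kA5 - gcoef ` I" for z
  proof -
    obtain x where x: "z = gcoef x" "x \<notin> I" using z unfolding carrier_range by blast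
    obtain y where "y * (x * u) = u" using assms(3)[OF x(2)] by blast
    then have "gcoef y \<otimes>\<^bsub>kA5\<^esub> (z \<otimes>\<^bsub>kA5\<^esub> gcoef u) = gcoef u" unfolding x(1) gcoef_ops[symmetric] by simp
    then show ?thesis using gcoef_mem by blast
  qed
  then show ?thesis unfolding local_top_def using assms(1,2) inj by (simp add: left_ideal_gcoef inj_image_mem_iff)
qed

lemma local_gen_RM:
  assumes "local_top kA5 (gcoef u) (gcoef ` I)" "u * m = m" "m \<noteq> 0"
  shows "local_gen kA5 (gcoef u) (gcoef ` I) RM (gcoef m)"
proof -
  have "gcoef m \<noteq> \<zero>\<^bsub>kA5\<^esub>" using assms(3) unfolding gcoef_ops(4)[symmetric] gcoef_inject .
  then show ?thesis unfolding local_gen_def using assms(1) gcoef_ops(1)[of u m] assms(2) by simp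
qed

definition annih :: "((nat \<Rightarrow> nat) \<Rightarrow> 'k, 's) module \<Rightarrow> 's \<Rightarrow> 'k galg set" where
  "annih M v = {x. gcoef x \<odot>\<^bsub>M\<^esub> v = \<zero>\<^bsub>M\<^esub>}"

text \<open>The data by which a simple module is the top of a projective one: a generating vector fixed by \<open>u\<close>, in a
  module on which the idempotents with index in \<open>J\<close> vanish. The set \<open>J\<close> tells the simple modules apart.\<close>

definition top_module :: "((nat \<Rightarrow> nat) \<Rightarrow> 'k, 's) module \<Rightarrow> 's \<Rightarrow> 'k galg \<Rightarrow> nat set \<Rightarrow> bool" where
  "top_module M v u J \<longleftrightarrow> left_module kA5 M \<and> v \<in> carrier M \<and> v \<noteq> \<zero>\<^bsub>M\<^esub> \<and> gcoef u \<odot>\<^bsub>M\<^esub> v = v \<and>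
     smult_set M (carrier kA5) v = carrier M \<and> (\<forall>j\<in>J. \<forall>x\<in>carrier M. gcoef (E j) \<odot>\<^bsub>M\<^esub> x = \<zero>\<^bsub>M\<^esub>)"

lemma top_module_ideal:
  assumes "top_module M v u J" shows "top_ideal (annih M v) u J"
proof -
  interpret M: left_module kA5 M using assms by (simp add: top_module_def)
  have v: "v \<in> carrier M" "v \<noteq> \<zero>\<^bsub>M\<^esub>" "gcoef u \<odot>\<^bsub>M\<^esub> v = v"
    "\<And>j x. j \<in> J \<Longrightarrow> x \<in> carrier M \<Longrightarrow> gcoef (E j) \<odot>\<^bsub>M\<^esub> x = \<zero>\<^bsub>M\<^esub>" using assms by (auto simp: top_module_def)
  show ?thesis
    unfolding top_ideal_def lideal_def annih_def
    using v by (auto simp: gcoef_ops M.smult_l_distr M.smult_assoc1)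
qed

lemma top_module_cyclic:
  assumes "top_module M v u J" shows "cyclic_on kA5 M v (gcoef ` annih M v)"
  using assms unfolding top_module_def cyclic_on_def annih_def carrier_range by auto

definition XX :: "'k galg list" where
  "XX = [E 0, e 1, e 1 * S, e 2, e 2 * S, f 1, q, q * S, f 1 * S]"
definition YY :: "'k galg list" where
  "YY = [E 0, e 1, S * e 1, e 2, S * e 2, f 1, p, S * p, S * f 1]"
definition UU :: "'k galg list" where
  "UU = [E 0, e 1, e 1, e 2, e 2, f 1, f 1, f 1, f 1]"
definition JJ :: "nat list" where "JJ = [0, 1, 4, 2, 3, 1, 2, 3, 4]"

lemma S_E_S: "S * E 1 = E 4 * S" "S * E 2 = E 3 * S" "S * E 4 = E 1 * S" "S * E 3 = E 2 * S"
  using S_E[of 1] S_E[of 2] S_E[of 4] S_E[of 3] by (simp_all add: One_nat_def)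

lemma less9: "(\<forall>k<9. P k) \<longleftrightarrow> P 0 \<and> P 1 \<and> P 2 \<and> P 3 \<and> P 4 \<and> P 5 \<and> P 6 \<and> P 7 \<and> P (8::nat)"
proof -
  have "k < 9 \<longleftrightarrow> k \<in> {0, 1, 2, 3, 4, 5, 6, 7, 8}" for k :: nat by auto
  then show ?thesis by auto
qed

lemma XX_E: "\<forall>k<9. XX ! k * E (JJ ! k) = XX ! k"
  unfolding less9 by (simp add: XX_def JJ_def mult.assoc S_E_S E_mult) (simp add: mult.assoc[symmetric])

lemma E_YY: "\<forall>k<9. E (JJ ! k) * YY ! k = YY ! k"
  unfolding less9 by (simp add: YY_def JJ_def mult.assoc[symmetric] S_E_S[symmetric] E_mult) (simp add: mult.assoc)

lemma orth: "X * E i = X \<Longrightarrow> E j * Y = Y \<Longrightarrow> i < 5 \<Longrightarrow> j < 5 \<Longrightarrow> i \<noteq> j \<Longrightarrow> X * Y = 0"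
proof -
  assume a: "X * E i = X" "E j * Y = Y" "i < 5" "j < 5" "i \<noteq> j"
  then have "X * Y = X * (E i * E j) * Y" by (metis mult.assoc)
  then show ?thesis using a by (simp add: E_mult)
qed

lemma XX_YY: assumes "k < 9" "l < 9" shows "XX ! k * YY ! l = (if k = l then UU ! k else 0)"
proof (cases "JJ ! k = JJ ! l")
  case False
  have "\<forall>k<9. JJ ! k < 5" unfolding less9 by (simp add: JJ_def)
  then show ?thesis using orth[of "XX ! k" "JJ ! k" "JJ ! l" "YY ! l"] XX_E E_YY assms False by auto
next
  case True
  have z: "e 1 * f 1 = 0" "f 1 * e 1 = 0" "f 1 * f 1 = f 1" "e 2 * f 2 = 0" "f 2 * e 2 = 0"
    using f_e[OF idempotents(1)] f_e[OF idempotents(2)] by simp_all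
  have "e 2 * p = e 2 * f 2 * p" "q * e 2 = q * (f 2 * e 2)" by (simp_all only: mult.assoc p_f) (simp only: mult.assoc[symmetric] p_f)
  then have z': "e 2 * p = 0" "q * e 2 = 0" by (simp_all add: z)
  have "\<forall>k<9. \<forall>l<9. JJ ! k = JJ ! l \<longrightarrow> XX ! k * YY ! l = (if k = l then UU ! k else 0)"
    unfolding less9 by (simp add: JJ_def XX_def YY_def UU_def mult.assoc S_S_mult E_mult idempotents z z' pq)
  then show ?thesis using assms True by blast
qed

lemma e_plus_f: "e i + f i = E i" by (simp add: f_def add_ac)

lemma sum_nine: "(\<Sum>k<9. g k) = g 0 + g 1 + g 2 + g 3 + g 4 + g 5 + g 6 + g 7 + g (8::nat)" for g :: "nat \<Rightarrow> 'k galg"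
proof -
  have "{..<9::nat} = {0, 1, 2, 3, 4, 5, 6, 7, 8}" by auto
  then show ?thesis by (simp add: add.assoc)
qed

lemma YY_XX: "(\<Sum>k<9. YY ! k * XX ! k) = 1"
proof -
  have "(\<Sum>k<9. YY ! k * XX ! k) = E 0 + (e 1 + f 1) + (e 2 + f 2) + S * (e 2 + f 2) * S + S * (e 1 + f 1) * S"
  proof -
    have "f 1 * f 1 = f 1" using f_e(3)[OF idempotents(1)] by simp
    then have "e 1 * (e 1 * S) = e 1 * S" "e 2 * (e 2 * S) = e 2 * S" "f 1 * (f 1 * S) = f 1 * S" "p * (q * S) = f 2 * S" "f 1 * f 1 = f 1"
      by (simp_all add: mult.assoc[symmetric] idempotents pq)
    then show ?thesis
      unfolding sum_nine by (simp add: XX_def YY_def mult.assoc E_mult idempotents pq distrib_left distrib_right add_ac)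
  qed
  also have "\<dots> = E 0 + E 1 + E 2 + E 3 + E 4"
    unfolding e_plus_f S_E_S by (simp add: mult.assoc group_relations)
  finally show ?thesis using sum_E by simp
qed

lemma YY_UU: "\<forall>k<9. \<exists>c. YY ! k = c * UU ! k"
proof -
  have "\<forall>k<9. YY ! k = [1, 1, S, 1, S, 1, p, S * p, S] ! k * UU ! k"
    unfolding less9 by (simp add: YY_def UU_def mult.assoc p_f)
  then show ?thesis by blast
qed

lemma UU_in: "k < 9 \<Longrightarrow> x * YY ! k \<in> L (UU ! k)"
  using YY_UU by (auto simp: img_def mult.assoc[symmetric])

lemma L_UU: assumes "k < 9" "x \<in> L (UU ! k)" shows "x * (UU ! k) = x"
proof -
  have "\<forall>k<9. UU ! k * UU ! k = UU ! k"
    unfolding less9 using f_e(3)[OF idempotents(1)] by (simp add: UU_def E_mult idempotents)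
  then show ?thesis using assms by (auto simp: img_def mult.assoc)
qed

text \<open>The regular module is the sum of the nine left ideals generated by the idempotents
  \<open>YY ! k * XX ! k\<close>.\<close>

lemma regular_decomposition:
  "mod_iso kA5 RM (PM (E 0) \<oplus>\<^sub>m mod_power (PM (e 1)) 2 \<oplus>\<^sub>m mod_power (PM (e 2)) 2 \<oplus>\<^sub>m mod_power (PM (f 1)) 4)"
proof -
  interpret R: ring "kA5 :: ((nat \<Rightarrow> nat) \<Rightarrow> 'k) ring" by (rule kA5_ring)
  let ?N = "PM (E 0) \<oplus>\<^sub>m mod_power (PM (e 1)) 2 \<oplus>\<^sub>m mod_power (PM (e 2)) 2 \<oplus>\<^sub>m mod_power (PM (f 1)) 4"
  let ?y = "\<lambda>z k. z \<otimes>\<^bsub>kA5\<^esub> gcoef (YY ! k)"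
  let ?h = "\<lambda>z. (?y z 0, \<lambda>i\<in>{..<2}. ?y z (1 + i), \<lambda>i\<in>{..<2}. ?y z (3 + i), \<lambda>i\<in>{..<4}. ?y z (5 + i))"
  have y: "?y (gcoef x) k = gcoef (x * YY ! k)" for x k by (simp add: gcoef_ops)
  have UU: "UU ! 0 = E 0" "i < 2 \<Longrightarrow> UU ! (1 + i) = e 1" "i < 2 \<Longrightarrow> UU ! (3 + i) = e 2" "i < 4 \<Longrightarrow> UU ! (5 + i) = f 1" for i
    by (simp_all add: UU_def nth_Cons' numeral_eq_Suc One_nat_def)
  have c: "carrier (PM u) = gcoef ` L u" for u by (simp add: smult_set_RM_carrier)
  have mem: "?y (gcoef x) k \<in> gcoef ` L (UU ! k)" if "k < 9" for x k unfolding y using UU_in[OF that] by blast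
  have inN: "?h (gcoef x) \<in> carrier ?N" for x
    unfolding mod_sum_simps mod_power_simps c using mem[of 0 x] mem[of _ x] by (auto simp: UU[symmetric] simp del: UU)
  have "?h \<in> mod_hom kA5 RM ?N"
  proof (rule mod_homI)
    fix z assume "z \<in> carrier RM"
    then show "?h z \<in> carrier ?N" using inN unfolding regular_simps carrier_range by blast
  qed (auto simp: R.l_distr R.m_assoc fun_eq_iff)
  moreover have "bij_betw ?h (carrier RM) (carrier ?N)"
    unfolding bij_betw_def
  proof
    show "inj_on ?h (carrier RM)"
    proof (rule inj_onI)
      fix z z' assume z: "z \<in> carrier RM" "z' \<in> carrier RM" "?h z = ?h z'"
      obtain x x' where x: "z = gcoef x" "z' = gcoef x'" using z(1,2) unfolding regular_simps carrier_range by blast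
      have eq: "(\<lambda>i\<in>{..<2}. ?y z (1 + i)) = (\<lambda>i\<in>{..<2}. ?y z' (1 + i))" "(\<lambda>i\<in>{..<2}. ?y z (3 + i)) = (\<lambda>i\<in>{..<2}. ?y z' (3 + i))"
        "(\<lambda>i\<in>{..<4}. ?y z (5 + i)) = (\<lambda>i\<in>{..<4}. ?y z' (5 + i))" "?y z 0 = ?y z' 0" using z(3) by simp_all
      have "\<forall>k<9. ?y z k = ?y z' k"
        unfolding less9 using fun_cong[OF eq(1), of 0] fun_cong[OF eq(1), of 1] fun_cong[OF eq(2), of 0] fun_cong[OF eq(2), of 1]
          fun_cong[OF eq(3), of 0] fun_cong[OF eq(3), of 1] fun_cong[OF eq(3), of 2] fun_cong[OF eq(3), of 3] eq(4) by simp
      then have "x * YY ! k = x' * YY ! k" if "k < 9" for k using that unfolding x y by (simp add: gcoef_inject)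
      then have "(\<Sum>k<9. x * YY ! k * XX ! k) = (\<Sum>k<9. x' * YY ! k * XX ! k)" by simp
      then have "x * (\<Sum>k<9. YY ! k * XX ! k) = x' * (\<Sum>k<9. YY ! k * XX ! k)" by (simp only: sum_distrib_left mult.assoc)
      then show "z = z'" unfolding YY_XX x by simp
    qed
    show "?h ` carrier RM = carrier ?N"
    proof
      show "?h ` carrier RM \<subseteq> carrier ?N" using inN unfolding regular_simps carrier_range by blast
      show "carrier ?N \<subseteq> ?h ` carrier RM"
      proof
        fix n assume n: "n \<in> carrier ?N"
        obtain x0 x1 x2 x3 where n': "n = (x0, x1, x2, x3)" by (cases n) auto
        have xs: "x0 \<in> gcoef ` L (E 0)" "x1 \<in> {..<2} \<rightarrow>\<^sub>E gcoef ` L (e 1)" "x2 \<in> {..<2} \<rightarrow>\<^sub>E gcoef ` L (e 2)" "x3 \<in> {..<4} \<rightarrow>\<^sub>E gcoef ` L (f 1)"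
          using n unfolding n' mod_sum_simps mod_power_simps c by auto
        define g where "g k = (if k = 0 then x0 else if k < 3 then x1 (k - 1) else if k < 5 then x2 (k - 3) else x3 (k - 5))" for k
        have "\<forall>k<9. g k \<in> gcoef ` L (UU ! k)"
          unfolding less9 g_def using xs by (auto simp: UU_def PiE_iff)
        then have "\<forall>k. \<exists>y. k < 9 \<longrightarrow> g k = gcoef y \<and> y \<in> L (UU ! k)" by blast
        from choice[OF this] obtain d where d: "\<And>k. k < 9 \<Longrightarrow> g k = gcoef (d k) \<and> d k \<in> L (UU ! k)" by blast
        define x where "x = (\<Sum>k<9. d k * XX ! k)"
        have "x * YY ! l = d l" if l: "l < 9" for l
        proof -
          have "x * YY ! l = (\<Sum>k<9. d k * (XX ! k * YY ! l))" unfolding x_def by (simp add: sum_distrib_right mult.assoc)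
          also have "\<dots> = (\<Sum>k<9. if k = l then d k * UU ! k else 0)" using XX_YY l by (intro sum.cong) auto
          also have "\<dots> = d l" using l L_UU[OF l] d[OF l] by simp
          finally show ?thesis .
        qed
        then have yg: "?y (gcoef x) k = g k" if "k < 9" for k unfolding y using d that by simp
        have "?h (gcoef x) = n"
          unfolding n'
          using yg[of 0] yg xs by (auto simp: g_def fun_eq_iff PiE_iff extensional_def)
        moreover have "gcoef x \<in> carrier RM" by simp
        ultimately show "n \<in> ?h ` carrier RM" by blast
      qed
    qed
  qed
  ultimately show ?thesis unfolding mod_iso_def by blast
qed

end

text \<open>The structure of the projective modules depends only on the idempotents acting on the four tops, so the
  simple modules are kept abstract here and constructed afterwards.\<close>

locale A5_tops = fifth_root \<zeta> for \<zeta> :: "'k::field" +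
  fixes M0 :: "((nat \<Rightarrow> nat) \<Rightarrow> 'k, 's0) module" and v0
    and M1 :: "((nat \<Rightarrow> nat) \<Rightarrow> 'k, 's1) module" and v1
    and M2 :: "((nat \<Rightarrow> nat) \<Rightarrow> 'k, 's2) module" and v2
    and M4 :: "((nat \<Rightarrow> nat) \<Rightarrow> 'k, 's4) module" and v4
  assumes T0: "top_module M0 v0 (E 0) {1, 2, 3, 4}"
    and T1: "top_module M1 v1 (e 1) {0, 2, 3}"
    and T2: "top_module M2 v2 (e 2) {0, 1, 4}"
    and T4: "top_module M4 v4 (f 1) {0}"
    and kill4: "\<And>x. x \<in> carrier M4 \<Longrightarrow> gcoef (e 1) \<odot>\<^bsub>M4\<^esub> x = \<zero>\<^bsub>M4\<^esub> \<and> gcoef (e 2) \<odot>\<^bsub>M4\<^esub> x = \<zero>\<^bsub>M4\<^esub>"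
begin

abbreviation "I0 \<equiv> annih M0 v0"
abbreviation "I1 \<equiv> annih M1 v1"
abbreviation "I2 \<equiv> annih M2 v2"
abbreviation "I4 \<equiv> annih M4 v4"

lemmas ideals = top_module_ideal[OF T0] top_module_ideal[OF T1] top_module_ideal[OF T2] top_module_ideal[OF T4]
lemmas cyclics = top_module_cyclic[OF T0] top_module_cyclic[OF T1] top_module_cyclic[OF T2] top_module_cyclic[OF T4]

lemma tops: "local_top kA5 (gcoef (E 0)) (gcoef ` I0)" "local_top kA5 (gcoef (e 1)) (gcoef ` I1)"
  "local_top kA5 (gcoef (e 2)) (gcoef ` I2)" "local_top kA5 (gcoef (f 1)) (gcoef ` I4)"
  using local_top_gcoef[OF top_idealD(1,2)[OF ideals(1)] local_E0[OF ideals(1)]]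
    local_top_gcoef[OF top_idealD(1,2)[OF ideals(2)] local_e1[OF ideals(2)]]
    local_top_gcoef[OF top_idealD(1,2)[OF ideals(3)] local_e2[OF ideals(3)]]
    local_top_gcoef[OF top_idealD(1,2)[OF ideals(4)] local_f[OF ideals(4)]] by blast+

lemma idem: "gcoef (E 0) \<otimes>\<^bsub>kA5\<^esub> gcoef (E 0) = gcoef (E 0)" "gcoef (e 1) \<otimes>\<^bsub>kA5\<^esub> gcoef (e 1) = gcoef (e 1)"
  "gcoef (e 2) \<otimes>\<^bsub>kA5\<^esub> gcoef (e 2) = gcoef (e 2)" "gcoef (f 1) \<otimes>\<^bsub>kA5\<^esub> gcoef (f 1) = gcoef (f 1)"
  using f_e(3)[OF idempotents(1)] by (simp_all add: gcoef_ops[symmetric] E_mult idempotents)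

lemma fix_v: "gcoef (E 0) \<odot>\<^bsub>M0\<^esub> v0 = v0" "gcoef (e 1) \<odot>\<^bsub>M1\<^esub> v1 = v1" "gcoef (e 2) \<odot>\<^bsub>M2\<^esub> v2 = v2" "gcoef (f 1) \<odot>\<^bsub>M4\<^esub> v4 = v4"
  using T0 T1 T2 T4 by (auto simp: top_module_def)

lemma covers: "projective_cover kA5 (PM (E 0)) M0" "projective_cover kA5 (PM (e 1)) M1"
  "projective_cover kA5 (PM (e 2)) M2" "projective_cover kA5 (PM (f 1)) M4"
  by (rule projective_cover_principal[OF kA5_ring idem(1) tops(1) cyclics(1) fix_v(1)]
      projective_cover_principal[OF kA5_ring idem(2) tops(2) cyclics(2) fix_v(2)]
      projective_cover_principal[OF kA5_ring idem(3) tops(3) cyclics(3) fix_v(3)]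
      projective_cover_principal[OF kA5_ring idem(4) tops(4) cyclics(4) fix_v(4)])+

lemma pims: "projective_indecomposable kA5 (PM (E 0))" "projective_indecomposable kA5 (PM (e 1))"
  "projective_indecomposable kA5 (PM (e 2))" "projective_indecomposable kA5 (PM (f 1))"
  by (rule projective_indecomposable_principal[OF kA5_ring idem(1) tops(1)]
      projective_indecomposable_principal[OF kA5_ring idem(2) tops(2)]
      projective_indecomposable_principal[OF kA5_ring idem(3) tops(3)]
      projective_indecomposable_principal[OF kA5_ring idem(4) tops(4)])+

lemma not_iso: "\<not> mod_iso kA5 (PM (E 0)) (PM (e 1))" "\<not> mod_iso kA5 (PM (E 0)) (PM (e 2))"
  "\<not> mod_iso kA5 (PM (E 0)) (PM (f 1))" "\<not> mod_iso kA5 (PM (e 1)) (PM (e 2))"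
  "\<not> mod_iso kA5 (PM (e 1)) (PM (f 1))" "\<not> mod_iso kA5 (PM (e 2)) (PM (f 1))"
proof -
  note n = not_iso_principal[OF kA5_ring _ _ _ _ _ gcoef_mem]
  have m: "left_module kA5 M1" "v1 \<in> carrier M1" "v1 \<noteq> \<zero>\<^bsub>M1\<^esub>" "left_module kA5 M2" "v2 \<in> carrier M2" "v2 \<noteq> \<zero>\<^bsub>M2\<^esub>"
    "left_module kA5 M4" "v4 \<in> carrier M4" "v4 \<noteq> \<zero>\<^bsub>M4\<^esub>" using T1 T2 T4 by (auto simp: top_module_def)
  interpret M2: left_module kA5 M2 by (rule m)
  have "gcoef (e 1 * E 1) \<odot>\<^bsub>M2\<^esub> x = \<zero>\<^bsub>M2\<^esub>" if "x \<in> carrier M2" for x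
    unfolding gcoef_ops using T2 that by (simp add: M2.smult_assoc1 top_module_def)
  then have k2: "gcoef (e 1) \<odot>\<^bsub>M2\<^esub> x = \<zero>\<^bsub>M2\<^esub>" if "x \<in> carrier M2" for x using that by simp
  have k0: "x \<in> carrier M1 \<Longrightarrow> gcoef (E 0) \<odot>\<^bsub>M1\<^esub> x = \<zero>\<^bsub>M1\<^esub>" "y \<in> carrier M2 \<Longrightarrow> gcoef (E 0) \<odot>\<^bsub>M2\<^esub> y = \<zero>\<^bsub>M2\<^esub>"
    "z \<in> carrier M4 \<Longrightarrow> gcoef (E 0) \<odot>\<^bsub>M4\<^esub> z = \<zero>\<^bsub>M4\<^esub>" for x y z
    using T1 T2 T4 by (auto simp: top_module_def)
  show "\<not> mod_iso kA5 (PM (E 0)) (PM (e 1))" by (rule n[OF idem(1) tops(1) m(1-3) fix_v(2) idem(2) k0(1)])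
  show "\<not> mod_iso kA5 (PM (E 0)) (PM (e 2))" by (rule n[OF idem(1) tops(1) m(4-6) fix_v(3) idem(3) k0(2)])
  show "\<not> mod_iso kA5 (PM (E 0)) (PM (f 1))" by (rule n[OF idem(1) tops(1) m(7-9) fix_v(4) idem(4) k0(3)])
  show "\<not> mod_iso kA5 (PM (e 1)) (PM (e 2))" by (rule n[OF idem(2) tops(2) m(4-6) fix_v(3) idem(3) k2])
  show "\<not> mod_iso kA5 (PM (e 1)) (PM (f 1))" by (rule n[OF idem(2) tops(2) m(7-9) fix_v(4) idem(4) conjunct1[OF kill4]])
  show "\<not> mod_iso kA5 (PM (e 2)) (PM (f 1))" by (rule n[OF idem(3) tops(3) m(7-9) fix_v(4) idem(4) conjunct2[OF kill4]])
qed

lemma gens: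
  "E 0 * m = m \<Longrightarrow> m \<noteq> 0 \<Longrightarrow> local_gen kA5 (gcoef (E 0)) (gcoef ` I0) RM (gcoef m)"
  "e 1 * m = m \<Longrightarrow> m \<noteq> 0 \<Longrightarrow> local_gen kA5 (gcoef (e 1)) (gcoef ` I1) RM (gcoef m)"
  "e 2 * m = m \<Longrightarrow> m \<noteq> 0 \<Longrightarrow> local_gen kA5 (gcoef (e 2)) (gcoef ` I2) RM (gcoef m)"
  by (rule local_gen_RM[OF tops(1)], assumption+, rule local_gen_RM[OF tops(2)], assumption+,
      rule local_gen_RM[OF tops(3)], assumption+)

lemma nonzero_idem: "E 0 \<noteq> 0" "e 1 \<noteq> 0" "e 2 \<noteq> 0" "f 1 \<noteq> 0"
  using top_idealD(2)[OF ideals(1)] lidealD(1)[OF top_idealD(1)[OF ideals(1)]]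
    top_idealD(2)[OF ideals(2)] lidealD(1)[OF top_idealD(1)[OF ideals(2)]]
    top_idealD(2)[OF ideals(3)] lidealD(1)[OF top_idealD(1)[OF ideals(3)]]
    top_idealD(2)[OF ideals(4)] lidealD(1)[OF top_idealD(1)[OF ideals(4)]] by auto

lemma imgs: "E 0 * m = m \<Longrightarrow> img I0 m = sumset (L (b 1 * m)) (L (b 2 * m))"
  "e 1 * m = m \<Longrightarrow> img I1 m = L (a 1 * m)" "e 2 * m = m \<Longrightarrow> img I2 m = L (a 2 * m)"
  by (erule img_E0[OF ideals(1)] img_e1[OF ideals(2)] img_e2[OF ideals(3)])+

lemma e_b: "e 1 * (b 1 * x) = b 1 * x" "e 2 * (b 2 * x) = b 2 * x" "b 1 * (a 1 * x) = 0" "b 2 * (a 2 * x) = 0"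
  by (simp_all only: mult.assoc[symmetric] idempotents ba_zero mult_zero_left)

lemma L_sum0: "sumset (L 0) (L x) = L x" "sumset (L x) (L 0) = L x"
  by (simp_all add: L_zero sumset_zero lideal_L)

text \<open>The vertex ideals act along the paths: each step is right multiplication by the next arrow.\<close>

lemma path_imgs:
  "img I0 (a 1) = L (b 2 * a 1)" "img I0 (a 2) = L (b 1 * a 2)"
  "img I2 (b 2 * a 1) = L (a 2 * (b 2 * a 1))" "img I1 (b 1 * a 2) = L (a 1 * (b 1 * a 2))"
  "img I0 (a 2 * (b 2 * a 1)) = L (b 1 * (a 2 * (b 2 * a 1)))" "img I0 (a 1 * (b 1 * a 2)) = L (b 2 * (a 1 * (b 1 * a 2)))"
  "img I1 (b 1 * (a 2 * (b 2 * a 1))) = {0}" "img I2 (b 2 * (a 1 * (b 1 * a 2))) = {0}"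
  "img I1 (e 1) = L (a 1)" "img I2 (e 2) = L (a 2)" "img I0 (E 0) = sumset (L (b 1)) (L (b 2))"
  "img I1 (b 1) = L (a 1 * b 1)" "img I2 (b 2) = L (a 2 * b 2)"
  "img I0 (a 1 * b 1) = L (b 2 * (a 1 * b 1))" "img I0 (a 2 * b 2) = L (b 1 * (a 2 * b 2))"
  "img I1 (b 1 * (a 2 * b 2)) = L w" "img I2 (b 2 * (a 1 * b 1)) = L w" "img I0 w = {0}"
proof -
  have w': "a 1 * (b 1 * (a 2 * b 2)) = w" "a 2 * (b 2 * (a 1 * b 1)) = w"
    using abab by (simp_all only: mult.assoc)
  note r = E0_ab e_b L_sum0 L_zero path_zero w' idempotents ba_zero E_mult arrows_squares sumset_zero(2) sumset_zero(1)[OF lideal_L]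
  show "img I0 (a 1) = L (b 2 * a 1)" "img I0 (a 2) = L (b 1 * a 2)"
    "img I0 (a 2 * (b 2 * a 1)) = L (b 1 * (a 2 * (b 2 * a 1)))" "img I0 (a 1 * (b 1 * a 2)) = L (b 2 * (a 1 * (b 1 * a 2)))"
    "img I0 (E 0) = sumset (L (b 1)) (L (b 2))"
    "img I0 (a 1 * b 1) = L (b 2 * (a 1 * b 1))" "img I0 (a 2 * b 2) = L (b 1 * (a 2 * b 2))" "img I0 w = {0}"
    by (simp_all add: imgs(1) r)
  show "img I1 (b 1 * a 2) = L (a 1 * (b 1 * a 2))" "img I1 (b 1 * (a 2 * (b 2 * a 1))) = {0}" "img I1 (e 1) = L (a 1)"
    "img I1 (b 1) = L (a 1 * b 1)" "img I1 (b 1 * (a 2 * b 2)) = L w"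
    by (simp_all add: imgs(2) r)
  show "img I2 (b 2 * a 1) = L (a 2 * (b 2 * a 1))" "img I2 (b 2 * (a 1 * (b 1 * a 2))) = {0}" "img I2 (e 2) = L (a 2)"
    "img I2 (b 2) = L (a 2 * b 2)" "img I2 (b 2 * (a 1 * b 1)) = L w"
    by (simp_all add: imgs(3) r)
qed

lemmas sets = smult_set_RM smult_set_RM_carrier set_add_RM path_imgs

lemma zero_RM: "gcoef 0 = \<zero>\<^bsub>RM\<^esub>" by (simp add: gcoef_ops)

definition series1 where "series1 = [(gcoef (e 1), gcoef ` I1, gcoef (e 1)), (gcoef (E 0), gcoef ` I0, gcoef (a 1)),
   (gcoef (e 2), gcoef ` I2, gcoef (b 2 * a 1)), (gcoef (E 0), gcoef ` I0, gcoef (a 2 * (b 2 * a 1))),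
   (gcoef (e 1), gcoef ` I1, gcoef (b 1 * (a 2 * (b 2 * a 1))))]"

definition series2 where "series2 = [(gcoef (e 2), gcoef ` I2, gcoef (e 2)), (gcoef (E 0), gcoef ` I0, gcoef (a 2)),
   (gcoef (e 1), gcoef ` I1, gcoef (b 1 * a 2)), (gcoef (E 0), gcoef ` I0, gcoef (a 1 * (b 1 * a 2))),
   (gcoef (e 2), gcoef ` I2, gcoef (b 2 * (a 1 * (b 1 * a 2))))]"

lemma local_series_P2: "local_series kA5 RM series1 (gcoef ` L (e 1))"
  unfolding series1_def
  by (simp add: gens sets nonzero_idem nonzero arrows_nonzero idempotents E0_ab e_b zero_RM del: regular_simps)

lemma local_series_P3: "local_series kA5 RM series2 (gcoef ` L (e 2))"
  unfolding series2_def
  by (simp add: gens sets nonzero_idem nonzero arrows_nonzero idempotents E0_ab e_b zero_RM del: regular_simps)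

lemma PM_eq: "PM u = RM\<lparr>carrier := gcoef ` L u\<rparr>" by (simp add: smult_set_RM_carrier)

lemma uniserial_P2: "uniserial kA5 (PM (e 1))" and uniserial_P3: "uniserial kA5 (PM (e 2))"
  unfolding PM_eq by (rule uniserial_local_series[OF RM_module local_series_P2] uniserial_local_series[OF RM_module local_series_P3])+

lemma layers_P2: "has_radical_layers kA5 (PM (e 1))
  [mod_iso kA5 M1, mod_iso kA5 M0, mod_iso kA5 M2, mod_iso kA5 M0, mod_iso kA5 M1]"
  unfolding PM_eq
proof (rule has_radical_layers_local_series[OF RM_module local_series_P2])
  show "list_all2 (\<lambda>(e, I, m) L. local_gen kA5 e I RM m \<longrightarrow> L (quot_module (RM\<lparr>carrier := smult_set RM (carrier kA5) m\<rparr>) (smult_set RM I m))) series1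
     [mod_iso kA5 M1, mod_iso kA5 M0, mod_iso kA5 M2, mod_iso kA5 M0, mod_iso kA5 M1]"
    unfolding series1_def
    by (simp add: gen_layer[OF RM_module _ cyclics(1)] gen_layer[OF RM_module _ cyclics(2)] gen_layer[OF RM_module _ cyclics(3)])
qed

lemma layers_P3: "has_radical_layers kA5 (PM (e 2))
  [mod_iso kA5 M2, mod_iso kA5 M0, mod_iso kA5 M1, mod_iso kA5 M0, mod_iso kA5 M2]"
  unfolding PM_eq
proof (rule has_radical_layers_local_series[OF RM_module local_series_P3])
  show "list_all2 (\<lambda>(e, I, m) L. local_gen kA5 e I RM m \<longrightarrow> L (quot_module (RM\<lparr>carrier := smult_set RM (carrier kA5) m\<rparr>) (smult_set RM I m))) series2
     [mod_iso kA5 M2, mod_iso kA5 M0, mod_iso kA5 M1, mod_iso kA5 M0, mod_iso kA5 M2]"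
    unfolding series2_def
    by (simp add: gen_layer[OF RM_module _ cyclics(1)] gen_layer[OF RM_module _ cyclics(2)] gen_layer[OF RM_module _ cyclics(3)])
qed

end

section \<open>The projective cover of the trivial module\<close>

context A5_tops
begin

lemma inj_gcoef: "inj (gcoef :: 'k galg \<Rightarrow> _)" by (simp add: inj_def gcoef_inject)

lemma mem_gcoef: "gcoef (x :: 'k galg) \<in> gcoef ` A \<longleftrightarrow> x \<in> A"
  by (rule inj_image_mem_iff[OF inj_gcoef])

text \<open>One radical layer of \<open>A E 0\<close> where two paths run side by side.\<close>

lemma radical_step:
  assumes g: "local_gen kA5 u J RM (gcoef x)" "local_gen kA5 u' J' RM (gcoef y)"
    and out: "x \<notin> L y" "y \<notin> L x" and S: "cyclic_on kA5 N1 n1 J" "cyclic_on kA5 N2 n2 J'"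
    and nxt: "smult_set RM J (gcoef x) <+>\<^bsub>RM\<^esub> smult_set RM J' (gcoef y) = N"
    and rest: "has_radical_layers kA5 (RM\<lparr>carrier := N\<rparr>) Ls"
  shows "has_radical_layers kA5 (RM\<lparr>carrier := gcoef ` sumset (L x) (L y)\<rparr>) (mod_iso kA5 (N1 \<oplus>\<^sub>m N2) # Ls)"
proof -
  have out': "gcoef x \<notin> smult_set RM (carrier kA5) (gcoef y)" "gcoef y \<notin> smult_set RM (carrier kA5) (gcoef x)"
    using out unfolding smult_set_RM_carrier mem_gcoef .
  have N: "gcoef ` sumset (L x) (L y) = smult_set RM (carrier kA5) (gcoef x) <+>\<^bsub>RM\<^esub> smult_set RM (carrier kA5) (gcoef y)"
    unfolding smult_set_RM_carrier set_add_RM ..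
  show ?thesis
    unfolding has_radical_layers_Cons N rad_two_gens[OF RM_module g out'] nxt
    using two_gens_layer[OF RM_module g out' S] rest unfolding nxt by simp
qed

lemma gen_E0: "local_gen kA5 (gcoef (E 0)) (gcoef ` I0) RM (gcoef (E 0))"
  by (rule gens(1)) (simp_all add: E_mult nonzero_idem)

lemma gen_b: "local_gen kA5 (gcoef (e 1)) (gcoef ` I1) RM (gcoef (b 1))" "local_gen kA5 (gcoef (e 2)) (gcoef ` I2) RM (gcoef (b 2))"
  by (simp_all add: gens idempotents arrows_nonzero)

lemma gen_ab: "local_gen kA5 (gcoef (E 0)) (gcoef ` I0) RM (gcoef (a 1 * b 1))" "local_gen kA5 (gcoef (E 0)) (gcoef ` I0) RM (gcoef (a 2 * b 2))"
  by (simp_all add: gens E0_ab arrows_nonzero)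

lemma gen_bab: "local_gen kA5 (gcoef (e 1)) (gcoef ` I1) RM (gcoef (b 1 * (a 2 * b 2)))"
  "local_gen kA5 (gcoef (e 2)) (gcoef ` I2) RM (gcoef (b 2 * (a 1 * b 1)))"
  by (simp_all add: gens e_b arrows_nonzero)

lemma gen_w: "local_gen kA5 (gcoef (E 0)) (gcoef ` I0) RM (gcoef w)"
  by (simp add: gens nonzero)

lemma rad_P1: "rad kA5 (PM (E 0)) = gcoef ` sumset (L (b 1)) (L (b 2))"
  using rad_gen[OF RM_module gen_E0] by (simp only: sets)

lemma layers_w: "has_radical_layers kA5 (RM\<lparr>carrier := gcoef ` L w\<rparr>) [mod_iso kA5 M0]"
proof (rule has_radical_layers_local_series[OF RM_module])
  show "local_series kA5 RM [(gcoef (E 0), gcoef ` I0, gcoef w)] (gcoef ` L w)"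
    using gen_w by (simp add: sets zero_RM del: regular_simps)
qed (simp add: gen_layer[OF RM_module _ cyclics(1)])

lemma layers_P1: "has_radical_layers kA5 (PM (E 0))
  [mod_iso kA5 M0, mod_iso kA5 (M2 \<oplus>\<^sub>m M1), mod_iso kA5 (M0 \<oplus>\<^sub>m M0), mod_iso kA5 (M1 \<oplus>\<^sub>m M2), mod_iso kA5 M0]"
proof -
  have 4: "has_radical_layers kA5 (RM\<lparr>carrier := gcoef ` sumset (L (b 1 * (a 2 * b 2))) (L (b 2 * (a 1 * b 1)))\<rparr>)
      [mod_iso kA5 (M1 \<oplus>\<^sub>m M2), mod_iso kA5 M0]"
    by (rule radical_step[OF gen_bab bab_independent cyclics(2,3) _ layers_w])
       (simp only: sets sumset_zero lideal_L)
  have 3: "has_radical_layers kA5 (RM\<lparr>carrier := gcoef ` sumset (L (a 2 * b 2)) (L (a 1 * b 1))\<rparr>)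
      [mod_iso kA5 (M0 \<oplus>\<^sub>m M0), mod_iso kA5 (M1 \<oplus>\<^sub>m M2), mod_iso kA5 M0]"
    by (rule radical_step[OF gen_ab(2,1) ab_independent cyclics(1,1) _ 4]) (simp only: sets)
  have 2: "has_radical_layers kA5 (RM\<lparr>carrier := gcoef ` sumset (L (b 2)) (L (b 1))\<rparr>)
      [mod_iso kA5 (M2 \<oplus>\<^sub>m M1), mod_iso kA5 (M0 \<oplus>\<^sub>m M0), mod_iso kA5 (M1 \<oplus>\<^sub>m M2), mod_iso kA5 M0]"
    by (rule radical_step[OF gen_b(2,1) b_independent cyclics(3,2) _ 3]) (simp only: sets)
  have "mod_iso kA5 M0 (quot_module (PM (E 0)) (rad kA5 (PM (E 0))))"
    using gen_layer[OF RM_module gen_E0 cyclics(1)] rad_gen[OF RM_module gen_E0] by simp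
  then show ?thesis
    unfolding has_radical_layers_Cons[of _ "PM (E 0)"] rad_P1
    using 2 by (simp add: sumset_zero(4)[of "L (b 1)" "L (b 2)"])
qed

lemma soc_P1: "soc kA5 (PM (E 0)) = gcoef ` L w"
proof -
  have w0: "L w \<subseteq> L (E 0)" using L_least[OF lideal_L] L_times[of w "E 0"] by simp
  have sE: "submodule (gcoef ` L (E 0)) kA5 RM" "submodule (gcoef ` L w) kA5 RM"
    using left_ideal_gcoef lideal_L by auto
  interpret RM: left_module kA5 RM by (rule RM_module)
  show ?thesis
  proof (rule soc_simple)
    show "left_module kA5 (PM (E 0))" unfolding PM_eq by (rule RM.left_module_submodule[OF sE(1)])
    show "submodule (gcoef ` L w) kA5 (PM (E 0))"
      unfolding PM_eq RM.submodule_of_submodule[OF sE(1)] using sE w0 by blast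
    have "N = {\<zero>\<^bsub>RM\<^esub>} \<or> N = gcoef ` L w" if "submodule N kA5 RM" "N \<subseteq> gcoef ` L w" for N
      using gen_dichotomy[OF RM_module gen_w that(1)] that unfolding sets zero_RM[symmetric]
      using RM.submodule_iff[of N] by (auto simp: zero_RM[symmetric])
    moreover have "gcoef ` L w \<noteq> {\<zero>\<^bsub>RM\<^esub>}"
      using gen_nz[OF RM_module gen_w] L_self[of w] by blast
    ultimately have "simple_module kA5 (RM\<lparr>carrier := gcoef ` L w\<rparr>)"
      unfolding simple_module_def RM.submodule_of_submodule[OF sE(2)]
      using RM.left_module_submodule[OF sE(2)] by simp
    then show "simple_module kA5 (PM (E 0)\<lparr>carrier := gcoef ` L w\<rparr>)" by simp
    fix N assume N: "submodule N kA5 (PM (E 0))" "N \<noteq> {\<zero>\<^bsub>PM (E 0)\<^esub>}"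
    then have N': "submodule N kA5 RM" "N \<subseteq> gcoef ` L (E 0)"
      unfolding PM_eq RM.submodule_of_submodule[OF sE(1)] by auto
    obtain I where I: "N = gcoef ` I" "lideal I" using left_ideal_RM[OF N'(1)] by blast
    have "I \<subseteq> L (E 0)" using N'(2) mem_gcoef unfolding I by blast
    moreover have "I \<noteq> {0}" using N(2) unfolding I by (auto simp: gcoef_ops)
    ultimately have "w \<in> I" using w_in_lideal[OF I(2)] by blast
    then show "gcoef ` L w \<subseteq> N" unfolding I using L_least[OF I(2)] by blast
  qed
qed

lemma soc_subset_rad: "soc kA5 (PM (E 0)) \<subseteq> rad kA5 (PM (E 0))"
  unfolding soc_P1 rad_P1 using L_least[OF lideal_sumset[OF lideal_L lideal_L]] mem_sumset(1)[OF lideal_L lideal_L w_in(1)] by blast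

definition "HX = RM\<lparr>carrier := gcoef ` sumset (L (b 1)) (L (b 2))\<rparr>"
definition "HM = quot_module HX (gcoef ` L w)"
definition "hq x = (gcoef ` L w) +>\<^bsub>HX\<^esub> (gcoef x)"

lemma heart_eq: "quot_module (PM (E 0)\<lparr>carrier := rad kA5 (PM (E 0))\<rparr>) (soc kA5 (PM (E 0))) = HM"
  unfolding HM_def HX_def rad_P1 soc_P1 by simp

lemma heart_submodule: "submodule (gcoef ` sumset (L (b 1)) (L (b 2))) kA5 RM"
  using left_ideal_gcoef lideal_sumset lideal_L by auto

lemma HX_module: "left_module kA5 HX"
  unfolding HX_def by (rule left_module.left_module_submodule[OF RM_module heart_submodule])

lemma HX_sub: "submodule (gcoef ` A) kA5 HX \<longleftrightarrow> lideal A \<and> A \<subseteq> sumset (L (b 1)) (L (b 2))"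
  unfolding HX_def left_module.submodule_of_submodule[OF RM_module heart_submodule] left_ideal_gcoef
  using mem_gcoef by blast

lemma b_in_heart: "b 1 \<in> sumset (L (b 1)) (L (b 2))" "b 2 \<in> sumset (L (b 1)) (L (b 2))"
  using mem_sumset[OF lideal_L lideal_L] L_self by auto

lemma heart_lideal: "lideal (sumset (L (b 1)) (L (b 2)))" by (intro lideal_sumset lideal_L)

lemma Lw_sub: "submodule (gcoef ` L w) kA5 HX"
proof -
  have "L w \<subseteq> sumset (L (b 1)) (L (b 2))"
    by (rule L_least[OF heart_lideal mem_sumset(1)[OF lideal_L lideal_L w_in(1)]])
  then show ?thesis unfolding HX_sub using lideal_L by blast
qed

lemmas hq_props = quot_module_props[OF HX_module Lw_sub, folded HM_def]

lemma HM_module: "left_module kA5 HM" by (rule hq_props(3))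

lemma hq_smult: "I \<subseteq> carrier kA5 \<Longrightarrow> m \<in> sumset (L (b 1)) (L (b 2)) \<Longrightarrow>
    smult_set HM I (hq m) = (\<lambda>z. (gcoef ` L w) +>\<^bsub>HX\<^esub> z) ` smult_set RM I (gcoef m)"
  unfolding hq_def using smult_set_hom[OF hq_props(1), of I "gcoef m"] mem_gcoef by (simp add: HX_def)

lemma hq_smult_img:
  assumes "m \<in> sumset (L (b 1)) (L (b 2))"
  shows "smult_set HM (gcoef ` I) (hq m) = hq ` img I m" "smult_set HM (carrier kA5) (hq m) = hq ` L m"
proof -
  have I: "gcoef ` I \<subseteq> carrier kA5" by auto
  show "smult_set HM (gcoef ` I) (hq m) = hq ` img I m"
    unfolding hq_smult[OF I assms] smult_set_RM image_image unfolding hq_def ..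
  show "smult_set HM (carrier kA5) (hq m) = hq ` L m"
    unfolding hq_smult[OF subset_refl assms] smult_set_RM_carrier image_image unfolding hq_def ..
qed

lemma hq_zero_iff: "m \<in> sumset (L (b 1)) (L (b 2)) \<Longrightarrow> hq m = \<zero>\<^bsub>HM\<^esub> \<longleftrightarrow> m \<in> L w"
  unfolding hq_def using hq_props(4)[of "gcoef m"] by (simp add: HX_def mem_gcoef)

lemma hq_Lw: "hq ` L w = {\<zero>\<^bsub>HM\<^esub>}"
proof -
  have "L w \<subseteq> sumset (L (b 1)) (L (b 2))" using Lw_sub HX_sub by blast
  then have "hq x = \<zero>\<^bsub>HM\<^esub>" if "x \<in> L w" for x using hq_zero_iff that by blast
  then show ?thesis using L_self[of w] by (auto simp: image_iff)
qed

lemma Lw_E: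
  assumes "x \<in> L w"
  shows "E 1 * x = 0" "E 2 * x = 0"
proof -
  obtain y where x: "x = y * w" using assms by (auto simp: img_def)
  have E: "E i * (y * w) = (E i * y * E 0) * w" for i by (simp add: mult.assoc)
  have z: "b 1 * (a 2 * (b 2 * w)) = 0" "b 2 * (a 1 * (b 1 * w)) = 0" "b 1 * w = 0" "b 2 * w = 0"
    by (simp_all add: arrows_squares)
  obtain \<alpha> \<beta> where 1: "E 1 * y * E 0 = \<alpha> \<star> b 1 + \<beta> \<star> (b 1 * (a 2 * b 2))" using span_i0(1) by blast
  obtain \<alpha>' \<beta>' where 2: "E 2 * y * E 0 = \<alpha>' \<star> b 2 + \<beta>' \<star> (b 2 * (a 1 * b 1))" using span_i0(2) by blast
  show "E 1 * x = 0" unfolding x E unfolding 1 by (simp add: distrib_right mult.assoc z)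
  show "E 2 * x = 0" unfolding x E unfolding 2 by (simp add: distrib_right mult.assoc z)
qed

lemma not_in_Lw: "b 1 \<notin> L w" "b 2 \<notin> L w" "b 1 * (a 2 * b 2) \<notin> L w" "b 2 * (a 1 * b 1) \<notin> L w"
  "a 1 * b 1 \<notin> L w" "a 2 * b 2 \<notin> L w"
proof -
  show 1: "b 1 \<notin> L w" "b 2 \<notin> L w" "b 1 * (a 2 * b 2) \<notin> L w" "b 2 * (a 1 * b 1) \<notin> L w"
    using Lw_E(1)[of "b 1"] Lw_E(2)[of "b 2"] Lw_E(1)[of "b 1 * (a 2 * b 2)"] Lw_E(2)[of "b 2 * (a 1 * b 1)"] arrows_nonzero
    by (auto simp: E_bx E_b)
  show "a 1 * b 1 \<notin> L w" "a 2 * b 2 \<notin> L w"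
    using 1 lidealD(3)[OF lideal_L, of "a 1 * b 1" w "b 2"] lidealD(3)[OF lideal_L, of "a 2 * b 2" w "b 1"] by auto
qed

lemma hq_gen:
  assumes "local_gen kA5 u J RM (gcoef m)" "m \<in> sumset (L (b 1)) (L (b 2))" "m \<notin> L w"
  shows "local_gen kA5 u J HM (hq m)"
proof -
  have "local_gen kA5 u J HX (gcoef m)" using assms(1,2) by (simp add: local_gen_def HX_def mem_gcoef)
  from local_gen_hom_image[OF this hq_props(1)] show ?thesis
    using hq_zero_iff[OF assms(2)] assms(3) unfolding hq_def by blast
qed

lemma in_heart: "x * b 1 \<in> sumset (L (b 1)) (L (b 2))" "x * b 2 \<in> sumset (L (b 1)) (L (b 2))"
  "x * (y * b 1) \<in> sumset (L (b 1)) (L (b 2))" "x * (y * b 2) \<in> sumset (L (b 1)) (L (b 2))"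
  using lidealD(3)[OF heart_lideal] b_in_heart by blast+

lemma heart_series:
  "local_series kA5 HM [(gcoef (e 2), gcoef ` I2, hq (b 2)), (gcoef (E 0), gcoef ` I0, hq (a 2 * b 2)),
     (gcoef (e 1), gcoef ` I1, hq (b 1 * (a 2 * b 2)))] (hq ` L (b 2))"
  "local_series kA5 HM [(gcoef (e 1), gcoef ` I1, hq (b 1)), (gcoef (E 0), gcoef ` I0, hq (a 1 * b 1)),
     (gcoef (e 2), gcoef ` I2, hq (b 2 * (a 1 * b 1)))] (hq ` L (b 1))"
  by (simp_all add: hq_gen gen_b gen_ab gen_bab in_heart b_in_heart not_in_Lw hq_smult_img path_imgs hq_Lw)

lemma heart_uniserial: "uniserial kA5 (HM\<lparr>carrier := hq ` L (b 2)\<rparr>)" "uniserial kA5 (HM\<lparr>carrier := hq ` L (b 1)\<rparr>)"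
  by (rule uniserial_local_series[OF HM_module heart_series(1)] uniserial_local_series[OF HM_module heart_series(2)])+

lemma heart_layers:
  "has_radical_layers kA5 (HM\<lparr>carrier := hq ` L (b 2)\<rparr>) [mod_iso kA5 M2, mod_iso kA5 M0, mod_iso kA5 M1]"
  "has_radical_layers kA5 (HM\<lparr>carrier := hq ` L (b 1)\<rparr>) [mod_iso kA5 M1, mod_iso kA5 M0, mod_iso kA5 M2]"
  by (rule has_radical_layers_local_series[OF HM_module heart_series(1)],
      simp add: gen_layer[OF HM_module _ cyclics(1)] gen_layer[OF HM_module _ cyclics(2)] gen_layer[OF HM_module _ cyclics(3)])
     (rule has_radical_layers_local_series[OF HM_module heart_series(2)],
      simp add: gen_layer[OF HM_module _ cyclics(1)] gen_layer[OF HM_module _ cyclics(2)] gen_layer[OF HM_module _ cyclics(3)])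

lemma hq_hom: "x \<in> sumset (L (b 1)) (L (b 2)) \<Longrightarrow> y \<in> sumset (L (b 1)) (L (b 2)) \<Longrightarrow> hq (x + y) = hq x \<oplus>\<^bsub>HM\<^esub> hq y"
  "x \<in> sumset (L (b 1)) (L (b 2)) \<Longrightarrow> hq (z * x) = gcoef z \<odot>\<^bsub>HM\<^esub> hq x"
proof -
  have c: "carrier HX = gcoef ` sumset (L (b 1)) (L (b 2))" by (simp add: HX_def)
  show "hq (x + y) = hq x \<oplus>\<^bsub>HM\<^esub> hq y" if "x \<in> sumset (L (b 1)) (L (b 2))" "y \<in> sumset (L (b 1)) (L (b 2))"
    using mod_homD(2)[OF hq_props(1), of "gcoef x" "gcoef y"] that unfolding c mem_gcoef hq_def by (simp add: gcoef_ops HX_def)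
  show "hq (z * x) = gcoef z \<odot>\<^bsub>HM\<^esub> hq x" if "x \<in> sumset (L (b 1)) (L (b 2))"
    using mod_homD(3)[OF hq_props(1), of "gcoef z" "gcoef x"] that unfolding c mem_gcoef hq_def by (simp add: gcoef_ops HX_def)
qed

lemma heart_carrier: "carrier HM = hq ` sumset (L (b 1)) (L (b 2))"
  using hq_props(2) by (simp add: HX_def hq_def image_image)

text \<open>The two submodules generated by \<open>b 1\<close> and \<open>b 2\<close> meet exactly in the socle \<open>A w\<close>, which is divided out.\<close>

lemma heart_sum: "internal_sum kA5 HM (hq ` L (b 2)) (hq ` L (b 1))"
proof -
  interpret HM: left_module kA5 HM by (rule HM_module)
  have sub: "submodule (hq ` L (b 2)) kA5 HM" "submodule (hq ` L (b 1)) kA5 HM"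
    using local_series_chain[OF HM_module] heart_series by blast+
  have LH: "L (b 1) \<subseteq> sumset (L (b 1)) (L (b 2))" "L (b 2) \<subseteq> sumset (L (b 1)) (L (b 2))"
    using mem_sumset[OF lideal_L lideal_L] by auto
  have "hq x = \<zero>\<^bsub>HM\<^esub>" if x: "x \<in> L (b 2)" "y \<in> L (b 1)" "hq x = hq y" for x y
  proof -
    have xy: "x \<in> sumset (L (b 1)) (L (b 2))" "y \<in> sumset (L (b 1)) (L (b 2))" using x LH by auto
    have "hq (x + y) = hq (y + y)" using hq_hom(1)[OF xy] hq_hom(1)[OF xy(2,2)] x(3) by simp
    also have "\<dots> = \<zero>\<^bsub>HM\<^esub>" using hq_Lw lidealD(1)[OF lideal_L[of w]] by auto
    finally have "x + y \<in> L w" using hq_zero_iff[of "x + y"] lidealD(2)[OF heart_lideal xy] by simp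
    then have "x + y \<in> L (b 1)" using L_b_Int by blast
    then have "x \<in> L (b 1)" using lideal_add_cancel[OF lideal_L] x(2) by blast
    then have "x \<in> L w" using x(1) L_b_Int by blast
    then show ?thesis using hq_zero_iff[OF xy(1)] by simp
  qed
  then have "hq ` L (b 2) \<inter> hq ` L (b 1) = {\<zero>\<^bsub>HM\<^esub>}"
  proof -
    assume h: "\<And>x y. x \<in> L (b 2) \<Longrightarrow> y \<in> L (b 1) \<Longrightarrow> hq x = hq y \<Longrightarrow> hq x = \<zero>\<^bsub>HM\<^esub>"
    have "z = \<zero>\<^bsub>HM\<^esub>" if z: "z \<in> hq ` L (b 2)" "z \<in> hq ` L (b 1)" for z
    proof -
      obtain x y where "x \<in> L (b 2)" "z = hq x" "y \<in> L (b 1)" "z = hq y" using z by blast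
      then show ?thesis using h[of x y] by simp
    qed
    moreover have "\<zero>\<^bsub>HM\<^esub> \<in> hq ` L (b 2)" "\<zero>\<^bsub>HM\<^esub> \<in> hq ` L (b 1)"
      using sub unfolding HM.submodule_iff by simp_all
    ultimately show ?thesis by blast
  qed
  moreover have "hq ` L (b 2) <+>\<^bsub>HM\<^esub> hq ` L (b 1) = carrier HM"
  proof
    show "hq ` L (b 2) <+>\<^bsub>HM\<^esub> hq ` L (b 1) \<subseteq> carrier HM"
      using HM.submodule_add[OF sub] unfolding HM.submodule_iff by (rule conjunct1)
    show "carrier HM \<subseteq> hq ` L (b 2) <+>\<^bsub>HM\<^esub> hq ` L (b 1)"
    proof
      fix z assume "z \<in> carrier HM"
      then obtain x y where "x \<in> L (b 1)" "y \<in> L (b 2)" "z = hq (x + y)" unfolding heart_carrier sumset_def by blast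
      moreover from this have "z = hq (y + x)" by (simp add: add.commute)
      moreover have "hq (y + x) = hq y \<oplus>\<^bsub>HM\<^esub> hq x" using calculation(1,2) LH by (intro hq_hom(1)) auto
      ultimately show "z \<in> hq ` L (b 2) <+>\<^bsub>HM\<^esub> hq ` L (b 1)" unfolding HM.mem_set_add by blast
    qed
  qed
  ultimately show ?thesis unfolding internal_sum_def using sub by blast
qed

lemma P4_iso: "mod_iso kA5 (PM (f 1)) M4"
proof -
  interpret M4: left_module kA5 M4 using T4 by (simp add: top_module_def)
  have v: "v4 \<in> carrier M4" "smult_set M4 (carrier kA5) v4 = carrier M4" using T4 by (auto simp: top_module_def)
  let ?h = "\<lambda>z. z \<odot>\<^bsub>M4\<^esub> v4"
  have h: "?h (gcoef (x * f 1)) = gcoef x \<odot>\<^bsub>M4\<^esub> v4" for x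
    using v fix_v(4) by (simp add: gcoef_ops M4.smult_assoc1)
  have c: "carrier (PM (f 1)) = gcoef ` L (f 1)" by (simp add: smult_set_RM_carrier)
  have "?h \<in> mod_hom kA5 (PM (f 1)) M4"
  proof (rule mod_homI)
    fix z y assume "z \<in> carrier (PM (f 1))" "y \<in> carrier (PM (f 1))"
    then have "z \<in> carrier kA5" "y \<in> carrier kA5" unfolding c by auto
    then show "?h (z \<oplus>\<^bsub>PM (f 1)\<^esub> y) = ?h z \<oplus>\<^bsub>M4\<^esub> ?h y"
      using M4.smult_l_distr[OF _ _ v(1), of z y] by simp
  next
    fix z y assume zy: "z \<in> carrier (kA5 :: ((nat \<Rightarrow> nat) \<Rightarrow> 'k) ring)" "y \<in> carrier (PM (f 1))"
    then have "y \<in> carrier kA5" unfolding c by auto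
    then show "?h (z \<odot>\<^bsub>PM (f 1)\<^esub> y) = z \<odot>\<^bsub>M4\<^esub> ?h y"
      using M4.smult_assoc1[OF zy(1) _ v(1), of y] by simp
  next
    fix z assume "z \<in> carrier (PM (f 1))"
    then obtain x where "z = gcoef x" unfolding c by blast
    then show "?h z \<in> carrier M4" using v(1) by simp
  qed
  moreover have "inj_on ?h (carrier (PM (f 1)))"
  proof (rule inj_onI)
    fix z y assume zy: "z \<in> carrier (PM (f 1))" "y \<in> carrier (PM (f 1))" "?h z = ?h y"
    obtain x x' where x: "z = gcoef (x * f 1)" "y = gcoef (x' * f 1)" using zy(1,2) unfolding c img_def by blast
    have "gcoef (x + x') \<odot>\<^bsub>M4\<^esub> v4 = gcoef (x' + x') \<odot>\<^bsub>M4\<^esub> v4"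
      using zy(3) unfolding x h gcoef_ops(2) by (simp only: M4.smult_l_distr[OF gcoef_mem gcoef_mem v(1)])
    then have "gcoef (x + x') \<odot>\<^bsub>M4\<^esub> v4 = \<zero>\<^bsub>M4\<^esub>" using v(1) by (simp add: gcoef_ops(4))
    then have "(x + x') * f 1 \<in> img I4 (f 1)" by (auto simp: img_def annih_def)
    then have "x * f 1 + x' * f 1 = 0" unfolding img_f[OF ideals(4)] by (simp add: distrib_right)
    then have "x * f 1 + (x' * f 1 + x' * f 1) = x' * f 1" unfolding add.assoc[symmetric] by simp
    then show "z = y" unfolding x by simp
  qed
  moreover have "?h ` carrier (PM (f 1)) = carrier M4"
  proof -
    have "?h ` carrier (PM (f 1)) = range (\<lambda>x. gcoef x \<odot>\<^bsub>M4\<^esub> v4)"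
      unfolding c img_def image_image h ..
    also have "\<dots> = smult_set M4 (carrier kA5) v4" unfolding smult_set_def carrier_range image_image ..
    finally show ?thesis unfolding v(2) .
  qed
  ultimately show ?thesis unfolding mod_iso_def bij_betw_def by blast
qed

lemma J_img: assumes "\<And>c. x * c \<in> I" "z \<in> L m" shows "x * z \<in> img I m"
proof -
  obtain c where "z = c * m" using assms(2) by (auto simp: img_def)
  then have "x * z = (x * c) * m" by (simp add: mult.assoc)
  then show ?thesis using assms(1) by (auto simp: img_def)
qed

lemma J_sumset:
  assumes "\<And>z. z \<in> A \<Longrightarrow> x * z \<in> A'" "\<And>z. z \<in> B \<Longrightarrow> x * z \<in> B'" "z \<in> sumset A B"
  shows "x * z \<in> sumset A' B'"
proof -
  obtain y y' where z: "y \<in> A" "y' \<in> B" "z = y + y'" using assms(3) unfolding sumset_def by blast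
  have "x * z = x * y + x * y'" by (simp add: z(3) distrib_left)
  then show ?thesis using assms(1)[OF z(1)] assms(2)[OF z(2)] unfolding sumset_def by blast
qed

text \<open>The filtrations \<open>N i\<close> are the radical series of the four modules, padded by \<open>{0}\<close>. Left multiplication by an
  element \<open>x\<close> with all \<open>x c\<close> in the four annihilators moves each of them one step down.\<close>

lemma pim_classification:
  assumes Q: "projective_indecomposable kA5 (Q :: ((nat \<Rightarrow> nat) \<Rightarrow> 'k, 'q) module)"
  shows "mod_iso kA5 Q (PM (E 0)) \<or> mod_iso kA5 Q (PM (e 1)) \<or> mod_iso kA5 Q (PM (e 2)) \<or> mod_iso kA5 Q (PM (f 1))"
proof -
  define N where "N = (\<lambda>(i::nat) (t::nat).
     if i = 0 then if t = 0 then L (E 0) else if t = 1 then sumset (L (b 1)) (L (b 2))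
       else if t = 2 then sumset (L (a 1 * b 1)) (L (a 2 * b 2))
       else if t = 3 then sumset (L (b 2 * (a 1 * b 1))) (L (b 1 * (a 2 * b 2))) else if t = 4 then L w else {0}
     else if i = 1 then if t = 0 then L (e 1) else if t = 1 then L (a 1) else if t = 2 then L (b 2 * a 1)
       else if t = 3 then L (a 2 * (b 2 * a 1)) else if t = 4 then L (b 1 * (a 2 * (b 2 * a 1))) else {0}
     else if i = 2 then if t = 0 then L (e 2) else if t = 1 then L (a 2) else if t = 2 then L (b 1 * a 2)
       else if t = 3 then L (a 1 * (b 1 * a 2)) else if t = 4 then L (b 2 * (a 1 * (b 1 * a 2))) else {0}
     else if t = 0 then L (f 1) else {0})"
  have zero: "lideal {0}" by (simp add: lideal_def)
  have late: "N i t = {0}" if "5 \<le> t" for i t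
    using that unfolding N_def by simp
  have lid: "lideal (N i t)" for i t
    unfolding N_def by (simp add: zero lideal_L lideal_sumset)
  have step: "x * z \<in> N i (Suc t)"
    if x: "\<And>c. x * c \<in> I0" "\<And>c. x * c \<in> I1" "\<And>c. x * c \<in> I2" "\<And>c. x * c \<in> I4" and z: "z \<in> N i t" for x z i t
  proof -
    note J = J_img[OF x(1)] J_img[OF x(2)] J_img[OF x(3)] J_img[OF x(4)]
    have s0: "z \<in> L (E 0) \<Longrightarrow> x * z \<in> sumset (L (b 1)) (L (b 2))"
      using J(1)[of z "E 0"] unfolding path_imgs img_f[OF ideals(4)] .
    have s1: "z \<in> sumset (L (b 1)) (L (b 2)) \<Longrightarrow> x * z \<in> sumset (L (a 1 * b 1)) (L (a 2 * b 2))"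
      by (rule J_sumset[of "L (b 1)" x "img I1 (b 1)" "L (b 2)" "img I2 (b 2)" z, OF J(2) J(3), unfolded path_imgs])
    have s2: "z \<in> sumset (L (a 1 * b 1)) (L (a 2 * b 2)) \<Longrightarrow> x * z \<in> sumset (L (b 2 * (a 1 * b 1))) (L (b 1 * (a 2 * b 2)))"
      by (rule J_sumset[of "L (a 1 * b 1)" x "img I0 (a 1 * b 1)" "L (a 2 * b 2)" "img I0 (a 2 * b 2)" z, OF J(1) J(1), unfolded path_imgs])
    have s3: "z \<in> sumset (L (b 2 * (a 1 * b 1))) (L (b 1 * (a 2 * b 2))) \<Longrightarrow> x * z \<in> sumset (L w) (L w)"
      by (rule J_sumset[of "L (b 2 * (a 1 * b 1))" x "img I2 (b 2 * (a 1 * b 1))" "L (b 1 * (a 2 * b 2))" "img I1 (b 1 * (a 2 * b 2))" z, OF J(3) J(2), unfolded path_imgs])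
    have s4: "z \<in> L w \<Longrightarrow> x * z \<in> {0}"
      using J(1)[of z w] unfolding path_imgs img_f[OF ideals(4)] .
    have s5: "z \<in> L (e 1) \<Longrightarrow> x * z \<in> L (a 1)"
      using J(2)[of z "e 1"] unfolding path_imgs img_f[OF ideals(4)] .
    have s6: "z \<in> L (a 1) \<Longrightarrow> x * z \<in> L (b 2 * a 1)"
      using J(1)[of z "a 1"] unfolding path_imgs img_f[OF ideals(4)] .
    have s7: "z \<in> L (b 2 * a 1) \<Longrightarrow> x * z \<in> L (a 2 * (b 2 * a 1))"
      using J(3)[of z "b 2 * a 1"] unfolding path_imgs img_f[OF ideals(4)] .
    have s8: "z \<in> L (a 2 * (b 2 * a 1)) \<Longrightarrow> x * z \<in> L (b 1 * (a 2 * (b 2 * a 1)))"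
      using J(1)[of z "a 2 * (b 2 * a 1)"] unfolding path_imgs img_f[OF ideals(4)] .
    have s9: "z \<in> L (b 1 * (a 2 * (b 2 * a 1))) \<Longrightarrow> x * z \<in> {0}"
      using J(2)[of z "b 1 * (a 2 * (b 2 * a 1))"] unfolding path_imgs img_f[OF ideals(4)] .
    have s10: "z \<in> L (e 2) \<Longrightarrow> x * z \<in> L (a 2)"
      using J(3)[of z "e 2"] unfolding path_imgs img_f[OF ideals(4)] .
    have s11: "z \<in> L (a 2) \<Longrightarrow> x * z \<in> L (b 1 * a 2)"
      using J(1)[of z "a 2"] unfolding path_imgs img_f[OF ideals(4)] .
    have s12: "z \<in> L (b 1 * a 2) \<Longrightarrow> x * z \<in> L (a 1 * (b 1 * a 2))"
      using J(2)[of z "b 1 * a 2"] unfolding path_imgs img_f[OF ideals(4)] .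
    have s13: "z \<in> L (a 1 * (b 1 * a 2)) \<Longrightarrow> x * z \<in> L (b 2 * (a 1 * (b 1 * a 2)))"
      using J(1)[of z "a 1 * (b 1 * a 2)"] unfolding path_imgs img_f[OF ideals(4)] .
    have s14: "z \<in> L (b 2 * (a 1 * (b 1 * a 2))) \<Longrightarrow> x * z \<in> {0}"
      using J(3)[of z "b 2 * (a 1 * (b 1 * a 2))"] unfolding path_imgs img_f[OF ideals(4)] .
    have s15: "z \<in> L (f 1) \<Longrightarrow> x * z \<in> {0}"
      using J(4)[of z "f 1"] unfolding path_imgs img_f[OF ideals(4)] .
    consider "5 \<le> t" | "t = 0" | "t = 1" | "t = 2" | "t = 3" | "t = 4" by linarith
    then show ?thesis
    proof cases
      case 1
      then show ?thesis using z late[of t i] late[of "Suc t" i] by simp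
    next
      case 2
      then show ?thesis using z s0 s5 s10 s15 by (simp add: N_def One_nat_def[symmetric] split: if_splits)
    next
      case 3
      then show ?thesis using z s1 s6 s11 by (auto simp add: N_def One_nat_def[symmetric] split: if_splits)
    next
      case 4
      then show ?thesis using z s2 s7 s12 by (auto simp add: N_def split: if_splits)
    next
      case 5
      then show ?thesis using z s3 s8 s13 unfolding sumset_zero(3)[OF lideal_L] by (auto simp add: N_def split: if_splits)
    next
      case 6
      then show ?thesis using z s4 s9 s14 by (auto simp add: N_def split: if_splits)
    qed
  qed
  have N0: "N 0 0 = L (E 0)" "N 1 0 = L (e 1)" "N 2 0 = L (e 2)" "N 3 0 = L (f 1)"
    unfolding N_def by simp_all
  define Z where "Z t = gcoef ` {z. \<forall>c. z * c * E 0 \<in> N 0 t \<and> z * c * e 1 \<in> N 1 t \<and> z * c * e 2 \<in> N 2 t \<and> z * c * f 1 \<in> N 3 t}" for t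
  let ?es = "{(gcoef (E 0), gcoef ` I0), (gcoef (e 1), gcoef ` I1), (gcoef (e 2), gcoef ` I2), (gcoef (f 1), gcoef ` I4)}"
  have "\<exists>(u, I)\<in>?es. mod_iso kA5 Q (principal_module kA5 u)"
  proof (rule projective_indecomposable_iso_principal[OF kA5_ring Q, where Z = Z and r = 5])
    fix u I assume "(u, I) \<in> ?es"
    then show "u \<otimes>\<^bsub>kA5\<^esub> u = u \<and> local_top kA5 u I" using idem tops by auto
  next
    show "Z 0 = carrier kA5" unfolding Z_def N0 carrier_range by (simp add: L_times)
    show "Z 5 = {\<zero>\<^bsub>kA5\<^esub>}"
    proof -
      have coll: "{z. P z} = {0}" if "\<And>z. P z \<Longrightarrow> z = 0" "P 0" for P :: "'k galg \<Rightarrow> bool"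
        using that by blast
      have "z = 0" if z: "\<forall>c. z * c * E 0 = 0 \<and> z * c * e 1 = 0 \<and> z * c * e 2 = 0 \<and> z * c * f 1 = 0" for z
      proof -
        have "z * 1 * E 0 = 0" "z * 1 * e 1 = 0" "z * 1 * e 2 = 0" "z * 1 * f 1 = 0" "z * S * e 1 = 0" "z * S * e 2 = 0"
          "z * S * f 1 = 0" "z * p * f 1 = 0" "z * (S * p) * f 1 = 0" using z by blast+
        then have "\<forall>k<9. z * YY ! k = 0" unfolding less9 by (simp add: YY_def mult.assoc p_f)
        then have "(\<Sum>k<9. z * YY ! k * XX ! k) = 0" by simp
        then have "z * (\<Sum>k<9. YY ! k * XX ! k) = 0" by (simp only: sum_distrib_left mult.assoc)
        then show ?thesis unfolding YY_XX by simp
      qed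
      moreover have "\<forall>c. 0 * c * E 0 = 0 \<and> 0 * c * e 1 = 0 \<and> 0 * c * e 2 = 0 \<and> 0 * c * f 1 = 0" by simp
      ultimately have "{z. \<forall>c. z * c * E 0 \<in> {0} \<and> z * c * e 1 \<in> {0} \<and> z * c * e 2 \<in> {0} \<and> z * c * f 1 \<in> {0}} = {0}"
        unfolding singleton_iff by (rule coll)
      then show ?thesis unfolding Z_def late[of 5, OF order_refl] by (simp add: gcoef_ops)
    qed
    fix t
    show "\<zero>\<^bsub>kA5\<^esub> \<in> Z t" unfolding Z_def gcoef_ops(4)[symmetric] mem_gcoef using lidealD(1)[OF lid] by simp
    show "x \<oplus>\<^bsub>kA5\<^esub> y \<in> Z t" if xy: "x \<in> Z t" "y \<in> Z t" for x y
    proof -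
      obtain x' y' where "x = gcoef x'" "y = gcoef y'" using xy unfolding Z_def by blast
      then show ?thesis using xy lidealD(2)[OF lid] unfolding Z_def by (simp add: gcoef_ops(2)[symmetric] mem_gcoef distrib_right)
    qed
    fix x z assume x: "x \<in> carrier kA5" and z: "z \<in> Z t"
      and J: "\<And>u I c. (u, I) \<in> ?es \<Longrightarrow> c \<in> carrier kA5 \<Longrightarrow> x \<otimes>\<^bsub>kA5\<^esub> c \<in> I"
    obtain x' z' where x': "x = gcoef x'" "z = gcoef z'" using x z unfolding Z_def carrier_range by blast
    have J': "x' * c \<in> I0" "x' * c \<in> I1" "x' * c \<in> I2" "x' * c \<in> I4" for c
      using J[of "gcoef (E 0)" "gcoef ` I0" "gcoef c"] J[of "gcoef (e 1)" "gcoef ` I1" "gcoef c"]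
        J[of "gcoef (e 2)" "gcoef ` I2" "gcoef c"] J[of "gcoef (f 1)" "gcoef ` I4" "gcoef c"]
      unfolding x' gcoef_ops(1)[symmetric] mem_gcoef by simp_all
    have "x' * (z' * c * u) \<in> N i (Suc t)" if "z' * c * u \<in> N i t" for c u i using step[OF J' that] .
    then show "x \<otimes>\<^bsub>kA5\<^esub> z \<in> Z (Suc t)"
      using z unfolding x' gcoef_ops(1)[symmetric] Z_def mem_gcoef by (simp add: mult.assoc)
  qed
  then show ?thesis by auto
qed

end

section \<open>The four simple modules\<close>

lemma sum_single: "p \<in> carrier A5 \<Longrightarrow> (\<Sum>g\<in>carrier A5. gcoef (single p) g * F g) = F p"
  by (simp add: gcoef_single if_distrib[of "\<lambda>u. u * _"] cong: if_cong)

lemma kA5_ops: "(a \<oplus>\<^bsub>kA5\<^esub> b) g = a g + b g" "\<one>\<^bsub>kA5\<^esub> g = (if g = id then 1 else 0)"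
  by (simp_all add: kA5_def group_algebra_def)

lemma sum_kA5_mult:
  "(\<Sum>g\<in>carrier A5. (a \<otimes>\<^bsub>kA5\<^esub> b) g * F g) = (\<Sum>x\<in>carrier A5. a x * (\<Sum>y\<in>carrier A5. b y * F (x \<circ> y)))"
  unfolding kA5_def group_algebra_sum_mult[OF A5_group A5_finite] by (simp add: sum_distrib_left mult.assoc)

lemma sum_kA5_one: "(\<Sum>g\<in>carrier A5. \<one>\<^bsub>kA5\<^esub> g * F g) = F id"
  by (simp add: kA5_ops if_distrib[of "\<lambda>u. u * _"] cong: if_cong)

lemma left_moduleI:
  assumes "ring R" "abelian_group M"
    and "\<And>a x. a \<in> carrier R \<Longrightarrow> x \<in> carrier M \<Longrightarrow> a \<odot>\<^bsub>M\<^esub> x \<in> carrier M"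
    and "\<And>a b x. a \<in> carrier R \<Longrightarrow> b \<in> carrier R \<Longrightarrow> x \<in> carrier M \<Longrightarrow>
      (a \<oplus>\<^bsub>R\<^esub> b) \<odot>\<^bsub>M\<^esub> x = a \<odot>\<^bsub>M\<^esub> x \<oplus>\<^bsub>M\<^esub> b \<odot>\<^bsub>M\<^esub> x"
    and "\<And>a x y. a \<in> carrier R \<Longrightarrow> x \<in> carrier M \<Longrightarrow> y \<in> carrier M \<Longrightarrow>
      a \<odot>\<^bsub>M\<^esub> (x \<oplus>\<^bsub>M\<^esub> y) = a \<odot>\<^bsub>M\<^esub> x \<oplus>\<^bsub>M\<^esub> a \<odot>\<^bsub>M\<^esub> y"
    and "\<And>a b x. a \<in> carrier R \<Longrightarrow> b \<in> carrier R \<Longrightarrow> x \<in> carrier M \<Longrightarrow>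
      (a \<otimes>\<^bsub>R\<^esub> b) \<odot>\<^bsub>M\<^esub> x = a \<odot>\<^bsub>M\<^esub> (b \<odot>\<^bsub>M\<^esub> x)"
    and "\<And>x. x \<in> carrier M \<Longrightarrow> \<one>\<^bsub>R\<^esub> \<odot>\<^bsub>M\<^esub> x = x"
  shows "left_module R M"
  using assms unfolding left_module_def left_module_axioms_def by blast

lemma S1_simps [simp]: "carrier S1 = UNIV" "\<zero>\<^bsub>S1\<^esub> = 0" "x \<oplus>\<^bsub>S1\<^esub> y = x + y"
  "a \<odot>\<^bsub>S1\<^esub> v = (\<Sum>g\<in>carrier A5. a g * v)"
  by (simp_all add: S1_def char_module_def)

lemma S1_module: "left_module kA5 (S1 :: (_, 'k::field) module)"
proof (rule left_moduleI[OF kA5_ring])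
  show "abelian_group (S1 :: (_, 'k) module)"
    by (rule abelian_groupI) (auto simp: add_ac intro: exI[of _ "- _"])
qed (simp_all add: sum_kA5_mult sum_kA5_one kA5_ops(1) distrib_left distrib_right sum.distrib)

lemma matrix_module_simps [simp]: "carrier (matrix_module A5 \<rho>) = UNIV" "\<zero>\<^bsub>matrix_module A5 \<rho>\<^esub> = 0"
  "x \<oplus>\<^bsub>matrix_module A5 \<rho>\<^esub> y = x + y"
  "a \<odot>\<^bsub>matrix_module A5 \<rho>\<^esub> v = (\<chi> i. \<Sum>g\<in>carrier A5. a g * (\<rho> g *v v) $ i)"
  by (simp_all add: matrix_module_def vec_eq_iff)

lemma matrix_vector_sum: "A *v (\<chi> i. \<Sum>g\<in>X. c g * f g $ i) = (\<chi> i. \<Sum>g\<in>X. c g * (A *v f g) $ i)"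
  for A :: "'k::field^'n^'m"
  by (simp add: vec_eq_iff matrix_vector_mult_def sum_distrib_left mult_ac) (rule allI, subst sum.swap, rule refl)

lemma matrix_module_left_module:
  fixes \<rho> :: "(nat \<Rightarrow> nat) \<Rightarrow> 'k::field^'n^'n"
  assumes "\<And>p q. p \<in> carrier A5 \<Longrightarrow> q \<in> carrier A5 \<Longrightarrow> \<rho> (p \<circ> q) = \<rho> p ** \<rho> q" "\<rho> id = mat 1"
  shows "left_module kA5 (matrix_module A5 \<rho>)"
proof (rule left_moduleI[OF kA5_ring])
  show "abelian_group (matrix_module A5 \<rho>)"
    by (rule abelian_groupI) (auto simp: add_ac intro: exI[of _ "- _"])
next
  fix a b v
  show "(a \<otimes>\<^bsub>kA5\<^esub> b) \<odot>\<^bsub>matrix_module A5 \<rho>\<^esub> v = a \<odot>\<^bsub>matrix_module A5 \<rho>\<^esub> (b \<odot>\<^bsub>matrix_module A5 \<rho>\<^esub> v)"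
    unfolding matrix_module_simps matrix_vector_sum sum_kA5_mult
    by (simp add: assms(1) matrix_vector_mul_assoc cong: sum.cong)
next
  fix v show "\<one>\<^bsub>kA5\<^esub> \<odot>\<^bsub>matrix_module A5 \<rho>\<^esub> v = v"
    unfolding matrix_module_simps sum_kA5_one assms(2) by simp
qed (simp_all add: vec_eq_iff kA5_ops(1) distrib_left distrib_right sum.distrib matrix_vector_right_distrib)

lemma S4_simps [simp]: "carrier S4 = {f. (\<forall>i. i \<notin> {1..5} \<longrightarrow> f i = 0) \<and> (\<Sum>i=1..5. f i) = 0}" "\<zero>\<^bsub>S4\<^esub> = (\<lambda>i. 0)"
  "f \<oplus>\<^bsub>S4\<^esub> f' = (\<lambda>i. f i + f' i)" "a \<odot>\<^bsub>S4\<^esub> f = (\<lambda>i. \<Sum>p\<in>carrier A5. a p * f (inv' p i))"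
  by (simp_all add: S4_def perm_module_def)

lemma S4_module: "left_module kA5 (S4 :: (_, nat \<Rightarrow> 'k::field) module)"
proof (rule left_moduleI[OF kA5_ring])
  show "abelian_group (S4 :: (_, nat \<Rightarrow> 'k) module)"
  proof (rule abelian_groupI)
    fix f :: "nat \<Rightarrow> 'k" assume "f \<in> carrier S4"
    then show "\<exists>f'\<in>carrier S4. f' \<oplus>\<^bsub>S4\<^esub> f = \<zero>\<^bsub>S4\<^esub>"
      by (intro bexI[of _ "\<lambda>i. - f i"]) (auto simp: sum_negf)
  qed (auto simp: add_ac sum.distrib)
next
  fix a and f :: "nat \<Rightarrow> 'k" assume f: "f \<in> carrier S4"
  have "f (inv' p i) = 0" if "p \<in> carrier A5" "i \<notin> {1..5}" for p i
    using f that permutes_not_in[OF permutes_inv, of p "{1..5}" i] by (simp add: A5_carrier)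
  moreover have "(\<Sum>i=1..5. \<Sum>p\<in>carrier A5. a p * f (inv' p i)) = 0"
  proof -
    have "(\<Sum>i=1..5. f (inv' p i)) = 0" if "p \<in> carrier A5" for p
      using f sum.permute[OF permutes_inv, of p "{1..5}" f] that by (simp add: A5_carrier comp_def)
    then have "(\<Sum>p\<in>carrier A5. a p * (\<Sum>i=1..5. f (inv' p i))) = 0" by simp
    then show ?thesis unfolding sum_distrib_left by (subst sum.swap)
  qed
  ultimately show "a \<odot>\<^bsub>S4\<^esub> f \<in> carrier S4" by simp
next
  fix a b and f :: "nat \<Rightarrow> 'k"
  have "inv' (x \<circ> y) i = inv' y (inv' x i)" if "x \<in> carrier A5" "y \<in> carrier A5" for x y i
    using that o_inv_distrib[of x y] permutes_bij[of x "{1..5}"] permutes_bij[of y "{1..5}"] by (auto simp: A5_carrier)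
  then show "(a \<otimes>\<^bsub>kA5\<^esub> b) \<odot>\<^bsub>S4\<^esub> f = a \<odot>\<^bsub>S4\<^esub> (b \<odot>\<^bsub>S4\<^esub> f)"
    by (simp add: sum_kA5_mult cong: sum.cong)
next
  fix f :: "nat \<Rightarrow> 'k"
  show "\<one>\<^bsub>kA5\<^esub> \<odot>\<^bsub>S4\<^esub> f = f" by (simp only: S4_simps sum_kA5_one) (simp add: inv_id)
qed (simp_all add: kA5_ops(1) distrib_left distrib_right sum.distrib)

locale kA5_module = left_module kA5 M for M :: "((nat \<Rightarrow> nat) \<Rightarrow> 'k::field, 's) module"
begin

abbreviation act :: "'k galg \<Rightarrow> 's \<Rightarrow> 's" (infixr \<open>\<cdot>\<close> 75) where "y \<cdot> x \<equiv> gcoef y \<odot>\<^bsub>M\<^esub> x"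

lemma act: assumes "x \<in> carrier M"
  shows "y \<cdot> x \<in> carrier M" "(y * z) \<cdot> x = y \<cdot> z \<cdot> x" "(y + z) \<cdot> x = y \<cdot> x \<oplus>\<^bsub>M\<^esub> z \<cdot> x" "1 \<cdot> x = x" "0 \<cdot> x = \<zero>\<^bsub>M\<^esub>"
    "y \<cdot> \<zero>\<^bsub>M\<^esub> = \<zero>\<^bsub>M\<^esub>"
  using assms by (simp_all add: gcoef gcoef_ring smult_l_distr smult_assoc1)

lemma act_add: "x \<in> carrier M \<Longrightarrow> x' \<in> carrier M \<Longrightarrow> y \<cdot> (x \<oplus>\<^bsub>M\<^esub> x') = y \<cdot> x \<oplus>\<^bsub>M\<^esub> y \<cdot> x'"
  by (rule smult_r_distr[OF gcoef])

lemma act_scale: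
  assumes "x \<in> carrier M" shows "y \<cdot> (c \<star> 1) \<cdot> x = (c \<star> y) \<cdot> x" "(c \<star> 1) \<cdot> y \<cdot> x = (c \<star> y) \<cdot> x"
  using assms by (simp_all add: act(2)[symmetric])

end

locale fifth_root_module = fifth_root \<zeta> + kA5_module M
  for \<zeta> :: "'k::field" and M :: "((nat \<Rightarrow> nat) \<Rightarrow> 'k, 's) module"
begin

lemma scale_zero: assumes "x \<in> carrier M" "(c \<star> y) \<cdot> x = \<zero>\<^bsub>M\<^esub>" "c \<noteq> 0" shows "y \<cdot> x = \<zero>\<^bsub>M\<^esub>"
proof -
  have "y \<cdot> x = (inverse c \<star> 1) \<cdot> (c \<star> y) \<cdot> x" using assms(1,3) by (simp add: act(2)[symmetric])
  then show ?thesis unfolding assms(2) by (simp add: act(6)[OF assms(1)])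
qed

text \<open>On an eigenvector of \<open>c\<close> for \<open>\<zeta>^i\<close> the relation \<open>E j c = \<zeta>^j E j\<close> forces \<open>(\<zeta>^i - \<zeta>^j) E j x = 0\<close>.\<close>

lemma eigenvector:
  assumes x: "x \<in> carrier M" "C \<cdot> x = (\<zeta> ^ i \<star> 1) \<cdot> x" and ij: "i < 5" "j < 5"
  shows "E j \<cdot> x = (if i = j then x else \<zero>\<^bsub>M\<^esub>)"
proof -
  have z: "E j \<cdot> x = \<zero>\<^bsub>M\<^esub>" if j: "j < 5" "i \<noteq> j" for j
  proof (rule scale_zero[OF x(1)])
    have "(\<zeta> ^ j \<star> E j) \<cdot> x = E j \<cdot> C \<cdot> x" unfolding E_C[symmetric] by (rule act(2)[OF x(1)])
    also have "\<dots> = (\<zeta> ^ i \<star> E j) \<cdot> x" unfolding x(2) by (rule act_scale(1)[OF x(1)])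
    finally have "(\<zeta> ^ i \<star> E j) \<cdot> x \<oplus>\<^bsub>M\<^esub> (\<zeta> ^ j \<star> E j) \<cdot> x = (\<zeta> ^ i \<star> E j + \<zeta> ^ i \<star> E j) \<cdot> x"
      by (simp only: act(3)[OF x(1)])
    then show "((\<zeta> ^ i + \<zeta> ^ j) \<star> E j) \<cdot> x = \<zero>\<^bsub>M\<^esub>"
      by (simp add: scale_add act(3)[OF x(1)] act(5)[OF x(1)])
    show "\<zeta> ^ i + \<zeta> ^ j \<noteq> 0"
    proof
      assume "\<zeta> ^ i + \<zeta> ^ j = 0"
      then have "\<zeta> ^ i = \<zeta> ^ j" by (rule add_zero_eq)
      then have "\<zeta> ^ (4 * j + i) = \<zeta> ^ (4 * j + j)" by (simp only: power_add)
      also have "\<dots> = 1" using root_pow_cong[of "4 * j + j" 0] by simp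
      finally have one: "\<zeta> ^ (4 * j + i) = 1" .
      have "i = 0 \<or> i = 1 \<or> i = 2 \<or> i = 3 \<or> i = 4" "j = 0 \<or> j = 1 \<or> j = 2 \<or> j = 3 \<or> j = 4"
        using ij(1) j(1) by linarith+
      then have "(4 * j + i) mod 5 \<noteq> 0" using j(2) by (elim disjE) simp_all
      then have "(\<Sum>m<5. \<zeta> ^ (m * (4 * j + i))) = 0" by (simp add: power_sum)
      moreover have "\<zeta> ^ (m * (4 * j + i)) = 1" for m
        using one by (simp add: mult.commute[of m] power_mult del: power_add)
      ultimately have "(\<Sum>m<5::nat. 1::'k) = 0" by (simp only:)
      moreover have "(\<Sum>m<5::nat. 1::'k) = 1"
        using power_sum[of 0] by (simp only: mult_0_right power_0 mod_0 if_True refl)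
      ultimately show False by (metis zero_neq_one)
    qed
  qed
  show ?thesis
  proof (cases "i = j")
    case True
    have five: "i = 0 \<or> i = 1 \<or> i = 2 \<or> i = 3 \<or> i = 4" using ij by linarith
    have "x = (E 0 + E 1 + E 2 + E 3 + E 4) \<cdot> x" unfolding sum_E act(4)[OF x(1)] ..
    also have "\<dots> = E i \<cdot> x"
      using five z[of 0] z[of 1] z[of 2] z[of 3] z[of 4] act(1)[OF x(1)] by (auto simp: act(3)[OF x(1)])
    finally show ?thesis using True by simp
  qed (simp add: z ij)
qed

text \<open>In the basis \<open>v\<close>, \<open>s v\<close> write \<open>g v = \<kappa> v + \<mu> s v\<close>. As \<open>g\<close> commutes with \<open>s\<close> and squares to \<open>1\<close>,
  \<open>(\<kappa> + \<mu>)\<^sup>2 = 1\<close>, hence \<open>\<kappa> + \<mu> = 1\<close> in characteristic 2; and \<open>e i v = (\<kappa> + \<mu>) v\<close>.\<close>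

lemma top_module_two:
  assumes i: "i = 1 \<or> i = 2" and v: "v \<in> carrier M" "v \<noteq> \<zero>\<^bsub>M\<^esub>" "C \<cdot> v = (\<zeta> ^ i \<star> 1) \<cdot> v"
    and span: "\<And>x. x \<in> carrier M \<Longrightarrow> \<exists>\<alpha> \<beta>. x = (\<alpha> \<star> 1 + \<beta> \<star> S) \<cdot> v"
  shows "top_module M v (e i) ({0, 1, 2, 3, 4} - {i, neg i})"
proof -
  have E: "E j \<cdot> v = (if i = j then v else \<zero>\<^bsub>M\<^esub>)" if "j < 5" for j
    using eigenvector[OF v(1,3) _ that] i by auto
  have nE: "E (neg i) \<cdot> v = \<zero>\<^bsub>M\<^esub>" using E[of "neg i"] i by auto
  have ES: "E j \<cdot> S \<cdot> v = (if neg i = j then S \<cdot> v else \<zero>\<^bsub>M\<^esub>)" if j: "j < 5" for j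
  proof -
    have "E j \<cdot> S \<cdot> v = E j \<cdot> S \<cdot> E i \<cdot> v" using E[of i] i by auto
    also have "\<dots> = (E j * (S * E i)) \<cdot> v" by (simp only: act(1,2) v(1))
    also have "\<dots> = (E j * E (neg i) * S) \<cdot> v" by (simp only: S_E mult.assoc)
    also have "\<dots> = (if neg i = j then E (neg i) \<cdot> S \<cdot> v else \<zero>\<^bsub>M\<^esub>)"
      using j E_mult[of j "neg i"] by (simp add: act v(1))
    also have "E (neg i) \<cdot> S \<cdot> v = (E (neg i) * S) \<cdot> v" by (simp only: act(2) v(1))
    also have "\<dots> = S \<cdot> E i \<cdot> v" by (simp only: S_E[symmetric] act(2) v(1))
    also have "E i \<cdot> v = v" using E[of i] i by auto
    finally show ?thesis .
  qed
  have kill: "E j \<cdot> x = \<zero>\<^bsub>M\<^esub>" if j: "j \<in> {0, 1, 2, 3, 4} - {i, neg i}" and x: "x \<in> carrier M" for j x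
  proof -
    obtain \<alpha> \<beta> where x': "x = (\<alpha> \<star> 1 + \<beta> \<star> S) \<cdot> v" using span[OF x] by blast
    have j': "j < 5" "i \<noteq> j" "neg i \<noteq> j" using j by auto
    have "E j \<cdot> x = (\<alpha> \<star> 1) \<cdot> E j \<cdot> v \<oplus>\<^bsub>M\<^esub> (\<beta> \<star> 1) \<cdot> E j \<cdot> S \<cdot> v"
      unfolding x' by (simp add: act(2)[symmetric] act(3)[symmetric] act(1) v(1) distrib_left)
    then show ?thesis using j' E[of j] ES[of j] act(6)[OF v(1)] by simp
  qed
  obtain \<kappa> \<mu> where G: "G \<cdot> v = (\<kappa> \<star> 1 + \<mu> \<star> S) \<cdot> v" using span[OF act(1)[OF v(1)], of G] by blast
  define r where "r = \<kappa> \<star> 1 + \<mu> \<star> (S :: 'k galg)"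
  note Gv = G[folded r_def]
  have "v = (G * G) \<cdot> v" by (simp add: group_relations act(4)[OF v(1)])
  also have "\<dots> = (G * r) \<cdot> v" by (simp only: act(2)[OF v(1)] Gv)
  also have "G * r = r * G" by (simp add: r_def distrib_left distrib_right group_relations)
  also have "(r * G) \<cdot> v = (r * r) \<cdot> v" by (simp only: act(2)[OF v(1)] Gv)
  also have "r * r = (\<kappa> * \<kappa> + \<mu> * \<mu>) \<star> 1 + ((\<kappa> * \<mu>) \<star> S + (\<kappa> * \<mu>) \<star> S)"
    by (simp add: r_def distrib_left distrib_right group_relations scale_add add_ac mult.commute)
  also have "\<dots> = (\<kappa> * \<kappa> + \<mu> * \<mu>) \<star> 1" by simp
  finally have "((\<kappa> * \<kappa> + \<mu> * \<mu>) \<star> 1) \<cdot> v \<oplus>\<^bsub>M\<^esub> 1 \<cdot> v = 1 \<cdot> v \<oplus>\<^bsub>M\<^esub> 1 \<cdot> v"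
    by (simp only: act(4)[OF v(1)])
  then have "((\<kappa> * \<kappa> + \<mu> * \<mu> + 1) \<star> 1) \<cdot> v = \<zero>\<^bsub>M\<^esub>"
    by (simp add: act(3)[OF v(1), symmetric] act(5)[OF v(1)] scale_add)
  then have "\<kappa> * \<kappa> + \<mu> * \<mu> + 1 = 0"
    using scale_zero[OF v(1), of _ 1] v(2) act(4)[OF v(1)] by metis
  moreover have "(\<kappa> + \<mu> + 1) * (\<kappa> + \<mu> + 1) = (\<kappa> * \<kappa> + \<mu> * \<mu> + 1) + ((\<kappa> * \<mu> + \<kappa> * \<mu>) + (\<kappa> + \<kappa>) + (\<mu> + \<mu>))"
    by (simp only: distrib_left distrib_right mult_1_left mult_1_right add_ac mult.commute)
  ultimately have "(\<kappa> + \<mu> + 1) * (\<kappa> + \<mu> + 1) = 0" by simp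
  then have "\<kappa> + \<mu> + 1 = 0" by simp
  then have lm: "\<kappa> + \<mu> = 1" using add_zero_eq by blast
  have rr: "(1 + S) * r = 1 + S"
  proof -
    have "(1 + S) * r = (\<kappa> + \<mu>) \<star> 1 + (\<kappa> + \<mu>) \<star> S"
      by (simp add: r_def distrib_left distrib_right group_relations scale_add add_ac)
    then show ?thesis unfolding lm by simp
  qed
  have "e i = E i * ((1 + S) * (G * E i))"
    by (simp add: e_def H_def H'_def distrib_left distrib_right mult.assoc group_relations(4))
  then have "e i \<cdot> v = E i \<cdot> (1 + S) \<cdot> G \<cdot> E i \<cdot> v" by (simp only: act(1,2) v(1))
  also have "E i \<cdot> v = v" using E[of i] i by auto
  also have "(1 + S) \<cdot> G \<cdot> v = (1 + S) \<cdot> v" unfolding Gv act(2)[OF v(1), symmetric] rr ..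
  also have "E i \<cdot> (1 + S) \<cdot> v = E i \<cdot> v \<oplus>\<^bsub>M\<^esub> E i \<cdot> S \<cdot> v"
    by (simp only: act(3)[OF v(1)] act(4)[OF v(1)] act_add[OF v(1) act(1)[OF v(1)]])
  also have "\<dots> = v" using E[of i] ES[of i] i v(1) by auto
  finally have ev: "e i \<cdot> v = v" .
  have gen: "smult_set M (carrier kA5) v = carrier M"
  proof
    show "smult_set M (carrier kA5) v \<subseteq> carrier M" unfolding smult_set_def using v(1) by auto
    show "carrier M \<subseteq> smult_set M (carrier kA5) v" unfolding smult_set_def using span gcoef by blast
  qed
  have kill': "\<forall>j\<in>{0, 1, 2, 3, 4} - {i, neg i}. \<forall>x\<in>carrier M. E j \<cdot> x = \<zero>\<^bsub>M\<^esub>"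
  proof (rule ballI, rule ballI)
    fix j x assume "j \<in> {0, 1, 2, 3, 4} - {i, neg i}" "x \<in> carrier M"
    then show "E j \<cdot> x = \<zero>\<^bsub>M\<^esub>" by (rule kill)
  qed
  have lm: "left_module kA5 M" by unfold_locales
  show ?thesis
    unfolding top_module_def
    by (rule conjI[OF lm conjI[OF v(1) conjI[OF v(2) conjI[OF ev conjI[OF gen kill']]]]])
qed

end

lemma gcoef_S1: "p \<in> carrier A5 \<Longrightarrow> gcoef (single p) \<odot>\<^bsub>S1\<^esub> v = v" "gcoef (c \<star> 1) \<odot>\<^bsub>S1\<^esub> v = c * v"
proof -
  show "p \<in> carrier A5 \<Longrightarrow> gcoef (single p) \<odot>\<^bsub>S1\<^esub> v = v" by (simp add: sum_single)
  show "gcoef (c \<star> 1) \<odot>\<^bsub>S1\<^esub> v = c * v"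
    unfolding single_id[symmetric] by (simp add: mult.assoc sum_distrib_left[symmetric] sum_single del: single_id)
qed

lemma gcoef_matrix: "p \<in> carrier A5 \<Longrightarrow> gcoef (single p) \<odot>\<^bsub>matrix_module A5 \<rho>\<^esub> v = \<rho> p *v v"
  "\<rho> id = mat 1 \<Longrightarrow> gcoef (c \<star> 1) \<odot>\<^bsub>matrix_module A5 \<rho>\<^esub> v = c *s v"
proof -
  show "p \<in> carrier A5 \<Longrightarrow> gcoef (single p) \<odot>\<^bsub>matrix_module A5 \<rho>\<^esub> v = \<rho> p *v v"
    by (simp add: vec_eq_iff sum_single)
  assume "\<rho> id = mat 1"
  then show "gcoef (c \<star> 1) \<odot>\<^bsub>matrix_module A5 \<rho>\<^esub> v = c *s v"
    unfolding single_id[symmetric]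
    by (simp add: vec_eq_iff mult.assoc sum_distrib_left[symmetric] sum_single del: single_id) (simp add: vec_eq_iff[symmetric])
qed

lemma gcoef_S4: "p \<in> carrier A5 \<Longrightarrow> gcoef (single p) \<odot>\<^bsub>S4\<^esub> v = (\<lambda>i. v (inv' p i))" "gcoef (c \<star> 1) \<odot>\<^bsub>S4\<^esub> v = (\<lambda>i. c * v i)"
proof -
  show "p \<in> carrier A5 \<Longrightarrow> gcoef (single p) \<odot>\<^bsub>S4\<^esub> v = (\<lambda>i. v (inv' p i))" by (simp add: sum_single)
  show "gcoef (c \<star> 1) \<odot>\<^bsub>S4\<^esub> v = (\<lambda>i. c * v i)"
    unfolding single_id[symmetric] by (simp add: mult.assoc sum_distrib_left[symmetric] sum_single inv_id del: single_id)
qed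

context fifth_root
begin

lemma top_S1: "top_module S1 1 (E 0) {1, 2, 3, 4}"
proof -
  interpret S: fifth_root_module \<zeta> S1
    by (intro fifth_root_module.intro kA5_module.intro fifth_root_axioms S1_module)
  have E: "gcoef (E j) \<odot>\<^bsub>S1\<^esub> x = (if j = 0 then x else 0)" if "j < 5" for j x
    using S.eigenvector[of x 0 j] that gcoef_S1(1)[of cc x] gcoef_S1(2)[of 1 x] by (simp add: C_def del: S1_simps(4))
  have "x \<in> smult_set S1 (carrier kA5) (1::'k)" for x
    unfolding smult_set_def using gcoef_S1(2)[of x "1::'k"] by (intro image_eqI[of _ _ "gcoef (x \<star> 1)"] gcoef) simp
  then have "smult_set S1 (carrier kA5) (1::'k) = UNIV" by blast
  then show ?thesis unfolding top_module_def using S1_module E by (simp del: S1_simps(4))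
qed

end

section \<open>The permutation module\<close>

definition quint :: "'a::zero \<Rightarrow> 'a \<Rightarrow> 'a \<Rightarrow> 'a \<Rightarrow> 'a \<Rightarrow> nat \<Rightarrow> 'a" where
  "quint a b c d e i = (if i = 1 then a else if i = 2 then b else if i = 3 then c
     else if i = 4 then d else if i = 5 then e else 0)"

lemma quint_eq: "quint a b c d e = quint a' b' c' d' e' \<longleftrightarrow> a = a' \<and> b = b' \<and> c = c' \<and> d = d' \<and> e = e'"
proof
  assume eq: "quint a b c d e = quint a' b' c' d' e'"
  show "a = a' \<and> b = b' \<and> c = c' \<and> d = d' \<and> e = e'"
    using fun_cong[OF eq, of 1] fun_cong[OF eq, of 2] fun_cong[OF eq, of 3] fun_cong[OF eq, of 4]
      fun_cong[OF eq, of 5] by (simp add: quint_def)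
qed simp

lemma quint_S4: "f \<in> carrier S4 \<longleftrightarrow> (\<exists>a b c d e. f = quint a b c d e \<and> a + b + c + d + e = 0)"
proof -
  have s: "{1..5::nat} = {1, 2, 3, 4, 5}" by auto
  have sum: "(\<Sum>i=1..5. f i) = f 1 + f 2 + f 3 + f 4 + f 5" for f :: "nat \<Rightarrow> 'a"
    unfolding s by (simp add: add.assoc)
  show ?thesis
  proof
    assume f: "f \<in> carrier S4"
    have "f i = quint (f 1) (f 2) (f 3) (f 4) (f 5) i" for i
    proof (cases "i \<in> {1..5}")
      case True
      then show ?thesis unfolding s quint_def by auto
    next
      case False
      then have "f i = 0" using f by simp
      moreover have "quint (f 1) (f 2) (f 3) (f 4) (f 5) i = 0" using False unfolding quint_def by auto
      ultimately show ?thesis by simp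
    qed
    then have "f = quint (f 1) (f 2) (f 3) (f 4) (f 5)" by (rule ext)
    moreover have "f 1 + f 2 + f 3 + f 4 + f 5 = 0" using f unfolding sum[symmetric] by simp
    ultimately show "\<exists>a b c d e. f = quint a b c d e \<and> a + b + c + d + e = 0" by blast
  next
    assume "\<exists>a b c d e. f = quint a b c d e \<and> a + b + c + d + e = 0"
    then obtain a b c d e where f: "f = quint a b c d e" "a + b + c + d + e = 0" by blast
    have "f i = 0" if "i \<notin> {1..5}" for i using that unfolding f quint_def by auto
    moreover have "(\<Sum>i=1..5. f i) = 0" unfolding sum using f(2) unfolding f(1) by (simp add: quint_def)
    ultimately show "f \<in> carrier S4" by simp
  qed
qed

lemma inv_perm5: "inv' cc = perm5 5 1 2 3 4" "inv' ss = ss" "inv' gg = gg"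
  by (rule inv_unique_comp; simp add: perm5_defs perm5_id)+

lemma quint_act:
  "gcoef C \<odot>\<^bsub>S4\<^esub> quint a b c d e = quint e a b c d" "gcoef S \<odot>\<^bsub>S4\<^esub> quint a b c d e = quint d c b a e"
  "gcoef G \<odot>\<^bsub>S4\<^esub> quint a b c d e = quint b a d c e"
  "gcoef (k \<star> 1) \<odot>\<^bsub>S4\<^esub> quint a b c d e = quint (k * a) (k * b) (k * c) (k * d) (k * e)"
  "quint a b c d e \<oplus>\<^bsub>S4\<^esub> quint a' b' c' d' e' = quint (a + a') (b + b') (c + c') (d + d') (e + e')"
  unfolding C_def S_def G_def gcoef_S4(2) gcoef_S4(1)[OF A5_gens(1)] gcoef_S4(1)[OF A5_gens(2)] gcoef_S4(1)[OF A5_gens(3)] inv_perm5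
  unfolding S4_simps perm5_defs perm5_def by (rule ext; simp add: quint_def)+

context fifth_root
begin

text \<open>The eigenvectors of the 5-cycle on \<open>k\<^sup>5\<close>.\<close>

definition ev :: "nat \<Rightarrow> nat \<Rightarrow> 'k" where "ev j = quint (\<zeta> ^ (4 * j)) (\<zeta> ^ (3 * j)) (\<zeta> ^ (2 * j)) (\<zeta> ^ j) 1"

lemma ev_eq: "ev 0 = quint 1 1 1 1 1" "ev 1 = quint (\<zeta>^4) (\<zeta>^3) (\<zeta>^2) \<zeta> 1" "ev 2 = quint (\<zeta>^3) \<zeta> (\<zeta>^4) (\<zeta>^2) 1"
  "ev 3 = quint (\<zeta>^2) (\<zeta>^4) \<zeta> (\<zeta>^3) 1" "ev 4 = quint \<zeta> (\<zeta>^2) (\<zeta>^3) (\<zeta>^4) 1"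
proof -
  have "\<zeta>^8 = \<zeta>^3" "\<zeta>^6 = \<zeta>" "\<zeta>^12 = \<zeta>^2" "\<zeta>^9 = \<zeta>^4" "\<zeta>^16 = \<zeta>"
    using root_pow_cong[of 8 3] root_pow_cong[of 6 1] root_pow_cong[of 12 2] root_pow_cong[of 9 4] root_pow_cong[of 16 1] by simp_all
  then show "ev 0 = quint 1 1 1 1 1" "ev 1 = quint (\<zeta>^4) (\<zeta>^3) (\<zeta>^2) \<zeta> 1" "ev 2 = quint (\<zeta>^3) \<zeta> (\<zeta>^4) (\<zeta>^2) 1"
    "ev 3 = quint (\<zeta>^2) (\<zeta>^4) \<zeta> (\<zeta>^3) 1" "ev 4 = quint \<zeta> (\<zeta>^2) (\<zeta>^3) (\<zeta>^4) 1"
    by (simp_all add: ev_def)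
qed

lemma ev_S4: "ev 1 \<in> carrier S4" "ev 2 \<in> carrier S4" "ev 3 \<in> carrier S4" "ev 4 \<in> carrier S4"
  using prim unfolding quint_S4 ev_eq quint_eq by (auto simp: add_ac)

lemma C_ev: "gcoef C \<odot>\<^bsub>S4\<^esub> ev j = gcoef (\<zeta> ^ j \<star> 1) \<odot>\<^bsub>S4\<^esub> ev j"
proof -
  have "\<zeta> ^ j * \<zeta> ^ (4 * j) = 1" "\<zeta> ^ j * \<zeta> ^ (3 * j) = \<zeta> ^ (4 * j)" "\<zeta> ^ j * \<zeta> ^ (2 * j) = \<zeta> ^ (3 * j)"
    "\<zeta> ^ j * \<zeta> ^ j = \<zeta> ^ (2 * j)"
  proof -
    have "j + 3 * j = 4 * j" "j + 2 * j = 3 * j" "j + j = 2 * j" by simp_all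
    then show "\<zeta> ^ j * \<zeta> ^ (3 * j) = \<zeta> ^ (4 * j)" "\<zeta> ^ j * \<zeta> ^ (2 * j) = \<zeta> ^ (3 * j)" "\<zeta> ^ j * \<zeta> ^ j = \<zeta> ^ (2 * j)"
      unfolding power_add[symmetric] by (simp_all only:)
    show "\<zeta> ^ j * \<zeta> ^ (4 * j) = 1"
      unfolding power_add[symmetric] using root_pow_cong[of "j + 4 * j" 0] by simp
  qed
  then show ?thesis unfolding ev_def quint_act by (simp add: quint_eq)
qed

lemma eigen_multiple:
  assumes "x \<in> carrier S4" "gcoef C \<odot>\<^bsub>S4\<^esub> x = gcoef (\<zeta> ^ j \<star> 1) \<odot>\<^bsub>S4\<^esub> x"
  shows "x = gcoef (x 5 \<star> 1) \<odot>\<^bsub>S4\<^esub> ev j"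
proof -
  obtain a b c d e where x: "x = quint a b c d e" using assms(1) unfolding quint_S4 by blast
  have e: "x 5 = e" unfolding x by (simp add: quint_def)
  have h: "e = \<zeta> ^ j * a \<and> a = \<zeta> ^ j * b \<and> b = \<zeta> ^ j * c \<and> c = \<zeta> ^ j * d \<and> d = \<zeta> ^ j * e"
    using assms(2) unfolding x quint_act quint_eq .
  have d: "d = \<zeta> ^ j * e" using h by blast
  have "c = \<zeta> ^ j * d" using h by blast
  then have c: "c = \<zeta> ^ j * (\<zeta> ^ j * e)" unfolding d .
  have "b = \<zeta> ^ j * c" using h by blast
  then have b: "b = \<zeta> ^ j * (\<zeta> ^ j * (\<zeta> ^ j * e))" unfolding c .
  have "a = \<zeta> ^ j * b" using h by blast
  then have a: "a = \<zeta> ^ j * (\<zeta> ^ j * (\<zeta> ^ j * (\<zeta> ^ j * e)))" unfolding b .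
  have p: "\<zeta> ^ (2 * j) = \<zeta> ^ j * \<zeta> ^ j" "\<zeta> ^ (3 * j) = \<zeta> ^ j * (\<zeta> ^ j * \<zeta> ^ j)" "\<zeta> ^ (4 * j) = \<zeta> ^ j * (\<zeta> ^ j * (\<zeta> ^ j * \<zeta> ^ j))"
  proof -
    have "j + j = 2 * j" "j + (j + j) = 3 * j" "j + (j + (j + j)) = 4 * j" by simp_all
    then show "\<zeta> ^ (2 * j) = \<zeta> ^ j * \<zeta> ^ j" "\<zeta> ^ (3 * j) = \<zeta> ^ j * (\<zeta> ^ j * \<zeta> ^ j)" "\<zeta> ^ (4 * j) = \<zeta> ^ j * (\<zeta> ^ j * (\<zeta> ^ j * \<zeta> ^ j))"
      unfolding power_add[symmetric] by (simp_all only:)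
  qed
  show ?thesis unfolding e unfolding x ev_def quint_act quint_eq p unfolding a b c d by (simp add: mult_ac)
qed

text \<open>The vectors \<open>(1 + s) g v\<close> for \<open>v = ev 1\<close> and \<open>v = ev 2\<close> are \<open>ev 2 + ev 3\<close> and \<open>ev 1 + ev 4\<close>, so \<open>e 1\<close> and \<open>e 2\<close>
  kill the module. From \<open>q p = f 1\<close> it follows that \<open>p\<close> takes \<open>ev 1\<close> to a nonzero multiple of \<open>ev 2\<close>, and \<open>s\<close>
  provides the other two eigenvectors; so \<open>ev 1\<close> generates.\<close>

lemma S4_tops:
  "top_module S4 (ev 1) (f 1) {0}"
  "x \<in> carrier S4 \<Longrightarrow> gcoef (e 1) \<odot>\<^bsub>S4\<^esub> x = \<zero>\<^bsub>S4\<^esub>" "x \<in> carrier S4 \<Longrightarrow> gcoef (e 2) \<odot>\<^bsub>S4\<^esub> x = \<zero>\<^bsub>S4\<^esub>"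
proof -
  interpret S: fifth_root_module \<zeta> S4
    by (intro fifth_root_module.intro kA5_module.intro fifth_root_axioms S4_module)
  note [simp del] = S4_simps
  note evs = ev_S4
  have mult: "\<exists>k. S.act (E j) x = S.act (k \<star> 1) (ev j)" if x: "x \<in> carrier S4" for j x
  proof -
    have "S.act C (S.act (E j) x) = S.act (\<zeta> ^ j \<star> 1) (S.act (E j) x)"
      by (simp add: S.act(2)[OF x, symmetric] C_E)
    then show ?thesis using eigen_multiple[OF S.act(1)[OF x]] by blast
  qed
  have E: "S.act (E i) (ev j) = (if j = i then ev j else \<zero>\<^bsub>S4\<^esub>)" if "i < 5" "j \<in> {1, 2, 3, 4}" for i j
    using S.eigenvector[OF _ C_ev, of j i] evs that by auto
  have E0: "S.act (E 0) x = \<zero>\<^bsub>S4\<^esub>" if x: "x \<in> carrier S4" for x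
  proof -
    obtain k where k: "S.act (E 0) x = S.act (k \<star> 1) (ev 0)" using mult[OF x] by blast
    then have k': "S.act (E 0) x = quint k k k k k" by (simp add: ev_eq quint_act)
    then obtain a b c d e where q: "quint k k k k k = quint a b c d e" and s: "a + b + c + d + e = 0"
      using S.act(1)[OF x, of "E 0"] unfolding quint_S4 by metis
    have "a = k" "b = k" "c = k" "d = k" "e = k" using q unfolding quint_eq by blast+
    then have "k + k + k + k + k = 0" using s by (simp only:)
    then have "k = 0" by simp
    then show ?thesis using k' by (auto simp: S4_simps quint_def)
  qed
  have ee: "e i = E i * ((1 + S) * (G * E i))" for i
    by (simp add: e_def H_def H'_def distrib_left distrib_right mult.assoc group_relations(4))
  have SG: "S.act (1 + S) (S.act G (ev 1)) = ev 2 \<oplus>\<^bsub>S4\<^esub> ev 3" "S.act (1 + S) (S.act G (ev 2)) = ev 1 \<oplus>\<^bsub>S4\<^esub> ev 4"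
    by (simp_all add: S.act(3,4)[OF S.act(1)[OF evs(1)]] S.act(3,4)[OF S.act(1)[OF evs(2)]])
       (simp_all add: ev_eq quint_act quint_eq add_ac)
  have e1: "S.act (e 1) (ev 1) = \<zero>\<^bsub>S4\<^esub>"
  proof -
    have "S.act (e 1) (ev 1) = S.act (E 1) (S.act (1 + S) (S.act G (S.act (E 1) (ev 1))))"
      unfolding ee by (simp only: S.act(1,2) evs)
    then show ?thesis using evs by (simp add: E SG S.act_add)
  qed
  have e2: "S.act (e 2) (ev 2) = \<zero>\<^bsub>S4\<^esub>"
  proof -
    have "S.act (e 2) (ev 2) = S.act (E 2) (S.act (1 + S) (S.act G (S.act (E 2) (ev 2))))"
      unfolding ee by (simp only: S.act(1,2) evs)
    then show ?thesis using evs by (simp add: E SG S.act_add)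
  qed
  have kill: "S.act (e i) x = \<zero>\<^bsub>S4\<^esub>" if x: "x \<in> carrier S4" and i: "i < 5" "ev i \<in> carrier S4" "S.act (e i) (ev i) = \<zero>\<^bsub>S4\<^esub>" for i x
  proof -
    obtain k where k: "S.act (E i) x = S.act (k \<star> 1) (ev i)" using mult[OF x] by blast
    have "S.act (e i) x = S.act (e i) (S.act (E i) x)" using i(1) by (simp add: S.act(2)[OF x, symmetric])
    also have "\<dots> = S.act (k \<star> 1) (S.act (e i) (ev i))" unfolding k by (simp only: S.act_scale[OF i(2)])
    also have "\<dots> = \<zero>\<^bsub>S4\<^esub>" unfolding i(3) by (rule S.act(6)[OF i(2)])
    finally show ?thesis .
  qed
  show "x \<in> carrier S4 \<Longrightarrow> gcoef (e 1) \<odot>\<^bsub>S4\<^esub> x = \<zero>\<^bsub>S4\<^esub>" "x \<in> carrier S4 \<Longrightarrow> gcoef (e 2) \<odot>\<^bsub>S4\<^esub> x = \<zero>\<^bsub>S4\<^esub>"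
    using kill[of x 1] kill[of x 2] e1 e2 evs by simp_all
  have nz: "ev 1 \<noteq> \<zero>\<^bsub>S4\<^esub>"
  proof
    assume "ev 1 = \<zero>\<^bsub>S4\<^esub>"
    then have "ev 1 5 = 0" by (simp add: S4_simps)
    then show False by (simp add: ev_def quint_def)
  qed
  have f1: "S.act (f 1) (ev 1) = ev 1" unfolding f_def S.act(3)[OF evs(1)] e1 using evs(1) E[of 1 1] by simp
  obtain k where k: "S.act p (ev 1) = S.act (k \<star> 1) (ev 2)"
    using mult[OF S.act(1)[OF evs(1), of p], of 2] by (auto simp: S.act(2)[OF evs(1), symmetric])
  have "k \<noteq> 0"
  proof
    assume "k = 0"
    then have "S.act q (S.act p (ev 1)) = \<zero>\<^bsub>S4\<^esub>" unfolding k using S.act(5,6)[OF evs(2)] by simp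
    then show False using f1 nz by (simp add: S.act(2)[OF evs(1), symmetric] pq)
  qed
  define y where "y = inverse k \<star> p"
  have y2: "ev 2 = S.act y (ev 1)"
  proof -
    have "S.act y (ev 1) = S.act (inverse k \<star> 1) (S.act p (ev 1))" by (simp add: y_def S.act_scale[OF evs(1)])
    also have "\<dots> = S.act (inverse k \<star> k \<star> 1) (ev 2)" unfolding k by (rule S.act_scale(2)[OF evs(2)])
    finally show ?thesis using \<open>k \<noteq> 0\<close> S.act(4)[OF evs(2)] by simp
  qed
  have y4: "ev 4 = S.act S (ev 1)" and y3': "ev 3 = S.act S (ev 2)" by (simp_all add: ev_eq quint_act)
  have y3: "ev 3 = S.act (S * y) (ev 1)" unfolding y3' y2 by (simp only: S.act(2)[OF evs(1)])
  have gen: "\<exists>z. x = S.act z (ev 1)" if x: "x \<in> carrier S4" for x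
  proof -
    obtain k1 k2 k3 k4 where k: "S.act (E 1) x = S.act (k1 \<star> 1) (ev 1)" "S.act (E 2) x = S.act (k2 \<star> 1) (ev 2)"
      "S.act (E 3) x = S.act (k3 \<star> 1) (ev 3)" "S.act (E 4) x = S.act (k4 \<star> 1) (ev 4)" using mult[OF x] by metis
    have "x = S.act (E 0 + E 1 + E 2 + E 3 + E 4) x" unfolding sum_E S.act(4)[OF x] ..
    also have "\<dots> = S.act (E 0) x \<oplus>\<^bsub>S4\<^esub> S.act (E 1) x \<oplus>\<^bsub>S4\<^esub> S.act (E 2) x \<oplus>\<^bsub>S4\<^esub> S.act (E 3) x \<oplus>\<^bsub>S4\<^esub> S.act (E 4) x"
      by (simp only: S.act(3)[OF x])
    also have "\<dots> = S.act (0 + (k1 \<star> 1 + 0) + k2 \<star> y + k3 \<star> (S * y) + k4 \<star> S) (ev 1)"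
      unfolding E0[OF x] k y2 y3 y4 S.act_scale[OF evs(1)] S.act(3)[OF evs(1)] S.act(5)[OF evs(1)]
      using S.act(1)[OF evs(1)] by simp
    finally show ?thesis by blast
  qed
  have cyc: "smult_set S4 (carrier kA5) (ev 1) = carrier S4"
  proof
    show "smult_set S4 (carrier kA5) (ev 1) \<subseteq> carrier S4" unfolding smult_set_def using evs(1) by auto
    show "carrier S4 \<subseteq> smult_set S4 (carrier kA5) (ev 1)" unfolding smult_set_def using gen gcoef by blast
  qed
  have kill0: "\<forall>j\<in>{0}. \<forall>x\<in>carrier S4. S.act (E j) x = \<zero>\<^bsub>S4\<^esub>" using E0 by simp
  show "top_module S4 (ev 1) (f 1) {0}"
    unfolding top_module_def
    by (rule conjI[OF S4_module conjI[OF evs(1) conjI[OF nz conjI[OF f1 conjI[OF cyc kill0]]]]])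
qed

end

section \<open>The two-dimensional modules and the choice of the root of unity\<close>

lemma two_vectors_span:
  fixes v v' x :: "'k::field^2"
  assumes "v \<noteq> 0" "\<And>c. v' \<noteq> c *s v"
  shows "\<exists>\<alpha> \<beta>. x = \<alpha> *s v + \<beta> *s v'"
proof -
  define d where "d = v $ 1 * v' $ 2 - v $ 2 * v' $ 1"
  have "d \<noteq> 0"
  proof
    assume d: "d = 0"
    have "v $ 1 \<noteq> 0 \<or> v $ 2 \<noteq> 0" using assms(1) by (auto simp: vec_eq_iff forall_2)
    then show False
    proof
      assume "v $ 1 \<noteq> 0"
      then have "v' = (v' $ 1 / v $ 1) *s v" using d by (simp add: d_def vec_eq_iff forall_2 field_simps)
      then show False using assms(2) by blast
    next
      assume "v $ 2 \<noteq> 0"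
      then have "v' = (v' $ 2 / v $ 2) *s v" using d by (simp add: d_def vec_eq_iff forall_2 field_simps)
      then show False using assms(2) by blast
    qed
  qed
  have "x $ 1 * d = (x $ 1 * v' $ 2 - x $ 2 * v' $ 1) * v $ 1 + (v $ 1 * x $ 2 - v $ 2 * x $ 1) * v' $ 1"
    "x $ 2 * d = (x $ 1 * v' $ 2 - x $ 2 * v' $ 1) * v $ 2 + (v $ 1 * x $ 2 - v $ 2 * x $ 1) * v' $ 2"
    unfolding d_def by (simp_all add: algebra_simps)
  then have "x = ((x $ 1 * v' $ 2 - x $ 2 * v' $ 1) / d) *s v + ((v $ 1 * x $ 2 - v $ 2 * x $ 1) / d) *s v'"
    using \<open>d \<noteq> 0\<close> by (simp add: vec_eq_iff forall_2 nonzero_eq_divide_eq add_divide_distrib[symmetric])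
  then show ?thesis by blast
qed

text \<open>A direct solution of the two linear equations for a root \<open>z\<close> of the characteristic polynomial.\<close>

lemma eigenvector_exists:
  fixes A :: "'k::field^2^2"
  assumes "det A = 1" "z\<^sup>2 - (A $ 1 $ 1 + A $ 2 $ 2) * z + 1 = 0"
  shows "\<exists>v. v \<noteq> 0 \<and> A *v v = z *s v"
proof -
  let ?a = "A $ 1 $ 1" and ?b = "A $ 1 $ 2" and ?c = "A $ 2 $ 1" and ?d = "A $ 2 $ 2"
  have det: "?a * ?d - ?b * ?c = 1" using assms(1) by (simp add: det_2)
  have eig: "A *v v = z *s v \<longleftrightarrow> ?a * v $ 1 + ?b * v $ 2 = z * v $ 1 \<and> ?c * v $ 1 + ?d * v $ 2 = z * v $ 2" for v
    by (simp add: vec_eq_iff forall_2 matrix_vector_mult_def sum_2)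
  have nz: "v \<noteq> 0 \<longleftrightarrow> v $ 1 \<noteq> 0 \<or> v $ 2 \<noteq> 0" for v :: "'k^2" by (auto simp: vec_eq_iff forall_2)
  have z: "z * z - (?a + ?d) * z + 1 = 0" using assms(2) by (simp add: power2_eq_square)
  have key: "?c * ?b + ?d * (z - ?a) = z * (z - ?a)" "?a * (z - ?d) + ?b * ?c = z * (z - ?d)"
  proof -
    have "z * (z - ?a) - (?c * ?b + ?d * (z - ?a)) = (z * z - (?a + ?d) * z + 1) + ((?a * ?d - ?b * ?c) - 1)"
      "z * (z - ?d) - (?a * (z - ?d) + ?b * ?c) = (z * z - (?a + ?d) * z + 1) + ((?a * ?d - ?b * ?c) - 1)"
      by (simp_all add: algebra_simps)
    then show "?c * ?b + ?d * (z - ?a) = z * (z - ?a)" "?a * (z - ?d) + ?b * ?c = z * (z - ?d)"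
      unfolding det z by simp_all
  qed
  consider "?b \<noteq> 0" | "?c \<noteq> 0" | "?b = 0" "?c = 0" "z = ?a" | "?b = 0" "?c = 0" "z = ?d"
  proof -
    have "(z - ?a) * (z - ?d) = 0" if "?b = 0" using det z that by (simp add: algebra_simps)
    then show thesis using that by fastforce
  qed
  then show ?thesis
  proof cases
    case 1
    let ?v = "vector [?b, z - ?a] :: 'k^2"
    show ?thesis unfolding eig nz using 1 key(1) by (intro exI[of _ ?v]) (simp add: algebra_simps)
  next
    case 2
    let ?v = "vector [z - ?d, ?c] :: 'k^2"
    show ?thesis unfolding eig nz using 2 key(2) by (intro exI[of _ ?v]) (simp add: algebra_simps)
  next
    case 3
    then show ?thesis unfolding eig nz by (intro exI[of _ "vector [1, 0] :: 'k^2"]) simp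
  next
    case 4
    then show ?thesis unfolding eig nz by (intro exI[of _ "vector [0, 1] :: 'k^2"]) simp
  qed
qed

context fifth_root
begin

text \<open>If \<open>s v\<close> were a multiple of \<open>v\<close>, it would be an eigenvector of \<open>c\<close> for both \<open>\<zeta>^i\<close> and \<open>\<zeta>^(-i)\<close>.\<close>

lemma two_dim_top:
  fixes \<rho> :: "(nat \<Rightarrow> nat) \<Rightarrow> 'k^2^2"
  assumes i: "i = 1 \<or> i = 2"
    and \<rho>: "\<And>p q. p \<in> carrier A5 \<Longrightarrow> q \<in> carrier A5 \<Longrightarrow> \<rho> (p \<circ> q) = \<rho> p ** \<rho> q" "\<rho> id = mat 1"
    and v: "v \<noteq> 0" "\<rho> cc *v v = \<zeta> ^ i *s v"
  shows "top_module (matrix_module A5 \<rho>) v (e i) ({0, 1, 2, 3, 4} - {i, neg i})"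
proof -
  interpret M: fifth_root_module \<zeta> "matrix_module A5 \<rho>"
    by (intro fifth_root_module.intro kA5_module.intro fifth_root_axioms matrix_module_left_module \<rho>)
  note [simp del] = matrix_module_simps(4)
  have c: "x \<in> carrier (matrix_module A5 \<rho>)" for x by simp
  have C: "M.act C v = M.act (\<zeta> ^ i \<star> 1) v"
    unfolding C_def gcoef_matrix(1)[OF A5_gens(1)] gcoef_matrix(2)[of \<rho>, OF \<rho>(2)] by (rule v(2))
  have S: "M.act S v = \<rho> ss *v v" unfolding S_def by (rule gcoef_matrix(1)[OF A5_gens(2)])
  have Ev: "M.act (E i) v = v" using M.eigenvector[OF c C, of i] i by auto
  have ESv: "M.act (E i) (M.act S v) = 0"
  proof -
    have "M.act (E i) (M.act S v) = M.act (E i * (S * E i)) v" by (simp only: M.act(2)[OF c] Ev)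
    also have "E i * (S * E i) = 0" using i by (auto simp: E_S_E)
    also have "M.act 0 v = 0" using M.act(5)[OF c, of v] unfolding matrix_module_simps(2) .
    finally show ?thesis .
  qed
  have "\<rho> ss *v v \<noteq> k *s v" for k
  proof
    assume k: "\<rho> ss *v v = k *s v"
    have kv: "M.act S v = M.act (k \<star> 1) v" unfolding S k by (rule gcoef_matrix(2)[of \<rho>, OF \<rho>(2), symmetric])
    have "M.act (E i) (M.act S v) = M.act (k \<star> 1) (M.act (E i) v)" unfolding kv M.act_scale[OF c] ..
    then have "M.act S v = 0" unfolding Ev ESv kv[symmetric] by (rule sym)
    then have "M.act S (M.act S v) = 0" using M.act(6)[OF c] by simp
    moreover have "M.act S (M.act S v) = v" by (simp only: M.act(2)[OF c, symmetric] group_relations M.act(4)[OF c])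
    ultimately show False using v(1) by simp
  qed
  then have span: "\<exists>\<alpha> \<beta>. x = \<alpha> *s v + \<beta> *s (\<rho> ss *v v)" for x by (rule two_vectors_span[OF v(1)])
  show ?thesis
  proof (rule M.top_module_two[OF i c _ C])
    show "v \<noteq> \<zero>\<^bsub>matrix_module A5 \<rho>\<^esub>" using v(1) by simp
    fix x
    obtain \<alpha> \<beta> where x: "x = \<alpha> *s v + \<beta> *s (\<rho> ss *v v)" using span by blast
    have "M.act (\<alpha> \<star> 1 + \<beta> \<star> S) v = M.act (\<alpha> \<star> 1) v + M.act (\<beta> \<star> 1) (M.act S v)"
      by (simp add: M.act(3)[OF c] M.act_scale[OF c])
    also have "\<dots> = x" unfolding x S gcoef_matrix(2)[of \<rho>, OF \<rho>(2)] ..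
    finally show "\<exists>\<alpha> \<beta>. x = M.act (\<alpha> \<star> 1 + \<beta> \<star> S) v" by metis
  qed
qed

end

lemma iso_SL2F4:
  assumes "\<phi> \<in> iso A5 (SL2F4 \<omega>)"
  shows "\<And>p q. p \<in> carrier A5 \<Longrightarrow> q \<in> carrier A5 \<Longrightarrow> \<phi> (p \<circ> q) = \<phi> p ** \<phi> q" "\<phi> id = mat 1"
    "\<And>p. p \<in> carrier A5 \<Longrightarrow> det (\<phi> p) = 1" "inj_on \<phi> (carrier A5)"
proof -
  have hom: "\<phi> \<in> hom A5 (SL2F4 \<omega>)" and bij: "bij_betw \<phi> (carrier A5) (carrier (SL2F4 \<omega>))"
    using assms by (auto simp: iso_def)
  show mult: "\<phi> (p \<circ> q) = \<phi> p ** \<phi> q" if "p \<in> carrier A5" "q \<in> carrier A5" for p q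
    using hom_mult[OF hom that] by (simp add: SL2F4_def)
  show "det (\<phi> p) = 1" if "p \<in> carrier A5" for p
    using hom_in_carrier[OF hom that] by (simp add: SL2F4_def)
  show "inj_on \<phi> (carrier A5)" using bij by (rule bij_betw_imp_inj_on)
  have "mat 1 \<in> carrier (SL2F4 \<omega>)" by (simp add: SL2F4_def F4_def) (simp add: mat_def)
  then obtain p where "p \<in> carrier A5" "\<phi> p = mat 1" using bij_betw_imp_surj_on[OF bij] by (metis imageE)
  then show "\<phi> id = mat 1" using mult[of id p] by simp
qed

text \<open>Squaring is a ring endomorphism in characteristic 2; it takes eigenvectors of a matrix to eigenvectors of the
  matrix of squares.\<close>

lemma squares_hom:
  fixes A B :: "'k::field^2^2" and v :: "'k^2"
  assumes "(1::'k) + 1 = 0"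
  shows "(\<chi> i j. ((A ** B) $ i $ j)\<^sup>2) = (\<chi> i j. (A $ i $ j)\<^sup>2) ** (\<chi> i j. (B $ i $ j)\<^sup>2)"
    "(\<chi> i j. (A $ i $ j)\<^sup>2) *v (\<chi> i. (v $ i)\<^sup>2) = (\<chi> i. ((A *v v) $ i)\<^sup>2)"
proof -
  have sq: "(x + y)\<^sup>2 = x\<^sup>2 + y\<^sup>2" for x y :: 'k
  proof -
    have "(x + y)\<^sup>2 = x\<^sup>2 + y\<^sup>2 + (1 + 1) * (x * y)" by (simp add: power2_eq_square algebra_simps)
    then show ?thesis unfolding assms by simp
  qed
  show "(\<chi> i j. ((A ** B) $ i $ j)\<^sup>2) = (\<chi> i j. (A $ i $ j)\<^sup>2) ** (\<chi> i j. (B $ i $ j)\<^sup>2)"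
    "(\<chi> i j. (A $ i $ j)\<^sup>2) *v (\<chi> i. (v $ i)\<^sup>2) = (\<chi> i. ((A *v v) $ i)\<^sup>2)"
    by (simp_all add: vec_eq_iff matrix_matrix_mult_def matrix_vector_mult_def sum_2 sq power_mult_distrib)
qed

text \<open>An eigenvalue \<open>z\<close> of \<open>\<phi> c\<close> satisfies \<open>z^5 = 1\<close>. If \<open>z = 1\<close>, the trace is zero and the Cayley-Hamilton theorem
  gives \<open>(\<phi> c)\<^sup>2 = 1\<close>, which contradicts the injectivity of \<open>\<phi>\<close>.\<close>

lemma exists_fifth_root:
  fixes \<phi> :: "(nat \<Rightarrow> nat) \<Rightarrow> 'k::alg_closed_field^2^2"
  assumes \<phi>: "\<phi> \<in> iso A5 (SL2F4 \<omega>)" and char2: "(1::'k) + 1 = 0"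
  shows "\<exists>z v. fifth_root z \<and> v \<noteq> 0 \<and> \<phi> cc *v v = z *s v"
proof -
  note hom = iso_SL2F4[OF \<phi>]
  let ?A = "\<phi> cc"
  let ?P = "[: 1, - (?A $ 1 $ 1 + ?A $ 2 $ 2), 1 :]"
  have "degree ?P > 0" by simp
  then obtain z where "poly ?P z = 0" using alg_closed_imp_poly_has_root by blast
  then have z: "z\<^sup>2 - (?A $ 1 $ 1 + ?A $ 2 $ 2) * z + 1 = 0" by (simp add: power2_eq_square algebra_simps)
  obtain v where v: "v \<noteq> 0" "?A *v v = z *s v" using eigenvector_exists[OF hom(3)[OF A5_gens(1)] z] by blast
  have pow: "\<phi> (cc ^^ n) *v v = z ^ n *s v" for n
  proof (induction n)
    case 0
    show ?case unfolding funpow.simps(1) hom(2) by simp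
  next
    case (Suc n)
    have "\<phi> (cc ^^ Suc n) *v v = ?A *v (\<phi> (cc ^^ n) *v v)" by (simp add: hom(1) matrix_vector_mul_assoc)
    also have "\<dots> = z ^ Suc n *s v" unfolding Suc vector_scalar_commute v(2) by (simp add: vec_eq_iff mult_ac)
    finally show ?case .
  qed
  have "z ^ 5 *s v = 1 *s v" using pow[of 5] by (simp add: cc_pow hom(2))
  then have z5: "z ^ 5 = 1" using v(1) by (auto simp: vec_eq_iff)
  have "z \<noteq> 1"
  proof
    assume "z = 1"
    then have tr: "?A $ 1 $ 1 + ?A $ 2 $ 2 = 0" using z char2 by (simp add: algebra_simps)
    have two: "x + x = 0" for x :: 'k using char2 by (metis distrib_left mult.right_neutral mult_zero_right)
    have d: "?A $ 2 $ 2 = ?A $ 1 $ 1"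
      using tr two[of "?A $ 1 $ 1"] by (metis add_left_cancel)
    have det: "?A $ 1 $ 1 * ?A $ 1 $ 1 - ?A $ 1 $ 2 * ?A $ 2 $ 1 = 1"
      using hom(3)[OF A5_gens(1)] by (simp add: det_2 d)
    have m: "- x = x" for x :: 'k using two[of x] by (metis add_eq_0_iff)
    have s: "?A $ 1 $ 1 * ?A $ 1 $ 1 + ?A $ 1 $ 2 * ?A $ 2 $ 1 = 1"
      using det m[of "?A $ 1 $ 2 * ?A $ 2 $ 1"] by (metis diff_conv_add_uminus)
    have "?A ** ?A = mat 1"
      unfolding vec_eq_iff forall_2 matrix_matrix_mult_def mat_def
      using s char2 by (simp add: sum_2 d mult.commute add.commute)
    then have "\<phi> (cc \<circ> cc) = \<phi> id" by (simp add: hom(1,2))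
    then have "cc \<circ> cc = id" by (rule inj_onD[OF hom(4)]) simp_all
    then show False by (simp add: cc_def perm5_id)
  qed
  have "(z - 1) * (z ^ 4 + z ^ 3 + z ^ 2 + z + 1) = z ^ 5 - 1" by (simp add: algebra_simps eval_nat_numeral)
  then have "z ^ 4 + z ^ 3 + z ^ 2 + z + 1 = 0" using \<open>z \<noteq> 1\<close> z5 by simp
  then have "fifth_root z" using char2 by unfold_locales
  then show ?thesis using v by blast
qed

lemma simple_tops:
  fixes \<phi> :: "(nat \<Rightarrow> nat) \<Rightarrow> 'k::alg_closed_field^2^2"
  assumes \<phi>: "\<phi> \<in> iso A5 (SL2F4 \<omega>)" and char2: "(1::'k) + 1 = 0"
  shows "\<exists>z v v'. A5_tops z S1 1 (S2 \<phi>) v (S3 \<phi>) v' S4 (fifth_root.ev z 1)"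
proof -
  note hom = iso_SL2F4[OF \<phi>]
  obtain z v where z: "fifth_root z" and v: "v \<noteq> 0" "\<phi> cc *v v = z *s v"
    using exists_fifth_root[OF \<phi> char2] by blast
  interpret fifth_root z by (rule z)
  have n: "{0, 1, 2, 3, 4} - {1, neg 1} = {0, 2, 3}" "{0, 1, 2, 3, 4} - {2, neg 2} = {0, 1, 4}" by auto
  have T1: "top_module (S2 \<phi>) v (e 1) {0, 2, 3}"
    using two_dim_top[of 1 \<phi> v, OF _ hom(1,2)] v unfolding S2_def n by simp
  let ?\<rho> = "\<lambda>g. \<chi> i j. (\<phi> g $ i $ j)\<^sup>2" and ?v = "\<chi> i. (v $ i)\<^sup>2"
  have T2: "top_module (S3 \<phi>) ?v (e 2) {0, 1, 4}"
    unfolding S3_def n(2)[symmetric]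
  proof (rule two_dim_top)
    show "?\<rho> (p \<circ> q) = ?\<rho> p ** ?\<rho> q" if "p \<in> carrier A5" "q \<in> carrier A5" for p q
      unfolding hom(1)[OF that] by (rule squares_hom(1)[OF char2])
    show "?\<rho> id = mat 1" by (simp add: hom(2) mat_def vec_eq_iff)
    show "?v \<noteq> 0" using v(1) by (simp add: vec_eq_iff)
    show "?\<rho> cc *v ?v = z ^ 2 *s ?v" unfolding squares_hom(2)[OF char2] v(2) by (simp add: vec_eq_iff power_mult_distrib)
  qed simp
  have "A5_tops z S1 1 (S2 \<phi>) v (S3 \<phi>) ?v S4 (ev 1)"
    by (intro A5_tops.intro A5_tops_axioms.intro z top_S1 T1 T2 S4_tops(1)) (simp add: S4_tops(2,3) del: S4_simps(4))
  then show ?thesis by blast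
qed

section \<open>Modules induced from the subgroup fixing 5\<close>

lemma hh_pow: "hh ^^ 2 = perm5 3 1 2 4 5"
  by (simp add: numeral_2_eq_2) (simp add: hh_def)

text \<open>The Klein four-group, listed.\<close>

definition VV :: "(nat \<Rightarrow> nat) set" where
  "VV = {perm5 1 2 3 4 5, perm5 4 3 2 1 5, perm5 2 1 4 3 5, perm5 3 4 1 2 5}"

lemma VV_alt: "VV = {id, ss, gg, gg \<circ> ss}"
  by (simp add: VV_def perm5_id ss_def gg_def)

lemma hh_V:
  assumes "i < 3" "j < 3" "v \<in> VV" "v' \<in> VV" "hh ^^ i \<circ> v = hh ^^ j \<circ> v'"
  shows "i = j"
proof -
  have "i = 0 \<or> i = 1 \<or> i = 2" "j = 0 \<or> j = 1 \<or> j = 2" using assms(1,2) by linarith+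
  then show ?thesis using assms(3,4,5) unfolding VV_def
    by (elim insertE emptyE disjE; simp add: hh_pow; simp add: hh_def)
qed

lemma V4_eq: "V4 = VV"
proof -
  have cl: "x \<circ> y \<in> VV" if "x \<in> VV" "y \<in> VV" for x y using that unfolding VV_def by auto
  have "inv' (gg \<circ> ss) = gg \<circ> ss" by (rule inv_unique_comp; simp add: perm5_defs perm5_id)
  then have inv: "inv\<^bsub>A5\<^esub> h \<in> VV" if "h \<in> {gg, gg \<circ> ss}" for h
    using that inv_perm5(3) by (auto simp: A5_inv VV_alt)
  have V4: "V4 = generate A5 {gg, gg \<circ> ss}" unfolding V4_def cycles_perm5 ..
  have "x \<in> VV" if "x \<in> generate A5 {gg, gg \<circ> ss}" for x
    using that
  proof (induction rule: generate.induct)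
    case one show ?case unfolding A5_one VV_alt by blast
  next
    case (incl h) then show ?case by (auto simp: VV_alt)
  next
    case (inv h) then show ?case by (rule \<open>\<And>h. h \<in> {gg, gg \<circ> ss} \<Longrightarrow> inv\<^bsub>A5\<^esub> h \<in> VV\<close>)
  next
    case (eng x y) then show ?case using cl unfolding A5_mult by blast
  qed
  moreover have "ss \<in> generate A5 {gg, gg \<circ> ss}"
  proof -
    have "gg \<otimes>\<^bsub>A5\<^esub> (gg \<circ> ss) \<in> generate A5 {gg, gg \<circ> ss}" by (intro generate.eng generate.incl) simp_all
    moreover have "gg \<circ> (gg \<circ> ss) = ss" by (simp add: perm5_defs)
    ultimately show ?thesis unfolding A5_mult by (simp only:)
  qed
  moreover have "id \<in> generate A5 {gg, gg \<circ> ss}" using generate.one[of A5 "{gg, gg \<circ> ss}"] unfolding A5_one .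
  moreover have "gg \<in> generate A5 {gg, gg \<circ> ss}" "gg \<circ> ss \<in> generate A5 {gg, gg \<circ> ss}"
    by (intro generate.incl; simp)+
  ultimately show ?thesis unfolding V4 VV_alt by blast
qed

text \<open>The exponent in the definition of the character is well defined: the cosets of \<open>V\<^sub>4\<close> by \<open>h^0, h^1, h^2\<close>
  are disjoint.\<close>

lemma T_char_value:
  assumes "j < 3" "v \<in> VV" shows "T_char \<xi> (hh ^^ j \<circ> v) = \<xi> ^ j"
proof -
  have "(LEAST i. \<exists>v'\<in>VV. hh ^^ j \<circ> v = hh ^^ i \<circ> v') = j"
  proof (rule Least_equality)
    show "\<exists>v'\<in>VV. hh ^^ j \<circ> v = hh ^^ j \<circ> v'" using assms(2) by blast
    fix i assume "\<exists>v'\<in>VV. hh ^^ j \<circ> v = hh ^^ i \<circ> v'"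
    then obtain v' where v': "v' \<in> VV" "hh ^^ j \<circ> v = hh ^^ i \<circ> v'" by blast
    show "j \<le> i"
    proof (rule ccontr)
      assume "\<not> j \<le> i"
      then have i: "i < j" "i < 3" using assms(1) by linarith+
      have "j = i" by (rule hh_V[OF assms(1) i(2) assms(2) v'])
      then show False using i(1) by simp
    qed
  qed
  then show ?thesis unfolding T_char_def cycles_perm5 V4_eq by simp
qed

lemma A4_decomp:
  assumes "u \<in> A4" shows "\<exists>j v. j < 3 \<and> v \<in> VV \<and> u = hh ^^ j \<circ> v"
proof -
  have "set A4_list \<subseteq> (\<Union>j\<in>{0, 1, 2}. (\<lambda>v. hh ^^ j \<circ> v) ` VV)"
    by (simp add: A4_list_def VV_def hh_pow) (simp add: hh_def)
  then obtain j v where "j \<in> {0, 1, 2::nat}" "v \<in> VV" "u = hh ^^ j \<circ> v" using assms A4_iff by blast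
  moreover from this(1) have "j < 3" by auto
  ultimately show ?thesis by blast
qed

lemma A4_A5: "A4 \<subseteq> carrier A5" "finite A4" "id \<in> A4"
proof -
  show "A4 \<subseteq> carrier A5" by (auto simp: A4_def)
  then show "finite A4" by (rule finite_subset) simp
  show "id \<in> A4" by (simp add: A4_def)
qed

lemma hh_A5: "hh \<in> carrier A5"
  using A4_list_A5 by (auto simp: A4_list_def hh_def)

lemma T_simps: "carrier (T \<xi>) = UNIV" "\<zero>\<^bsub>T \<xi>\<^esub> = 0" "x \<oplus>\<^bsub>T \<xi>\<^esub> y = x + y"
  by (simp_all add: T_def char_module_def)

lemma T_smult: "h \<in> A4 \<Longrightarrow> ga_single c h \<odot>\<^bsub>T \<xi>\<^esub> v = c * (T_char \<xi> h * v)"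
  using A4_A5(2)
  by (simp add: T_def char_module_def ga_single_def if_distrib[of "\<lambda>u. u * _"] cong: if_cong)

lemma T_char_id: "T_char \<xi> id = 1"
  using T_char_value[of 0 id \<xi>] by (simp add: VV_alt)

lemma T_finsum: "finite A \<Longrightarrow> finsum (T \<xi>) F A = sum F A"
proof (induction A rule: finite_induct)
  interpret abelian_group "T \<xi>"
    by (rule abelian_groupI) (auto simp: T_simps add_ac intro: exI[of _ "- _"])
  {
    case empty show ?case by (simp add: T_simps)
  next
    case (insert x A)
    then show ?case using finsum_insert[of A x F] by (simp add: T_simps)
  }
qed

lemma tensor_simps:
  "carrier (scalar_tensor A5 (T \<xi>)) = carrier A5 \<rightarrow>\<^sub>E UNIV" "\<zero>\<^bsub>scalar_tensor A5 (T \<xi>)\<^esub> = (\<lambda>g\<in>carrier A5. 0)"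
  "f \<oplus>\<^bsub>scalar_tensor A5 (T \<xi>)\<^esub> f' = (\<lambda>g\<in>carrier A5. f g + f' g)"
  "a \<odot>\<^bsub>scalar_tensor A5 (T \<xi>)\<^esub> f = (\<lambda>g\<in>carrier A5. \<Sum>x\<in>carrier A5. a x * f (inv\<^bsub>A5\<^esub> x \<circ> g))"
  by (simp_all add: scalar_tensor_def T_simps T_smult[OF A4_A5(3)] T_char_id T_finsum)

text \<open>The tensor product over \<open>k\<close> with a one-dimensional module is the regular module. Its elements are
  extensional functions, whence the restriction.\<close>

definition res :: "((nat \<Rightarrow> nat) \<Rightarrow> 'k) \<Rightarrow> (nat \<Rightarrow> nat) \<Rightarrow> 'k" where "res a = restrict a (carrier A5)"

lemma res_hom: "res \<in> mod_hom kA5 (regular_module kA5) (scalar_tensor A5 (T \<xi>))"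
proof (rule mod_homI)
  fix a b :: "(nat \<Rightarrow> nat) \<Rightarrow> 'a"
  show "res a \<in> carrier (scalar_tensor A5 (T \<xi>))" by (simp add: res_def tensor_simps)
  show "res (a \<oplus>\<^bsub>regular_module kA5\<^esub> b) = res a \<oplus>\<^bsub>scalar_tensor A5 (T \<xi>)\<^esub> res b"
    by (simp add: res_def tensor_simps kA5_ops fun_eq_iff restrict_def)
  have "inv\<^bsub>A5\<^esub> x \<circ> g \<in> carrier A5" if "x \<in> carrier A5" "g \<in> carrier A5" for x g
    using that group.inv_closed[OF A5_group] by simp
  then show "res (a \<odot>\<^bsub>regular_module kA5\<^esub> b) = a \<odot>\<^bsub>scalar_tensor A5 (T \<xi>)\<^esub> res b"
    by (simp add: res_def tensor_simps kA5_def group_algebra_def fun_eq_iff restrict_def cong: sum.cong)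
qed

lemma res_surj: "res ` carrier (regular_module kA5) = carrier (scalar_tensor A5 (T \<xi>))"
proof
  show "res ` carrier (regular_module kA5) \<subseteq> carrier (scalar_tensor A5 (T \<xi>))"
    using mod_homD(1)[OF res_hom] by blast
  show "carrier (scalar_tensor A5 (T \<xi>)) \<subseteq> res ` carrier (regular_module kA5)"
  proof
    fix f assume f: "f \<in> carrier (scalar_tensor A5 (T \<xi>))"
    let ?a = "\<lambda>g. if g \<in> carrier A5 then f g else 0"
    have "f g = res ?a g" for g
      using f PiE_arb[of f "carrier A5" "\<lambda>_. UNIV" g] by (simp add: tensor_simps res_def restrict_def)
    then have "f = res ?a" by (rule ext)
    moreover have "?a \<in> carrier kA5" by (simp add: kA5_carrier_iff)
    ultimately show "f \<in> res ` carrier (regular_module kA5)" by (intro image_eqI) simp_all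
  qed
qed

lemma res_zero: "res \<zero>\<^bsub>kA5\<^esub> = \<zero>\<^bsub>scalar_tensor A5 (T \<xi>)\<^esub>"
  by (simp add: res_def tensor_simps kA5_def group_algebra_def)

lemma tensor_module: "left_module kA5 (scalar_tensor A5 (T \<xi>))"
  by (rule left_module_surj_image[OF left_module_regular[OF kA5_ring] res_hom res_surj]) (simp add: res_zero)

lemma res_pure: "pure_tensor A5 (T \<xi>) g v = res (gcoef (v \<star> single g))" if "g \<in> carrier A5"
  using that by (simp add: pure_tensor_def res_def fun_eq_iff restrict_def T_simps gcoef_single)

lemma tensor_relation:
  assumes "g \<in> carrier A5" "h \<in> A4"
  shows "pure_tensor A5 (T \<xi>) (g \<otimes>\<^bsub>A5\<^esub> h) v \<ominus>\<^bsub>scalar_tensor A5 (T \<xi>)\<^esub> pure_tensor A5 (T \<xi>) g (ga_single 1 h \<odot>\<^bsub>T \<xi>\<^esub> v)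
    = res (gcoef (v \<star> single (g \<circ> h) - (T_char \<xi> h * v) \<star> single g))"
proof -
  have gh: "g \<circ> h \<in> carrier A5" using assms A4_A5(1) by auto
  have eq: "gcoef x \<ominus>\<^bsub>regular_module kA5\<^esub> gcoef y = gcoef (x - y)" for x y :: "'a galg"
  proof -
    interpret RM: left_module kA5 "regular_module kA5 :: (_, (nat \<Rightarrow> nat) \<Rightarrow> 'a) module"
      by (rule left_module_regular[OF kA5_ring])
    have z: "gcoef (- y) \<oplus>\<^bsub>regular_module kA5\<^esub> gcoef y = \<zero>\<^bsub>regular_module kA5\<^esub>"
      using plus_galg.rep_eq[of "- y" y] zero_galg.rep_eq[where 'a = 'a] by simp
    have "\<ominus>\<^bsub>regular_module kA5\<^esub> gcoef y = gcoef (- y)"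
      by (rule RM.M.minus_equality[OF z]) (simp_all add: gcoef)
    then show ?thesis using plus_galg.rep_eq[of x "- y"] by (simp add: a_minus_def)
  qed
  have d: "res (gcoef x) \<ominus>\<^bsub>scalar_tensor A5 (T \<xi>)\<^esub> res (gcoef y) = res (gcoef (x - y))" for x y :: "'a galg"
    unfolding eq[symmetric]
    by (rule mod_hom_diff[OF left_module_regular[OF kA5_ring] tensor_module res_hom, symmetric]) (simp_all add: gcoef)
  show ?thesis
    unfolding A5_mult res_pure[OF gh] res_pure[OF assms(1)] T_smult[OF assms(2)] mult_1_left d ..
qed

context fifth_root_module
begin

lemma minus_eq_plus: "(x :: 'k galg) - y = x + y"
proof -
  have "- y = y" using double_galg(1)[of y] by (metis add_eq_0_iff)
  then show ?thesis by (metis diff_conv_add_uminus)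
qed

lemma act_cancel: assumes "m \<in> carrier M" "y \<cdot> m = z \<cdot> m" shows "(y + z) \<cdot> m = \<zero>\<^bsub>M\<^esub>"
proof -
  have "(y + z) \<cdot> m = z \<cdot> m \<oplus>\<^bsub>M\<^esub> z \<cdot> m" unfolding act(3)[OF assms(1)] assms(2) ..
  also have "\<dots> = (z + z) \<cdot> m" by (simp only: act(3)[OF assms(1)])
  finally show ?thesis by (simp add: act(5)[OF assms(1)])
qed

lemma A4_act:
  assumes m: "m \<in> carrier M" and h: "single hh \<cdot> m = (\<xi> \<star> 1) \<cdot> m" and S: "S \<cdot> m = m" and G: "G \<cdot> m = m"
    and u: "u \<in> A4"
  shows "single u \<cdot> m = (T_char \<xi> u \<star> 1) \<cdot> m"
proof -
  obtain j v where jv: "j < 3" "v \<in> VV" "u = hh ^^ j \<circ> v" using A4_decomp[OF u] by blast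
  have v: "single v \<cdot> m = m"
  proof -
    have "single (gg \<circ> ss) = G * (S :: 'k galg)" by (simp add: G_def S_def)
    then have "single (gg \<circ> ss) \<cdot> m = m" by (simp only: act(2)[OF m] S G)
    then show ?thesis using jv(2) S G act(4)[OF m] unfolding VV_alt by (auto simp: S_def G_def)
  qed
  have pow: "(single hh ^ n) \<cdot> m = (\<xi> ^ n \<star> 1) \<cdot> m" for n
  proof (induction n)
    case 0 show ?case by simp
  next
    case (Suc n)
    have "(single hh ^ Suc n) \<cdot> m = single hh \<cdot> (\<xi> ^ n \<star> 1) \<cdot> m" by (simp only: power_Suc act(2)[OF m] Suc)
    also have "\<dots> = (\<xi> ^ n \<star> 1) \<cdot> single hh \<cdot> m" by (simp only: act_scale[OF m])
    also have "\<dots> = (\<xi> ^ n \<star> \<xi> \<star> 1) \<cdot> m" unfolding h by (rule act_scale(2)[OF m])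
    also have "\<xi> ^ n \<star> \<xi> \<star> 1 = \<xi> ^ Suc n \<star> (1 :: 'k galg)" by (simp add: mult.commute)
    finally show ?case .
  qed
  have vA: "v \<in> carrier A5" using jv(2) unfolding VV_alt by auto
  have "single u = single hh ^ j * (single v :: 'k galg)"
    unfolding jv(3) single_power[OF hh_A5] by (simp only: single_mult[OF A5_pow[OF hh_A5] vA])
  then show ?thesis unfolding jv(3) T_char_value[OF jv(1,2)] by (simp only: act(2)[OF m] v pow jv(3))
qed

text \<open>The elements \<open>a\<close> with \<open>a m = 0\<close> have to be shown to be combinations of the relations
  \<open>g h - \<xi>(h) g\<close>. Modulo these every \<open>a\<close> is an element \<open>z\<close> of \<open>k\<langle>c\<rangle>\<close>, and each \<open>E j z\<close> is a multiple \<open>\<mu>\<close> of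
  \<open>E j\<close>; as \<open>E j m\<close> is not zero, \<open>z m = 0\<close> forces all these \<open>\<mu>\<close> to vanish.\<close>

lemma induced_iso:
  assumes m: "m \<in> carrier M" and h: "single hh \<cdot> m = (\<xi> \<star> 1) \<cdot> m" and S: "S \<cdot> m = m" and G: "G \<cdot> m = m"
    and nz: "\<And>j. j < 5 \<Longrightarrow> E j \<cdot> m \<noteq> \<zero>\<^bsub>M\<^esub>" and gen: "smult_set M (carrier kA5) m = carrier M"
  shows "mod_iso kA5 M (induced_module A5 A4 (T \<xi>))"
proof -
  let ?R = "regular_module kA5 :: ((nat \<Rightarrow> nat) \<Rightarrow> 'k, (nat \<Rightarrow> nat) \<Rightarrow> 'k) module" and ?X = "scalar_tensor A5 (T \<xi>)" and ?k = "\<lambda>a. a \<odot>\<^bsub>M\<^esub> m"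
  let ?rel = "\<lambda>g h v. v \<star> single (g \<circ> h) - (T_char \<xi> h * v) \<star> single g"
  let ?gens = "{pure_tensor A5 (T \<xi>) (g \<otimes>\<^bsub>A5\<^esub> h) v \<ominus>\<^bsub>?X\<^esub> pure_tensor A5 (T \<xi>) g (ga_single 1 h \<odot>\<^bsub>T \<xi>\<^esub> v) | g h v.
        g \<in> carrier A5 \<and> h \<in> A4 \<and> v \<in> carrier (T \<xi>)}"
  have Rm: "left_module kA5 ?R" by (rule left_module_regular[OF kA5_ring])
  have lm: "left_module kA5 M" by unfold_locales
  have khom: "?k \<in> mod_hom kA5 ?R M"
    by (rule mod_homI) (simp_all add: m smult_l_distr smult_assoc1)
  have ksurj: "?k ` carrier ?R = carrier M" using gen by (simp add: smult_set_def)
  have kerR: "?k a = \<zero>\<^bsub>M\<^esub>" if a: "a \<in> carrier ?R" "res a = \<zero>\<^bsub>?X\<^esub>" for a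
  proof -
    have "a g = \<zero>\<^bsub>kA5\<^esub> g" for g
    proof (cases "g \<in> carrier A5")
      case True
      then show ?thesis using fun_cong[OF a(2), of g] by (simp add: res_def tensor_simps kA5_def group_algebra_def)
    next
      case False
      then show ?thesis using a(1) by (simp add: kA5_carrier_iff) (simp add: kA5_def group_algebra_def)
    qed
    then have "a = \<zero>\<^bsub>kA5\<^esub>" by (rule ext)
    then show ?thesis using m by simp
  qed
  define Q where "Q = res ` {a \<in> carrier ?R. ?k a = \<zero>\<^bsub>M\<^esub>}"
  have Q_gcoef: "res (gcoef y) \<in> Q" if "y \<cdot> m = \<zero>\<^bsub>M\<^esub>" for y using that gcoef[of y] unfolding Q_def by auto
  have subQ: "submodule Q kA5 ?X"
    unfolding Q_def by (rule image_submodule[OF Rm tensor_module res_hom kernel_submodule[OF Rm lm khom]])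
  have act_h: "(single g * single u) \<cdot> m = (T_char \<xi> u \<star> single g) \<cdot> m" if "u \<in> A4" for g u
    unfolding act(2)[OF m] A4_act[OF m h S G that] by (rule act_scale(1)[OF m])
  have rel0: "?rel g u v \<cdot> m = \<zero>\<^bsub>M\<^esub>" if gu: "g \<in> carrier A5" "u \<in> A4" for g u v
  proof -
    have u: "u \<in> carrier A5" using gu A4_A5 by blast
    have "(v \<star> single (g \<circ> u)) \<cdot> m = (v \<star> 1) \<cdot> (single g * single u) \<cdot> m"
      unfolding single_mult[OF gu(1) u] by (rule act_scale(2)[OF m, symmetric])
    also have "\<dots> = (v \<star> T_char \<xi> u \<star> single g) \<cdot> m" unfolding act_h[OF gu(2)] by (rule act_scale(2)[OF m])
    also have "v \<star> T_char \<xi> u \<star> single g = (T_char \<xi> u * v) \<star> (single g :: 'k galg)" by (simp add: mult.commute)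
    finally show ?thesis unfolding minus_eq_plus by (rule act_cancel[OF m])
  qed
  have gensQ: "?gens \<subseteq> Q"
  proof
    fix n assume "n \<in> ?gens"
    then obtain g u v where n: "n = pure_tensor A5 (T \<xi>) (g \<otimes>\<^bsub>A5\<^esub> u) v \<ominus>\<^bsub>?X\<^esub> pure_tensor A5 (T \<xi>) g (ga_single 1 u \<odot>\<^bsub>T \<xi>\<^esub> v)"
      and gu: "g \<in> carrier A5" "u \<in> A4" by blast
    show "n \<in> Q" unfolding n tensor_relation[OF gu] by (rule Q_gcoef[OF rel0[OF gu]])
  qed
  have least: "Q \<subseteq> N" if N: "submodule N kA5 ?X" "?gens \<subseteq> N" for N
  proof
    interpret X: left_module kA5 ?X by (rule tensor_module)
    note Nc = N(1)[unfolded X.submodule_iff]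
    note hom = mod_homD[OF res_hom[of \<xi>]]
    define K where "K = {y. y \<cdot> m = \<zero>\<^bsub>M\<^esub> \<and> res (gcoef y) \<in> N}"
    have K_add: "y + z \<in> K" if yz: "y \<in> K" "z \<in> K" for y z
    proof -
      have "res (gcoef (y + z)) = res (gcoef y) \<oplus>\<^bsub>?X\<^esub> res (gcoef z)"
        using hom(2)[of "gcoef y" "gcoef z"] gcoef by (simp add: gcoef_ring)
      moreover have "(y + z) \<cdot> m = \<zero>\<^bsub>M\<^esub>" by (rule act_cancel[OF m]) (use yz in \<open>simp add: K_def\<close>)
      ultimately show ?thesis using yz Nc unfolding K_def by simp
    qed
    have K_mult: "z * y \<in> K" if y: "y \<in> K" for y z
    proof -
      have "res (gcoef (z * y)) = gcoef z \<odot>\<^bsub>?X\<^esub> res (gcoef y)"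
        using hom(3)[of "gcoef z" "gcoef y"] gcoef by (simp add: gcoef_ring)
      moreover have "(z * y) \<cdot> m = \<zero>\<^bsub>M\<^esub>" using y act(6)[OF m] unfolding act(2)[OF m] K_def by simp
      ultimately show ?thesis using y Nc gcoef[of z] unfolding K_def by simp
    qed
    have K_scale: "c \<star> y \<in> K" if "y \<in> K" for c y using K_mult[OF that, of "c \<star> 1"] by simp
    have red: "\<exists>z. (\<forall>j<5. \<exists>\<mu>. E j * z = \<mu> \<star> E j) \<and> y + z \<in> K" for y
    proof (induction y rule: galg_induct)
      case (single p)
      obtain i u where iu: "u \<in> set A4_list" "p = cc ^^ i \<circ> u" using A5_normal_form[OF single] by blast
      have u: "u \<in> A4" using iu(1) A4_iff by blast
      have g: "cc ^^ i \<in> carrier A5" by simp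
      have one_T: "(1::'k) \<in> carrier (T \<xi>)" by (simp add: T_simps)
      have "?rel (cc ^^ i) u 1 \<in> K"
      proof -
        have "res (gcoef (?rel (cc ^^ i) u 1)) \<in> ?gens"
          unfolding tensor_relation[OF g u, symmetric] using g u one_T by blast
        then show ?thesis using N(2) rel0[OF g u] unfolding K_def by blast
      qed
      then have "single p + T_char \<xi> u \<star> C ^ i \<in> K" unfolding minus_eq_plus iu(2) C_pow by simp
      moreover have "E j * (T_char \<xi> u \<star> C ^ i) = (T_char \<xi> u * \<zeta> ^ (j * i)) \<star> E j" for j by (simp add: E_Cpow)
      ultimately show ?case by blast
    next
      case (scale c y)
      then obtain z where z: "\<forall>j<5. \<exists>\<mu>. E j * z = \<mu> \<star> E j" "y + z \<in> K" by blast
      have "\<forall>j<5. \<exists>\<mu>. E j * (c \<star> z) = \<mu> \<star> E j"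
      proof (intro allI impI)
        fix j :: nat assume "j < 5"
        then obtain \<mu> where "E j * z = \<mu> \<star> E j" using z(1) by blast
        then have "E j * (c \<star> z) = (c * \<mu>) \<star> E j" by simp
        then show "\<exists>\<mu>. E j * (c \<star> z) = \<mu> \<star> E j" by blast
      qed
      moreover have "c \<star> y + c \<star> z \<in> K" using K_scale[OF z(2), of c] by (simp add: scale_add)
      ultimately show ?case by blast
    next
      case (add y y')
      then obtain z z' where z: "\<forall>j<5. \<exists>\<mu>. E j * z = \<mu> \<star> E j" "y + z \<in> K"
        and z': "\<forall>j<5. \<exists>\<mu>. E j * z' = \<mu> \<star> E j" "y' + z' \<in> K" by blast
      have "\<forall>j<5. \<exists>\<mu>. E j * (z + z') = \<mu> \<star> E j"
      proof (intro allI impI)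
        fix j :: nat assume "j < 5"
        then obtain \<mu> \<mu>' where "E j * z = \<mu> \<star> E j" "E j * z' = \<mu>' \<star> E j" using z(1) z'(1) by blast
        then have "E j * (z + z') = (\<mu> + \<mu>') \<star> E j" by (simp add: distrib_left scale_add)
        then show "\<exists>\<mu>. E j * (z + z') = \<mu> \<star> E j" by blast
      qed
      moreover have "y + y' + (z + z') \<in> K" using K_add[OF z(2) z'(2)] by (simp add: add_ac)
      ultimately show ?case by blast
    qed
    fix n assume "n \<in> Q"
    then obtain a where a: "n = res a" "a \<in> carrier kA5" "a \<odot>\<^bsub>M\<^esub> m = \<zero>\<^bsub>M\<^esub>" unfolding Q_def by auto
    obtain y where y: "a = gcoef y" using Galg_inverse[OF a(2), symmetric] by blast
    obtain z where z: "\<forall>j<5. \<exists>\<mu>. E j * z = \<mu> \<star> E j" "y + z \<in> K" using red by blast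
    have "z = y + (y + z)" by simp
    then have "z \<cdot> m = y \<cdot> m \<oplus>\<^bsub>M\<^esub> (y + z) \<cdot> m" using act(3)[OF m, of y "y + z"] by (simp only:)
    then have zm: "z \<cdot> m = \<zero>\<^bsub>M\<^esub>" using a(3) z(2) unfolding y K_def by simp
    have Ez: "E j * z = 0" if j: "j < 5" for j
    proof -
      obtain \<mu> where \<mu>: "E j * z = \<mu> \<star> E j" using z(1) j by blast
      have "(\<mu> \<star> E j) \<cdot> m = \<zero>\<^bsub>M\<^esub>" unfolding \<mu>[symmetric] act(2)[OF m] zm by (rule act(6)[OF m])
      then have "\<mu> = 0" using scale_zero[OF m] nz[OF j] by blast
      then show ?thesis using \<mu> by simp
    qed
    have "z = (E 0 + E 1 + E 2 + E 3 + E 4) * z" unfolding sum_E by simp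
    also have "\<dots> = 0" by (simp add: distrib_right Ez)
    finally show "n \<in> N" using z(2) unfolding a(1) y K_def by simp
  qed
  have "submodule_span kA5 ?X ?gens = Q"
    unfolding submodule_span_def
  proof (rule antisym)
    show "\<Inter>{N. submodule N kA5 ?X \<and> ?gens \<subseteq> N} \<subseteq> Q"
      by (rule Inter_lower) (intro CollectI conjI subQ gensQ)
    show "Q \<subseteq> \<Inter>{N. submodule N kA5 ?X \<and> ?gens \<subseteq> N}"
    proof (rule Inter_greatest)
      fix N assume "N \<in> {N. submodule N kA5 ?X \<and> ?gens \<subseteq> N}"
      then have N: "submodule N kA5 ?X \<and> ?gens \<subseteq> N" by (rule CollectD)
      show "Q \<subseteq> N" by (rule least[OF conjunct1[OF N] conjunct2[OF N]])
    qed
  qed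
  then have "induced_module A5 A4 (T \<xi>) = quot_module ?X Q" unfolding induced_module_def kA5_def by simp
  moreover have "mod_iso kA5 M (quot_module ?X Q)"
    unfolding Q_def by (rule iso_of_surjections[OF Rm tensor_module res_hom lm khom ksurj res_surj kerR])
  ultimately show ?thesis by simp
qed

end

context fifth_root
begin

text \<open>Equations in \<open>A E 0\<close> are checked in the five components, where the multiplication table applies.\<close>

lemma E_eqI: assumes "\<And>j. j < 5 \<Longrightarrow> E j * y = E j * z" shows "y = z"
proof -
  have "y = (E 0 + E 1 + E 2 + E 3 + E 4) * y" unfolding sum_E by simp
  also have "\<dots> = (E 0 + E 1 + E 2 + E 3 + E 4) * z" by (simp add: distrib_right assms)
  finally show ?thesis unfolding sum_E by simp
qed

lemma E_G: "E j * (G * x) = H j 0 * x + H j 1 * x + H j 2 * x + H j 3 * x + H j 4 * x"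
proof -
  have "E j * (G * x) = E j * (G * ((E 0 + E 1 + E 2 + E 3 + E 4) * x))" unfolding sum_E by simp
  then show ?thesis by (simp only: H_def distrib_left distrib_right mult.assoc)
qed

lemma E_h: "E j * (single hh * x) = \<zeta> ^ j \<star> (H' j 0 * x + \<zeta> ^ 2 \<star> (H' j 1 * x) + \<zeta> ^ 4 \<star> (H' j 2 * x)
    + \<zeta> \<star> (H' j 3 * x) + \<zeta> ^ 3 \<star> (H' j 4 * x))"
proof -
  have hh: "hh = cc \<circ> (gg \<circ> ss) \<circ> cc ^^ 2" unfolding cc_pow by (simp add: perm5_defs)
  have "single hh = C * (G * S) * (C ^ 2 :: 'k galg)"
    unfolding C_pow hh by (simp only: C_def S_def G_def single_mult A5_gens A5_comp A5_pow)
  then have h: "E j * (single hh * x) = (E j * C) * ((G * S) * (C ^ 2 * x))" by (simp only: mult.assoc)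
  have c: "C ^ 2 * (E i * x) = \<zeta> ^ (i * 2) \<star> (E i * x)" for i
    by (simp only: mult.assoc[symmetric] Cpow_E scale_simps)
  have "C ^ 2 * x = C ^ 2 * ((E 0 + E 1 + E 2 + E 3 + E 4) * x)" unfolding sum_E by simp
  also have "\<dots> = \<zeta> ^ (0 * 2) \<star> (E 0 * x) + \<zeta> ^ (1 * 2) \<star> (E 1 * x) + \<zeta> ^ (2 * 2) \<star> (E 2 * x)
      + \<zeta> ^ (3 * 2) \<star> (E 3 * x) + \<zeta> ^ (4 * 2) \<star> (E 4 * x)"
    by (simp only: distrib_left distrib_right c)
  finally have c2: "C ^ 2 * x = E 0 * x + \<zeta> ^ 2 \<star> (E 1 * x) + \<zeta> ^ 4 \<star> (E 2 * x) + \<zeta> \<star> (E 3 * x) + \<zeta> ^ 3 \<star> (E 4 * x)"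
    using root_pow_cong[of 6 1] root_pow_cong[of 8 3] by simp
  show ?thesis unfolding h E_C c2 by (simp only: scale_simps scale_add distrib_left H'_def mult.assoc mult.commute[of "\<zeta> ^ j"])
qed

lemma D_arrows: "j < 5 \<Longrightarrow> i \<noteq> 0 \<Longrightarrow> i < 5 \<Longrightarrow> H j i * D 0 = 0" "j < 5 \<Longrightarrow> i \<noteq> 0 \<Longrightarrow> i < 5 \<Longrightarrow> H' j i * D 0 = 0"
  "j < 5 \<Longrightarrow> E j * D 0 = (if j = 0 then D 0 else 0)"
proof -
  have d: "y * D 0 = (y * E 0) * D 0" for y unfolding mult.assoc D0(4) ..
  show "H j i * D 0 = 0" "H' j i * D 0 = 0" if "j < 5" "i \<noteq> 0" "i < 5"
    unfolding d[of "H j i"] d[of "H' j i"] using that by (simp_all add: H_E)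
  show "E j * D 0 = (if j = 0 then D 0 else 0)" if "j < 5"
    using that d[of "E j"] by (cases "j = 0") (simp_all add: D0 E_mult)
qed

text \<open>Lifts of the generators of the two summands of the heart. In \<open>A b 2\<close> modulo \<open>w\<close> the group generated by \<open>s\<close>
  and \<open>g\<close> fixes a plane, and the 3-cycle \<open>(1 2 3)\<close> has \<open>x2\<close> as an eigenvector in it.\<close>

definition "x2 = (1 + S) * (b 2 + b 1 * (a 2 * b 2)) + a 2 * b 2"
definition "x1 = (1 + S) * (b 1 + b 2 * (a 1 * b 1)) + a 1 * b 1"

lemma S_arrows: "S * H 2 0 = H' 3 0" "S * H' 2 0 = H 3 0" "S * H 1 0 = H' 4 0" "S * H' 1 0 = H 4 0"
  "S * H' 3 0 = H 2 0" "S * H 3 0 = H' 2 0" "S * H' 4 0 = H 1 0" "S * H 4 0 = H' 1 0"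
  "S * H 0 0 = H' 0 0" "S * H' 0 0 = H 0 0" "S * D 0 = E 0" "S * E 0 = D 0"
  using S_H[of 3 0] S_H'[of 3 0] S_H[of 4 0] S_H'[of 4 0] S_H[of 2 0] S_H'[of 2 0] S_H[of 1 0] S_H'[of 1 0] S_H[of 0 0] S_H'[of 0 0]
  by (simp_all add: D_def S_S_mult One_nat_def[symmetric])

lemma x_expand:
  "x2 = H 2 0 + H' 3 0 + H 1 0 + H' 1 0 + H' 4 0 + H 4 0 + D 0 + (t + 1) \<star> H' 0 0 + t \<star> H 0 0"
  "x1 = H 1 0 + H' 4 0 + H 2 0 + H' 2 0 + H' 3 0 + H 3 0 + D 0 + t \<star> H' 0 0 + (t + 1) \<star> H 0 0"
  unfolding x2_def x1_def paths unfolding ab unfolding b_def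
  by (simp_all add: distrib_left distrib_right S_arrows add_ac)

text \<open>Reduction of coefficients to the basis \<open>1, \<zeta>, \<zeta>\<^sup>2, \<zeta>\<^sup>3\<close> over the prime field.\<close>

lemma zeta_reduce: "\<zeta>^4 = \<zeta>^3 + \<zeta>^2 + \<zeta> + 1" "t = \<zeta>^3 + \<zeta>^2 + 1" "\<zeta> * \<zeta> = \<zeta>^2" "\<zeta> * \<zeta>^2 = \<zeta>^3"
  "\<zeta> * \<zeta>^3 = \<zeta>^3 + \<zeta>^2 + \<zeta> + 1" "\<zeta>^2 * \<zeta> = \<zeta>^3" "\<zeta>^3 * \<zeta> = \<zeta>^3 + \<zeta>^2 + \<zeta> + 1"
  "\<zeta>^5 = 1" "\<zeta>^6 = \<zeta>" "\<zeta>^7 = \<zeta>^2" "\<zeta>^8 = \<zeta>^3" "(2::'k) = 0"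
proof -
  have "\<zeta>^4 + (\<zeta>^3 + \<zeta>^2 + \<zeta> + 1) = 0" using prim by (simp only: add.assoc)
  then show z4: "\<zeta>^4 = \<zeta>^3 + \<zeta>^2 + \<zeta> + 1" by (rule add_zero_eq)
  have "t = (\<zeta>^2 + \<zeta>^3) + 1" unfolding t_other add.assoc char2 by simp
  then show "t = \<zeta>^3 + \<zeta>^2 + 1" by (simp only: add.commute[of "\<zeta>^2"])
  show "\<zeta> * \<zeta> = \<zeta>^2" by (simp add: power2_eq_square)
  show "\<zeta> * \<zeta>^2 = \<zeta>^3" "\<zeta>^2 * \<zeta> = \<zeta>^3" using power_Suc[of \<zeta> 2] power_Suc2[of \<zeta> 2] by simp_all
  show "\<zeta> * \<zeta>^3 = \<zeta>^3 + \<zeta>^2 + \<zeta> + 1" "\<zeta>^3 * \<zeta> = \<zeta>^3 + \<zeta>^2 + \<zeta> + 1"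
    unfolding z4[symmetric] using power_Suc[of \<zeta> 3] power_Suc2[of \<zeta> 3] by simp_all
  show "\<zeta>^5 = 1" "\<zeta>^6 = \<zeta>" "\<zeta>^7 = \<zeta>^2" "\<zeta>^8 = \<zeta>^3"
    using root_pow5 root_pow_cong[of 6 1] root_pow_cong[of 7 2] root_pow_cong[of 8 3] by simp_all
  show "(2::'k) = 0" unfolding one_add_one[symmetric] by (rule char2)
qed

lemma less_5: "j < 5 \<Longrightarrow> j = 0 \<or> j = 1 \<or> j = 2 \<or> j = 3 \<or> j = (4::nat)" by linarith

lemma x_S: "S * x2 = x2 + w" "S * x1 = x1 + w"
  unfolding x_expand w_def by (simp_all add: S_arrows lin)

lemma x_G: "G * x2 = x2 + (t + 1) \<star> w" "G * x1 = x1 + t \<star> w"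
proof -
  show "G * x2 = x2 + (t + 1) \<star> w"
  proof (rule E_eqI)
    fix j :: nat assume "j < 5"
    then show "E j * (G * x2) = E j * (x2 + (t + 1) \<star> w)"
      unfolding E_G x_expand w_def by (elim less_5[elim_format] disjE) (simp_all add: hecke D_arrows lin)
  qed
  show "G * x1 = x1 + t \<star> w"
  proof (rule E_eqI)
    fix j :: nat assume "j < 5"
    then show "E j * (G * x1) = E j * (x1 + t \<star> w)"
      unfolding E_G x_expand w_def by (elim less_5[elim_format] disjE) (simp_all add: hecke D_arrows lin)
  qed
qed

lemma x_h: "single hh * x2 = (t + 1) \<star> x2 + \<zeta> \<star> w" "single hh * x1 = t \<star> x1 + \<zeta> ^ 3 \<star> w"
proof -
  show "single hh * x2 = (t + 1) \<star> x2 + \<zeta> \<star> w"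
  proof (rule E_eqI)
    fix j :: nat assume "j < 5"
    then show "E j * (single hh * x2) = E j * ((t + 1) \<star> x2 + \<zeta> \<star> w)"
      unfolding E_h x_expand w_def
      by (elim less_5[elim_format] disjE) (simp_all add: hecke D_arrows scale_add distrib_left distrib_right add_ac zeta_reduce)
  qed
  show "single hh * x1 = t \<star> x1 + \<zeta> ^ 3 \<star> w"
  proof (rule E_eqI)
    fix j :: nat assume "j < 5"
    then show "E j * (single hh * x1) = E j * (t \<star> x1 + \<zeta> ^ 3 \<star> w)"
      unfolding E_h x_expand w_def
      by (elim less_5[elim_format] disjE) (simp_all add: hecke D_arrows scale_add distrib_left distrib_right add_ac zeta_reduce)
  qed
qed

lemma E_x: "E 0 * x2 = a 2 * b 2" "E 1 * x2 = b 1 * (a 2 * b 2)" "E 2 * x2 = b 2" "S * (E 3 * x2) = b 2" "S * (E 4 * x2) = b 1 * (a 2 * b 2)"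
  "E 0 * x1 = a 1 * b 1" "E 2 * x1 = b 2 * (a 1 * b 1)" "E 1 * x1 = b 1" "S * (E 4 * x1) = b 1" "S * (E 3 * x1) = b 2 * (a 1 * b 1)"
  unfolding x_expand paths unfolding ab unfolding b_def
  by (simp_all add: hecke D_arrows distrib_left S_arrows add_ac)

end

context A5_tops
begin

lemma heart_summand:
  assumes x: "x \<in> L m" "m \<in> L x" and m: "L m \<subseteq> sumset (L (b 1)) (L (b 2))" "submodule (hq ` L m) kA5 HM"
    and act: "S * x = x + \<alpha> \<star> w" "G * x = x + \<beta> \<star> w" "single hh * x = \<xi> \<star> x + \<gamma> \<star> w"
    and nz: "\<And>j. j < 5 \<Longrightarrow> E j * x \<notin> L w"
  shows "mod_iso kA5 (HM\<lparr>carrier := hq ` L m\<rparr>) (induced_module A5 A4 (T \<xi>))"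
proof -
  interpret HM: left_module kA5 HM by (rule HM_module)
  let ?U = "HM\<lparr>carrier := hq ` L m\<rparr>"
  have U: "left_module kA5 ?U" by (rule HM.left_module_submodule[OF m(2)])
  interpret U: fifth_root_module \<zeta> ?U
    by (intro fifth_root_module.intro kA5_module.intro fifth_root_axioms U)
  have xh: "x \<in> sumset (L (b 1)) (L (b 2))" using x(1) m(1) by blast
  have hx: "hq x \<in> carrier ?U" using x(1) by simp
  have in_h: "y * x \<in> sumset (L (b 1)) (L (b 2))" for y by (rule lidealD(3)[OF heart_lideal xh])
  have hq_mult: "gcoef y \<odot>\<^bsub>?U\<^esub> hq x = hq (y * x)" for y using hq_hom(2)[OF xh] by simp
  have hw: "w \<in> sumset (L (b 1)) (L (b 2))" by (rule mem_sumset(1)[OF lideal_L lideal_L w_in(1)])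
  have mod_w: "hq (y * x + c \<star> w) = hq (y * x)" for y c
  proof -
    have cw: "c \<star> w \<in> sumset (L (b 1)) (L (b 2))" "c \<star> w \<in> L w"
      using lidealD(4)[OF heart_lideal hw] lidealD(4)[OF lideal_L L_self] by auto
    have "hq (y * x + c \<star> w) = hq (y * x) \<oplus>\<^bsub>HM\<^esub> \<zero>\<^bsub>HM\<^esub>"
      using hq_hom(1)[OF in_h cw(1)] hq_zero_iff[OF cw(1)] cw(2) by simp
    moreover have "hq (y * x) \<in> carrier HM" unfolding heart_carrier using in_h by blast
    ultimately show ?thesis by simp
  qed
  show ?thesis
  proof (rule U.induced_iso[OF hx])
    show "gcoef (single hh) \<odot>\<^bsub>?U\<^esub> hq x = gcoef (\<xi> \<star> 1) \<odot>\<^bsub>?U\<^esub> hq x"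
      unfolding hq_mult using mod_w[of "\<xi> \<star> 1" \<gamma>] by (simp add: act)
    show "gcoef S \<odot>\<^bsub>?U\<^esub> hq x = hq x" "gcoef G \<odot>\<^bsub>?U\<^esub> hq x = hq x"
      unfolding hq_mult act using mod_w[of 1] by simp_all
    show "gcoef (E j) \<odot>\<^bsub>?U\<^esub> hq x \<noteq> \<zero>\<^bsub>?U\<^esub>" if "j < 5" for j
      unfolding hq_mult using hq_zero_iff[OF in_h, of "E j"] nz[OF that] by simp
    have "L x = L m" using L_least[OF lideal_L x(1)] L_least[OF lideal_L x(2)] by blast
    then show "smult_set ?U (carrier kA5) (hq x) = carrier ?U"
      using hq_smult_img(2)[OF xh] by (simp add: smult_set_def)
  qed
qed

lemma heart_induced:
  "mod_iso kA5 (HM\<lparr>carrier := hq ` L (b 2)\<rparr>) (induced_module A5 A4 (T (t + 1)))"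
  "mod_iso kA5 (HM\<lparr>carrier := hq ` L (b 1)\<rparr>) (induced_module A5 A4 (T t))"
proof -
  have sub: "submodule (hq ` L (b 2)) kA5 HM" "submodule (hq ` L (b 1)) kA5 HM"
    using heart_sum by (auto simp: internal_sum_def)
  have LH: "L (b 1) \<subseteq> sumset (L (b 1)) (L (b 2))" "L (b 2) \<subseteq> sumset (L (b 1)) (L (b 2))"
    using mem_sumset[OF lideal_L lideal_L] by auto
  have x2: "x2 \<in> L (b 2)" unfolding x2_def
    using lidealD(2,3)[OF lideal_L] L_self L_times[of "b 1 * a 2" "b 2"] L_times[of "a 2" "b 2"] by (simp add: mult.assoc)
  have x1: "x1 \<in> L (b 1)" unfolding x1_def
    using lidealD(2,3)[OF lideal_L] L_self L_times[of "b 2 * a 1" "b 1"] L_times[of "a 1" "b 1"] by (simp add: mult.assoc)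
  have gen: "b 2 \<in> L x2" "b 1 \<in> L x1" using L_times[of "E 2" x2] L_times[of "E 1" x1] by (simp_all add: E_x)
  have "y \<notin> L w" if "S * y \<notin> L w" for y using that lidealD(3)[OF lideal_L] by blast
  then have S: "S * y \<notin> L w \<Longrightarrow> y \<notin> L w" for y by blast
  have nz2: "E j * x2 \<notin> L w" if "j < 5" for j
    using less_5[OF that] S[of "E 3 * x2"] S[of "E 4 * x2"] unfolding E_x
    by (elim disjE) (simp_all add: E_x not_in_Lw)
  have nz1: "E j * x1 \<notin> L w" if "j < 5" for j
    using less_5[OF that] S[of "E 3 * x1"] S[of "E 4 * x1"] unfolding E_x
    by (elim disjE) (simp_all add: E_x not_in_Lw)
  have s: "S * x2 = x2 + 1 \<star> w" "S * x1 = x1 + 1 \<star> w" using x_S by simp_all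
  show "mod_iso kA5 (HM\<lparr>carrier := hq ` L (b 2)\<rparr>) (induced_module A5 A4 (T (t + 1)))"
    by (rule heart_summand[OF x2 gen(1) LH(2) sub(1) s(1) x_G(1) x_h(1) nz2])
  show "mod_iso kA5 (HM\<lparr>carrier := hq ` L (b 1)\<rparr>) (induced_module A5 A4 (T t))"
    by (rule heart_summand[OF x1 gen(2) LH(1) sub(2) s(2) x_G(2) x_h(2) nz1])
qed

text \<open>The cube roots of unity \<open>\<omega>\<close> and \<open>\<omega>\<^sup>2\<close> are \<open>t\<close> and \<open>t + 1\<close> in one order or the other.\<close>

lemma heart_sum_induced:
  assumes "\<omega>\<^sup>2 + \<omega> + 1 = 0"
  shows "mod_iso kA5 HM (induced_module A5 A4 (T \<omega>) \<oplus>\<^sub>m induced_module A5 A4 (T (\<omega>\<^sup>2)))"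
proof -
  interpret HM: left_module kA5 HM by (rule HM_module)
  let ?U = "HM\<lparr>carrier := hq ` L (b 2)\<rparr>" and ?W = "HM\<lparr>carrier := hq ` L (b 1)\<rparr>"
  have sub: "submodule (hq ` L (b 2)) kA5 HM" "submodule (hq ` L (b 1)) kA5 HM"
    using heart_sum by (auto simp: internal_sum_def)
  have iso: "mod_iso kA5 HM (?U \<oplus>\<^sub>m ?W)"
    by (rule mod_iso_sym[OF left_module_mod_sum[OF HM.left_module_submodule[OF sub(1)] HM.left_module_submodule[OF sub(2)]]
          mod_iso_internal_sum[OF HM_module heart_sum]])
  have HM: "mod_iso kA5 HM (induced_module A5 A4 (T (t + 1)) \<oplus>\<^sub>m induced_module A5 A4 (T t))"
    by (rule mod_iso_trans[OF iso mod_iso_sum[OF heart_induced]])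
  have "\<omega>\<^sup>2 + (\<omega> + 1) = 0" using assms by (simp only: add.assoc)
  then have w2: "\<omega>\<^sup>2 = \<omega> + 1" by (rule add_zero_eq)
  have "(\<omega> + t) * (\<omega> + (t + 1)) = (\<omega>\<^sup>2 + \<omega>) + (t * t + t) + (\<omega> * t + \<omega> * t)"
    by (simp only: power2_eq_square distrib_left distrib_right mult_1_right mult_1_left add_ac mult.commute)
  also have "\<dots> = 0" unfolding w2 t_square by (simp add: add_ac)
  finally have "\<omega> + t = 0 \<or> \<omega> + (t + 1) = 0" by simp
  then have "\<omega> = t \<or> \<omega> = t + 1" using add_zero_eq by blast
  then show ?thesis
  proof
    assume "\<omega> = t"
    then show ?thesis unfolding w2 using mod_iso_trans[OF HM mod_iso_sum_commute] by simp
  next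
    assume w: "\<omega> = t + 1"
    have "\<omega> + 1 = t" unfolding w add.assoc char2 by simp
    then show ?thesis unfolding w2 using HM w by simp
  qed
qed

lemma heart_summands:
  "\<exists>U W. internal_sum kA5 HM U W \<and> uniserial kA5 (HM\<lparr>carrier := U\<rparr>) \<and>
     has_radical_layers kA5 (HM\<lparr>carrier := U\<rparr>) [mod_iso kA5 M2, mod_iso kA5 M0, mod_iso kA5 M1] \<and>
     uniserial kA5 (HM\<lparr>carrier := W\<rparr>) \<and>
     has_radical_layers kA5 (HM\<lparr>carrier := W\<rparr>) [mod_iso kA5 M1, mod_iso kA5 M0, mod_iso kA5 M2]"
  using heart_sum heart_uniserial heart_layers by blast

end

theorem mainTheorem7:
  fixes \<omega> :: "'k::alg_closed_field"
    and \<phi> :: "(nat \<Rightarrow> nat) \<Rightarrow> 'k^2^2"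
  assumes "CHAR('k) = 2"
    and "\<omega>\<^sup>2 + \<omega> + 1 = 0"
    and "\<phi> \<in> iso A5 (SL2F4 \<omega>)"
  shows "\<exists>(P1 :: ((nat \<Rightarrow> nat) \<Rightarrow> 'k, (nat \<Rightarrow> nat) \<Rightarrow> 'k) module)
       (P2 :: ((nat \<Rightarrow> nat) \<Rightarrow> 'k, (nat \<Rightarrow> nat) \<Rightarrow> 'k) module)
       (P3 :: ((nat \<Rightarrow> nat) \<Rightarrow> 'k, (nat \<Rightarrow> nat) \<Rightarrow> 'k) module)
       (P4 :: ((nat \<Rightarrow> nat) \<Rightarrow> 'k, (nat \<Rightarrow> nat) \<Rightarrow> 'k) module).
    \<comment> \<open>the projective indecomposable modules\<close>
    projective_cover kA5 P1 S1 \<and> projective_cover kA5 P2 (S2 \<phi>) \<and>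
    projective_cover kA5 P3 (S3 \<phi>) \<and> projective_cover kA5 P4 S4 \<and>
    projective_indecomposable kA5 P1 \<and> projective_indecomposable kA5 P2 \<and>
    projective_indecomposable kA5 P3 \<and> projective_indecomposable kA5 P4 \<and>
    \<not> mod_iso kA5 P1 P2 \<and> \<not> mod_iso kA5 P1 P3 \<and> \<not> mod_iso kA5 P1 P4 \<and>
    \<not> mod_iso kA5 P2 P3 \<and> \<not> mod_iso kA5 P2 P4 \<and> \<not> mod_iso kA5 P3 P4 \<and>
    (\<forall>Q :: ((nat \<Rightarrow> nat) \<Rightarrow> 'k, 'm) module. projective_indecomposable kA5 Q \<longrightarrow>
       mod_iso kA5 Q P1 \<or> mod_iso kA5 Q P2 \<or> mod_iso kA5 Q P3 \<or> mod_iso kA5 Q P4) \<and>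
    mod_iso kA5 (regular_module kA5)
      (P1 \<oplus>\<^sub>m mod_power P2 2 \<oplus>\<^sub>m mod_power P3 2 \<oplus>\<^sub>m mod_power P4 4) \<and>
    \<comment> \<open>(a)\<close>
    has_radical_layers kA5 P1
      [mod_iso kA5 S1, mod_iso kA5 (S3 \<phi> \<oplus>\<^sub>m S2 \<phi>), mod_iso kA5 (S1 \<oplus>\<^sub>m S1),
       mod_iso kA5 (S2 \<phi> \<oplus>\<^sub>m S3 \<phi>), mod_iso kA5 S1] \<and>
    soc kA5 P1 \<subseteq> rad kA5 P1 \<and>
    (let H = quot_module (P1\<lparr>carrier := rad kA5 P1\<rparr>) (soc kA5 P1) in
      (\<exists>U W. internal_sum kA5 H U W \<and>
        uniserial kA5 (H\<lparr>carrier := U\<rparr>) \<and>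
        has_radical_layers kA5 (H\<lparr>carrier := U\<rparr>)
          [mod_iso kA5 (S3 \<phi>), mod_iso kA5 S1, mod_iso kA5 (S2 \<phi>)] \<and>
        uniserial kA5 (H\<lparr>carrier := W\<rparr>) \<and>
        has_radical_layers kA5 (H\<lparr>carrier := W\<rparr>)
          [mod_iso kA5 (S2 \<phi>), mod_iso kA5 S1, mod_iso kA5 (S3 \<phi>)]) \<and>
      mod_iso kA5 H (induced_module A5 A4 (T \<omega>) \<oplus>\<^sub>m induced_module A5 A4 (T (\<omega>\<^sup>2)))) \<and>
    \<comment> \<open>(b)\<close>
    uniserial kA5 P2 \<and>
    has_radical_layers kA5 P2
      [mod_iso kA5 (S2 \<phi>), mod_iso kA5 S1, mod_iso kA5 (S3 \<phi>), mod_iso kA5 S1,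
       mod_iso kA5 (S2 \<phi>)] \<and>
    \<comment> \<open>(c)\<close>
    uniserial kA5 P3 \<and>
    has_radical_layers kA5 P3
      [mod_iso kA5 (S3 \<phi>), mod_iso kA5 S1, mod_iso kA5 (S2 \<phi>), mod_iso kA5 S1,
       mod_iso kA5 (S3 \<phi>)] \<and>
    \<comment> \<open>(d)\<close>
    mod_iso kA5 P4 S4"
proof -
  have char2: "(1::'k) + 1 = 0"
    using of_nat_CHAR[where 'a = 'k] assms(1) by simp
  obtain z v v' where "A5_tops z S1 1 (S2 \<phi>) v (S3 \<phi>) v' S4 (fifth_root.ev z 1)"
    using simple_tops[OF assms(3) char2] by blast
  then interpret A5_tops z S1 1 "S2 \<phi>" v "S3 \<phi>" v' S4 "fifth_root.ev z 1" .
  show ?thesis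
    by (rule exI[of _ "PM (E 0)"], rule exI[of _ "PM (e 1)"], rule exI[of _ "PM (e 2)"], rule exI[of _ "PM (f 1)"],
        unfold Let_def heart_eq, intro conjI allI impI)
       (rule covers pims not_iso regular_decomposition layers_P1 soc_subset_rad heart_summands
          heart_sum_induced[OF assms(2)] uniserial_P2 layers_P2 uniserial_P3 layers_P3 P4_iso
        | (rule pim_classification, assumption))+
qed

end
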